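(* Let $M$ be a pointwise semi-slant submanifold of a cosymplectic manifold $\tilde M$, with orthogonal decomposition $TM=\mathfrak{D}\oplus\mathfrak{D}^\theta\oplus\langle\xi\rangle$ and slant function $\theta$. Then $M$ is locally a non-trivial warped product submanifold of the form $M_T\times_f M_\theta$, where $M_T$ is an invariant submanifold and $M_\theta$ is a proper pointwise slant submanifold of $\tilde M$, if and only if $$A_{FW}\varphi X-A_{FPW}X=\sin^2\theta\,X(\mu)\,W\qquad\text{for all }X\in\Gamma(\mathfrak{D}\oplus\langle\xi\rangle),\ W\in\Gamma(\mathfrak{D}^\theta),$$ for some smooth function $\mu$ on $M$ satisfying $Z(\mu)=0$ for any $Z\in\Gamma(\mathfrak{D}^\theta)$.
   Context: An almost contact metric manifold $(\tilde M,\varphi,\xi,\eta,g)$ is an odd-dimensional manifold with a $(1,1)$-tensor field $\varphi$, a vector field $\xi$, a 1-form $\eta$ and a Riemannian metric $g$ such that $\varphi^2=-I+\eta\otimes\xi$, $\eta(\xi)=1$, $\varphi\xi=0$, $\eta\circ\varphi=0$, $g(\varphi X,\varphi Y)=g(X,Y)-\eta(X)\eta(Y)$. It is cosymplectic if $\tilde\nabla\varphi=0$ and $\tilde\nabla\xi=0$, with $\tilde\nabla$ the Levi-Civita connection of $g$. For a submanifold $M$ of $\tilde M$ with $\xi$ tangent to $M$ (induced metric also denoted $g$), write $\varphi X=PX+FX$ with $PX$ tangent and $FX$ normal to $M$, for $X$ tangent to $M$. $A_N$ denotes the shape operator for a normal field $N$: $g(A_NX,Y)=g(h(X,Y),N)$,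 where $h$ is the second fundamental form of $M$ in $\tilde M$. $\Gamma(\cdot)$ denotes the sections of a bundle or distribution. $M$ is pointwise semi-slant if there are orthogonal distributions $\mathfrak{D},\mathfrak{D}^\theta$ on $M$ with $TM=\mathfrak{D}\oplus\mathfrak{D}^\theta\oplus\langle\xi\rangle$ orthogonally, $\varphi(\mathfrak{D})=\mathfrak{D}$, and $\mathfrak{D}^\theta$ pointwise slant with slant function $\theta$, i.e. at each $p\in M$ the angle between $\varphi Z$ and $\mathfrak{D}^\theta_p$ equals $\theta(p)$ for all nonzero $Z\in\mathfrak{D}^\theta_p$. A submanifold is invariant if its tangent bundle is $\varphi$-invariant. It is pointwise slant if the angle between $\varphi X$ and its tangent space depends only on the point (for nonzero tangent $X$ not proportional to $\xi$), and this angle defines its slant function; it is proper if the slant function is neither $0$, nor $\pi/2$, nor constant. The warped product $M_1\times_fM_2$, with $f$ a positive differentiable function on $M_1$, is $M_1\times M_2$ with metric $\pi_1^*g_1+(f\circ\pi_1)^2\pi_2^*g_2$, where $g_1,g_2$ are the Riemannian metrics of $M_1,M_2$ and $\pi_1,\pi_2$ the projections; it is non-trivial if $f$ is not constant. In warped products $M_T\times_fM_\theta$, $\xi$ is taken tangent to $M_T$.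
   Formalization: Corrected: the equation's side also requires θ nowhere 0 or π/2 and on no open set constant along D^θ, and μ non-constant on every open set; μ is only required near each point, not on all of M. "Locally" means on arbitrarily small neighbourhoods. *)

theory Defs
  imports "HOL-Analysis.Analysis"
begin

section \<open>Smooth functions between Euclidean spaces\<close>

text \<open>\<open>Ck_on k S f\<close> is meant for open \<open>S\<close>: all iterated directional derivatives of order at most
  \<open>k\<close> exist as Frechet derivatives and are continuous on \<open>S\<close>.\<close>

primrec Ck_on ::
  "nat \<Rightarrow> 'u::real_normed_vector set \<Rightarrow> ('u \<Rightarrow> 'w::real_normed_vector) \<Rightarrow> bool" where
  "Ck_on 0 S f = continuous_on S f"
| "Ck_on (Suc k) S f =
     ((\<forall>x\<in>S. f differentiable (at x)) \<and> (\<forall>v. Ck_on k S (\<lambda>x. frechet_derivative f (at x) v)))"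

definition smooth_on ::
  "'u::real_normed_vector set \<Rightarrow> ('u \<Rightarrow> 'w::real_normed_vector) \<Rightarrow> bool" where
  "smooth_on S f \<longleftrightarrow> (\<forall>k. Ck_on k S f)"


section \<open>Smooth manifolds\<close>

text \<open>A manifold is a topology together with an atlas of charts \<open>(U, c)\<close> with values in the
  Euclidean space \<open>'e\<close>; its dimension is \<open>DIM('e)\<close>.\<close>

record ('a, 'e) manifold =
  mtop :: "'a topology"
  atlas :: "('a set \<times> ('a \<Rightarrow> 'e)) set"

abbreviation points :: "('a, 'e, 'z) manifold_scheme \<Rightarrow> 'a set" where
  "points M \<equiv> topspace (mtop M)"

definition top_chart :: "('a, 'e::euclidean_space, 'z) manifold_scheme \<Rightarrow> 'a set \<Rightarrow> ('a \<Rightarrow> 'e) \<Rightarrow> bool"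
  where "top_chart M U c \<longleftrightarrow>
    openin (mtop M) U \<and> open (c ` U) \<and>
    homeomorphic_map (subtopology (mtop M) U) (top_of_set (c ` U)) c"

definition compatible_charts ::
  "'a set \<Rightarrow> ('a \<Rightarrow> 'e::euclidean_space) \<Rightarrow> 'a set \<Rightarrow> ('a \<Rightarrow> 'e) \<Rightarrow> bool" where
  "compatible_charts U c V d \<longleftrightarrow>
    smooth_on (c ` (U \<inter> V)) (d \<circ> the_inv_into U c) \<and>
    smooth_on (d ` (U \<inter> V)) (c \<circ> the_inv_into V d)"

definition smooth_manifold :: "('a, 'e::euclidean_space, 'z) manifold_scheme \<Rightarrow> bool" where
  "smooth_manifold M \<longleftrightarrow>
    Hausdorff_space (mtop M) \<and> second_countable (mtop M) \<and>
    (\<forall>(U, c) \<in> atlas M. top_chart M U c) \<and>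
    (\<Union>(U, c) \<in> atlas M. U) = points M \<and>
    (\<forall>(U, c) \<in> atlas M. \<forall>(V, d) \<in> atlas M. compatible_charts U c V d)"

text \<open>Charts of the maximal atlas.\<close>

definition smooth_chart ::
  "('a, 'e::euclidean_space, 'z) manifold_scheme \<Rightarrow> 'a set \<Rightarrow> ('a \<Rightarrow> 'e) \<Rightarrow> bool" where
  "smooth_chart M U c \<longleftrightarrow>
    top_chart M U c \<and> (\<forall>(V, d) \<in> atlas M. compatible_charts U c V d)"

text \<open>Every point \<open>p\<close> gets a preferred chart. A tangent vector at \<open>p\<close> is represented by
  its coordinate vector in the preferred chart at \<open>p\<close>, so the tangent space at each point is the
  whole type \<open>'e\<close>. Vectors at different points may only be compared after conversion to a common
  chart, which is what \<open>trans\<close> does below.\<close>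

definition pchart :: "('a, 'e, 'z) manifold_scheme \<Rightarrow> 'a \<Rightarrow> 'a set \<times> ('a \<Rightarrow> 'e)" where
  "pchart M p = (SOME C. C \<in> atlas M \<and> p \<in> fst C)"

definition cdom :: "('a, 'e, 'z) manifold_scheme \<Rightarrow> 'a \<Rightarrow> 'a set" where
  "cdom M p = fst (pchart M p)"

definition cmap :: "('a, 'e, 'z) manifold_scheme \<Rightarrow> 'a \<Rightarrow> 'a \<Rightarrow> 'e" where
  "cmap M p = snd (pchart M p)"

definition cinv :: "('a, 'e, 'z) manifold_scheme \<Rightarrow> 'a \<Rightarrow> 'e \<Rightarrow> 'a" where
  "cinv M p = the_inv_into (cdom M p) (cmap M p)"

text \<open>\<open>trans M a b q v\<close>: coordinates in the preferred chart of \<open>b\<close> of the tangent vector at \<open>q\<close>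
  whose coordinates in the preferred chart of \<open>a\<close> are \<open>v\<close>.\<close>

definition trans ::
  "('a, 'e::euclidean_space, 'z) manifold_scheme \<Rightarrow> 'a \<Rightarrow> 'a \<Rightarrow> 'a \<Rightarrow> 'e \<Rightarrow> 'e" where
  "trans M a b q v = frechet_derivative (cmap M b \<circ> cinv M a) (at (cmap M a q)) v"

text \<open>\<open>S\<close> is an open coordinate neighbourhood of \<open>p\<close> inside \<open>U\<close>, in the preferred chart of \<open>p\<close>.\<close>

definition coord_nbhd ::
  "('a, 'e::euclidean_space, 'z) manifold_scheme \<Rightarrow> 'a set \<Rightarrow> 'a \<Rightarrow> 'e set \<Rightarrow> bool" where
  "coord_nbhd M U p S \<longleftrightarrow> open S \<and> cmap M p p \<in> S \<and> S \<subseteq> cmap M p ` (U \<inter> cdom M p)"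

definition smooth_fun ::
  "('a, 'e::euclidean_space, 'z) manifold_scheme \<Rightarrow> 'a set \<Rightarrow> ('a \<Rightarrow> real) \<Rightarrow> bool" where
  "smooth_fun M U f \<longleftrightarrow> (\<forall>p\<in>U. \<exists>S. coord_nbhd M U p S \<and> smooth_on S (f \<circ> cinv M p))"

definition smooth_map ::
  "('b, 'm::euclidean_space, 'y) manifold_scheme \<Rightarrow> ('a, 'e::euclidean_space, 'z) manifold_scheme
    \<Rightarrow> 'b set \<Rightarrow> ('b \<Rightarrow> 'a) \<Rightarrow> bool" where
  "smooth_map N M U F \<longleftrightarrow>
    (\<forall>p\<in>U. F p \<in> points M \<and>
      (\<exists>S. coord_nbhd N (U \<inter> F -` cdom M (F p)) p S \<and>
           smooth_on S (cmap M (F p) \<circ> F \<circ> cinv N p)))"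

definition mderiv ::
  "('b, 'm::euclidean_space, 'y) manifold_scheme \<Rightarrow> ('a, 'e::euclidean_space, 'z) manifold_scheme
    \<Rightarrow> ('b \<Rightarrow> 'a) \<Rightarrow> 'b \<Rightarrow> 'm \<Rightarrow> 'e" where
  "mderiv N M F p u =
    frechet_derivative (cmap M (F p) \<circ> F \<circ> cinv N p) (at (cmap N p p)) u"

definition fderiv ::
  "('b, 'm::euclidean_space, 'y) manifold_scheme \<Rightarrow> ('b \<Rightarrow> real) \<Rightarrow> 'b \<Rightarrow> 'm \<Rightarrow> real" where
  "fderiv N f p u = frechet_derivative (f \<circ> cinv N p) (at (cmap N p p)) u"

text \<open>Smooth vector fields along a map \<open>F : N \<rightarrow> M\<close>, i.e. \<open>Y q\<close> is tangent to \<open>M\<close> at \<open>F q\<close>.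
  Vector fields on \<open>M\<close> are the case where \<open>F\<close> is the identity.\<close>

definition smooth_along ::
  "('b, 'm::euclidean_space, 'y) manifold_scheme \<Rightarrow> ('a, 'e::euclidean_space, 'z) manifold_scheme
    \<Rightarrow> ('b \<Rightarrow> 'a) \<Rightarrow> 'b set \<Rightarrow> ('b \<Rightarrow> 'e) \<Rightarrow> bool" where
  "smooth_along N M F U Y \<longleftrightarrow>
    (\<forall>p\<in>U. \<exists>S. coord_nbhd N (U \<inter> F -` cdom M (F p)) p S \<and>
       smooth_on S (\<lambda>x. let q = cinv N p x in trans M (F q) (F p) (F q) (Y q)))"

text \<open>Smooth curves on an open set of parameters, and their velocity.\<close>

definition smooth_curve ::
  "('a, 'e::euclidean_space, 'z) manifold_scheme \<Rightarrow> real set \<Rightarrow> (real \<Rightarrow> 'a) \<Rightarrow> bool" where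
  "smooth_curve M J c \<longleftrightarrow>
    (\<forall>t\<in>J. c t \<in> points M \<and>
      (\<exists>T. open T \<and> t \<in> T \<and> T \<subseteq> J \<and> c ` T \<subseteq> cdom M (c t) \<and> smooth_on T (cmap M (c t) \<circ> c)))"

definition velocity ::
  "('a, 'e::euclidean_space, 'z) manifold_scheme \<Rightarrow> (real \<Rightarrow> 'a) \<Rightarrow> real \<Rightarrow> 'e" where
  "velocity M c t = vector_derivative (cmap M (c t) \<circ> c) (at t)"

text \<open>Embedded submanifolds, by slice charts.\<close>

definition embedded_submanifold ::
  "('b, 'm::euclidean_space, 'y) manifold_scheme \<Rightarrow> 'b set \<Rightarrow> bool" where
  "embedded_submanifold M S \<longleftrightarrow>
    S \<subseteq> points M \<and>
    (\<exists>k. \<forall>p\<in>S. \<exists>V c L. smooth_chart M V c \<and> p \<in> V \<and> subspace L \<and> dim L = k \<and>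
       c ` (S \<inter> V) = c ` V \<inter> L)"

definition smooth_fun_sub ::
  "('b, 'm::euclidean_space, 'y) manifold_scheme \<Rightarrow> 'b set \<Rightarrow> ('b \<Rightarrow> real) \<Rightarrow> bool" where
  "smooth_fun_sub M S f \<longleftrightarrow>
    (\<forall>p\<in>S. \<exists>V F. openin (mtop M) V \<and> p \<in> V \<and> smooth_fun M V F \<and> (\<forall>q \<in> S \<inter> V. F q = f q))"


section \<open>Riemannian metrics and the Levi-Civita connection\<close>

definition gnorm :: "('e \<Rightarrow> 'e \<Rightarrow> real) \<Rightarrow> 'e \<Rightarrow> real" where
  "gnorm b v = sqrt (b v v)"

definition orth_proj :: "('e::real_vector \<Rightarrow> 'e \<Rightarrow> real) \<Rightarrow> 'e set \<Rightarrow> 'e \<Rightarrow> 'e" where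
  "orth_proj b W v = (THE w. w \<in> W \<and> (\<forall>z\<in>W. b (v - w) z = 0))"

text \<open>Angle between a nonzero vector and a subspace.\<close>

definition angle_to :: "('e::real_vector \<Rightarrow> 'e \<Rightarrow> real) \<Rightarrow> 'e \<Rightarrow> 'e set \<Rightarrow> real" where
  "angle_to b v W = arccos (gnorm b (orth_proj b W v) / gnorm b v)"

text \<open>The metric in the preferred chart of \<open>p\<close>, as a function of the coordinate point \<open>x\<close>.\<close>

definition met_in ::
  "('a, 'e::euclidean_space, 'z) manifold_scheme \<Rightarrow> ('a \<Rightarrow> 'e \<Rightarrow> 'e \<Rightarrow> real)
    \<Rightarrow> 'a \<Rightarrow> 'e \<Rightarrow> 'e \<Rightarrow> 'e \<Rightarrow> real" where
  "met_in M g p x u v = (let r = cinv M p x in g r (trans M p r r u) (trans M p r r v))"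

definition riemannian_metric ::
  "('a, 'e::euclidean_space, 'z) manifold_scheme \<Rightarrow> ('a \<Rightarrow> 'e \<Rightarrow> 'e \<Rightarrow> real) \<Rightarrow> bool" where
  "riemannian_metric M g \<longleftrightarrow>
    (\<forall>p \<in> points M.
       bilinear (g p) \<and> (\<forall>u v. g p u v = g p v u) \<and> (\<forall>u. u \<noteq> 0 \<longrightarrow> g p u u > 0) \<and>
       (\<forall>u v. smooth_on (cmap M p ` cdom M p) (\<lambda>x. met_in M g p x u v)))"

text \<open>Christoffel symbols at \<open>p\<close> in the preferred chart of \<open>p\<close>:
  \<open>g(\<Gamma>(u,v),z) = (\<partial>\<^sub>u g(v,z) + \<partial>\<^sub>v g(u,z) - \<partial>\<^sub>z g(u,v)) / 2\<close> for constant \<open>u, v, z\<close>.\<close>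

definition christoffel ::
  "('a, 'e::euclidean_space, 'z) manifold_scheme \<Rightarrow> ('a \<Rightarrow> 'e \<Rightarrow> 'e \<Rightarrow> real)
    \<Rightarrow> 'a \<Rightarrow> 'e \<Rightarrow> 'e \<Rightarrow> 'e" where
  "christoffel M g p u v = (THE w. \<forall>z.
     g p w z =
       (frechet_derivative (\<lambda>x. met_in M g p x v z) (at (cmap M p p)) u
      + frechet_derivative (\<lambda>x. met_in M g p x u z) (at (cmap M p p)) v
      - frechet_derivative (\<lambda>x. met_in M g p x u v) (at (cmap M p p)) z) / 2)"

text \<open>Levi-Civita covariant derivative at \<open>p\<close>, in the direction of the tangent vector \<open>u\<close> of \<open>N\<close>, of
  a vector field \<open>Y\<close> along \<open>F : N \<rightarrow> M\<close>. For \<open>N = M\<close> and \<open>F\<close> the identity this is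
  the Levi-Civita connection of \<open>g\<close> itself.\<close>

definition nabla ::
  "('b, 'm::euclidean_space, 'y) manifold_scheme \<Rightarrow> ('a, 'e::euclidean_space, 'z) manifold_scheme
    \<Rightarrow> ('a \<Rightarrow> 'e \<Rightarrow> 'e \<Rightarrow> real) \<Rightarrow> ('b \<Rightarrow> 'a) \<Rightarrow> 'b \<Rightarrow> 'm \<Rightarrow> ('b \<Rightarrow> 'e) \<Rightarrow> 'e" where
  "nabla N M g F p u Y =
     frechet_derivative
       (\<lambda>x. let q = cinv N p x in trans M (F q) (F p) (F q) (Y q)) (at (cmap N p p)) u
     + christoffel M g (F p) (mderiv N M F p u) (Y p)"


section \<open>Almost contact metric and cosymplectic manifolds\<close>

record ('a, 'e) acm = "('a, 'e) manifold" +
  phi :: "'a \<Rightarrow> 'e \<Rightarrow> 'e"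
  xi  :: "'a \<Rightarrow> 'e"
  eta :: "'a \<Rightarrow> 'e \<Rightarrow> real"
  met :: "'a \<Rightarrow> 'e \<Rightarrow> 'e \<Rightarrow> real"

definition almost_contact_metric :: "('a, 'e::euclidean_space) acm \<Rightarrow> bool" where
  "almost_contact_metric A \<longleftrightarrow>
    smooth_manifold A \<and> odd (DIM('e)) \<and> riemannian_metric A (met A) \<and>
    smooth_along A A (\<lambda>p. p) (points A) (xi A) \<and>
    (\<forall>p \<in> points A.
       linear (phi A p) \<and> linear (eta A p) \<and>
       (\<forall>u. smooth_on (cmap A p ` cdom A p)
              (\<lambda>x. let r = cinv A p x in trans A r p r (phi A r (trans A p r r u)))) \<and>
       (\<forall>u. smooth_on (cmap A p ` cdom A p)
              (\<lambda>x. let r = cinv A p x in eta A r (trans A p r r u))) \<and>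
       (\<forall>u. phi A p (phi A p u) = - u + eta A p u *\<^sub>R xi A p) \<and>
       eta A p (xi A p) = 1 \<and> phi A p (xi A p) = 0 \<and> (\<forall>u. eta A p (phi A p u) = 0) \<and>
       (\<forall>u v. met A p (phi A p u) (phi A p v) = met A p u v - eta A p u * eta A p v))"

definition cosymplectic :: "('a, 'e::euclidean_space) acm \<Rightarrow> bool" where
  "cosymplectic A \<longleftrightarrow>
    almost_contact_metric A \<and>
    (\<forall>p \<in> points A. \<forall>u.
       (\<forall>V Y. openin (mtop A) V \<and> p \<in> V \<and> smooth_along A A (\<lambda>q. q) V Y \<longrightarrow>
          nabla A A (met A) (\<lambda>q. q) p u (\<lambda>q. phi A q (Y q))
            = phi A p (nabla A A (met A) (\<lambda>q. q) p u Y)) \<and>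
       nabla A A (met A) (\<lambda>q. q) p u (xi A) = 0)"


section \<open>Submanifolds of an almost contact metric manifold\<close>

text \<open>A submanifold is an isometrically immersed manifold \<open>\<iota> : M \<rightarrow> A\<close>. Tangent vectors of \<open>M\<close>
  at \<open>p\<close> are identified with their images in the tangent space \<open>'e\<close> of \<open>A\<close> at \<open>\<iota> p\<close>; vector
  fields, distributions and normal fields on \<open>M\<close> are taken in this form throughout. The induced
  metric at \<open>p\<close> is then simply \<open>met A (\<iota> p)\<close> on \<open>TM p\<close>.\<close>

definition immersion ::
  "('b, 'm::euclidean_space, 'y) manifold_scheme \<Rightarrow> ('a, 'e::euclidean_space, 'z) manifold_scheme
    \<Rightarrow> ('b \<Rightarrow> 'a) \<Rightarrow> bool" where
  "immersion M A \<iota> \<longleftrightarrow>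
    smooth_map M A (points M) \<iota> \<and> (\<forall>p \<in> points M. inj (mderiv M A \<iota> p))"

definition TM ::
  "('b, 'm::euclidean_space, 'y) manifold_scheme \<Rightarrow> ('a, 'e::euclidean_space, 'z) manifold_scheme
    \<Rightarrow> ('b \<Rightarrow> 'a) \<Rightarrow> 'b \<Rightarrow> 'e set" where
  "TM M A \<iota> p = range (mderiv M A \<iota> p)"

text \<open>The vector of \<open>M\<close> represented by a vector of \<open>A\<close> tangent to \<open>M\<close>.\<close>

definition intrinsic ::
  "('b, 'm::euclidean_space, 'y) manifold_scheme \<Rightarrow> ('a, 'e::euclidean_space, 'z) manifold_scheme
    \<Rightarrow> ('b \<Rightarrow> 'a) \<Rightarrow> 'b \<Rightarrow> 'e \<Rightarrow> 'm" where
  "intrinsic M A \<iota> p v = inv (mderiv M A \<iota> p) v"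

text \<open>\<open>X(f)\<close> at \<open>p\<close>, for a vector \<open>X\<close> tangent to \<open>M\<close> at \<open>p\<close>.\<close>

definition dir_deriv ::
  "('b, 'm::euclidean_space, 'y) manifold_scheme \<Rightarrow> ('a, 'e::euclidean_space, 'z) manifold_scheme
    \<Rightarrow> ('b \<Rightarrow> 'a) \<Rightarrow> 'b \<Rightarrow> 'e \<Rightarrow> ('b \<Rightarrow> real) \<Rightarrow> real" where
  "dir_deriv M A \<iota> p v f = fderiv M f p (intrinsic M A \<iota> p v)"

definition tan_proj ::
  "('a, 'e::euclidean_space) acm \<Rightarrow> ('b, 'm::euclidean_space, 'y) manifold_scheme
    \<Rightarrow> ('b \<Rightarrow> 'a) \<Rightarrow> 'b \<Rightarrow> 'e \<Rightarrow> 'e" where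
  "tan_proj A M \<iota> p v = orth_proj (met A (\<iota> p)) (TM M A \<iota> p) v"

text \<open>\<open>\<phi> X = P X + F X\<close>\<close>

definition P_op ::
  "('a, 'e::euclidean_space) acm \<Rightarrow> ('b, 'm::euclidean_space, 'y) manifold_scheme
    \<Rightarrow> ('b \<Rightarrow> 'a) \<Rightarrow> 'b \<Rightarrow> 'e \<Rightarrow> 'e" where
  "P_op A M \<iota> p v = tan_proj A M \<iota> p (phi A (\<iota> p) v)"

definition F_op ::
  "('a, 'e::euclidean_space) acm \<Rightarrow> ('b, 'm::euclidean_space, 'y) manifold_scheme
    \<Rightarrow> ('b \<Rightarrow> 'a) \<Rightarrow> 'b \<Rightarrow> 'e \<Rightarrow> 'e" where
  "F_op A M \<iota> p v = phi A (\<iota> p) v - P_op A M \<iota> p v"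

text \<open>Smooth sections over the open set \<open>V\<close> of a family \<open>D\<close> of subspaces.\<close>

definition is_section ::
  "('a, 'e::euclidean_space) acm \<Rightarrow> ('b, 'm::euclidean_space, 'y) manifold_scheme
    \<Rightarrow> ('b \<Rightarrow> 'a) \<Rightarrow> 'b set \<Rightarrow> ('b \<Rightarrow> 'e set) \<Rightarrow> ('b \<Rightarrow> 'e) \<Rightarrow> bool" where
  "is_section A M \<iota> V D X \<longleftrightarrow> smooth_along M A \<iota> V X \<and> (\<forall>q\<in>V. X q \<in> D q)"

text \<open>Second fundamental form \<open>h(X,Y)\<close> at \<open>p\<close> for a tangent vector \<open>X\<close> at \<open>p\<close> and a tangent
  vector field \<open>Y\<close>: the normal part of the ambient covariant derivative of \<open>Y\<close> along \<open>X\<close>.\<close>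

definition second_ff ::
  "('a, 'e::euclidean_space) acm \<Rightarrow> ('b, 'm::euclidean_space, 'y) manifold_scheme
    \<Rightarrow> ('b \<Rightarrow> 'a) \<Rightarrow> 'b \<Rightarrow> 'e \<Rightarrow> ('b \<Rightarrow> 'e) \<Rightarrow> 'e" where
  "second_ff A M \<iota> p X Y =
     (let w = nabla M A (met A) \<iota> p (intrinsic M A \<iota> p X) Y in w - tan_proj A M \<iota> p w)"

definition shape_op ::
  "('a, 'e::euclidean_space) acm \<Rightarrow> ('b, 'm::euclidean_space, 'y) manifold_scheme
    \<Rightarrow> ('b \<Rightarrow> 'a) \<Rightarrow> 'b \<Rightarrow> 'e \<Rightarrow> 'e \<Rightarrow> 'e" where
  "shape_op A M \<iota> p N X = (THE a. a \<in> TM M A \<iota> p \<and>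
     (\<forall>V Y. openin (mtop M) V \<and> p \<in> V \<and> is_section A M \<iota> V (TM M A \<iota>) Y \<longrightarrow>
        met A (\<iota> p) a (Y p) = met A (\<iota> p) (second_ff A M \<iota> p X Y) N))"

text \<open>A distribution on \<open>M\<close>, i.e. a smooth subbundle of \<open>TM\<close> of constant rank.\<close>

definition distribution ::
  "('a, 'e::euclidean_space) acm \<Rightarrow> ('b, 'm::euclidean_space, 'y) manifold_scheme
    \<Rightarrow> ('b \<Rightarrow> 'a) \<Rightarrow> ('b \<Rightarrow> 'e set) \<Rightarrow> bool" where
  "distribution A M \<iota> D \<longleftrightarrow>
    (\<exists>k. \<forall>p \<in> points M. subspace (D p) \<and> D p \<subseteq> TM M A \<iota> p \<and> dim (D p) = k \<and>
      (\<forall>v \<in> D p. \<exists>V X. openin (mtop M) V \<and> p \<in> V \<and> is_section A M \<iota> V D X \<and> X p = v))"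

definition pointwise_semi_slant ::
  "('a, 'e::euclidean_space) acm \<Rightarrow> ('b, 'm::euclidean_space) manifold
    \<Rightarrow> ('b \<Rightarrow> 'a) \<Rightarrow> ('b \<Rightarrow> 'e set) \<Rightarrow> ('b \<Rightarrow> 'e set) \<Rightarrow> ('b \<Rightarrow> real) \<Rightarrow> bool" where
  "pointwise_semi_slant A M \<iota> D D\<theta> \<theta> \<longleftrightarrow>
    smooth_manifold M \<and> immersion M A \<iota> \<and> distribution A M \<iota> D \<and> distribution A M \<iota> D\<theta> \<and>
    (\<forall>p \<in> points M.
       TM M A \<iota> p = {x + z + c *\<^sub>R xi A (\<iota> p) | x z c. x \<in> D p \<and> z \<in> D\<theta> p} \<and>
       (\<forall>x \<in> D p. \<forall>z \<in> D\<theta> p. met A (\<iota> p) x z = 0) \<and>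
       (\<forall>x \<in> D p. met A (\<iota> p) x (xi A (\<iota> p)) = 0) \<and>
       (\<forall>z \<in> D\<theta> p. met A (\<iota> p) z (xi A (\<iota> p)) = 0) \<and>
       phi A (\<iota> p) ` D p = D p \<and>
       (\<forall>z \<in> D\<theta> p. z \<noteq> 0 \<longrightarrow> angle_to (met A (\<iota> p)) (phi A (\<iota> p) z) (D\<theta> p) = \<theta> p))"

text \<open>\<open>D \<oplus> \<langle>\<xi>\<rangle>\<close>\<close>

definition plus_xi ::
  "('a, 'e::euclidean_space) acm \<Rightarrow> ('b \<Rightarrow> 'a) \<Rightarrow> ('b \<Rightarrow> 'e set) \<Rightarrow> 'b \<Rightarrow> 'e set" where
  "plus_xi A \<iota> D p = {x + c *\<^sub>R xi A (\<iota> p) | x c. x \<in> D p}"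


section \<open>Warped product submanifolds\<close>

text \<open>Tangent space at \<open>q\<close> of an embedded submanifold \<open>S\<close> of \<open>M\<close>, as a subspace of the tangent space
  of \<open>A\<close> at \<open>\<iota> q\<close>: the velocities of the smooth curves lying in \<open>S\<close>. The predicates below regard \<open>S\<close>
  as a submanifold of \<open>A\<close> through \<open>\<iota>\<close>.\<close>

definition T_sub ::
  "('a, 'e::euclidean_space) acm \<Rightarrow> ('b, 'm::euclidean_space) manifold \<Rightarrow> ('b \<Rightarrow> 'a)
    \<Rightarrow> 'b set \<Rightarrow> 'b \<Rightarrow> 'e set" where
  "T_sub A M \<iota> S q = {velocity A (\<iota> \<circ> c) 0 | c e.
     e > 0 \<and> smooth_curve M {-e<..<e} c \<and> c 0 = q \<and> c ` {-e<..<e} \<subseteq> S}"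

definition invariant_submanifold ::
  "('a, 'e::euclidean_space) acm \<Rightarrow> ('b, 'm::euclidean_space) manifold \<Rightarrow> ('b \<Rightarrow> 'a)
    \<Rightarrow> 'b set \<Rightarrow> bool" where
  "invariant_submanifold A M \<iota> S \<longleftrightarrow>
    embedded_submanifold M S \<and>
    (\<forall>q\<in>S. phi A (\<iota> q) ` T_sub A M \<iota> S q \<subseteq> T_sub A M \<iota> S q)"

definition slant_function_of ::
  "('a, 'e::euclidean_space) acm \<Rightarrow> ('b, 'm::euclidean_space) manifold \<Rightarrow> ('b \<Rightarrow> 'a)
    \<Rightarrow> 'b set \<Rightarrow> ('b \<Rightarrow> real) \<Rightarrow> bool" where
  "slant_function_of A M \<iota> S \<theta> \<longleftrightarrow>
    (\<forall>q\<in>S. \<forall>X \<in> T_sub A M \<iota> S q. X \<notin> span {xi A (\<iota> q)} \<longrightarrow>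
       angle_to (met A (\<iota> q)) (phi A (\<iota> q) X) (T_sub A M \<iota> S q) = \<theta> q)"

text \<open>Properness: the slant function takes neither the value \<open>0\<close> nor the value \<open>\<pi>/2\<close> and is not
  constant.\<close>

definition proper_pointwise_slant ::
  "('a, 'e::euclidean_space) acm \<Rightarrow> ('b, 'm::euclidean_space) manifold \<Rightarrow> ('b \<Rightarrow> 'a)
    \<Rightarrow> 'b set \<Rightarrow> bool" where
  "proper_pointwise_slant A M \<iota> S \<longleftrightarrow>
    embedded_submanifold M S \<and>
    (\<exists>\<theta>. slant_function_of A M \<iota> S \<theta> \<and>
       (\<forall>q\<in>S. \<theta> q \<noteq> 0 \<and> \<theta> q \<noteq> pi / 2) \<and> \<not> \<theta> constant_on S)"

text \<open>The open set \<open>U\<close> of \<open>M\<close> is a non-trivial warped product \<open>MT \<times>\<^sub>f M\<theta>\<close>, with base point \<open>p\<close>.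
  The identification of \<open>U\<close> with \<open>MT \<times> M\<theta>\<close> is given by its two components \<open>\<pi>1\<close> and \<open>\<pi>2\<close>: it is
  a smooth bijection with bijective differential, hence a diffeomorphism, and it carries the
  induced metric to the warped product metric. As usual for warped product submanifolds the factors
  are identified with the leaves through \<open>p\<close> (which normalizes \<open>f p = 1\<close>), and being
  invariant, resp. proper pointwise slant, is required of all leaves.\<close>

definition warped_product_piece ::
  "('a, 'e::euclidean_space) acm \<Rightarrow> ('b, 'm::euclidean_space) manifold \<Rightarrow> ('b \<Rightarrow> 'a)
    \<Rightarrow> 'b set \<Rightarrow> 'b \<Rightarrow> 'b set \<Rightarrow> 'b set \<Rightarrow> ('b \<Rightarrow> real) \<Rightarrow> ('b \<Rightarrow> 'b) \<Rightarrow> ('b \<Rightarrow> 'b) \<Rightarrow> bool" where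
  "warped_product_piece A M \<iota> U p MT M\<theta> f \<pi>1 \<pi>2 \<longleftrightarrow>
    embedded_submanifold M MT \<and> embedded_submanifold M M\<theta> \<and>
    connectedin (mtop M) MT \<and> connectedin (mtop M) M\<theta> \<and>
    MT \<subseteq> U \<and> M\<theta> \<subseteq> U \<and> p \<in> MT \<and> p \<in> M\<theta> \<and>
    (\<forall>x\<in>MT. \<pi>1 x = x \<and> \<pi>2 x = p) \<and> (\<forall>y\<in>M\<theta>. \<pi>1 y = p \<and> \<pi>2 y = y) \<and>
    smooth_map M M U \<pi>1 \<and> smooth_map M M U \<pi>2 \<and>
    bij_betw (\<lambda>q. (\<pi>1 q, \<pi>2 q)) U (MT \<times> M\<theta>) \<and>
    (\<forall>q\<in>U. bij_betw (\<lambda>u. (mderiv M A (\<iota> \<circ> \<pi>1) q u, mderiv M A (\<iota> \<circ> \<pi>2) q u)) UNIV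
              (T_sub A M \<iota> MT (\<pi>1 q) \<times> T_sub A M \<iota> M\<theta> (\<pi>2 q))) \<and>
    smooth_fun_sub M MT f \<and> (\<forall>x\<in>MT. f x > 0) \<and> \<not> f constant_on MT \<and>
    (\<forall>q\<in>U. \<forall>u v.
       met A (\<iota> q) (mderiv M A \<iota> q u) (mderiv M A \<iota> q v) =
         met A (\<iota> (\<pi>1 q)) (mderiv M A (\<iota> \<circ> \<pi>1) q u) (mderiv M A (\<iota> \<circ> \<pi>1) q v)
       + (f (\<pi>1 q))\<^sup>2 *
         met A (\<iota> (\<pi>2 q)) (mderiv M A (\<iota> \<circ> \<pi>2) q u) (mderiv M A (\<iota> \<circ> \<pi>2) q v)) \<and>
    (\<forall>y\<in>M\<theta>. let S = {q \<in> U. \<pi>2 q = y} in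
       invariant_submanifold A M \<iota> S \<and> (\<forall>q\<in>S. xi A (\<iota> q) \<in> T_sub A M \<iota> S q)) \<and>
    (\<forall>x\<in>MT. proper_pointwise_slant A M \<iota> {q \<in> U. \<pi>1 q = x})"

text \<open>``Locally'' means: on arbitrarily small neighbourhoods of every point.\<close>

definition locally_warped_product ::
  "('a, 'e::euclidean_space) acm \<Rightarrow> ('b, 'm::euclidean_space) manifold \<Rightarrow> ('b \<Rightarrow> 'a) \<Rightarrow> bool"
  where
  "locally_warped_product A M \<iota> \<longleftrightarrow>
    (\<forall>p \<in> points M. \<forall>V. openin (mtop M) V \<and> p \<in> V \<longrightarrow>
      (\<exists>U MT M\<theta> f \<pi>1 \<pi>2. openin (mtop M) U \<and> p \<in> U \<and> U \<subseteq> V \<and>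
         warped_product_piece A M \<iota> U p MT M\<theta> f \<pi>1 \<pi>2))"

text \<open>Properness of the slant function of a pointwise semi-slant submanifold, in infinitesimal form:
  \<open>\<theta>\<close> takes values different from \<open>0\<close> and \<open>\<pi>/2\<close>, and there is no nonempty open set on which it
  is constant in the directions of \<open>D\<theta>\<close>.\<close>

definition proper_slant_along ::
  "('a, 'e::euclidean_space) acm \<Rightarrow> ('b, 'm::euclidean_space) manifold \<Rightarrow> ('b \<Rightarrow> 'a)
    \<Rightarrow> ('b \<Rightarrow> 'e set) \<Rightarrow> ('b \<Rightarrow> real) \<Rightarrow> bool" where
  "proper_slant_along A M \<iota> D\<theta> \<theta> \<longleftrightarrow>
    (\<forall>p \<in> points M. \<theta> p \<noteq> 0 \<and> \<theta> p \<noteq> pi / 2) \<and>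
    (\<forall>V. openin (mtop M) V \<and> V \<noteq> {} \<longrightarrow>
       (\<exists>q\<in>V. \<exists>Z \<in> D\<theta> q. Z \<noteq> 0 \<and> dir_deriv M A \<iota> q Z \<theta> \<noteq> 0))"

end

theory Submission
 imports Defs
begin

text \<open>The condition on the shape operators says that \<open>g(\<nabla>\<^sub>v X, w) = X(\<mu>) g(v, w)\<close> for \<open>X\<close> in
 \<open>D \<oplus> \<langle>\<xi>\<rangle>\<close>, \<open>w\<close> in \<open>D\<theta>\<close> and \<open>v\<close> tangent to \<open>M\<close>. Hence both distributions are involutive, and in
 coordinates straightening them (Frobenius) the metric of \<open>D \<oplus> \<langle>\<xi>\<rangle>\<close> does not depend on the leaf, while
 that of \<open>D\<theta>\<close> is scaled by \<open>e\<^sup>2\<^sup>\<mu>\<close>: a warped product with \<open>f = e\<^sup>\<mu>\<close>. As the fundamental 2-form is closed,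
 \<open>e\<^sup>2\<^sup>\<mu> cos \<theta>\<close> is constant along the leaves of \<open>D \<oplus> \<langle>\<xi>\<rangle>\<close>; so \<open>\<theta>\<close> is not constant on any leaf of \<open>D\<theta>\<close>
 unless it is constant in the direction of \<open>D\<theta>\<close> on an open set. Conversely, the tangent spaces of the leaves
 of a warped product are \<open>D \<oplus> \<langle>\<xi>\<rangle>\<close> and \<open>D\<theta>\<close>, because the splitting is determined by \<open>P\<^sup>2\<close>, and Koszul's
 formula gives the connection with \<open>\<mu> = ln f\<close>.\<close>

section \<open>Calculus of smooth functions\<close>

text \<open>The factor sin^2 \<theta> has a single source: \<nabla>\<phi> = 0 moves \<phi> off
  \<open>X\<close>, and P^2 = -cos^2 \<theta> on D\<theta>. Where sin \<theta> = 0 the condition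
  says nothing about the connection, so properness is needed before the geometry can begin. The
  function \<mu> exists only near each point and the product neighbourhoods may be arbitrarily
  small; hence non-constancy is required on every nonempty open subset. The work takes place in
  coordinate boxes closed under \<open>y - Q y + Q z\<close>, where both distributions are kernel
  and range of one constant projection \<open>Q\<close>, so that statements about leaves become
  derivatives along segments. Straightening needs flows that are smooth in the initial point; they
  come from inverting an operator on a Banach space of curves. In the converse the factors are bare
  subsets of the manifold: their tangent spaces and slant functions are unknown and have to be
  identified with D \<oplus> \<langle>\<xi>\<rangle>, D\<theta> and \<theta>. For this the second
  factor must have positive dimension, which follows because a nonconstant function lives on a
  connected leaf.\<close>

abbreviation fd :: "('u::real_normed_vector => 'w::real_normed_vector) => 'u filter => 'u => 'w" where
 "fd \<equiv> frechet_derivative"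

lemma linear_Basis_expand:
 fixes L :: "'v::euclidean_space => 'w::real_vector"
 assumes "linear L"
 shows "L v = (\<Sum>i\<in>Basis. (v \<bullet> i) *\<^sub>R L i)"
 using linear_sum[OF assms, of "%i. (v \<bullet> i) *\<^sub>R i" Basis]
 by (simp add: euclidean_representation linear_scale[OF assms])

lemma Ck_on_subset: "Ck_on k S f ==> T \<subseteq> S ==> Ck_on k T f"
 by (induction k arbitrary: f) (auto intro: continuous_on_subset)

lemma Ck_on_SucD: "Ck_on (Suc k) S f ==> Ck_on k S f"
proof (induction k arbitrary: f)
 case 0
 then show ?case
  by (auto intro!: continuous_at_imp_continuous_on differentiable_imp_continuous_within)
qed auto

lemma Ck_on_mono: "Ck_on k S f ==> j \<le> k ==> Ck_on j S f"
 by (induction k) (use Ck_on_SucD le_Suc_eq in auto)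

lemma frechet_derivative_cong_open:
 assumes "open S" "x \<in> S" "\<And>y. y \<in> S ==> f y = g y"
 shows "fd f (at x) = fd g (at x)"
  and "f differentiable (at x) \<longleftrightarrow> g differentiable (at x)"
proof -
 have "(f has_derivative D) (at x) \<longleftrightarrow> (g has_derivative D) (at x)" for D
  using has_derivative_transform_within_open[of f D x UNIV S g]
   has_derivative_transform_within_open[of g D x UNIV S f] assms by auto
 then show "fd f (at x) = fd g (at x)"
  "f differentiable (at x) \<longleftrightarrow> g differentiable (at x)"
  by (auto simp: frechet_derivative_def differentiable_def)
qed

lemma Ck_on_cong:
 assumes "open S" "\<And>x. x \<in> S ==> f x = g x" "Ck_on k S f"
 shows "Ck_on k S g"
 using assms(2,3)
proof (induction k arbitrary: f g)
 case 0
 then show ?case by (metis Ck_on.simps(1) continuous_on_cong)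
next
 case (Suc k)
 have *: "fd f (at x) = fd g (at x)"
  "f differentiable (at x) \<longleftrightarrow> g differentiable (at x)" if "x \<in> S" for x
  using frechet_derivative_cong_open[OF \<open>open S\<close> that, of f g] Suc.prems by auto
 have "Ck_on k S (%x. fd g (at x) v)" for v
  by (rule Suc.IH[of "%x. fd f (at x) v"]) (use Suc.prems * in auto)
 then show ?case using Suc.prems * by auto
qed

text \<open>Differentiation rules deliver a derivative \<open>f'\<close> of their own shape. Stating
  the step for any such \<open>f'\<close> lets each closure property be an induction on
  \<open>k\<close> whose step merely repeats that rule.\<close>

lemma Ck_on_SucI:
 assumes "open S" "\<And>x. x \<in> S ==> (f has_derivative f' x) (at x)"
  "\<And>v. Ck_on k S (%x. f' x v)"
 shows "Ck_on (Suc k) S f"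
proof -
 have "Ck_on k S (%x. fd f (at x) v)" for v
 proof (rule Ck_on_cong[OF assms(1) _ assms(3)])
  show "f' x v = fd f (at x) v" if "x \<in> S" for x
   using frechet_derivative_at[OF assms(2)[OF that]] by simp
 qed
 moreover have "\<forall>x\<in>S. f differentiable (at x)"
  using assms(2) differentiableI by blast
 ultimately show ?thesis by simp
qed

lemma Ck_on_has_derivative:
 "Ck_on (Suc k) S f ==> x \<in> S ==> (f has_derivative fd f (at x)) (at x)"
 by (metis Ck_on.simps(2) frechet_derivative_works)

lemma Ck_on_local:
 assumes "\<And>x. x \<in> S ==> \<exists>T. open T \<and> x \<in> T \<and> Ck_on k T f"
 shows "Ck_on k S f"
 using assms
proof (induction k arbitrary: f)
 case 0
 then show ?case
  by (metis Ck_on.simps(1) continuous_at_imp_continuous_on continuous_on_eq_continuous_at)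
next
 case (Suc k)
 have "Ck_on k S (%x. fd f (at x) v)" for v
  by (rule Suc.IH) (use Suc.prems in fastforce)
 then show ?case using Suc.prems by fastforce
qed

lemma Ck_on_const: "Ck_on k S (%x. c)"
 by (induction k arbitrary: c) auto

lemma Ck_on_bounded_linear:
 assumes "bounded_linear L" "open S" "Ck_on k S f"
 shows "Ck_on k S (%x. L (f x))"
 using assms(3)
proof (induction k arbitrary: f)
 case 0
 then show ?case
  using bounded_linear.continuous_on[OF assms(1)] by auto
next
 case (Suc k)
 have "(f has_derivative fd f (at x)) (at x)" if "x \<in> S" for x
  using Ck_on_has_derivative[OF Suc.prems that] .
 then have d: "((%x. L (f x)) has_derivative (%v. L (fd f (at x) v))) (at x)"
  if "x \<in> S" for x
  using bounded_linear.has_derivative[OF assms(1)] that by blast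
 show ?case
  by (rule Ck_on_SucI[OF assms(2) d]) (use Suc in auto)
qed

lemma Ck_on_linear:
 assumes "bounded_linear L" "open S"
 shows "Ck_on k S L"
proof -
 have "Ck_on k S (%x. x)"
 proof (cases k)
  case (Suc j)
  then show ?thesis
   using Ck_on_SucI[OF assms(2), of "%x. x" "%_ v. v" j] by (simp add: Ck_on_const)
 qed simp
 from Ck_on_bounded_linear[OF assms this] show ?thesis by simp
qed

lemma Ck_on_add:
 assumes "open S" "Ck_on k S f" "Ck_on k S g"
 shows "Ck_on k S (%x. f x + g x)"
 using assms(2,3)
proof (induction k arbitrary: f g)
 case 0
 then show ?case by (simp add: continuous_on_add)
next
 case (Suc k)
 have d: "((%x. f x + g x) has_derivative
  (%v. fd f (at x) v + fd g (at x) v)) (at x)" if "x \<in> S" for x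
  by (intro has_derivative_add Ck_on_has_derivative[OF _ that]) (fact Suc.prems)+
 show ?case
  by (rule Ck_on_SucI[OF assms(1) d]) (use Suc in auto)
qed

lemma Ck_on_sum:
 assumes "open S" "\<And>i. i \<in> I ==> Ck_on k S (f i)"
 shows "Ck_on k S (%x. \<Sum>i\<in>I. f i x)"
 using assms(2)
 by (induction I rule: infinite_finite_induct) (auto simp: Ck_on_const intro!: Ck_on_add assms(1))

lemma Ck_on_bilinear:
 assumes "bounded_bilinear B" "open S" "Ck_on k S f" "Ck_on k S g"
 shows "Ck_on k S (%x. B (f x) (g x))"
 using assms(3,4)
proof (induction k arbitrary: f g)
 case 0
 then show ?case using bounded_bilinear.continuous_on[OF assms(1)] by auto
next
 case (Suc k)
 have d: "((%x. B (f x) (g x)) has_derivative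
  (%v. B (f x) (fd g (at x) v) + B (fd f (at x) v) (g x))) (at x)"
  if "x \<in> S" for x
  by (intro bounded_bilinear.FDERIV[OF assms(1)] Ck_on_has_derivative[OF _ that]) (fact Suc.prems)+
 show ?case
 proof (rule Ck_on_SucI[OF assms(2) d])
  show "Ck_on k S (%x. B (f x) (fd g (at x) v) + B (fd f (at x) v) (g x))" for v
   using Suc.prems Ck_on_SucD[OF Suc.prems(1)] Ck_on_SucD[OF Suc.prems(2)]
   by (intro Ck_on_add[OF assms(2)] Suc.IH) simp_all
 qed
qed

text \<open>The chain rule, expanded in a basis, writes the derivative as a sum of scalar functions
  of class \<open>C^k\<close> times partial derivatives of \<open>g\<close> composed with
  \<open>f\<close>. So the induction runs over all \<open>g\<close> with one and the same inner
  map.\<close>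

lemma Ck_on_compose:
 fixes f :: "'u::real_normed_vector => 'v::euclidean_space"
 assumes "open S" "open T" "f ` S \<subseteq> T" "Ck_on k S f" "Ck_on k T g"
 shows "Ck_on k S (%x. g (f x))"
 using assms(4,5)
proof (induction k arbitrary: g)
 case 0
 then show ?case using assms(3) by (auto intro: continuous_on_compose2)
next
 case (Suc k)
 have fd: "(f has_derivative fd f (at x)) (at x)" if "x \<in> S" for x
  using Ck_on_has_derivative[OF Suc.prems(1) that] .
 have gd: "(g has_derivative fd g (at y)) (at y)" if "y \<in> T" for y
  using Ck_on_has_derivative[OF Suc.prems(2) that] .
 have d: "((%x. g (f x)) has_derivative
  (%v. \<Sum>i\<in>Basis. (fd f (at x) v \<bullet> i) *\<^sub>R fd g (at (f x)) i)) (at x)"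
  if "x \<in> S" for x
 proof -
  have "linear (fd g (at (f x)))"
   using gd[of "f x"] assms(3) that has_derivative_linear by blast
  note rep = linear_Basis_expand[OF this]
  have "((%x. g (f x)) has_derivative
   (%v. fd g (at (f x)) (fd f (at x) v))) (at x)"
   by (rule has_derivative_compose[OF fd gd]) (use that assms(3) in auto)
  then show ?thesis by (rule has_derivative_eq_rhs) (rule ext, rule rep)
 qed
 show ?case
 proof (rule Ck_on_SucI[OF assms(1) d])
  show "Ck_on k S (%x. \<Sum>i\<in>Basis. (fd f (at x) v \<bullet> i) *\<^sub>R fd g (at (f x)) i)" for v
  proof (intro Ck_on_sum assms(1) Ck_on_bilinear[OF bounded_bilinear_scaleR]
    Ck_on_bounded_linear[OF bounded_linear_inner_left])
   fix i :: 'v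
   show "Ck_on k S (%x. fd f (at x) v)" using Suc.prems(1) by simp
   show "Ck_on k S (%x. fd g (at (f x)) i)"
    by (rule Suc.IH[OF Ck_on_SucD[OF Suc.prems(1)]]) (use Suc.prems(2) in simp)
  qed
 qed
qed

section \<open>Smooth functions: closure properties and families of linear maps\<close>

lemma smooth_on_subset: "smooth_on S f ==> T \<subseteq> S ==> smooth_on T f"
 by (auto simp: smooth_on_def intro: Ck_on_subset)

lemma smooth_on_cong: "open S ==> (\<And>x. x \<in> S ==> f x = g x) ==> smooth_on S f ==> smooth_on S g"
 by (metis smooth_on_def Ck_on_cong)

lemma smooth_on_local:
 "(\<And>x. x \<in> S ==> \<exists>T. open T \<and> x \<in> T \<and> smooth_on T f) ==> smooth_on S f"
 unfolding smooth_on_def by (meson Ck_on_local)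

lemma smooth_on_iff:
 "smooth_on S f \<longleftrightarrow>
  (\<forall>x\<in>S. f differentiable (at x)) \<and> (\<forall>v. smooth_on S (%x. fd f (at x) v))"
proof
 assume *: "smooth_on S f"
 then have "Ck_on (Suc k) S f" for k by (simp add: smooth_on_def)
 then show "(\<forall>x\<in>S. f differentiable (at x)) \<and> (\<forall>v. smooth_on S (%x. fd f (at x) v))"
  by (auto simp: smooth_on_def)
next
 assume *: "(\<forall>x\<in>S. f differentiable (at x)) \<and> (\<forall>v. smooth_on S (%x. fd f (at x) v))"
 then have "Ck_on (Suc k) S f" for k by (simp add: smooth_on_def)
 from Ck_on_SucD[OF this] show "smooth_on S f" by (simp add: smooth_on_def)
qed

lemma smooth_onI:
 assumes "open S" "\<And>x. x \<in> S ==> (f has_derivative f' x) (at x)"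
  "\<And>v. smooth_on S (%x. f' x v)"
 shows "smooth_on S f"
proof -
 have "Ck_on (Suc k) S f" for k
  by (rule Ck_on_SucI[OF assms(1,2)]) (use assms(3) in \<open>auto simp: smooth_on_def\<close>)
 from Ck_on_SucD[OF this] show ?thesis by (simp add: smooth_on_def)
qed

lemma smooth_on_differentiable: "smooth_on S f ==> x \<in> S ==> f differentiable (at x)"
 using smooth_on_iff by blast

lemma smooth_on_has_derivative:
 "smooth_on S f ==> x \<in> S ==> (f has_derivative fd f (at x)) (at x)"
 using smooth_on_differentiable frechet_derivative_works by blast

lemma smooth_on_frechet: "smooth_on S f ==> smooth_on S (%x. fd f (at x) v)"
 using smooth_on_iff by blast

lemma smooth_on_continuous: "smooth_on S f ==> continuous_on S f"
 unfolding smooth_on_def by (metis Ck_on.simps(1))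

lemma smooth_on_const [simp]: "smooth_on S (%x. c)"
 by (simp add: smooth_on_def Ck_on_const)

lemma smooth_on_linear: "bounded_linear L ==> open S ==> smooth_on S L"
 by (simp add: smooth_on_def Ck_on_linear)

lemma smooth_on_id: "open S ==> smooth_on S (%x. x)"
 by (simp add: smooth_on_linear bounded_linear_ident)

lemma smooth_on_bounded_linear:
 "bounded_linear L ==> open S ==> smooth_on S f ==> smooth_on S (%x. L (f x))"
 by (simp add: smooth_on_def Ck_on_bounded_linear)

lemma smooth_on_add:
 "open S ==> smooth_on S f ==> smooth_on S g ==> smooth_on S (%x. f x + g x)"
 by (simp add: smooth_on_def Ck_on_add)

lemma smooth_on_sum:
 "open S ==> (\<And>i. i \<in> I ==> smooth_on S (f i)) ==> smooth_on S (%x. \<Sum>i\<in>I. f i x)"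
 by (simp add: smooth_on_def Ck_on_sum)

lemma smooth_on_bilinear:
 "bounded_bilinear B ==> open S ==> smooth_on S f ==> smooth_on S g ==> smooth_on S (%x. B (f x) (g x))"
 by (simp add: smooth_on_def Ck_on_bilinear)

lemma smooth_on_compose:
 fixes f :: "'u::real_normed_vector => 'v::euclidean_space"
 shows "open S ==> open T ==> f ` S \<subseteq> T ==> smooth_on S f ==> smooth_on T g ==> smooth_on S (%x. g (f x))"
 by (simp add: smooth_on_def Ck_on_compose)

lemma smooth_on_uminus: "open S ==> smooth_on S f ==> smooth_on S (%x. - f x)"
 using smooth_on_bounded_linear[OF bounded_linear_minus[OF bounded_linear_ident]] .

lemma smooth_on_diff:
 "open S ==> smooth_on S f ==> smooth_on S g ==> smooth_on S (%x. f x - g x)"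
 using smooth_on_add[of S f "%x. - g x"] smooth_on_uminus[of S g] by simp

lemma smooth_on_scaleR:
 "open S ==> smooth_on S f ==> smooth_on S g ==> smooth_on S (%x. f x *\<^sub>R g x)"
 by (rule smooth_on_bilinear[OF bounded_bilinear_scaleR])

lemma smooth_on_mult:
 fixes f :: "'a::real_normed_vector => real"
 shows "open S ==> smooth_on S f ==> smooth_on S g ==> smooth_on S (%x. f x * g x)"
 by (rule smooth_on_bilinear[OF bounded_bilinear_mult])

lemma smooth_on_inner:
 fixes f :: "'a::real_normed_vector => 'e::real_inner"
 shows "open S ==> smooth_on S f ==> smooth_on S g ==> smooth_on S (%x. f x \<bullet> g x)"
 by (rule smooth_on_bilinear[OF bounded_bilinear_inner])

lemma smooth_on_Pair:
 assumes "open S" "smooth_on S f" "smooth_on S g"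
 shows "smooth_on S (%x. (f x, g x))"
proof -
 have "bounded_linear (%a. (a, 0))" "bounded_linear (%b. (0, b))"
  by (rule bounded_linear_Pair[OF bounded_linear_ident bounded_linear_zero],
    rule bounded_linear_Pair[OF bounded_linear_zero bounded_linear_ident])
 then have "smooth_on S (%x. (f x, 0) + (0, g x))"
  by (intro smooth_on_add assms smooth_on_bounded_linear[of "%a. (a, 0)"]
    smooth_on_bounded_linear[of "%b. (0, b)"])
 then show ?thesis by simp
qed

text \<open>Expanding the argument in a basis reduces the claim to smoothness of
  \<open>L x v\<close> for each fixed \<open>v\<close>. Metric, \<phi>, transition maps and
  projections all enter the proof in this separate form.\<close>

lemma smooth_on_linear_family:
 fixes L :: "'u::real_normed_vector => 'v::euclidean_space => 'w::real_normed_vector"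
 assumes "open S" "\<And>x. x \<in> S ==> linear (L x)" "\<And>v. smooth_on S (%x. L x v)" "smooth_on S f"
 shows "smooth_on S (%x. L x (f x))"
proof (rule smooth_on_cong[OF assms(1)])
 show "smooth_on S (%x. \<Sum>i\<in>Basis. (f x \<bullet> i) *\<^sub>R L x i)"
  by (intro smooth_on_sum smooth_on_scaleR assms smooth_on_inner smooth_on_const)
 show "(\<Sum>i\<in>Basis. (f x \<bullet> i) *\<^sub>R L x i) = L x (f x)" if "x \<in> S" for x
  using linear_Basis_expand[OF assms(2)[OF that], of "f x"] by simp
qed

lemma linear_Blinfun_apply:
 fixes L :: "'v::euclidean_space => 'w::real_normed_vector"
 shows "linear L ==> blinfun_apply (Blinfun L) = L"
 using linear_conv_bounded_linear[of L] bounded_linear_Blinfun_apply[of L] by simp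

text \<open>The operator is a finite sum of rank-one operators with smooth coefficients, so
  smoothness on each fixed vector already gives smoothness in the operator norm.\<close>

lemma smooth_on_Blinfun:
 fixes L :: "'u::real_normed_vector => 'v::euclidean_space => 'w::real_normed_vector"
 assumes "open S" "\<And>x. x \<in> S ==> linear (L x)" "\<And>v. smooth_on S (%x. L x v)"
 shows "smooth_on S (%x. Blinfun (L x))"
proof (rule smooth_on_cong[OF assms(1)])
 show "smooth_on S (%x. \<Sum>i\<in>Basis. blinfun_scaleR_left (L x i) o\<^sub>L blinfun_inner_right i)"
  by (intro smooth_on_sum smooth_on_bilinear[OF bounded_bilinear_blinfun_compose] smooth_on_const
    smooth_on_bounded_linear[OF bounded_linear_blinfun_scaleR_left] assms)
 show "(\<Sum>i\<in>Basis. blinfun_scaleR_left (L x i) o\<^sub>L blinfun_inner_right i) = Blinfun (L x)"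
  if "x \<in> S" for x
 proof (rule blinfun_eqI)
  fix v
  have bl: "bounded_linear (L x)" using assms(2)[OF that] linear_conv_bounded_linear by blast
  have rep: "L x v = (\<Sum>i\<in>Basis. (v \<bullet> i) *\<^sub>R L x i)"
   by (rule linear_Basis_expand[OF assms(2)[OF that]])
  show "blinfun_apply (\<Sum>i\<in>Basis. blinfun_scaleR_left (L x i) o\<^sub>L blinfun_inner_right i) v
    = blinfun_apply (Blinfun (L x)) v"
   unfolding bounded_linear_Blinfun_apply[OF bl] rep by (simp add: blinfun.sum_left inner_commute)
 qed
qed

text \<open>The derivative is minus the square of \<open>inverse\<close>, a polynomial in the
  function itself, so each order of smoothness yields the next.\<close>

lemma smooth_on_inverse_real: "smooth_on {x::real. x \<noteq> 0} inverse"
proof -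
 have op: "open {x::real. x \<noteq> 0}" by (simp add: open_Collect_neq)
 have "Ck_on k {x::real. x \<noteq> 0} inverse" for k
 proof (induction k)
  case 0
  then show ?case by (auto intro!: continuous_intros)
 next
  case (Suc k)
  have d: "(inverse has_derivative (%v. (- v) * (inverse x * inverse x))) (at x)"
   if "x \<in> {x::real. x \<noteq> 0}" for x
   using that has_derivative_inverse'[of x UNIV] by (simp add: algebra_simps)
  show ?case
   by (rule Ck_on_SucI[OF op d], assumption)
    (intro Ck_on_bilinear[OF bounded_bilinear_mult op] Suc.IH Ck_on_const)
 qed
 then show ?thesis by (simp add: smooth_on_def)
qed

lemma smooth_on_inverse:
 fixes f :: "'a::real_normed_vector => real"
 assumes "open S" "smooth_on S f" "\<And>x. x \<in> S ==> f x \<noteq> 0"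
 shows "smooth_on S (%x. inverse (f x))"
proof (rule smooth_on_compose[OF assms(1) _ _ assms(2) smooth_on_inverse_real])
 show "open {x::real. x \<noteq> 0}" by (simp add: open_Collect_neq)
 show "f ` S \<subseteq> {x. x \<noteq> 0}" using assms(3) by auto
qed

lemma smooth_on_ln:
 fixes f :: "'a::real_normed_vector => real"
 assumes "open S" "smooth_on S f" "\<And>x. x \<in> S ==> f x > 0"
 shows "smooth_on S (%x. ln (f x))"
proof -
 have d: "(ln has_derivative (%v. inverse x * v)) (at x)" if "x \<in> {0<..}" for x :: real
  using that DERIV_ln[of x] by (simp add: has_field_derivative_def)
 have "smooth_on {0::real<..} ln"
  by (rule smooth_onI[OF open_greaterThan d], assumption)
   (intro smooth_on_mult open_greaterThan smooth_on_const smooth_on_subset[OF smooth_on_inverse_real]; auto)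
 then show ?thesis
  using smooth_on_compose[of S "{0<..}" f ln] assms by auto
qed

lemma smooth_on_exp:
 fixes f :: "'a::real_normed_vector => real"
 assumes "open S" "smooth_on S f"
 shows "smooth_on S (%x. exp (f x))"
proof -
 have "Ck_on k UNIV (exp :: real => real)" for k
 proof (induction k)
  case (Suc k)
  have d: "(exp has_derivative (%v. exp x * v)) (at x)" for x :: real
   using DERIV_exp[of x] by (simp add: has_field_derivative_def)
  show ?case
   by (rule Ck_on_SucI[OF open_UNIV d]) (intro Ck_on_bilinear[OF bounded_bilinear_mult open_UNIV] Suc.IH Ck_on_const)
 qed (simp add: continuous_on_exp)
 then show ?thesis using smooth_on_compose[of S UNIV f exp] assms by (auto simp: smooth_on_def)
qed

text \<open>The derivative of the inverse is \<open>- R K' R\<close>. It involves \<open>R\<close>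
  itself, so continuity of \<open>R\<close> starts the induction and each order gives the next. The
  spaces may be infinite-dimensional because the flow is obtained from operators on curves.\<close>

lemma Ck_on_blinfun_inverse:
 fixes K :: "'u::real_normed_vector => ('v::real_normed_vector \<Rightarrow>\<^sub>L 'w::real_normed_vector)"
 assumes "open S" "\<And>x. x \<in> S ==> R x o\<^sub>L K x = id_blinfun" "\<And>x. x \<in> S ==> K x o\<^sub>L R x = id_blinfun"
  and "Ck_on k S K"
 shows "Ck_on k S R"
proof -
 \<comment> \<open>The resolvent identity; continuity and derivative of \<open>R\<close> both come
   from it.\<close>
 have diff: "R y - R x = R y o\<^sub>L (K x - K y) o\<^sub>L R x" if "x \<in> S" "y \<in> S" for x y
 proof (rule blinfun_eqI)
  fix v
  have "blinfun_apply (R y) (blinfun_apply (K y) w) = w" for w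
   using arg_cong[OF assms(2)[OF that(2)], of "%L. blinfun_apply L w"] by simp
  moreover have "blinfun_apply (K x) (blinfun_apply (R x) v) = v"
   using arg_cong[OF assms(3)[OF that(1)], of "%L. blinfun_apply L v"] by simp
  ultimately show "blinfun_apply (R y - R x) v = blinfun_apply (R y o\<^sub>L (K x - K y) o\<^sub>L R x) v"
   by (simp add: blinfun.diff_left blinfun.diff_right)
 qed
 have cont: "continuous_on S R" if "continuous_on S K"
 proof (rule continuous_at_imp_continuous_on, rule ballI)
  fix x assume "x \<in> S"
  have "(K \<longlongrightarrow> K x) (at x)"
   using that \<open>open S\<close> \<open>x \<in> S\<close> by (metis continuous_on_def at_within_open)
  from tendsto_norm_zero[OF LIM_zero[OF this]]
  have lim: "((%y. norm (K x - K y)) \<longlongrightarrow> 0) (at x)"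
   by (simp only: norm_minus_commute)
  \<comment> \<open>The bound 1/2 allows the term with \<open>norm (R y)\<close> to be absorbed: it
    yields \<open>norm (R y) \<le> 2 * norm (R x)\<close> near \<open>x\<close> without any prior
    bound on \<open>R\<close>.\<close>
  have ev: "\<forall>\<^sub>F y in at x. norm (K x - K y) * norm (R x) < 1/2 \<and> y \<in> S"
  proof (rule eventually_conj)
   have "((%y. norm (K x - K y) * norm (R x)) \<longlongrightarrow> 0) (at x)"
    using tendsto_mult_left_zero[OF lim] .
   then show "\<forall>\<^sub>F y in at x. norm (K x - K y) * norm (R x) < 1/2"
    by (rule order_tendstoD) simp
   show "\<forall>\<^sub>F y in at x. y \<in> S"
    using \<open>open S\<close> \<open>x \<in> S\<close> eventually_at_in_open' by blast
  qed
  have "\<forall>\<^sub>F y in at x. norm (R y - R x) \<le> (2 * norm (R x) * norm (R x)) * norm (K x - K y)"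
   using ev
  proof eventually_elim
   case (elim y)
   have b: "norm (R y - R x) \<le> norm (R y) * (norm (K x - K y) * norm (R x))"
    unfolding diff[OF \<open>x \<in> S\<close> conjunct2[OF elim]]
    by (smt (verit) norm_blinfun_compose mult.assoc mult_right_mono norm_ge_zero)
   have "norm (R y) \<le> norm (R x) + norm (R y - R x)"
    by (metis add.commute diff_add_cancel norm_triangle_ineq)
   also have "\<dots> \<le> norm (R x) + norm (R y) * (1/2)"
    using b elim by (smt (verit) mult_left_mono norm_ge_zero)
   finally have "norm (R y) \<le> 2 * norm (R x)" by simp
   then have "norm (R y) * (norm (K x - K y) * norm (R x)) \<le> (2 * norm (R x)) * (norm (K x - K y) * norm (R x))"
    by (intro mult_right_mono) auto
   with b show ?case by (simp add: mult_ac)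
  qed
  moreover have "((%y. (2 * norm (R x) * norm (R x)) * norm (K x - K y)) \<longlongrightarrow> 0) (at x)"
   using tendsto_mult_right_zero[OF lim] .
  ultimately have "((%y. R y - R x) \<longlongrightarrow> 0) (at x)"
   by (rule Lim_null_comparison)
  then show "isCont R x" unfolding isCont_def using LIM_zero_iff by blast
 qed
 show ?thesis using assms(4)
 proof (induction k)
  case 0
  then show ?case using cont by simp
 next
  case (Suc k)
  have KC: "continuous_on S K" using Ck_on_mono[OF Suc.prems, of 0] by simp
  note RC = cont[OF KC]
  have d: "(R has_derivative (%v. - (R x o\<^sub>L fd K (at x) v o\<^sub>L R x))) (at x)" if "x \<in> S" for x
  proof -
   have Kd: "(K has_derivative fd K (at x)) (at x)"
    using Ck_on_has_derivative[OF Suc.prems that] .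
   have Rt: "(R \<longlongrightarrow> R x) (at x within UNIV)"
    using RC that \<open>open S\<close> by (metis continuous_on_def at_within_open)
   have "bounded_linear (%v. - (R x o\<^sub>L fd K (at x) v o\<^sub>L R x))"
    by (intro bounded_linear_minus
      bounded_linear_compose[OF bounded_bilinear.bounded_linear_left[OF bounded_bilinear_blinfun_compose]]
      bounded_linear_compose[OF bounded_bilinear.bounded_linear_right[OF bounded_bilinear_blinfun_compose]]
      has_derivative_bounded_linear[OF Kd])
   moreover have "((%y. (R y - R x - - (R x o\<^sub>L fd K (at x) (y - x) o\<^sub>L R x)) /\<^sub>R norm (y - x)) \<longlongrightarrow> 0) (at x)"
   proof -
    \<comment> \<open>By the resolvent identity the remainder of \<open>R\<close> is a sum of two
      products: one contains the remainder \<open>?q\<close> of \<open>K\<close>, the other the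
      factor \<open>R y - R x\<close> together with the bounded quotient \<open>?l\<close>.\<close>
    let ?q = "%y. (K y - K x - fd K (at x) (y - x)) /\<^sub>R norm (y - x)"
    let ?l = "%y. fd K (at x) (y - x) /\<^sub>R norm (y - x)"
    obtain B where B: "\<And>v. norm (fd K (at x) v) \<le> norm v * B"
     using bounded_linear.bounded[OF has_derivative_bounded_linear[OF Kd]] by blast
    have q: "(?q \<longlongrightarrow> 0) (at x)" using Kd by (simp add: has_derivative_at_within)
    have 1: "((%y. - (R y o\<^sub>L ?q y o\<^sub>L R x)) \<longlongrightarrow> - (R x o\<^sub>L 0 o\<^sub>L R x)) (at x)"
     by (intro tendsto_minus bounded_bilinear.tendsto[OF bounded_bilinear_blinfun_compose] q Rt[simplified] tendsto_const)
    have lb: "norm (?l y) \<le> \<bar>B\<bar>" for y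
    proof (cases "y = x")
     case False
     then have "norm (fd K (at x) (y - x)) / norm (y - x) \<le> B"
      using B[of "y - x"] by (simp add: field_simps)
     then show ?thesis by (simp add: divide_inverse mult.commute)
    qed simp
    have 2: "((%y. - ((R y - R x) o\<^sub>L ?l y o\<^sub>L R x)) \<longlongrightarrow> 0) (at x)"
    proof (rule Lim_null_comparison)
     have "norm (- ((R y - R x) o\<^sub>L ?l y o\<^sub>L R x)) \<le> norm (R y - R x) * (\<bar>B\<bar> * norm (R x))" for y
     proof -
      have "norm ((R y - R x) o\<^sub>L ?l y o\<^sub>L R x) \<le> norm (R y - R x) * norm (?l y) * norm (R x)"
       by (meson norm_blinfun_compose mult_right_mono norm_ge_zero order_trans)
      also have "\<dots> \<le> norm (R y - R x) * \<bar>B\<bar> * norm (R x)"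
       using lb[of y] by (intro mult_right_mono mult_left_mono) auto
      finally show ?thesis by (simp add: mult.assoc)
     qed
     then show "\<forall>\<^sub>F y in at x. norm (- ((R y - R x) o\<^sub>L ?l y o\<^sub>L R x)) \<le> norm (R y - R x) * (\<bar>B\<bar> * norm (R x))"
      by simp
     have "((%y. norm (R y - R x)) \<longlongrightarrow> 0) (at x)"
      using Rt by (simp add: tendsto_norm_zero LIM_zero)
     then show "((%y. norm (R y - R x) * (\<bar>B\<bar> * norm (R x))) \<longlongrightarrow> 0) (at x)"
      by (rule tendsto_mult_left_zero)
    qed
    have "((%y. - (R y o\<^sub>L ?q y o\<^sub>L R x) + - ((R y - R x) o\<^sub>L ?l y o\<^sub>L R x)) \<longlongrightarrow> 0) (at x)"
     using tendsto_add[OF 1 2] by (simp add: bounded_bilinear.zero_left[OF bounded_bilinear_blinfun_compose] bounded_bilinear.zero_right[OF bounded_bilinear_blinfun_compose])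
    moreover have "\<forall>\<^sub>F y in at x. - (R y o\<^sub>L ?q y o\<^sub>L R x) + - ((R y - R x) o\<^sub>L ?l y o\<^sub>L R x) =
      (R y - R x - - (R x o\<^sub>L fd K (at x) (y - x) o\<^sub>L R x)) /\<^sub>R norm (y - x)"
    proof -
     have "\<forall>\<^sub>F y in at x. y \<in> S" using \<open>open S\<close> that eventually_at_in_open' by blast
     then show ?thesis
     proof eventually_elim
      case (elim y)
      have "R y - R x - - (R x o\<^sub>L fd K (at x) (y - x) o\<^sub>L R x)
        = (R y o\<^sub>L (K x - K y) o\<^sub>L R x) + (R x o\<^sub>L fd K (at x) (y - x) o\<^sub>L R x)"
       using diff[OF that elim] by simp
      then show ?case
       by (simp only:, intro blinfun_eqI)
        (simp add: blinfun.diff_left blinfun.diff_right blinfun.add_left blinfun.add_right blinfun.minus_left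
         blinfun.scaleR_left blinfun.scaleR_right algebra_simps)
     qed
    qed
    ultimately show ?thesis by (rule Lim_transform_eventually)
   qed
   ultimately show ?thesis by (simp add: has_derivative_at_within)
  qed
  show ?case
  proof (rule Ck_on_SucI[OF assms(1) d])
   show "Ck_on k S (%x. - (R x o\<^sub>L fd K (at x) v o\<^sub>L R x))" for v
    using Suc.prems Suc.IH[OF Ck_on_SucD[OF Suc.prems]]
    by (intro Ck_on_bounded_linear[OF bounded_linear_minus[OF bounded_linear_ident] assms(1)]
      Ck_on_bilinear[OF bounded_bilinear_blinfun_compose assms(1)]) simp_all
  qed
 qed
qed

lemma smooth_on_blinfun_inverse:
 assumes "open S" "\<And>x. x \<in> S ==> R x o\<^sub>L K x = id_blinfun" "\<And>x. x \<in> S ==> K x o\<^sub>L R x = id_blinfun"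
  and "smooth_on S K"
 shows "smooth_on S R"
 using Ck_on_blinfun_inverse[OF assms(1-3)] assms(4) by (simp add: smooth_on_def)

lemma linear_bij_of_inj:
 fixes L :: "'v::euclidean_space => 'v"
 assumes "linear L" "\<And>v. L v = 0 ==> v = 0"
 shows "bij L"
 using assms linear_injective_imp_surjective[OF assms(1)] linear_injective_0[OF assms(1)]
 by (auto simp: bij_def)

lemma smooth_on_inv_family:
 fixes L :: "'u::real_normed_vector => 'v::euclidean_space => 'v"
 assumes S: "open S" and lin: "\<And>x. x \<in> S ==> linear (L x)"
  and inj: "\<And>x v. x \<in> S ==> L x v = 0 ==> v = 0"
  and sm: "\<And>v. smooth_on S (%x. L x v)"
 shows "smooth_on S (%x. inv (L x) v)"
proof -
 have bij: "bij (L x)" if "x \<in> S" for x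
  using linear_bij_of_inj[OF lin[OF that] inj[OF that]] .
 have linv: "linear (inv (L x))" if "x \<in> S" for x
  using bij[OF that] lin[OF that] by (simp add: linear_injective_left_inverse inj_linear_imp_inv_linear bij_is_inj)
 have a: "blinfun_apply (Blinfun (L x)) = L x" "blinfun_apply (Blinfun (inv (L x))) = inv (L x)" if "x \<in> S" for x
  using linear_Blinfun_apply[OF lin[OF that]] linear_Blinfun_apply[OF linv[OF that]] .
 have "smooth_on S (%x. Blinfun (inv (L x)))"
 proof (rule smooth_on_blinfun_inverse[OF S])
  show "smooth_on S (%x. Blinfun (L x))" by (rule smooth_on_Blinfun[OF S lin sm])
  show "Blinfun (inv (L x)) o\<^sub>L Blinfun (L x) = id_blinfun" if "x \<in> S" for x
   by (rule blinfun_eqI) (simp add: a[OF that] bij_is_inj[OF bij[OF that]])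
  show "Blinfun (L x) o\<^sub>L Blinfun (inv (L x)) = id_blinfun" if "x \<in> S" for x
   by (rule blinfun_eqI) (simp add: a[OF that] surj_f_inv_f[OF bij_is_surj[OF bij[OF that]]])
 qed
 then have "smooth_on S (%x. blinfun_apply (Blinfun (inv (L x))) v)"
  by (rule smooth_on_bilinear[OF bounded_bilinear_blinfun_apply S _ smooth_on_const])
 then show ?thesis
  by (rule smooth_on_cong[OF S, rotated]) (simp add: a)
qed

text \<open>The inverse function theorem supplies a differentiable \<open>g\<close> with derivative
  \<open>inv (fd f (at (g y)))\<close>. Operator inversion is smooth, so this derivative is of class
  \<open>C^k\<close> whenever \<open>g\<close> is, which raises \<open>g\<close> one order at a
  time.\<close>

lemma smooth_inverse_function:
 fixes f :: "'v::euclidean_space => 'v"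
 assumes S: "open S" and f: "smooth_on S f" and x0: "x0 \<in> S"
  and inj: "\<And>v. fd f (at x0) v = 0 ==> v = 0"
 obtains U V g where "open U" "U \<subseteq> S" "x0 \<in> U" "open V" "homeomorphism U V f g"
  "smooth_on V g" "\<And>x v. x \<in> U ==> fd f (at x) v = 0 ==> v = 0"
proof -
 let ?f' = "%x. Blinfun (fd f (at x))"
 have fd: "(f has_derivative fd f (at x)) (at x)" if "x \<in> S" for x
  using smooth_on_has_derivative[OF f that] .
 have lin: "linear (fd f (at x))" if "x \<in> S" for x
  using fd[OF that] has_derivative_linear by blast
 have ap: "blinfun_apply (?f' x) = fd f (at x)" if "x \<in> S" for x
  using linear_Blinfun_apply[OF lin[OF that]] .
 have sm: "smooth_on S ?f'"
  by (rule smooth_on_Blinfun[OF S lin]) (use f smooth_on_frechet in auto)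
 let ?L = "fd f (at x0)"
 have bij0: "bij ?L" using linear_bij_of_inj[OF lin[OF x0] inj] .
 have "linear (inv ?L)" using bij0 lin[OF x0] by (simp add: inj_linear_imp_inv_linear bij_is_inj)
 then have "blinfun_apply (Blinfun (inv ?L)) = inv ?L"
  by (rule linear_Blinfun_apply)
 then have inv0: "Blinfun (inv ?L) o\<^sub>L ?f' x0 = id_blinfun"
  by (intro blinfun_eqI) (simp add: ap[OF x0] bij_is_inj[OF bij0])
 have fd': "(f has_derivative blinfun_apply (?f' x)) (at x)" if "x \<in> S" for x
  using fd[OF that] ap[OF that] by simp
 show ?thesis
 proof (rule inverse_function_theorem[OF S fd' smooth_on_continuous[OF sm] x0 inv0])
 fix U V g g'
 assume U: "open U" "U \<subseteq> S" "x0 \<in> U" "open V" "f x0 \<in> V" and hom: "homeomorphism U V f g"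
  and gd: "\<And>y. y \<in> V ==> (g has_derivative (g' y)) (at y)"
  and g': "\<And>y. y \<in> V ==> g' y = inv (blinfun_apply (?f'(g y)))"
  and gb: "\<And>y. y \<in> V ==> bij (blinfun_apply (?f'(g y)))"
 have gV: "g y \<in> U" if "y \<in> V" for y using hom that by (auto simp: homeomorphism_def)
 have fU: "f x \<in> V" "g (f x) = x" if "x \<in> U" for x using hom that by (auto simp: homeomorphism_def)
 have injU: "v = 0" if "x \<in> U" "fd f (at x) v = 0" for x v
 proof -
  have "bij (fd f (at x))"
   using gb[OF fU(1)[OF that(1)]] fU(2)[OF that(1)] ap that(1) U(2) by auto
  then show ?thesis
   using that lin[of x] U(2) by (metis bij_is_inj linear_injective_0 subsetD)
 qed
 have sminv: "smooth_on U (%x. inv (fd f (at x)) v)" for v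
  by (rule smooth_on_inv_family[OF U(1)]) (use lin U(2) injU smooth_on_subset[OF smooth_on_frechet[OF f] U(2)] in auto)
 have "Ck_on k V g" for k
 proof (induction k)
  case 0
  then show ?case using hom by (simp add: homeomorphism_def)
 next
  case (Suc k)
  show ?case
  proof (rule Ck_on_SucI[OF U(4) gd])
   fix v
   have "Ck_on k V (%y. inv (fd f (at (g y))) v)"
    by (rule Ck_on_compose[OF U(4) U(1) _ Suc.IH]) (use gV sminv in \<open>auto simp: smooth_on_def\<close>)
   then show "Ck_on k V (%y. g' y v)"
    by (rule Ck_on_cong[OF U(4), rotated]) (simp add: g' ap[OF subsetD[OF U(2) gV]])
  qed
 qed
 then have "smooth_on V g" by (simp add: smooth_on_def)
 then show thesis by (rule that[OF U(1-4) hom _ injU])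
 qed
qed

subsection \<open>Bump functions\<close>

text \<open>From the right, the substitution of \<open>inverse t\<close> gives a power divided by an
  exponential at infinity; from the left the function is zero.\<close>

lemma exp_decay_tendsto_0:
 "((%t::real. if 0 < t then inverse t ^ m * exp (- inverse t) else 0) \<longlongrightarrow> 0) (at 0)"
proof -
 have "((%t::real. inverse t ^ m / exp (inverse t)) \<longlongrightarrow> 0) (at_right 0)"
  using filterlim_compose[OF tendsto_power_div_exp_0 filterlim_inverse_at_top_right, of m] by simp
 moreover have "\<forall>\<^sub>F t in at_right (0::real). inverse t ^ m / exp (inverse t) =
   (if 0 < t then inverse t ^ m * exp (- inverse t) else 0)"
  unfolding eventually_at_right_field by (intro exI[of _ 1]) (simp add: exp_minus divide_inverse)
 ultimately have r: "((%t::real. if 0 < t then inverse t ^ m * exp (- inverse t) else 0) \<longlongrightarrow> 0) (at_right 0)"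
  by (rule Lim_transform_eventually)
 have "\<forall>\<^sub>F t in at_left (0::real). 0 = (if 0 < t then inverse t ^ m * exp (- inverse t) else 0)"
  unfolding eventually_at_left_field by (intro exI[of _ "-1"]) simp
 then have l: "((%t::real. if 0 < t then inverse t ^ m * exp (- inverse t) else 0) \<longlongrightarrow> 0) (at_left 0)"
  by (rule Lim_transform_eventually[OF tendsto_const])
 show ?thesis using filterlim_split_at[OF l r] .
qed

text \<open>These functions are closed under differentiation up to linear combinations, which makes
  smoothness an induction over all \<open>n\<close> at once. At 0 the difference quotient of
  \<open>F n\<close> is \<open>F (Suc n)\<close>, already known to tend to 0.\<close>

lemma exp_decay_has_derivative:
 fixes x :: real
 defines "F \<equiv> %n (t::real). if 0 < t then inverse t ^ n * exp (- inverse t) else 0"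
 shows "(F n has_real_derivative (F (n + 2) x - real n * F (n + 1) x)) (at x)"
proof (cases "x = 0")
 case True
 have "((%h. (F n (x + h) - F n x) / h) \<longlongrightarrow> 0) (at 0)"
 proof (rule Lim_transform_eventually)
  show "(F (Suc n) \<longlongrightarrow> 0) (at 0)"
   unfolding F_def using exp_decay_tendsto_0[of "Suc n"] .
  show "\<forall>\<^sub>F h in at 0. F (Suc n) h = (F n (x + h) - F n x) / h"
   by (rule always_eventually) (auto simp: F_def True divide_inverse)
 qed
 then show ?thesis unfolding DERIV_def by (simp add: F_def True)
next
 case False
 show ?thesis
 proof (cases "x > 0")
  case True
  have "((%t. inverse t ^ n * exp (- inverse t)) has_real_derivative
    (F (n + 2) x - real n * F (n + 1) x)) (at x)"
  proof -
   have i: "(inverse has_real_derivative - (inverse x ^ 2)) (at x)"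
    using DERIV_inverse[of x] True by (simp add: numeral_2_eq_2)
   have p: "((%t. inverse t ^ n) has_real_derivative real n * (- (inverse x ^ 2) * inverse x ^ (n - Suc 0))) (at x)"
    using DERIV_power[OF i] .
   have e: "((%t. exp (- inverse t)) has_real_derivative exp (- inverse x) * inverse x ^ 2) (at x)"
    using DERIV_fun_exp[OF DERIV_minus[OF i]] by simp
   have n: "real n * inverse x ^ (n - Suc 0) * inverse x = real n * inverse x ^ n"
    by (cases n) auto
   have "real n * (- (inverse x ^ 2) * inverse x ^ (n - Suc 0)) =
     - ((real n * inverse x ^ (n - Suc 0) * inverse x) * inverse x)"
    by (simp only: power2_eq_square) algebra
   also have "\<dots> = - (real n * inverse x ^ n * inverse x)" by (simp only: n)
   finally have n2: "real n * (- (inverse x ^ 2) * inverse x ^ (n - Suc 0)) = - (real n * inverse x ^ n * inverse x)" .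
   have eq: "real n * (- (inverse x ^ 2) * inverse x ^ (n - Suc 0)) * exp (- inverse x) +
     exp (- inverse x) * inverse x ^ 2 * inverse x ^ n = F (n + 2) x - real n * F (n + 1) x"
    unfolding n2 using True by (simp add: F_def power_add power2_eq_square algebra_simps)
   show ?thesis using DERIV_mult[OF p e] unfolding eq .
  qed
  then show ?thesis
   by (rule has_field_derivative_transform_within_open[where S="{0<..}"]) (use True in \<open>auto simp: F_def\<close>)
 next
  case f: False
  have "((%t. 0) has_real_derivative (F (n + 2) x - real n * F (n + 1) x)) (at x)"
   using f by (auto simp: F_def)
  then show ?thesis
   by (rule has_field_derivative_transform_within_open[where S="{..<0}"]) (use f False in \<open>auto simp: F_def\<close>)
 qed
qed

lemma smooth_on_exp_decay:
 "smooth_on UNIV (%t::real. if 0 < t then exp (- inverse t) else 0)"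
proof -
 define F where "F \<equiv> %n (t::real). if 0 < t then inverse t ^ n * exp (- inverse t) else 0"
 have "Ck_on k UNIV (F n)" for k n
 proof (induction k arbitrary: n)
  case 0
  have "isCont (F n) x" for x
   using exp_decay_has_derivative[of n x] DERIV_isCont unfolding F_def by blast
  then show ?case by (simp add: continuous_at_imp_continuous_on)
 next
  case (Suc k)
  have d: "(F n has_derivative (%v. (F (n + 2) x + (- real n) * F (n + 1) x) * v)) (at x)" for x
   using exp_decay_has_derivative[of n x] unfolding F_def has_field_derivative_def
   by (rule has_derivative_eq_rhs) (auto simp: fun_eq_iff algebra_simps)
  show ?case
  proof (rule Ck_on_SucI[OF open_UNIV d])
   show "Ck_on k UNIV (%x. (F (n + 2) x + (- real n) * F (n + 1) x) * v)" for v
    by (intro Ck_on_bilinear[OF bounded_bilinear_mult] Ck_on_add open_UNIV Suc.IH Ck_on_const)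
  qed
 qed
 moreover have "F 0 = (%t::real. if 0 < t then exp (- inverse t) else 0)"
  by (auto simp: F_def fun_eq_iff)
 ultimately show ?thesis unfolding smooth_on_def by metis
qed

text \<open>The usual quotient of two flat functions, fed with the squared distance because that is
  smooth at \<open>y0\<close> as well.\<close>

lemma smooth_bump:
 fixes y0 :: "'e::euclidean_space"
 assumes "0 < r" "r < R"
 obtains \<psi> :: "'e => real" where "smooth_on UNIV \<psi>" "\<And>y. dist y0 y \<le> r ==> \<psi> y = 1"
  "\<And>y. dist y0 y \<ge> R ==> \<psi> y = 0"
proof -
 define h where "h \<equiv> %t::real. if 0 < t then exp (- inverse t) else 0"
 define q where "q \<equiv> %y::'e. (y - y0) \<bullet> (y - y0)"
 define \<psi> where "\<psi> \<equiv> %y. h (R^2 - q y) * inverse (h (R^2 - q y) + h (q y - r^2))"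
 have sq: "smooth_on UNIV q" unfolding q_def
  by (intro smooth_on_inner smooth_on_diff smooth_on_id smooth_on_const open_UNIV)
 have sh: "smooth_on UNIV (%y. h (f y))" if "smooth_on UNIV f" for f :: "'e => real"
  using smooth_on_compose[OF open_UNIV open_UNIV _ that, of h] smooth_on_exp_decay
  unfolding h_def by auto
 have rR: "r^2 < R^2" using assms by (intro power_strict_mono) auto
 \<comment> \<open>\<open>r < R\<close> forces one of the two arguments of \<open>h\<close> to be
   positive, and \<open>h\<close> is positive there.\<close>
 have pos: "h (R^2 - q y) + h (q y - r^2) \<noteq> 0" for y
 proof -
  have "R^2 - q y > 0 \<or> q y - r^2 > 0" using rR by linarith
  moreover have "h t \<ge> 0" "t > 0 ==> h t > 0" for t by (auto simp: h_def)
  ultimately show ?thesis by (smt (verit))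
 qed
 have "smooth_on UNIV \<psi>" unfolding \<psi>_def
  by (intro smooth_on_mult smooth_on_inverse pos open_UNIV smooth_on_add sh smooth_on_diff sq smooth_on_const)
 moreover have qd: "q y = (dist y0 y)^2" for y
  by (simp add: q_def dist_norm norm_minus_commute[of y0] power2_norm_eq_inner)
 have "\<psi> y = 1" if "dist y0 y \<le> r" for y
 proof -
  have "q y \<le> r^2" unfolding qd using that by (intro power_mono) auto
  then have "h (q y - r^2) = 0" by (simp add: h_def)
  then show ?thesis using pos[of y] by (simp add: \<psi>_def)
 qed
 moreover have "\<psi> y = 0" if "dist y0 y \<ge> R" for y
 proof -
  have "q y \<ge> R^2" unfolding qd using that assms by (intro power_mono) auto
  then have "h (R^2 - q y) = 0" by (simp add: h_def)
  then show ?thesis by (simp add: \<psi>_def)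
 qed
 ultimately show ?thesis using that by blast
qed

text \<open>Near points outside \<open>S\<close> the function vanishes: the gap
  \<open>R' < R\<close> puts such points into the open complement of \<open>cball y0 R'\<close>,
  where \<open>\<psi>\<close> is zero.\<close>

lemma smooth_on_cutoff:
 fixes y0 :: "'e::euclidean_space" and G :: "'e => 'w::real_normed_vector"
 assumes "open S" "smooth_on S G" "cball y0 R \<subseteq> S" "smooth_on UNIV \<psi>" "\<And>y. dist y0 y \<ge> R' ==> \<psi> y = 0" "R' < R"
 shows "smooth_on UNIV (%y. if y \<in> S then \<psi> y *\<^sub>R G y else 0)"
proof (rule smooth_on_local)
 fix x :: 'e
 show "\<exists>T. open T \<and> x \<in> T \<and> smooth_on T (%y. if y \<in> S then \<psi> y *\<^sub>R G y else 0)"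
 proof (cases "x \<in> S")
  case True
  have "smooth_on S (%y. \<psi> y *\<^sub>R G y)"
   by (intro smooth_on_scaleR assms smooth_on_subset[OF assms(4)]) auto
  then have "smooth_on S (%y. if y \<in> S then \<psi> y *\<^sub>R G y else 0)"
   by (rule smooth_on_cong[OF assms(1), rotated]) auto
  then show ?thesis using assms(1) True by blast
 next
  case False
  have "smooth_on (- cball y0 R') (%y. if y \<in> S then \<psi> y *\<^sub>R G y else 0)"
   by (rule smooth_on_cong[OF _ _ smooth_on_const[of _ 0]]) (use assms(5) in auto)
  moreover have "x \<notin> cball y0 R'" using False assms(3,6) by (auto simp: subset_iff)
  moreover have "open (- cball y0 R')" by (simp add: open_Compl)
  ultimately show ?thesis by blast
 qed
qed

subsection \<open>Flows of smooth vector fields\<close>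

text \<open>Superposition operators on the Banach space of bounded curves, for compactly supported
 nonlinearities, so that no domain conditions arise.\<close>

definition cs_smooth :: "('e::euclidean_space => 'w::real_normed_vector) => bool" where
 "cs_smooth G \<longleftrightarrow> smooth_on UNIV G \<and> (\<exists>y0 R. \<forall>y. R < dist y0 y \<longrightarrow> G y = 0)"

lemma cs_smooth_bounded:
 assumes "cs_smooth G"
 obtains C where "C > 0" "\<And>y. norm (G y) \<le> C"
proof -
 obtain y0 R where R: "\<And>y. R < dist y0 y ==> G y = 0" and sm: "smooth_on UNIV G"
  using assms unfolding cs_smooth_def by blast
 have "compact (G ` cball y0 R)"
  by (intro compact_continuous_image compact_cball continuous_on_subset[OF smooth_on_continuous[OF sm]]) auto
 then obtain C where C: "C > 0" "\<And>z. z \<in> G ` cball y0 R ==> norm z \<le> C"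
  using compact_imp_bounded bounded_pos by metis
 have "norm (G y) \<le> C" for y
  by (cases "R < dist y0 y") (use R[of y] C in \<open>auto simp: not_less\<close>)
 then show ?thesis by (rule that[OF C(1)])
qed

lemma cs_smooth_frechet:
 fixes G :: "'e::euclidean_space => 'w::real_normed_vector"
 assumes "cs_smooth G"
 shows "cs_smooth (%y. fd G (at y) v)" "cs_smooth (%y. Blinfun (fd G (at y)))"
proof -
 obtain y0 R where R: "\<And>y. R < dist y0 y ==> G y = 0" and sm: "smooth_on UNIV G"
  using assms unfolding cs_smooth_def by blast
 have 0: "fd G (at y) = (%v. 0)" if "R < dist y0 y" for y
 proof -
  have "fd G (at y) = fd (%_. 0) (at y)"
   by (rule frechet_derivative_cong_open(1)[of "- cball y0 R"]) (use R that in auto)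
  then show ?thesis by simp
 qed
 show "cs_smooth (%y. fd G (at y) v)"
  unfolding cs_smooth_def using smooth_on_frechet[OF sm, of v] 0 by metis
 have lin: "linear (fd G (at y))" for y
  using smooth_on_has_derivative[OF sm, of y] has_derivative_linear by blast
 have "smooth_on UNIV (%y. Blinfun (fd G (at y)))"
  by (rule smooth_on_Blinfun[OF open_UNIV lin]) (rule smooth_on_frechet[OF sm])
 moreover have "Blinfun (fd G (at y)) = 0" if "R < dist y0 y" for y
  using 0[OF that] by (simp add: zero_blinfun_def)
 ultimately show "cs_smooth (%y. Blinfun (fd G (at y)))"
  unfolding cs_smooth_def by metis
qed

lemma cs_smooth_linear: "cs_smooth G ==> linear (fd G (at y))"
 unfolding cs_smooth_def using smooth_on_has_derivative[of UNIV G y] has_derivative_linear by blast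

text \<open>The derivative of a compactly supported function is again one, so it is bounded, and the
  mean value inequality applies on the whole space.\<close>

lemma cs_smooth_Lipschitz:
 fixes G :: "'e::euclidean_space => 'w::real_normed_vector"
 assumes "cs_smooth G"
 obtains L where "L > 0" "\<And>y z. norm (G y - G z) \<le> L * norm (y - z)"
  "\<And>y v. norm (fd G (at y) v) \<le> L * norm v"
proof -
 let ?G' = "%y. Blinfun (fd G (at y))"
 obtain L where L: "L > 0" "\<And>y. norm (?G' y) \<le> L"
  using cs_smooth_bounded[OF cs_smooth_frechet(2)[OF assms]] by metis
 have ap: "blinfun_apply (?G' y) = fd G (at y)" for y
  by (rule linear_Blinfun_apply[OF cs_smooth_linear[OF assms]])
 have on: "onorm (fd G (at y)) \<le> L" for y
  using L(2)[of y] by (simp add: norm_blinfun.rep_eq ap)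
 have 1: "norm (G y - G z) \<le> L * norm (y - z)" for y z
  by (rule differentiable_bound[OF convex_UNIV _ on])
   (use smooth_on_has_derivative[of UNIV G] assms in \<open>auto simp: cs_smooth_def\<close>)
 have 2: "norm (fd G (at y) v) \<le> L * norm v" for y v
  using norm_blinfun[of "?G' y" v] mult_right_mono[OF L(2)[of y] norm_ge_zero[of v]] by (simp add: ap)
 show ?thesis by (rule that[OF L(1) 1 2])
qed

text \<open>The remainder bound is uniform in the base point \<open>y\<close>; only so does it
  survive taking the supremum along a curve in \<open>nem_has_derivative\<close>.\<close>

lemma cs_smooth_quadratic:
 fixes G :: "'e::euclidean_space => 'w::real_normed_vector"
 assumes "cs_smooth G"
 obtains C where "C > 0" "\<And>y h. norm (G (y + h) - G y - fd G (at y) h) \<le> C * norm h ^ 2"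
proof -
 let ?G' = "%y. Blinfun (fd G (at y))"
 obtain C where C: "C > 0" "\<And>y z. norm (?G' y - ?G' z) \<le> C * norm (y - z)"
  using cs_smooth_Lipschitz[OF cs_smooth_frechet(2)[OF assms]] by metis
 have ap: "blinfun_apply (?G' y) = fd G (at y)" for y
  by (rule linear_Blinfun_apply[OF cs_smooth_linear[OF assms]])
 have "norm (G (y + h) - G y - fd G (at y) h) \<le> C * norm h ^ 2" for y h
 proof -
  have "norm (G (y + h) - G y - fd G (at y) ((y + h) - y)) \<le> norm ((y + h) - y) * (C * norm h)"
  proof (rule differentiable_bound_linearization[where S = "cball y (norm h)"])
   show "y + t *\<^sub>R (y + h - y) \<in> cball y (norm h)" if "t \<in> {0..1}" for t
    using that by (auto simp: dist_norm mult_left_le_one_le)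
   show "(G has_derivative fd G (at x)) (at x within cball y (norm h))" for x
    using smooth_on_has_derivative[of UNIV G x] assms has_derivative_at_withinI
    by (auto simp: cs_smooth_def)
   show "onorm (fd G (at x) - fd G (at y)) \<le> C * norm h"
    if "x \<in> cball y (norm h)" for x
   proof -
    have "onorm (fd G (at x) - fd G (at y)) = norm (?G' x - ?G' y)"
     by (simp add: norm_blinfun.rep_eq minus_blinfun.rep_eq ap fun_diff_def)
    also have "\<dots> \<le> C * norm (x - y)" by (rule C(2))
    also have "\<dots> \<le> C * norm h" using that C(1) by (simp add: dist_norm norm_minus_commute)
    finally show ?thesis .
   qed
  qed auto
  then show ?thesis by (simp add: power2_eq_square mult_ac)
 qed
 then show ?thesis by (rule that[OF C(1)])
qed

text \<open>The superposition (Nemytskii) operator of \<open>G\<close> on bounded continuous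
  curves.\<close>

definition nem :: "('e::euclidean_space => 'w::real_normed_vector) => (real \<Rightarrow>\<^sub>C 'e) => (real \<Rightarrow>\<^sub>C 'w)" where
 "nem G \<gamma> = Bcontfun (%t. G (apply_bcontfun \<gamma> t))"

lemma nem_apply: "cs_smooth G ==> apply_bcontfun (nem G \<gamma>) t = G (apply_bcontfun \<gamma> t)"
proof -
 assume G: "cs_smooth G"
 obtain C where C: "\<And>y. norm (G y) \<le> C" using cs_smooth_bounded[OF G] by metis
 have "continuous_on UNIV (%t. G (apply_bcontfun \<gamma> t))"
  by (rule continuous_on_compose2[OF smooth_on_continuous[of UNIV G]])
   (use G in \<open>auto simp: cs_smooth_def\<close>)
 then have "(%t. G (apply_bcontfun \<gamma> t)) \<in> bcontfun" by (rule bcontfun_normI) (rule C)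
 then show ?thesis by (simp add: nem_def Bcontfun_inverse)
qed

text \<open>With this product the derivative of \<open>nem G\<close> can be written through
  \<open>nem\<close> of the partial derivatives of \<open>G\<close>, so that inductions on the order
  of smoothness stay within one class of operators.\<close>

definition pscale :: "(real \<Rightarrow>\<^sub>C real) => (real \<Rightarrow>\<^sub>C 'w::real_normed_vector) => (real \<Rightarrow>\<^sub>C 'w)" where
 "pscale a B = Bcontfun (%t. apply_bcontfun a t *\<^sub>R apply_bcontfun B t)"

lemma pscale_apply: "apply_bcontfun (pscale a B) t = apply_bcontfun a t *\<^sub>R apply_bcontfun B t"
proof -
 have "(%t. apply_bcontfun a t *\<^sub>R apply_bcontfun B t) \<in> bcontfun"
  by (rule bcontfun_normI[of _ "norm a * norm B"])
   (auto intro!: continuous_intros mult_mono norm_bounded[of a, simplified] norm_bounded)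
 then show ?thesis by (simp add: pscale_def Bcontfun_inverse)
qed

lemma bounded_bilinear_pscale: "bounded_bilinear pscale"
proof
 show "\<exists>K. \<forall>a b. norm (pscale a b :: real \<Rightarrow>\<^sub>C 'w::real_normed_vector) \<le> norm a * norm b * K"
 proof (intro exI[of _ 1] allI)
  fix a and b :: "real \<Rightarrow>\<^sub>C 'w"
  show "norm (pscale a b) \<le> norm a * norm b * 1"
   by (rule norm_bound) (auto simp: pscale_apply intro!: mult_mono norm_bounded[of a, simplified] norm_bounded)
 qed
qed (auto intro!: bcontfun_eqI simp: pscale_apply algebra_simps)

definition coord_curve :: "'e::euclidean_space => (real \<Rightarrow>\<^sub>C 'e) => (real \<Rightarrow>\<^sub>C real)" where
 "coord_curve i \<gamma> = Bcontfun (%t. apply_bcontfun \<gamma> t \<bullet> i)"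

lemma coord_curve_apply: "apply_bcontfun (coord_curve i \<gamma>) t = apply_bcontfun \<gamma> t \<bullet> i"
proof -
 have "(%t. apply_bcontfun \<gamma> t \<bullet> i) \<in> bcontfun"
  by (rule bcontfun_normI[of _ "norm \<gamma> * norm i"])
   (auto intro!: continuous_intros order_trans[OF Cauchy_Schwarz_ineq2] mult_right_mono norm_bounded)
 then show ?thesis by (simp add: coord_curve_def Bcontfun_inverse)
qed

lemma bounded_linear_coord_curve: "bounded_linear (coord_curve i)"
proof
 show "\<exists>K. \<forall>x. norm (coord_curve i x) \<le> norm x * K"
 proof (intro exI[of _ "norm i"] allI)
  fix x show "norm (coord_curve i x) \<le> norm x * norm i"
   by (rule norm_bound)
    (auto simp: coord_curve_apply intro!: order_trans[OF Cauchy_Schwarz_ineq2] mult_right_mono norm_bounded)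
 qed
qed (auto intro!: bcontfun_eqI simp: coord_curve_apply algebra_simps)

definition unit_clamp :: "real => real" where "unit_clamp t = max 0 (min 1 t)"

text \<open>The primitive from 0, frozen outside the unit interval so that it remains a bounded
  curve on the whole line. The flow equation is claimed for times in \<open>{0..1}\<close>.\<close>

definition curve_int :: "(real \<Rightarrow>\<^sub>C 'w::banach) => (real \<Rightarrow>\<^sub>C 'w)" where
 "curve_int \<gamma> = Bcontfun (%t. integral {0..unit_clamp t} (apply_bcontfun \<gamma>))"

lemma unit_clamp_mem: "unit_clamp t \<in> {0..1}" by (auto simp: unit_clamp_def)

lemma norm_integral_clamp:
 fixes \<gamma> :: "real \<Rightarrow>\<^sub>C 'w::banach"
 shows "norm (integral {0..unit_clamp t} (apply_bcontfun \<gamma>)) \<le> norm \<gamma>"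
proof -
 have "norm (integral {0..unit_clamp t} (apply_bcontfun \<gamma>)) \<le> norm \<gamma> * (unit_clamp t - 0)"
  by (rule integral_bound) (use unit_clamp_mem[of t] in \<open>auto intro: norm_bounded\<close>)
 also have "\<dots> \<le> norm \<gamma> * 1" using unit_clamp_mem[of t] by (intro mult_left_mono) auto
 finally show ?thesis by simp
qed

lemma curve_int_apply:
 "apply_bcontfun (curve_int \<gamma>) t = integral {0..unit_clamp t} (apply_bcontfun \<gamma>)"
proof -
 have 1: "continuous_on {0..1} (%x. integral {0..x} (apply_bcontfun \<gamma>))"
  by (intro indefinite_integral_continuous_1 integrable_continuous_real) simp
 have 2: "continuous_on UNIV unit_clamp" unfolding unit_clamp_def[abs_def] by (intro continuous_intros)
 have 3: "unit_clamp ` UNIV \<subseteq> {0..1}" by (rule image_subsetI) (rule unit_clamp_mem)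
 have "continuous_on UNIV (%t. integral {0..unit_clamp t} (apply_bcontfun \<gamma>))"
  by (rule continuous_on_compose2[OF 1 2 3])
 then have "(%t. integral {0..unit_clamp t} (apply_bcontfun \<gamma>)) \<in> bcontfun"
  by (rule bcontfun_normI) (rule norm_integral_clamp)
 then show ?thesis by (simp add: curve_int_def Bcontfun_inverse)
qed

lemma bounded_linear_curve_int: "bounded_linear (curve_int :: (real \<Rightarrow>\<^sub>C 'w::banach) => _)"
 and norm_curve_int: "norm (curve_int \<gamma>) \<le> norm \<gamma>" for \<gamma> :: "real \<Rightarrow>\<^sub>C 'w::banach"
proof -
 have b: "norm (curve_int \<gamma>) \<le> norm \<gamma>" for \<gamma> :: "real \<Rightarrow>\<^sub>C 'w::banach"
  by (rule norm_bound) (simp add: curve_int_apply norm_integral_clamp)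
 then show "norm (curve_int \<gamma>) \<le> norm \<gamma>" for \<gamma> :: "real \<Rightarrow>\<^sub>C 'w::banach" .
 show "bounded_linear (curve_int :: (real \<Rightarrow>\<^sub>C 'w::banach) => _)"
 proof
  show "\<exists>K. \<forall>x::real \<Rightarrow>\<^sub>C 'w. norm (curve_int x) \<le> norm x * K"
   using b by (intro exI[of _ 1]) simp
 qed (auto intro!: bcontfun_eqI simp: curve_int_apply integral_add integrable_continuous_real)
qed

text \<open>The candidate acts pointwise as \<open>fd G\<close>, and the uniform quadratic remainder
  of \<open>G\<close> bounds the error by \<open>C * norm h ^ 2\<close> in the supremum
  norm.\<close>

lemma nem_has_derivative:
 fixes G :: "'e::euclidean_space => 'w::real_normed_vector"
 assumes G: "cs_smooth G"
 shows "(nem G has_derivative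
  (%\<eta>. \<Sum>i\<in>Basis. pscale (coord_curve i \<eta>) (nem (%y. fd G (at y) i) \<gamma>))) (at \<gamma>)"
  (is "(_ has_derivative ?D) _")
proof -
 have Dap: "apply_bcontfun (?D \<eta>) t = fd G (at (apply_bcontfun \<gamma> t)) (apply_bcontfun \<eta> t)" for \<eta> t
 proof -
  have "apply_bcontfun (\<Sum>i\<in>I. f i) t = (\<Sum>i\<in>I. apply_bcontfun (f i) t)"
   for I :: "'e set" and f :: "'e => real \<Rightarrow>\<^sub>C 'w"
   by (induction I rule: infinite_finite_induct) auto
  then show ?thesis
   by (simp add: pscale_apply coord_curve_apply nem_apply[OF cs_smooth_frechet(1)[OF G]]
     linear_Basis_expand[OF cs_smooth_linear[OF G], of _ "apply_bcontfun \<eta> t"])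
 qed
 have bl: "bounded_linear ?D"
  by (intro bounded_linear_sum
    bounded_linear_compose[OF bounded_bilinear.bounded_linear_left[OF bounded_bilinear_pscale]]
    bounded_linear_coord_curve)
 obtain C where C: "C > 0" "\<And>y h. norm (G (y + h) - G y - fd G (at y) h) \<le> C * norm h ^ 2"
  using cs_smooth_quadratic[OF G] by metis
 have est: "norm (nem G (\<gamma> + h) - nem G \<gamma> - ?D h) \<le> C * norm h ^ 2" for h
 proof (rule norm_bound)
  fix t
  have "norm (apply_bcontfun (nem G (\<gamma> + h) - nem G \<gamma> - ?D h) t) \<le> C * norm (apply_bcontfun h t) ^ 2"
   using C(2)[of "apply_bcontfun \<gamma> t" "apply_bcontfun h t"]
   by (simp only: minus_bcontfun.rep_eq plus_bcontfun.rep_eq Dap nem_apply[OF G])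
  also have "\<dots> \<le> C * norm h ^ 2"
   using C(1) by (intro mult_left_mono power_mono norm_bounded) auto
  finally show "norm (apply_bcontfun (nem G (\<gamma> + h) - nem G \<gamma> - ?D h) t) \<le> C * norm h ^ 2" .
 qed
 have "((%h. norm (nem G (\<gamma> + h) - nem G \<gamma> - ?D h) / norm h) \<longlongrightarrow> 0) (at 0)"
 proof (rule Lim_null_comparison)
  have "norm (norm (nem G (\<gamma> + h) - nem G \<gamma> - ?D h) / norm h) \<le> C * norm h" for h
   using est[of h] by (cases "h = 0") (auto simp: field_simps power2_eq_square)
  then show "\<forall>\<^sub>F h in at 0. norm (norm (nem G (\<gamma> + h) - nem G \<gamma> - ?D h) / norm h) \<le> C * norm h" by simp
  show "((%h. C * norm h) \<longlongrightarrow> 0) (at (0::real \<Rightarrow>\<^sub>C 'e))"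
   by (intro tendsto_mult_right_zero tendsto_norm_zero tendsto_ident_at)
 qed
 with bl show ?thesis unfolding has_derivative_at by (rule conjI)
qed

text \<open>The derivative is assembled from \<open>nem\<close> of the partial derivatives of
  \<open>G\<close>, which again have compact support; hence the induction ranges over all such
  \<open>G\<close>.\<close>

lemma Ck_on_nem:
 fixes G :: "'e::euclidean_space => 'w::real_normed_vector" and \<gamma> :: "'p::real_normed_vector => real \<Rightarrow>\<^sub>C 'e"
 assumes "open S" "cs_smooth G" "Ck_on k S \<gamma>"
 shows "Ck_on k S (%p. nem G (\<gamma> p))"
 using assms(2,3)
proof (induction k arbitrary: G)
 case 0
 have "isCont (nem G) x" for x
  using has_derivative_continuous[OF nem_has_derivative[OF 0(1)]] by blast
 then have "continuous_on UNIV (nem G)" by (simp add: continuous_at_imp_continuous_on)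
 then show ?case using 0(2) by (auto intro: continuous_on_compose2)
next
 case (Suc k)
 have d: "((%p. nem G (\<gamma> p)) has_derivative (%v. \<Sum>i\<in>Basis.
   pscale (coord_curve i (fd \<gamma> (at p) v)) (nem (%y. fd G (at y) i) (\<gamma> p)))) (at p)"
  if "p \<in> S" for p
  by (rule has_derivative_compose[OF Ck_on_has_derivative[OF Suc.prems(2) that] nem_has_derivative[OF Suc.prems(1)]])
 show ?case
 proof (rule Ck_on_SucI[OF assms(1) d])
  fix v
  have "Ck_on k S (%p. fd \<gamma> (at p) v)" using Suc.prems by simp
  then show "Ck_on k S (%p. \<Sum>i\<in>Basis.
   pscale (coord_curve i (fd \<gamma> (at p) v)) (nem (%y. fd G (at y) i) (\<gamma> p)))"
   by (intro Ck_on_sum assms(1) Ck_on_bilinear[OF bounded_bilinear_pscale]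
     Ck_on_bounded_linear[OF bounded_linear_coord_curve] Suc.IH
     cs_smooth_frechet(1)[OF Suc.prems(1)] Ck_on_SucD[OF Suc.prems(2)])
 qed
qed

text \<open>Banach's fixed point theorem solves \<open>\<delta> = y + K \<delta>\<close>. The bound
  1/2 makes the map a contraction and the solution at most \<open>2 * norm y\<close> in norm, so the
  solution operator is bounded.\<close>

lemma blinfun_near_id_invertible:
 fixes K :: "'x::{real_normed_vector,complete_space} \<Rightarrow>\<^sub>L 'x"
 assumes "norm K \<le> 1/2"
 obtains R where "R o\<^sub>L (id_blinfun - K) = id_blinfun" "(id_blinfun - K) o\<^sub>L R = id_blinfun"
proof -
 have K: "norm (blinfun_apply K v) \<le> 1/2 * norm v" for v
  using norm_blinfun[of K v] mult_right_mono[OF assms norm_ge_zero[of v]] by simp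
 have ex: "\<exists>!\<delta>. y + blinfun_apply K \<delta> = \<delta>" for y
 proof (rule banach_fix_type[of "1/2"])
  show "\<forall>a b. dist (y + blinfun_apply K a) (y + blinfun_apply K b) \<le> 1/2 * dist a b"
   using K by (simp only: dist_norm add_diff_cancel_left blinfun.diff_right[symmetric]) blast
 qed auto
 define r where "r y = (THE \<delta>. y + blinfun_apply K \<delta> = \<delta>)" for y
 have r: "y + blinfun_apply K (r y) = r y" for y unfolding r_def by (rule theI'[OF ex])
 have r_eq: "r y = \<delta>" if "y + blinfun_apply K \<delta> = \<delta>" for y \<delta> using ex[of y] r[of y] that by blast
 have rb: "norm (r y) \<le> norm y * 2" for y
  using norm_triangle_ineq[of y "blinfun_apply K (r y)"] K[of "r y"] r[of y] by simp
 have "bounded_linear r"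
 proof
  show "r (x + y) = r x + r y" for x y
  proof (rule r_eq)
   have "x + y + blinfun_apply K (r x + r y) = (x + blinfun_apply K (r x)) + (y + blinfun_apply K (r y))"
    by (simp add: blinfun.add_right)
   then show "x + y + blinfun_apply K (r x + r y) = r x + r y" by (simp only: r)
  qed
  show "r (c *\<^sub>R x) = c *\<^sub>R r x" for c x
   by (rule r_eq) (metis r scaleR_add_right blinfun.scaleR_right)
  show "\<exists>C. \<forall>x. norm (r x) \<le> norm x * C" using rb by blast
 qed
 then have a: "blinfun_apply (Blinfun r) = r" by (rule bounded_linear_Blinfun_apply)
 show ?thesis
 proof (rule that)
  show "Blinfun r o\<^sub>L (id_blinfun - K) = id_blinfun"
   by (rule blinfun_eqI) (simp add: a blinfun.diff_left r_eq)
  show "(id_blinfun - K) o\<^sub>L Blinfun r = id_blinfun"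
   by (rule blinfun_eqI) (use r in \<open>simp add: a blinfun.diff_left diff_eq_eq\<close>)
 qed
qed

text \<open>The derivative of \<open>nem G\<close> as an element of the operator space, where it can
  depend smoothly on a parameter and enter an operator inverse.\<close>

definition nem_deriv :: "('e::euclidean_space => 'e) => (real \<Rightarrow>\<^sub>C 'e) => (real \<Rightarrow>\<^sub>C 'e) \<Rightarrow>\<^sub>L (real \<Rightarrow>\<^sub>C 'e)" where
 "nem_deriv G \<gamma> = (\<Sum>i\<in>Basis. bounded_bilinear.prod_left pscale (nem (%y. fd G (at y) i) \<gamma>)
   o\<^sub>L Blinfun (coord_curve i))"

lemma nem_deriv_apply:
 "blinfun_apply (nem_deriv G \<gamma>) \<eta> =
  (\<Sum>i\<in>Basis. pscale (coord_curve i \<eta>) (nem (%y. fd G (at y) i) \<gamma>))"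
 by (simp add: nem_deriv_def blinfun.sum_left bounded_linear_Blinfun_apply[OF bounded_linear_coord_curve]
   bounded_bilinear.prod_left.rep_eq[OF bounded_bilinear_pscale])

lemma nem_deriv_eval:
 fixes G :: "'e::euclidean_space => 'e"
 assumes G: "cs_smooth G"
 shows "apply_bcontfun (blinfun_apply (nem_deriv G \<gamma>) \<eta>) t =
  fd G (at (apply_bcontfun \<gamma> t)) (apply_bcontfun \<eta> t)"
proof -
 have "apply_bcontfun (\<Sum>i\<in>I. f i) t = (\<Sum>i\<in>I. apply_bcontfun (f i) t)"
  for I :: "'e set" and f :: "'e => real \<Rightarrow>\<^sub>C 'e"
  by (induction I rule: infinite_finite_induct) auto
 then show ?thesis
  by (simp add: nem_deriv_apply pscale_apply coord_curve_apply nem_apply[OF cs_smooth_frechet(1)[OF G]]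
    linear_Basis_expand[OF cs_smooth_linear[OF G], of _ "apply_bcontfun \<eta> t"])
qed

lemma Ck_on_nem_deriv:
 fixes \<gamma> :: "'p::real_normed_vector => real \<Rightarrow>\<^sub>C 'e::euclidean_space"
 assumes "open S" "cs_smooth G" "Ck_on k S \<gamma>"
 shows "Ck_on k S (%p. nem_deriv G (\<gamma> p))"
 unfolding nem_deriv_def
 by (intro Ck_on_sum assms(1) Ck_on_bilinear[OF bounded_bilinear_blinfun_compose] Ck_on_const
   Ck_on_bounded_linear[OF bounded_bilinear.bounded_linear_prod_left[OF bounded_bilinear_pscale]]
   Ck_on_nem cs_smooth_frechet(1) assms)

text \<open>The flow at all times at once, as a smooth map into the space of curves: the inverse of
 \<open>\<gamma> \<mapsto> \<gamma> - \<kappa> \<integral> G \<circ> \<gamma>\<close> on constant curves.\<close>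

lemma flow_curve:
 fixes G :: "'e::euclidean_space => 'e"
 assumes G: "cs_smooth G"
 obtains \<kappa>0 where "\<kappa>0 > 0" "\<And>\<kappa>. 0 < \<kappa> ==> \<kappa> \<le> \<kappa>0 ==> \<exists>\<Gamma>. smooth_on UNIV \<Gamma> \<and>
  (\<forall>p. \<Gamma> p = const_bcontfun p + \<kappa> *\<^sub>R curve_int (nem G (\<Gamma> p))) \<and>
  (\<forall>p v. fd \<Gamma> (at p) v =
    const_bcontfun v + \<kappa> *\<^sub>R curve_int (blinfun_apply (nem_deriv G (\<Gamma> p)) (fd \<Gamma> (at p) v)))"
proof -
 obtain L where L: "L > 0" "\<And>y z. norm (G y - G z) \<le> L * norm (y - z)"
  "\<And>y v. norm (fd G (at y) v) \<le> L * norm v"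
  using cs_smooth_Lipschitz[OF G] by metis
 show ?thesis
 proof (rule that[of "inverse (2 * L)"])
  show "inverse (2 * L) > 0" using L(1) by simp
  fix \<kappa> :: real assume \<kappa>: "0 < \<kappa>" "\<kappa> \<le> inverse (2 * L)"
  \<comment> \<open>Hence the integral operator contracts by 1/2, and so does its linearization; the
    same constant serves for the fixed point and for inverting the derivative.\<close>
  then have \<kappa>L: "\<kappa> * L \<le> 1/2" using L(1) by (simp add: field_simps)
  have lip: "norm (nem G a - nem G b) \<le> L * norm (a - b)" for a b
  proof (rule norm_bound)
   fix t
   have "norm (apply_bcontfun (nem G a - nem G b) t) \<le> L * norm (apply_bcontfun (a - b) t)"
    using L(2) by (simp add: nem_apply[OF G])
   also have "\<dots> \<le> L * norm (a - b)"
    using L(1) by (intro mult_left_mono norm_bounded) simp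
   finally show "norm (apply_bcontfun (nem G a - nem G b) t) \<le> L * norm (a - b)" .
  qed
  define T where "T \<equiv> %y \<gamma>. y + \<kappa> *\<^sub>R curve_int (nem G \<gamma>)"
  have Tlip: "norm (\<kappa> *\<^sub>R curve_int (nem G a) - \<kappa> *\<^sub>R curve_int (nem G b)) \<le> 1/2 * norm (a - b)" for a b
  proof -
   have "norm (\<kappa> *\<^sub>R curve_int (nem G a) - \<kappa> *\<^sub>R curve_int (nem G b)) = \<kappa> * norm (curve_int (nem G a - nem G b))"
    using \<kappa>(1) by (simp only: scaleR_diff_right[symmetric] linear_diff[symmetric, OF bounded_linear.linear[OF bounded_linear_curve_int]]
      norm_scaleR abs_of_pos)
   also have "\<dots> \<le> \<kappa> * (L * norm (a - b))"
    using \<kappa>(1) by (intro mult_left_mono order_trans[OF norm_curve_int lip]) auto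
   also have "\<dots> \<le> 1/2 * norm (a - b)"
    using mult_right_mono[OF \<kappa>L norm_ge_zero[of "a - b"]] by (simp add: mult.assoc)
   finally show ?thesis .
  qed
  have ex: "\<exists>!\<gamma>. T y \<gamma> = \<gamma>" for y
  proof (rule banach_fix_type[of "1/2"])
   show "\<forall>a b. dist (T y a) (T y b) \<le> 1/2 * dist a b"
    using Tlip by (simp only: T_def dist_norm add_diff_cancel_left) blast
  qed auto
  define g where "g y = (THE \<gamma>. T y \<gamma> = \<gamma>)" for y
  have g: "T y (g y) = g y" for y unfolding g_def by (rule theI'[OF ex])
  \<comment> \<open>\<open>g y\<close> is the fixed point of \<open>T y\<close>, so \<open>H\<close>
    undoes \<open>g\<close>. With the Lipschitz bound on \<open>g\<close>, the derivative of
    \<open>g\<close> is the inverse of that of \<open>H\<close>.\<close>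
  define H where "H \<equiv> %\<gamma>. \<gamma> - \<kappa> *\<^sub>R curve_int (nem G \<gamma>)"
  have Hg: "H (g y) = y" for y using g[of y] by (simp add: H_def T_def algebra_simps)
  have glip: "norm (g y - g z) \<le> 2 * norm (y - z)" for y z
  proof -
   have "g y - g z = (y - z) + (\<kappa> *\<^sub>R curve_int (nem G (g y)) - \<kappa> *\<^sub>R curve_int (nem G (g z)))"
    using g[of y] g[of z] by (simp add: T_def algebra_simps)
   then have "norm (g y - g z) \<le> norm (y - z) +
     norm (\<kappa> *\<^sub>R curve_int (nem G (g y)) - \<kappa> *\<^sub>R curve_int (nem G (g z)))"
    by (simp only: norm_triangle_ineq)
   with Tlip[of "g y" "g z"] show ?thesis by simp
  qed
  define KK where "KK \<equiv> %\<gamma>. (\<kappa> *\<^sub>R Blinfun curve_int) o\<^sub>L nem_deriv G \<gamma>"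
  have KKa: "blinfun_apply (KK \<gamma>) \<eta> = \<kappa> *\<^sub>R curve_int (blinfun_apply (nem_deriv G \<gamma>) \<eta>)" for \<gamma> \<eta>
   by (simp add: KK_def blinfun.scaleR_left bounded_linear_Blinfun_apply[OF bounded_linear_curve_int])
  have KKn: "norm (KK \<gamma>) \<le> 1/2" for \<gamma>
  proof (rule norm_blinfun_bound)
   fix \<eta>
   have "norm (blinfun_apply (nem_deriv G \<gamma>) \<eta>) \<le> L * norm \<eta>"
   proof (rule norm_bound)
    fix t
    have "norm (apply_bcontfun (blinfun_apply (nem_deriv G \<gamma>) \<eta>) t) \<le> L * norm (apply_bcontfun \<eta> t)"
     unfolding nem_deriv_eval[OF G] by (rule L(3))
    also have "\<dots> \<le> L * norm \<eta>"
     using L(1) by (intro mult_left_mono norm_bounded) simp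
    finally show "norm (apply_bcontfun (blinfun_apply (nem_deriv G \<gamma>) \<eta>) t) \<le> L * norm \<eta>" .
   qed
   then have "norm (curve_int (blinfun_apply (nem_deriv G \<gamma>) \<eta>)) \<le> L * norm \<eta>"
    using norm_curve_int order_trans by blast
   then have "norm (blinfun_apply (KK \<gamma>) \<eta>) \<le> \<kappa> * (L * norm \<eta>)"
    using \<kappa>(1) by (simp add: KKa)
   also have "\<dots> \<le> 1/2 * norm \<eta>"
    using mult_right_mono[OF \<kappa>L norm_ge_zero[of \<eta>]] by (simp add: mult.assoc)
   finally show "norm (blinfun_apply (KK \<gamma>) \<eta>) \<le> 1/2 * norm \<eta>" .
  qed simp
  have Hd: "(H has_derivative blinfun_apply (id_blinfun - KK \<gamma>)) (at \<gamma>)" for \<gamma>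
   unfolding H_def
   by (rule has_derivative_eq_rhs[OF has_derivative_diff[OF has_derivative_ident has_derivative_scaleR_right[OF
      bounded_linear.has_derivative[OF bounded_linear_curve_int nem_has_derivative[OF G]]]]])
    (simp add: fun_eq_iff KKa nem_deriv_apply blinfun.diff_left)
  have "\<forall>\<gamma>. \<exists>R. R o\<^sub>L (id_blinfun - KK \<gamma>) = id_blinfun \<and> (id_blinfun - KK \<gamma>) o\<^sub>L R = id_blinfun"
   using blinfun_near_id_invertible[OF KKn] by metis
  then obtain R where R: "\<And>\<gamma>. R \<gamma> o\<^sub>L (id_blinfun - KK \<gamma>) = id_blinfun"
    "\<And>\<gamma>. (id_blinfun - KK \<gamma>) o\<^sub>L R \<gamma> = id_blinfun" by metis
  have gd: "(g has_derivative blinfun_apply (R (g y))) (at y)" for y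
  proof (rule has_derivative_inverse_basic[OF Hd blinfun.bounded_linear_right _ _ open_UNIV UNIV_I Hg])
   show "blinfun_apply (R (g y)) \<circ> blinfun_apply (id_blinfun - KK (g y)) = id"
    using arg_cong[OF R(1), of blinfun_apply] by (simp add: fun_eq_iff)
   have "(g \<longlongrightarrow> g y) (at y)"
   proof (rule Lim_null[THEN iffD2], rule Lim_null_comparison)
    show "\<forall>\<^sub>F z in at y. norm (g z - g y) \<le> 2 * norm (z - y)" using glip by simp
    show "((%z. 2 * norm (z - y)) \<longlongrightarrow> 0) (at y)"
     by (intro tendsto_mult_right_zero tendsto_norm_zero LIM_zero tendsto_ident_at)
   qed
   then show "continuous (at y) g" by (simp add: isCont_def)
  qed
  have blc: "bounded_linear (const_bcontfun :: 'e => real \<Rightarrow>\<^sub>C 'e)"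
  proof
   show "\<exists>K. \<forall>x. norm (const_bcontfun x :: real \<Rightarrow>\<^sub>C 'e) \<le> norm x * K"
    by (intro exI[of _ 1] allI norm_bound) simp
  qed (auto intro!: bcontfun_eqI)
  define \<Gamma> where "\<Gamma> \<equiv> %p. g (const_bcontfun p)"
  have \<Gamma>d: "(\<Gamma> has_derivative (%v. blinfun_apply (R (\<Gamma> p)) (const_bcontfun v))) (at p)" for p
   unfolding \<Gamma>_def
   by (rule has_derivative_compose[OF bounded_linear_imp_has_derivative[OF blc] gd])
  have "Ck_on k UNIV \<Gamma>" for k
  proof (induction k)
   case 0
   then show ?case using has_derivative_continuous[OF \<Gamma>d]
    by (simp add: continuous_at_imp_continuous_on)
  next
   case (Suc k)
   have "Ck_on k UNIV (%p. id_blinfun + - KK (\<Gamma> p))" unfolding KK_def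
    by (intro Ck_on_add Ck_on_const open_UNIV Ck_on_bounded_linear[OF bounded_linear_minus[OF bounded_linear_ident]]
      Ck_on_bilinear[OF bounded_bilinear_blinfun_compose] Ck_on_nem_deriv G Suc.IH)
   then have RC: "Ck_on k UNIV (%p. R (\<Gamma> p))"
    by (intro Ck_on_blinfun_inverse[OF open_UNIV, of "%p. R (\<Gamma> p)" "%p. id_blinfun - KK (\<Gamma> p)"] R) simp
   show ?case
   proof (rule Ck_on_SucI[OF open_UNIV \<Gamma>d])
    show "Ck_on k UNIV (%x. blinfun_apply (R (\<Gamma> x)) (const_bcontfun v))" for v
     by (intro Ck_on_bilinear[OF bounded_bilinear_blinfun_apply open_UNIV RC] Ck_on_const)
   qed
  qed
  then have sm: "smooth_on UNIV \<Gamma>" by (simp add: smooth_on_def)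
  have fp: "\<Gamma> p = const_bcontfun p + \<kappa> *\<^sub>R curve_int (nem G (\<Gamma> p))" for p
   using g[of "const_bcontfun p"] by (simp add: \<Gamma>_def T_def)
  have fd: "fd \<Gamma> (at p) v = blinfun_apply (R (\<Gamma> p)) (const_bcontfun v)" for p v
   using frechet_derivative_at[OF \<Gamma>d[of p]] by metis
  have "fd \<Gamma> (at p) v =
    const_bcontfun v + \<kappa> *\<^sub>R curve_int (blinfun_apply (nem_deriv G (\<Gamma> p)) (fd \<Gamma> (at p) v))" for p v
   using arg_cong[OF R(2)[of "\<Gamma> p"], of "%A. blinfun_apply A (const_bcontfun v)"]
   unfolding fd KKa[symmetric] by (simp add: blinfun.diff_left diff_eq_eq)
  with sm fp show "\<exists>\<Gamma>. smooth_on UNIV \<Gamma> \<and>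
  (\<forall>p. \<Gamma> p = const_bcontfun p + \<kappa> *\<^sub>R curve_int (nem G (\<Gamma> p))) \<and>
  (\<forall>p v. fd \<Gamma> (at p) v =
    const_bcontfun v + \<kappa> *\<^sub>R curve_int (blinfun_apply (nem_deriv G (\<Gamma> p)) (fd \<Gamma> (at p) v)))"
   by blast
 qed
qed

text \<open>The field is cut off to compact support. The factor \<kappa> slows the curves down so
  that over unit time they stay in the ball where the cutoff is 1; there the flow of the truncated
  field solves the original equation. Differentiating in the initial point gives the linearized
  equation.\<close>

theorem local_flow:
 fixes G :: "'e::euclidean_space => 'e"
 assumes \<Omega>: "open \<Omega>" "smooth_on \<Omega> G" "y0 \<in> \<Omega>"
 obtains \<kappa> \<epsilon> and \<phi> :: "real => 'e => 'e" where "\<kappa> > 0" "\<epsilon> > 0"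
  "\<And>t. smooth_on UNIV (\<phi> t)" "\<And>p. \<phi> 0 p = p" "\<And>p v. fd (\<phi> 0) (at p) v = v"
  "\<And>p t. p \<in> ball y0 \<epsilon> ==> t \<in> {0..1} ==> \<phi> t p \<in> \<Omega>"
  "\<And>p t. p \<in> ball y0 \<epsilon> ==> t \<in> {0..1} ==>
   ((%s. \<phi> s p) has_vector_derivative \<kappa> *\<^sub>R G (\<phi> t p)) (at t within {0..1})"
  "\<And>p v t. p \<in> ball y0 \<epsilon> ==> t \<in> {0..1} ==>
   ((%s. fd (\<phi> s) (at p) v) has_vector_derivative
    \<kappa> *\<^sub>R fd G (at (\<phi> t p)) (fd (\<phi> t) (at p) v)) (at t within {0..1})"
proof -
 obtain R where R: "R > 0" "cball y0 R \<subseteq> \<Omega>" using \<Omega> open_contains_cball by blast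
 obtain \<psi> :: "'e => real" where \<psi>: "smooth_on UNIV \<psi>" "\<And>y. dist y0 y \<le> R/3 ==> \<psi> y = 1"
  "\<And>y. dist y0 y \<ge> R/2 ==> \<psi> y = 0"
  using smooth_bump[of "R/3" "R/2" y0] R(1) by auto
 define Gc where "Gc \<equiv> %y. if y \<in> \<Omega> then \<psi> y *\<^sub>R G y else 0"
 have "smooth_on UNIV Gc" unfolding Gc_def
  by (rule smooth_on_cutoff[where R=R and R'="R/2" and ?y0.0=y0]) (use \<Omega> R \<psi> in auto)
 then have G: "cs_smooth Gc" unfolding cs_smooth_def
  using \<psi>(3) by (auto simp: Gc_def intro!: exI[of _ y0] exI[of _ "R/2"])
 have Gc_eq: "Gc y = G y" if "y \<in> ball y0 (R/3)" for y
  using that \<psi>(2)[of y] R by (auto simp: Gc_def subset_iff)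
 obtain C where C: "C > 0" "\<And>y. norm (Gc y) \<le> C" using cs_smooth_bounded[OF G] by metis
 obtain \<kappa>0 where \<kappa>0: "\<kappa>0 > 0" and fl: "\<And>\<kappa>. 0 < \<kappa> ==> \<kappa> \<le> \<kappa>0 ==> \<exists>\<Gamma>. smooth_on UNIV \<Gamma> \<and>
  (\<forall>p. \<Gamma> p = const_bcontfun p + \<kappa> *\<^sub>R curve_int (nem Gc (\<Gamma> p))) \<and>
  (\<forall>p v. fd \<Gamma> (at p) v =
    const_bcontfun v + \<kappa> *\<^sub>R curve_int (blinfun_apply (nem_deriv Gc (\<Gamma> p)) (fd \<Gamma> (at p) v)))"
  using flow_curve[OF G] by metis
 \<comment> \<open>The speed is at most \<open>\<kappa> * C \<le> R/6\<close>, so curves that start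
   within \<open>R/6\<close> of \<open>y0\<close> stay within \<open>R/3\<close>, where
   \<open>Gc = G\<close>.\<close>
 define \<kappa> where "\<kappa> = min \<kappa>0 (R / 6 / C)"
 have \<kappa>: "0 < \<kappa>" "\<kappa> \<le> \<kappa>0" "\<kappa> * C \<le> R/6"
  using \<kappa>0 R(1) C(1) by (auto simp: \<kappa>_def min_def field_simps)
 obtain \<Gamma> where \<Gamma>: "smooth_on UNIV \<Gamma>"
  "\<And>p. \<Gamma> p = const_bcontfun p + \<kappa> *\<^sub>R curve_int (nem Gc (\<Gamma> p))"
  "\<And>p v. fd \<Gamma> (at p) v =
    const_bcontfun v + \<kappa> *\<^sub>R curve_int (blinfun_apply (nem_deriv Gc (\<Gamma> p)) (fd \<Gamma> (at p) v))"
  using fl[OF \<kappa>(1,2)] by blast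
 define \<phi> where "\<phi> \<equiv> %t p. apply_bcontfun (\<Gamma> p) t"
 have ev: "bounded_linear (%x::real \<Rightarrow>\<^sub>C 'e. apply_bcontfun x t)" for t :: real
 proof
  show "\<exists>K. \<forall>x::real \<Rightarrow>\<^sub>C 'e. norm (apply_bcontfun x t) \<le> norm x * K"
   by (intro exI[of _ 1] allI) (simp add: norm_bounded)
 qed auto
 have sm: "smooth_on UNIV (\<phi> t)" for t
  unfolding \<phi>_def by (rule smooth_on_bounded_linear[OF ev open_UNIV \<Gamma>(1)])
 have fd: "fd (\<phi> t) (at p) v = apply_bcontfun (fd \<Gamma> (at p) v) t" for t p v
 proof -
  have "(\<phi> t has_derivative (%v. apply_bcontfun (fd \<Gamma> (at p) v) t)) (at p)"
   unfolding \<phi>_def by (rule bounded_linear.has_derivative[OF ev smooth_on_has_derivative[OF \<Gamma>(1) UNIV_I]])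
  from frechet_derivative_at[OF this] show ?thesis by metis
 qed
 have int: "\<phi> t p = p + \<kappa> *\<^sub>R integral {0..unit_clamp t} (apply_bcontfun (nem Gc (\<Gamma> p)))" for t p
  unfolding \<phi>_def by (subst \<Gamma>(2)) (simp add: curve_int_apply)
 have dint: "fd (\<phi> t) (at p) v = v + \<kappa> *\<^sub>R integral {0..unit_clamp t}
   (apply_bcontfun (blinfun_apply (nem_deriv Gc (\<Gamma> p)) (fd \<Gamma> (at p) v)))" for t p v
  unfolding fd by (subst \<Gamma>(3)) (simp add: curve_int_apply)
 have vd: "((%s. c + \<kappa> *\<^sub>R integral {0..unit_clamp s} (apply_bcontfun \<gamma>)) has_vector_derivative
   \<kappa> *\<^sub>R apply_bcontfun \<gamma> t) (at t within {0..1})" if "t \<in> {0..1}" for c t and \<gamma> :: "real \<Rightarrow>\<^sub>C 'e"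
 proof -
  have "((%s. c + \<kappa> *\<^sub>R integral {0..s} (apply_bcontfun \<gamma>)) has_vector_derivative
   0 + \<kappa> *\<^sub>R apply_bcontfun \<gamma> t) (at t within {0..1})"
   by (intro has_vector_derivative_add has_vector_derivative_const
     bounded_linear.has_vector_derivative[OF bounded_linear_scaleR_right]
     integral_has_vector_derivative that) simp
  then have "((%s. c + \<kappa> *\<^sub>R integral {0..unit_clamp s} (apply_bcontfun \<gamma>)) has_vector_derivative
   0 + \<kappa> *\<^sub>R apply_bcontfun \<gamma> t) (at t within {0..1})"
   by (rule has_vector_derivative_transform[OF that, rotated]) (auto simp: unit_clamp_def)
  then show ?thesis by simp
 qed
 have near: "\<phi> t p \<in> ball y0 (R/3)" if "p \<in> ball y0 (R/6)" for t p
 proof -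
  have "norm (nem Gc (\<Gamma> p)) \<le> C" by (rule norm_bound) (simp add: nem_apply[OF G] C)
  then have "norm (integral {0..unit_clamp t} (apply_bcontfun (nem Gc (\<Gamma> p)))) \<le> C"
   using norm_integral_clamp order_trans by blast
  then have "norm (\<kappa> *\<^sub>R integral {0..unit_clamp t} (apply_bcontfun (nem Gc (\<Gamma> p)))) \<le> R/6"
   using \<kappa> by (smt (verit) mult_left_mono norm_scaleR real_norm_def abs_of_pos)
  then have "dist p (\<phi> t p) \<le> R/6" by (simp add: int dist_norm)
  then show ?thesis using that dist_triangle[of y0 "\<phi> t p" p] by simp
 qed
 show ?thesis
 proof (rule that[of \<kappa> "R/6" \<phi>])
  show "\<kappa> > 0" "R/6 > 0" using \<kappa> R by auto
  show "smooth_on UNIV (\<phi> t)" for t by (rule sm)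
  show "\<phi> 0 p = p" for p by (simp add: int unit_clamp_def)
  show "fd (\<phi> 0) (at p) v = v" for p v by (simp add: dint unit_clamp_def)
 next
  fix p t v assume p: "p \<in> ball y0 (R/6)" and t: "t \<in> {0..1::real}"
  show "\<phi> t p \<in> \<Omega>" using near[OF p, of t] R by auto
  have 1: "apply_bcontfun (nem Gc (\<Gamma> p)) t = G (\<phi> t p)"
   using Gc_eq[OF near[OF p]] by (simp add: nem_apply[OF G] \<phi>_def)
  have "fd Gc (at (\<phi> t p)) = fd G (at (\<phi> t p))"
   by (rule frechet_derivative_cong_open(1)[OF open_ball near[OF p] Gc_eq])
  then have 2: "apply_bcontfun (blinfun_apply (nem_deriv Gc (\<Gamma> p)) (fd \<Gamma> (at p) v)) t =
   fd G (at (\<phi> t p)) (fd (\<phi> t) (at p) v)"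
   by (simp add: nem_deriv_eval[OF G] fd) (simp add: \<phi>_def)
  show "((%s. \<phi> s p) has_vector_derivative \<kappa> *\<^sub>R G (\<phi> t p)) (at t within {0..1})"
   using vd[OF t, of p "nem Gc (\<Gamma> p)"] unfolding 1 int[symmetric] .
  show "((%s. fd (\<phi> s) (at p) v) has_vector_derivative
    \<kappa> *\<^sub>R fd G (at (\<phi> t p)) (fd (\<phi> t) (at p) v)) (at t within {0..1})"
   using vd[OF t, of v "blinfun_apply (nem_deriv Gc (\<Gamma> p)) (fd \<Gamma> (at p) v)"]
   unfolding 2 dint[symmetric] .
 qed
qed

subsection \<open>The Frobenius theorem\<close>

lemma frechet_chain:
 assumes "f differentiable (at x)" "g differentiable (at (f x))"
 shows "fd (%x. g (f x)) (at x) v = fd g (at (f x)) (fd f (at x) v)"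
  and "(%x. g (f x)) differentiable (at x)"
proof -
 have "(f has_derivative fd f (at x)) (at x)"
  "(g has_derivative fd g (at (f x))) (at (f x))"
  using assms frechet_derivative_works by blast+
 from has_derivative_compose[OF this]
 have d: "((%x. g (f x)) has_derivative (%v. fd g (at (f x)) (fd f (at x) v))) (at x)" .
 show "fd (%x. g (f x)) (at x) v = fd g (at (f x)) (fd f (at x) v)"
  using frechet_derivative_at[OF d] by metis
 show "(%x. g (f x)) differentiable (at x)" using d differentiableI by blast
qed

lemma frechet_bounded_linear:
 assumes "bounded_linear L" "f differentiable (at x)"
 shows "fd (%x. L (f x)) (at x) v = L (fd f (at x) v)"
proof -
 have "(f has_derivative fd f (at x)) (at x)"
  using assms(2) frechet_derivative_works by blast
 from frechet_derivative_at[OF bounded_linear.has_derivative[OF assms(1) this]] show ?thesis by metis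
qed

lemma frechet_derivative_inverse:
 assumes "open U" "open V" "homeomorphism U V f g" "smooth_on U f" "smooth_on V g"
 shows "y \<in> V ==> fd f (at (g y)) (fd g (at y) v) = v"
  and "x \<in> U ==> fd g (at (f x)) (fd f (at x) v) = v"
proof -
 have m: "\<And>x. x \<in> U ==> f x \<in> V" "\<And>y. y \<in> V ==> g y \<in> U"
  and i: "\<And>x. x \<in> U ==> g (f x) = x" "\<And>y. y \<in> V ==> f (g y) = y"
  using assms(3) by (auto simp: homeomorphism_def)
 show "fd f (at (g y)) (fd g (at y) v) = v" if "y \<in> V"
 proof -
  have "fd (%y. f (g y)) (at y) v = fd f (at (g y)) (fd g (at y) v)"
   by (rule frechet_chain) (use that m assms smooth_on_differentiable in blast)+
  moreover have "fd (%y. f (g y)) (at y) = fd (%y. y) (at y)"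
   by (rule frechet_derivative_cong_open(1)[OF assms(2) that i(2)])
  ultimately show ?thesis by simp
 qed
 show "fd g (at (f x)) (fd f (at x) v) = v" if "x \<in> U"
 proof -
  have "fd (%y. g (f y)) (at x) v = fd g (at (f x)) (fd f (at x) v)"
   by (rule frechet_chain) (use that m assms smooth_on_differentiable in blast)+
  moreover have "fd (%y. g (f y)) (at x) = fd (%y. y) (at x)"
   by (rule frechet_derivative_cong_open(1)[OF assms(1) that i(1)])
  ultimately show ?thesis by simp
 qed
qed

lemma linear_family_has_derivative:
 fixes L :: "'u::real_normed_vector => 'v::euclidean_space => 'w::real_normed_vector"
 assumes S: "open S" "x \<in> S" and lin: "\<And>x. x \<in> S ==> linear (L x)" and sm: "\<And>v. smooth_on S (%x. L x v)"
  and X: "(X has_derivative X') (at x)"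
 shows "((%y. L y (X y)) has_derivative (%w. fd (%y. L y (X x)) (at x) w + L x (X' w))) (at x)"
  and "linear (%v. fd (%y. L y v) (at x) w)"
proof -
 let ?B = "%y. Blinfun (L y)"
 have ap: "blinfun_apply (?B y) = L y" if "y \<in> S" for y
  by (rule linear_Blinfun_apply[OF lin[OF that]])
 have B: "(?B has_derivative fd ?B (at x)) (at x)"
  by (rule smooth_on_has_derivative[OF smooth_on_Blinfun[OF S(1) lin sm] S(2)])
 have 1: "fd (%y. L y v) (at x) w = blinfun_apply (fd ?B (at x) w) v" for v w
 proof -
  have "fd (%y. L y v) (at x) = fd (%y. blinfun_apply (?B y) v) (at x)"
   by (rule frechet_derivative_cong_open(1)[OF S]) (simp add: ap)
  moreover have "((%y. blinfun_apply (?B y) v) has_derivative (%w. blinfun_apply (fd ?B (at x) w) v)) (at x)"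
   by (rule bounded_linear.has_derivative[OF blinfun.bounded_linear_left B])
  ultimately show ?thesis using frechet_derivative_at by metis
 qed
 have "((%y. blinfun_apply (?B y) (X y)) has_derivative
   (%w. blinfun_apply (?B x) (X' w) + blinfun_apply (fd ?B (at x) w) (X x))) (at x)"
  by (rule bounded_bilinear.FDERIV[OF bounded_bilinear_blinfun_apply B X])
 then have "((%y. blinfun_apply (?B y) (X y)) has_derivative
   (%w. fd (%y. L y (X x)) (at x) w + L x (X' w))) (at x)"
  by (simp add: 1 ap[OF S(2)] add.commute)
 then show "((%y. L y (X y)) has_derivative (%w. fd (%y. L y (X x)) (at x) w + L x (X' w))) (at x)"
  by (rule has_derivative_transform_within_open[OF _ S]) (simp add: ap)
 show "linear (%v. fd (%y. L y v) (at x) w)"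
  unfolding 1 by (rule bounded_linear.linear[OF blinfun.bounded_linear_right])
qed

text \<open>Gronwall's argument: exp(-2 C t) times the squared norm of \<open>m\<close> has
  nonpositive derivative and starts at zero.\<close>

lemma vector_derivative_growth_unique:
 fixes m :: "real => 'a::real_inner"
 assumes d: "\<And>t. t \<in> {0..1} ==> (m has_vector_derivative m' t) (at t within {0..1})"
  and b: "\<And>t. t \<in> {0..1} ==> norm (m' t) \<le> C * norm (m t)" and "m 0 = 0" and t: "t \<in> {0..1}"
 shows "m t = 0"
proof (cases "t = 0")
 case False
 define h where "h \<equiv> %s. exp (- (2 * C * s)) * (m s \<bullet> m s)"
 have hd: "(h has_derivative (%v. exp (- (2 * C * s)) * (2 * (m s \<bullet> m' s) - 2 * C * (m s \<bullet> m s)) * v)) (at s within {0..t})"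
  if "s \<in> {0..t}" for s
 proof -
  have "(m has_derivative (%v. v *\<^sub>R m' s)) (at s within {0..t})"
   using d[of s] that t has_derivative_subset[of m _ s "{0..1}" "{0..t}"]
   by (auto simp: has_vector_derivative_def)
  note [derivative_intros] = this
  show ?thesis unfolding h_def
   by (auto intro!: derivative_eq_intros simp: fun_eq_iff algebra_simps inner_commute)
 qed
 have "0 < t" using False t by auto
 then obtain s where s: "s \<in> {0<..<t}" and e:
  "h t - h 0 = exp (- (2 * C * s)) * (2 * (m s \<bullet> m' s) - 2 * C * (m s \<bullet> m s)) * (t - 0)"
  using mvt_simple[OF \<open>0 < t\<close> hd] by auto
 have "m s \<bullet> m' s \<le> norm (m s) * norm (m' s)" by (rule norm_cauchy_schwarz)
 also have "\<dots> \<le> norm (m s) * (C * norm (m s))" using b[of s] s t by (intro mult_left_mono) auto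
 also have "\<dots> = C * (m s \<bullet> m s)" by (simp add: power2_norm_eq_inner[symmetric] power2_eq_square)
 finally have "2 * (m s \<bullet> m' s) - 2 * C * (m s \<bullet> m s) \<le> 0" by simp
 then have "h t \<le> h 0" using e \<open>0 < t\<close>
  by (smt (verit) exp_gt_zero mult_nonneg_nonpos mult_nonpos_nonneg)
 then have "m t \<bullet> m t \<le> 0" using \<open>m 0 = 0\<close> by (simp add: h_def mult_le_0_iff)
 then show ?thesis by (metis inner_ge_zero order_antisym inner_eq_zero_iff)
qed (use \<open>m 0 = 0\<close> in simp)

lemma vector_derivative_zero_unit:
 fixes f :: "real => 'a::real_inner"
 assumes "\<And>t. t \<in> {0..1} ==> (f has_vector_derivative 0) (at t within {0..1})" "t \<in> {0..1}"
 shows "f t = f 0"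
proof -
 have "((%s. f s - f 0) has_vector_derivative 0) (at t within {0..1})" if "t \<in> {0..1}" for t
  using has_vector_derivative_diff[OF assms(1)[OF that] has_vector_derivative_const[of "f 0"]] by simp
 then have "f t - f 0 = 0"
  by (rule vector_derivative_growth_unique[where C=0]) (use assms(2) in auto)
 then show ?thesis by simp
qed

text \<open>The leaf through \<open>\<eta>\<close> in the direction \<open>x\<close> is reached by the radial equation
 \<open>z' = \<kappa> \<beta>(z) x\<close>, \<open>z 0 = \<eta>\<close>, where \<open>\<beta>\<close> lifts the fibre at \<open>x0\<close> to the distribution; involutivity makes the
 time-one map send the plane of all \<open>x\<close> to the distribution.\<close>

theorem frobenius:
 fixes \<rho> :: "'m::euclidean_space => 'm => 'm"
 assumes S: "open S" "x0 \<in> S" and lin: "\<And>x. x \<in> S ==> linear (\<rho> x)"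
  and sm: "\<And>v. smooth_on S (%x. \<rho> x v)" and idem: "\<And>x v. x \<in> S ==> \<rho> x (\<rho> x v) = \<rho> x v"
  and invol: "\<And>x u v. x \<in> S ==> \<rho> x u = u ==> \<rho> x v = v ==>
   \<rho> x (fd (%y. \<rho> y v) (at x) u - fd (%y. \<rho> y u) (at x) v) =
   fd (%y. \<rho> y v) (at x) u - fd (%y. \<rho> y u) (at x) v"
 obtains U f where "open U" "x0 \<in> U" "U \<subseteq> S" "smooth_on U f" "\<And>x. x \<in> U ==> \<rho> x0 (f x) = 0"
  "\<And>x v. x \<in> U ==> fd f (at x) v = 0 \<longleftrightarrow> \<rho> x v = v"
proof -
 define Q1 where "Q1 = \<rho> x0"
 define Q2 where "Q2 v = v - Q1 v" for v
 have Q1l: "linear Q1" unfolding Q1_def by (rule lin[OF S(2)])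
 have Q2l: "linear Q2" unfolding Q2_def[abs_def] by (intro linear_compose_sub linear_ident Q1l)
 note Q1b = Q1l[unfolded linear_conv_bounded_linear] and Q2b = Q2l[unfolded linear_conv_bounded_linear]
 have Q: "Q1 (Q1 v) = Q1 v" "Q1 (Q2 v) = 0" "Q2 (Q1 v) = 0" "Q2 (Q2 v) = Q2 v" "Q1 v + Q2 v = v" for v
  using idem[OF S(2)] by (simp_all add: Q1_def Q2_def linear_diff[OF lin[OF S(2)]])
 \<comment> \<open>\<open>N z\<close> is the identity at \<open>x0\<close>; it acts as
   \<open>Q1\<close> on the range of \<open>\<rho> z\<close> and as \<open>Q2\<close> on its kernel.
   Where it is invertible, its inverse lifts the fibre at \<open>x0\<close> to the fibre at
   \<open>z\<close>.\<close>
 define N where "N z v = Q1 (\<rho> z v) + Q2 (v - \<rho> z v)" for z v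
 have Nlin: "linear (N z)" if "z \<in> S" for z
  unfolding N_def[abs_def]
  by (intro linear_compose_add linear_compose[OF _ Q1l, unfolded o_def] linear_compose[OF _ Q2l, unfolded o_def]
    linear_compose_sub linear_ident lin that)
 have Nsm: "smooth_on S (%z. N z v)" for v
  unfolding N_def
  by (intro smooth_on_add S(1) smooth_on_bounded_linear[OF Q1b] smooth_on_bounded_linear[OF Q2b]
    smooth_on_diff smooth_on_const sm)
 have N0: "N x0 v = v" for v
  using Q by (simp add: N_def Q1_def[symmetric]) (simp add: Q2_def[symmetric] Q)
 \<comment> \<open>At distance less than 1/2 from the identity, \<open>N z\<close> has trivial
   kernel.\<close>
 define S' where "S' = {z \<in> S. norm (Blinfun (N z) - id_blinfun) < 1/2}"
 have Nc: "continuous_on S (%z. norm (Blinfun (N z) - id_blinfun))"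
  by (intro continuous_intros smooth_on_continuous smooth_on_Blinfun S(1) Nlin Nsm)
 have "S' = S \<inter> (%z. norm (Blinfun (N z) - id_blinfun)) -` {..<1/2}" by (auto simp: S'_def)
 then have S'o: "open S'"
  using continuous_open_preimage[OF Nc S(1) open_lessThan] by simp
 have S'S: "S' \<subseteq> S" by (auto simp: S'_def)
 have "Blinfun (N x0) = id_blinfun"
  by (rule blinfun_eqI) (simp add: linear_Blinfun_apply[OF Nlin[OF S(2)]] N0)
 then have x0S': "x0 \<in> S'" using S(2) by (simp add: S'_def)
 have Ninj: "v = 0" if "z \<in> S'" "N z v = 0" for z v
 proof -
  have "norm (blinfun_apply (Blinfun (N z) - id_blinfun) v) \<le> 1/2 * norm v"
   using that(1) by (intro order_trans[OF norm_blinfun] mult_right_mono) (auto simp: S'_def)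
  moreover have "blinfun_apply (Blinfun (N z)) v = 0"
   using that S'S linear_Blinfun_apply[OF Nlin] by auto
  ultimately show ?thesis by (simp add: blinfun.diff_left)
 qed
 have Nbij: "bij (N z)" if "z \<in> S'" for z
  by (rule linear_bij_of_inj[OF Nlin Ninj]) (use that S'S in auto)
 have Ninv: "N z (inv (N z) v) = v" "inv (N z) (N z v) = v" if "z \<in> S'" for z v
  using Nbij[OF that] by (simp_all add: bij_is_surj surj_f_inv_f bij_is_inj)
 \<comment> \<open>\<open>\<beta> z u\<close> is the vector of the distribution at \<open>z\<close>
   with the same \<open>Q1\<close>-part as \<open>u\<close>.\<close>
 define \<beta> where "\<beta> z u = inv (N z) (Q1 u)" for z u
 have \<beta>sm: "smooth_on S' (%z. \<beta> z u)" for u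
  unfolding \<beta>_def by (rule smooth_on_inv_family[OF S'o Nlin Ninj smooth_on_subset[OF Nsm S'S]]) (use S'S in auto)
 have \<beta>lin: "linear (\<beta> z)" if "z \<in> S'" for z
 proof -
  have "linear (inv (N z))"
   using Nbij[OF that] Nlin[of z] that S'S by (auto intro!: inj_linear_imp_inv_linear bij_is_inj)
  then show ?thesis unfolding \<beta>_def[abs_def] by (rule linear_compose[OF Q1l, unfolded o_def])
 qed
 have \<beta>E: "\<rho> z (\<beta> z u) = \<beta> z u" and \<beta>Q: "Q1 (\<beta> z u) = Q1 u" if "z \<in> S'" for z u
 proof -
  have zS: "z \<in> S" using that S'S by auto
  have n: "N z (\<beta> z u) = Q1 u" unfolding \<beta>_def by (rule Ninv(1)[OF that])
  have "Q1 (N z (\<beta> z u)) = Q1 (\<rho> z (\<beta> z u))" "Q2 (N z (\<beta> z u)) = Q2 (\<beta> z u - \<rho> z (\<beta> z u))"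
   unfolding N_def by (simp_all add: linear_add[OF Q1l] linear_add[OF Q2l] Q)
  then have n2: "Q1 (\<rho> z (\<beta> z u)) = Q1 u" "Q2 (\<beta> z u - \<rho> z (\<beta> z u)) = 0"
   unfolding n by (simp_all add: Q)
  have "N z (\<beta> z u - \<rho> z (\<beta> z u)) = 0"
   unfolding N_def using n2(2)
   by (simp add: linear_diff[OF lin[OF zS]] idem[OF zS] linear_0[OF Q1l])
  from Ninj[OF that this] show e: "\<rho> z (\<beta> z u) = \<beta> z u" by simp
  show "Q1 (\<beta> z u) = Q1 u" using n2(1) e by simp
 qed
 have \<beta>_fix: "\<beta> z v = v" if "z \<in> S'" "\<rho> z v = v" for z v
 proof -
  have "N z v = Q1 v" unfolding N_def using that by (simp add: linear_0[OF Q2l])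
  then show ?thesis unfolding \<beta>_def using Ninv(2)[OF that(1), of v] by simp
 qed
 define D where "D z w u = fd (%y. \<beta> y u) (at z) w" for z w u
 have \<beta>d: "((%y. \<beta> y u) has_derivative (%w. D z w u)) (at z)" if "z \<in> S'" for z u
  unfolding D_def using smooth_on_has_derivative[OF \<beta>sm that] by simp
 have Dlin1: "linear (%w. D z w u)" if "z \<in> S'" for z u
  using has_derivative_linear[OF \<beta>d[OF that]] .
 have Dlin2: "linear (D z w)" if "z \<in> S'" for z w
  unfolding D_def[abs_def] by (rule linear_family_has_derivative(2)[OF S'o that \<beta>lin \<beta>sm \<beta>d[OF that]])
 \<comment> \<open>The fields that \<open>\<beta>\<close> assigns to \<open>u\<close> and
   \<open>v\<close> commute: their bracket lies in the distribution by involutivity, and its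
   \<open>Q1\<close>-part vanishes because \<open>Q1 (\<beta> z u)\<close> does not depend on
   \<open>z\<close>. Then \<open>N z\<close> kills it.\<close>
 have Dsym: "D z (\<beta> z u) v = D z (\<beta> z v) u" if z: "z \<in> S'" for z u v
 proof -
  have zS: "z \<in> S" using that S'S by auto
  have DQ: "Q1 (D z w v) = 0" for w v
  proof -
   have "((%y. Q1 (\<beta> y v)) has_derivative (%w. Q1 (D z w v))) (at z)"
    by (rule bounded_linear.has_derivative[OF Q1b \<beta>d[OF z]])
   then have "((%y. Q1 v) has_derivative (%w. Q1 (D z w v))) (at z)"
    by (rule has_derivative_transform_within_open[OF _ S'o z]) (simp add: \<beta>Q)
   from has_derivative_unique[OF this has_derivative_const] show ?thesis by metis
  qed
  have D\<rho>: "D z w v = fd (%y. \<rho> y (\<beta> z v)) (at z) w + \<rho> z (D z w v)" for w v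
  proof -
   have "((%y. \<rho> y (\<beta> y v)) has_derivative
     (%w. fd (%y. \<rho> y (\<beta> z v)) (at z) w + \<rho> z (D z w v))) (at z)"
    by (rule linear_family_has_derivative(1)[OF S(1) zS lin sm \<beta>d[OF z]])
   then have "((%y. \<beta> y v) has_derivative
     (%w. fd (%y. \<rho> y (\<beta> z v)) (at z) w + \<rho> z (D z w v))) (at z)"
    by (rule has_derivative_transform_within_open[OF _ S'o z]) (simp add: \<beta>E)
   from has_derivative_unique[OF \<beta>d[OF z] this] show ?thesis by metis
  qed
  define E where "E = fd (%y. \<rho> y (\<beta> z v)) (at z) (\<beta> z u) -
   fd (%y. \<rho> y (\<beta> z u)) (at z) (\<beta> z v)"
  define X where "X = D z (\<beta> z u) v - D z (\<beta> z v) u"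
  have E: "\<rho> z E = E" unfolding E_def by (rule invol[OF zS \<beta>E[OF z] \<beta>E[OF z]])
  have XE: "X = E + \<rho> z X"
   unfolding X_def E_def linear_diff[OF lin[OF zS]]
   using arg_cong2[OF D\<rho>[of "\<beta> z u" v] D\<rho>[of "\<beta> z v" u], of minus] by (simp only: add_diff_add)
  then have "\<rho> z X = \<rho> z E + \<rho> z (\<rho> z X)" by (metis linear_add[OF lin[OF zS]])
  then have "E = 0" using E idem[OF zS] by simp
  then have "\<rho> z X = X" using XE by simp
  moreover have "Q1 X = 0" unfolding X_def by (simp add: linear_diff[OF Q1l] DQ)
  ultimately have "N z X = 0" unfolding N_def by (simp add: linear_0[OF Q2l])
  from Ninj[OF z this] show ?thesis by (simp add: X_def)
 qed
 \<comment> \<open>The direction is carried along as a first component that does not move, so a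
   single flow produces the rays in all directions, smoothly in direction and starting
   point.\<close>
 define G where "G p = (0::'m, \<beta> (snd p) (fst p))" for p
 have Om: "open (UNIV \<times> S' :: ('m \<times> 'm) set)" using S'o by (simp add: open_Times)
 have "smooth_on (UNIV \<times> S') (%p::'m\<times>'m. \<beta> (snd p) (fst p))"
 proof (rule smooth_on_linear_family[where L="%p. \<beta> (snd p)" and f=fst, OF Om])
  show "linear (\<beta> (snd p))" if "p \<in> UNIV \<times> S'" for p :: "'m \<times> 'm" using that \<beta>lin by auto
  show "smooth_on (UNIV \<times> S') (%p::'m\<times>'m. \<beta> (snd p) v)" for v
   by (rule smooth_on_compose[OF Om S'o _ smooth_on_linear[OF bounded_linear_snd Om] \<beta>sm]) auto
  show "smooth_on (UNIV \<times> S') (fst :: 'm \<times> 'm => 'm)" by (rule smooth_on_linear[OF bounded_linear_fst Om])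
 qed
 then have Gsm: "smooth_on (UNIV \<times> S') G"
  unfolding G_def[abs_def] by (intro smooth_on_Pair Om smooth_on_const)
 have Gd: "fd G (at p) (\<alpha>, d) = (0, D (snd p) d (fst p) + \<beta> (snd p) \<alpha>)" if "snd p \<in> S'" for p \<alpha> d
 proof -
  have pO: "p \<in> UNIV \<times> S'" using that by (cases p) auto
  have l: "linear (\<beta> (snd q))" if "q \<in> UNIV \<times> S'" for q :: "'m \<times> 'm" using that \<beta>lin by auto
  have s: "smooth_on (UNIV \<times> S') (%q::'m\<times>'m. \<beta> (snd q) v)" for v
   by (rule smooth_on_compose[OF Om S'o _ smooth_on_linear[OF bounded_linear_snd Om] \<beta>sm]) auto
  have "((%q. \<beta> (snd q) (fst q)) has_derivative
    (%w. fd (%q. \<beta> (snd q) (fst p)) (at p) w + \<beta> (snd p) (fst w))) (at p)"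
   by (rule linear_family_has_derivative(1)[OF Om pO l s bounded_linear_imp_has_derivative[OF bounded_linear_fst]])
  moreover have "((%q. \<beta> (snd q) (fst p)) has_derivative (%w. D (snd p) (snd w) (fst p))) (at p)"
   by (rule has_derivative_compose[OF bounded_linear_imp_has_derivative[OF bounded_linear_snd] \<beta>d[OF that]])
  ultimately have "((%q. \<beta> (snd q) (fst q)) has_derivative
    (%w. D (snd p) (snd w) (fst p) + \<beta> (snd p) (fst w))) (at p)"
   using frechet_derivative_at by metis
  then have "(G has_derivative (%w. (0, D (snd p) (snd w) (fst p) + \<beta> (snd p) (fst w)))) (at p)"
   unfolding G_def[abs_def] by (intro has_derivative_Pair has_derivative_const)
  from frechet_derivative_at[OF this, symmetric] show ?thesis by simp
 qed
 have Gd': "fd G (at p) q = (0, D (snd p) (snd q) (fst p) + \<beta> (snd p) (fst q))" if "snd p \<in> S'" for p q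
  using Gd[OF that, of "fst q" "snd q"] by simp
 show ?thesis
 proof (rule local_flow[OF Om Gsm, of "(0, x0)"])
  show "(0, x0) \<in> UNIV \<times> S'" using x0S' by simp
  fix \<kappa> \<epsilon> :: real and \<phi> :: "real => 'm \<times> 'm => 'm \<times> 'm"
  assume \<kappa>: "\<kappa> > 0" and \<epsilon>: "\<epsilon> > 0" and \<phi>sm: "\<And>t. smooth_on UNIV (\<phi> t)"
   and \<phi>0: "\<And>p. \<phi> 0 p = p" and \<phi>d0: "\<And>p v. fd (\<phi> 0) (at p) v = v"
   and \<phi>in: "\<And>p t. p \<in> ball (0, x0) \<epsilon> ==> t \<in> {0..1} ==> \<phi> t p \<in> UNIV \<times> S'"
   and \<phi>v: "\<And>p t. p \<in> ball (0, x0) \<epsilon> ==> t \<in> {0..1} ==>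
    ((%s. \<phi> s p) has_vector_derivative \<kappa> *\<^sub>R G (\<phi> t p)) (at t within {0..1})"
   and \<phi>dv: "\<And>p v t. p \<in> ball (0, x0) \<epsilon> ==> t \<in> {0..1} ==>
    ((%s. fd (\<phi> s) (at p) v) has_vector_derivative
     \<kappa> *\<^sub>R fd G (at (\<phi> t p)) (fd (\<phi> t) (at p) v)) (at t within {0..1})"
  have fstv: "((%s. fst (f s)) has_vector_derivative fst v) F" and sndv: "((%s. snd (f s)) has_vector_derivative snd v) F"
   if "(f has_vector_derivative v) F" for f :: "real => 'm \<times> 'm" and v F
   using bounded_linear.has_vector_derivative[OF bounded_linear_fst that]
    bounded_linear.has_vector_derivative[OF bounded_linear_snd that] by auto
  have fst\<phi>: "fst (\<phi> t p) = fst p" if p: "p \<in> ball (0, x0) \<epsilon>" and t: "t \<in> {0..1}" for p t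
  proof -
   have "((%s. fst (\<phi> s p)) has_vector_derivative 0) (at t within {0..1})" if "t \<in> {0..1}" for t
    using fstv[OF \<phi>v[OF p that]] by (simp add: G_def)
   from vector_derivative_zero_unit[OF this t] show ?thesis by (simp add: \<phi>0)
  qed
  have snd\<phi>: "snd (\<phi> t p) \<in> S'" if "p \<in> ball (0, x0) \<epsilon>" "t \<in> {0..1}" for p t
   using \<phi>in[OF that] by auto
  have \<zeta>v: "((%s. snd (\<phi> s p)) has_vector_derivative \<kappa> *\<^sub>R \<beta> (snd (\<phi> t p)) (fst p)) (at t within {0..1})"
   if "p \<in> ball (0, x0) \<epsilon>" "t \<in> {0..1}" for p t
   using sndv[OF \<phi>v[OF that]] fst\<phi>[OF that] by (simp add: G_def)
  have fstd: "fst (fd (\<phi> t) (at p) v) = fst v" if p: "p \<in> ball (0, x0) \<epsilon>" and t: "t \<in> {0..1}" for p t v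
  proof -
   have "((%s. fst (fd (\<phi> s) (at p) v)) has_vector_derivative 0) (at t within {0..1})" if "t \<in> {0..1}" for t
    using fstv[OF \<phi>dv[OF p that, of v]] Gd'[OF snd\<phi>[OF p that], of "fd (\<phi> t) (at p) v"]
    by simp
   from vector_derivative_zero_unit[OF this t] show ?thesis by (simp add: \<phi>d0)
  qed
  have dv: "((%s. snd (fd (\<phi> s) (at p) v)) has_vector_derivative
    \<kappa> *\<^sub>R (D (snd (\<phi> t p)) (snd (fd (\<phi> t) (at p) v)) (fst p) + \<beta> (snd (\<phi> t p)) (fst v))) (at t within {0..1})"
   if p: "p \<in> ball (0, x0) \<epsilon>" and t: "t \<in> {0..1}" for p t v
   using sndv[OF \<phi>dv[OF p t, of v]]
    Gd'[OF snd\<phi>[OF p t], of "fd (\<phi> t) (at p) v"]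
   by (simp add: fstd[OF p t] fst\<phi>[OF p t])
  \<comment> \<open>The variation \<open>d\<close> of the ray in its direction and the multiple
    \<open>e\<close> of the field of \<open>v\<close> along the ray solve the same linear equation,
    thanks to \<open>Dsym\<close>, and both start at zero.\<close>
  have key: "snd (fd (\<phi> 1) (at p) (v, 0)) = \<kappa> *\<^sub>R \<beta> (snd (\<phi> 1 p)) v"
   if p: "p \<in> ball (0, x0) \<epsilon>" for p v
  proof -
   define \<zeta> where "\<zeta> t = snd (\<phi> t p)" for t
   define d where "d t = snd (fd (\<phi> t) (at p) (v, 0))" for t
   define e where "e t = (t * \<kappa>) *\<^sub>R \<beta> (\<zeta> t) v" for t
   define a where "a = fst p"
   have \<zeta>S: "\<zeta> t \<in> S'" if "t \<in> {0..1}" for t unfolding \<zeta>_def by (rule snd\<phi>[OF p that])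
   have \<zeta>d: "(\<zeta> has_vector_derivative \<kappa> *\<^sub>R \<beta> (\<zeta> t) a) (at t within {0..1})" if "t \<in> {0..1}" for t
    using \<zeta>v[OF p that] by (simp add: \<zeta>_def[abs_def] a_def)
   have dd: "(d has_vector_derivative \<kappa> *\<^sub>R (D (\<zeta> t) (d t) a + \<beta> (\<zeta> t) v)) (at t within {0..1})" if "t \<in> {0..1}" for t
    using dv[OF p that, of "(v, 0)"] by (simp add: d_def[abs_def] \<zeta>_def a_def)
   have ed: "(e has_vector_derivative \<kappa> *\<^sub>R (D (\<zeta> t) (e t) a + \<beta> (\<zeta> t) v)) (at t within {0..1})" if t: "t \<in> {0..1}" for t
   proof -
    have "((%s. \<beta> (\<zeta> s) v) has_derivative (%h. D (\<zeta> t) (h *\<^sub>R (\<kappa> *\<^sub>R \<beta> (\<zeta> t) a)) v)) (at t within {0..1})"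
     using has_derivative_in_compose[OF \<zeta>d[OF t, unfolded has_vector_derivative_def]
       has_derivative_at_withinI[OF \<beta>d[OF \<zeta>S[OF t]]]] .
    then have "((%s. \<beta> (\<zeta> s) v) has_vector_derivative D (\<zeta> t) (\<kappa> *\<^sub>R \<beta> (\<zeta> t) a) v) (at t within {0..1})"
     by (simp add: has_vector_derivative_def linear_scale[OF Dlin1[OF \<zeta>S[OF t]]])
    moreover have "((%s. s * \<kappa>) has_real_derivative \<kappa>) (at t within {0..1})"
     by (auto intro!: derivative_eq_intros)
    ultimately have "(e has_vector_derivative
      (t * \<kappa>) *\<^sub>R D (\<zeta> t) (\<kappa> *\<^sub>R \<beta> (\<zeta> t) a) v + \<kappa> *\<^sub>R \<beta> (\<zeta> t) v) (at t within {0..1})"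
     unfolding e_def[abs_def] by (intro has_vector_derivative_scaleR)
    moreover have "(t * \<kappa>) *\<^sub>R D (\<zeta> t) (\<kappa> *\<^sub>R \<beta> (\<zeta> t) a) v = \<kappa> *\<^sub>R D (\<zeta> t) (e t) a"
     unfolding e_def
     by (simp add: linear_scale[OF Dlin1[OF \<zeta>S[OF t]]] Dsym[OF \<zeta>S[OF t], of a v] mult_ac)
    ultimately show ?thesis by (simp add: scaleR_add_right)
   qed
   have md: "((%s. d s - e s) has_vector_derivative \<kappa> *\<^sub>R D (\<zeta> t) (d t - e t) a) (at t within {0..1})" if t: "t \<in> {0..1}" for t
    using has_vector_derivative_diff[OF dd[OF t] ed[OF t]]
    by (simp add: linear_diff[OF Dlin1[OF \<zeta>S[OF t]]] scaleR_diff_right scaleR_add_right)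
   define q where "q t = (\<Sum>i\<in>Basis. norm (\<kappa> *\<^sub>R D (\<zeta> t) i a))" for t
   have c1: "continuous_on {0..1} \<zeta>"
    unfolding continuous_on_eq_continuous_within using has_vector_derivative_continuous[OF \<zeta>d] by blast
   have c2: "continuous_on S' (%z. D z i a)" for i
    unfolding D_def by (rule smooth_on_continuous[OF smooth_on_frechet[OF \<beta>sm]])
   have "continuous_on {0..1} (%t. D (\<zeta> t) i a)" for i
    by (rule continuous_on_compose2[OF c2 c1]) (use \<zeta>S in auto)
   then have "continuous_on {0..1} q" unfolding q_def[abs_def] by (intro continuous_intros)
   then have "bounded (q ` {0..1})" by (intro compact_imp_bounded compact_continuous_image) auto
   then obtain C where C: "\<And>t. t \<in> {0..1} ==> norm (q t) \<le> C" unfolding bounded_iff by blast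
   have qb: "norm (\<kappa> *\<^sub>R D (\<zeta> t) m a) \<le> C * norm m" if t: "t \<in> {0..1}" for t m
   proof -
    have "\<kappa> *\<^sub>R D (\<zeta> t) m a = (\<Sum>i\<in>Basis. (m \<bullet> i) *\<^sub>R (\<kappa> *\<^sub>R D (\<zeta> t) i a))"
     by (subst linear_Basis_expand[OF Dlin1[OF \<zeta>S[OF t]]]) (simp add: scaleR_sum_right mult.commute)
    also have "norm \<dots> \<le> (\<Sum>i\<in>Basis. norm ((m \<bullet> i) *\<^sub>R (\<kappa> *\<^sub>R D (\<zeta> t) i a)))" by (rule norm_sum)
    also have "\<dots> \<le> (\<Sum>i\<in>Basis. norm m * norm (\<kappa> *\<^sub>R D (\<zeta> t) i a))"
     by (rule sum_mono) (simp only: norm_scaleR, intro mult_right_mono, auto simp: Basis_le_norm)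
    also have "\<dots> = norm m * q t" by (simp add: q_def sum_distrib_left)
    also have "\<dots> \<le> C * norm m" using C[OF t] by (subst mult.commute, intro mult_right_mono) auto
    finally show ?thesis .
   qed
   have "d 1 - e 1 = 0"
    by (rule vector_derivative_growth_unique[OF md qb]) (auto simp: d_def e_def \<phi>d0)
   then show ?thesis by (simp add: d_def e_def \<zeta>_def)
  qed
  have still: "snd (\<phi> t p) = snd p" if p: "p \<in> ball (0, x0) \<epsilon>" and t: "t \<in> {0..1}" and "fst p = 0" for p t
  proof -
   have "((%s. snd (\<phi> s p)) has_vector_derivative 0) (at t within {0..1})" if "t \<in> {0..1}" for t
    using \<zeta>v[OF p that] linear_0[OF \<beta>lin[OF snd\<phi>[OF p that]]] \<open>fst p = 0\<close> by simp
   from vector_derivative_zero_unit[OF this t] show ?thesis by (simp add: \<phi>0)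
  qed
  have stilld: "snd (fd (\<phi> 1) (at p) (0, v)) = v" if p: "p \<in> ball (0, x0) \<epsilon>" and "fst p = 0" for p v
  proof -
   have "((%s. snd (fd (\<phi> s) (at p) (0, v))) has_vector_derivative 0) (at t within {0..1})" if "t \<in> {0..1}" for t
    using dv[OF p that, of "(0, v)"] linear_0[OF \<beta>lin[OF snd\<phi>[OF p that]]] linear_0[OF Dlin2[OF snd\<phi>[OF p that]]] \<open>fst p = 0\<close> by simp
   from vector_derivative_zero_unit[OF this, of 1] show ?thesis by (simp add: \<phi>d0)
  qed
  \<comment> \<open>Rays start on the transversal at \<open>x0 + Q2 w\<close> and run in the
    direction \<open>Q1 w\<close>, so one point \<open>w\<close> encodes both.\<close>
  define j where "j w = (Q1 w, x0 + Q2 w)" for w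
  define \<Psi> where "\<Psi> w = snd (\<phi> 1 (j w))" for w
  have jd: "(j has_derivative (%v. (Q1 v, Q2 v))) (at w)" for w
   unfolding j_def[abs_def]
   using has_derivative_add[OF has_derivative_const bounded_linear_imp_has_derivative[OF Q2b]]
   by (intro has_derivative_Pair bounded_linear_imp_has_derivative[OF Q1b]) simp
  have jsm: "smooth_on UNIV j"
   unfolding j_def[abs_def] by (intro smooth_on_Pair smooth_on_add smooth_on_const smooth_on_linear[OF Q1b] smooth_on_linear[OF Q2b] open_UNIV)
  have \<Psi>sm: "smooth_on UNIV \<Psi>"
   unfolding \<Psi>_def[abs_def]
   by (rule smooth_on_bounded_linear[OF bounded_linear_snd open_UNIV smooth_on_compose[OF open_UNIV open_UNIV _ jsm \<phi>sm]]) auto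
  define B where "B = j -` ball (0, x0) \<epsilon>"
  have Bo: "open B" unfolding B_def
   by (rule open_vimage[OF open_ball smooth_on_continuous[OF jsm]])
  have B0: "0 \<in> B" using \<epsilon> by (simp add: B_def j_def linear_0[OF Q1l] linear_0[OF Q2l])
  have \<Psi>d: "fd \<Psi> (at w) v = snd (fd (\<phi> 1) (at (j w)) (Q1 v, Q2 v))" for w v
  proof -
   have "(\<Psi> has_derivative (%v. snd (fd (\<phi> 1) (at (j w)) (Q1 v, Q2 v)))) (at w)"
    unfolding \<Psi>_def[abs_def]
    by (rule bounded_linear.has_derivative[OF bounded_linear_snd
       has_derivative_compose[OF jd smooth_on_has_derivative[OF \<phi>sm UNIV_I]]])
   from frechet_derivative_at[OF this] show ?thesis by metis
  qed
  have \<Psi>S: "\<Psi> w \<in> S'" if "w \<in> B" for w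
   using snd\<phi>[of "j w" 1] that by (simp add: \<Psi>_def B_def)
  have \<Psi>1: "fd \<Psi> (at w) v = \<kappa> *\<^sub>R \<beta> (\<Psi> w) v" if "w \<in> B" "Q1 v = v" for w v
   using key[of "j w" v] that by (simp add: \<Psi>d \<Psi>_def B_def Q2_def)
  have \<Psi>0: "\<Psi> 0 = x0"
   using still[of "j 0" 1] B0 by (simp add: \<Psi>_def B_def) (simp add: j_def linear_0[OF Q1l] linear_0[OF Q2l])
  have \<Psi>2: "fd \<Psi> (at 0) v = v" if "Q1 v = 0" for v
   using stilld[of "j 0" v] B0 that by (simp add: \<Psi>d B_def Q2_def) (simp add: j_def linear_0[OF Q1l])
  have \<Psi>lin: "linear (fd \<Psi> (at w))" for w
   using smooth_on_has_derivative[OF \<Psi>sm UNIV_I] has_derivative_linear by blast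
  have inj: "v = 0" if "fd \<Psi> (at 0) v = 0" for v
  proof -
   have "\<beta> x0 (Q1 v) = Q1 v" by (rule \<beta>_fix[OF x0S']) (simp add: Q1_def idem[OF S(2)])
   then have "\<kappa> *\<^sub>R Q1 v + Q2 v = 0"
    using that linear_add[OF \<Psi>lin, of 0 "Q1 v" "Q2 v"] \<Psi>1[OF B0, of "Q1 v"] \<Psi>2[of "Q2 v"] by (simp add: Q \<Psi>0)
   then have "Q1 (\<kappa> *\<^sub>R Q1 v + Q2 v) = 0" "Q2 (\<kappa> *\<^sub>R Q1 v + Q2 v) = 0"
    by (simp_all add: linear_0[OF Q1l] linear_0[OF Q2l])
   then have "Q1 v = 0" "Q2 v = 0"
    using \<kappa> by (simp_all add: linear_add[OF Q1l] linear_add[OF Q2l] linear_scale[OF Q1l] linear_scale[OF Q2l] Q)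
   then show "v = 0" using Q(5)[of v] by simp
  qed
  obtain U V g where U: "open U" "U \<subseteq> B" "0 \<in> U" "open V" and hom: "homeomorphism U V \<Psi> g" and gsm: "smooth_on V g"
   by (rule smooth_inverse_function[OF Bo smooth_on_subset[OF \<Psi>sm subset_UNIV] B0 inj]) blast
  have gU: "g x \<in> B" "\<Psi> (g x) = x" if "x \<in> V" for x using hom that U(2) by (auto simp: homeomorphism_def)
  have VS: "V \<subseteq> S'"
  proof
   fix x assume "x \<in> V"
   then show "x \<in> S'" using \<Psi>S[OF gU(1)] gU(2) by metis
  qed
  have \<Psi>U: "smooth_on U \<Psi>" using smooth_on_subset[OF \<Psi>sm] by auto
  note inv1 = frechet_derivative_inverse(1)[OF U(1) U(4) hom \<Psi>U gsm]
  have inv2: "fd g (at x) (fd \<Psi> (at (g x)) v) = v" if "x \<in> V" for x v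
   using frechet_derivative_inverse(2)[OF U(1) U(4) hom \<Psi>U gsm, of "g x" v] hom that
   by (auto simp: homeomorphism_def)
  \<comment> \<open>In the coordinates \<open>g\<close> the distribution becomes the constant range
    of \<open>Q1\<close>; the \<open>Q2\<close>-part is therefore the function that is constant
    along it.\<close>
  show thesis
  proof (rule that[of V "%x. Q2 (g x)"])
   show "open V" by fact
   show "x0 \<in> V" using hom U(3) \<Psi>0 by (auto simp: homeomorphism_def)
   show "V \<subseteq> S" using VS S'S by auto
   show "smooth_on V (%x. Q2 (g x))" by (rule smooth_on_bounded_linear[OF Q2b U(4) gsm])
   show "\<rho> x0 (Q2 (g x)) = 0" for x using Q(2) by (simp add: Q1_def)
   fix x v assume x: "x \<in> V"
   have gl: "linear (fd g (at x))"
    using smooth_on_has_derivative[OF gsm x] has_derivative_linear by blast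
   have "fd (%x. Q2 (g x)) (at x) v = Q2 (fd g (at x) v)"
    by (rule frechet_bounded_linear[OF Q2b smooth_on_differentiable[OF gsm x]])
   moreover have "Q2 (fd g (at x) v) = 0 \<longleftrightarrow> \<rho> x v = v"
   proof
    assume "Q2 (fd g (at x) v) = 0"
    then have "Q1 (fd g (at x) v) = fd g (at x) v" by (simp add: Q2_def)
    from \<Psi>1[OF gU(1)[OF x] this] have "v = \<beta> x (\<kappa> *\<^sub>R fd g (at x) v)"
     using x VS by (simp add: inv1 gU(2) linear_scale[OF \<beta>lin[OF subsetD[OF VS x]]])
    then show "\<rho> x v = v" using \<beta>E[OF subsetD[OF VS x]] by metis
   next
    assume v: "\<rho> x v = v"
    have xS': "x \<in> S'" using x VS by auto
    have "\<beta> x (Q1 v) = \<beta> x v" unfolding \<beta>_def by (simp add: Q)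
    then have "fd \<Psi> (at (g x)) (Q1 v) = \<kappa> *\<^sub>R v"
     using \<Psi>1[OF gU(1)[OF x], of "Q1 v"] \<beta>_fix[OF xS' v] by (simp add: Q gU(2)[OF x])
    then have "\<kappa> *\<^sub>R fd g (at x) v = Q1 v"
     using inv2[OF x, of "Q1 v"] by (simp add: linear_scale[OF gl])
    then have "Q2 (\<kappa> *\<^sub>R fd g (at x) v) = 0" by (simp add: Q)
    then show "Q2 (fd g (at x) v) = 0" using \<kappa> by (simp add: linear_scale[OF Q2l])
   qed
   ultimately show "fd (%x. Q2 (g x)) (at x) v = 0 \<longleftrightarrow> \<rho> x v = v" by simp
  qed
 qed
qed

section \<open>Charts and parametrizations\<close>

lemma top_chartD:
 assumes "top_chart M U c"
 shows "openin (mtop M) U" "open (c ` U)" "inj_on c U" "U \<subseteq> points M"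
  and "openin (mtop M) O' ==> open (c ` (U \<inter> O'))"
  and "open T ==> openin (mtop M) {q \<in> U. c q \<in> T}"
proof -
 show U: "openin (mtop M) U" and V: "open (c ` U)" using assms by (auto simp: top_chart_def)
 show Up: "U \<subseteq> points M" using U openin_subset by blast
 have "homeomorphic_map (subtopology (mtop M) U) (top_of_set (c ` U)) c"
  using assms by (auto simp: top_chart_def)
 then have h: "continuous_map (subtopology (mtop M) U) (top_of_set (c ` U)) c"
  "open_map (subtopology (mtop M) U) (top_of_set (c ` U)) c"
  "inj_on c (points M \<inter> U)"
  by (auto simp: homeomorphic_eq_everything_map)
 show "inj_on c U" using h(3) Up by (simp add: Int_absorb1)
 show "open (c ` (U \<inter> O'))" if "openin (mtop M) O'"
 proof -
  have "openin (subtopology (mtop M) U) (U \<inter> O')"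
   using that by (auto simp: openin_subtopology)
  then have "openin (top_of_set (c ` U)) (c ` (U \<inter> O'))" using h(2) by (simp add: open_map_def)
  then show ?thesis using V openin_open_eq by blast
 qed
 show "openin (mtop M) {q \<in> U. c q \<in> T}" if "open T"
 proof -
  have "openin (top_of_set (c ` U)) (c ` U \<inter> T)" using that by (simp add: openin_open_Int)
  then have "openin (subtopology (mtop M) U) {q \<in> topspace (subtopology (mtop M) U). c q \<in> c ` U \<inter> T}"
   using openin_continuous_map_preimage[OF h(1)] by blast
  moreover have "{q \<in> topspace (subtopology (mtop M) U). c q \<in> c ` U \<inter> T} = {q \<in> U. c q \<in> T}"
   using Up by auto
  ultimately have "openin (subtopology (mtop M) U) {q \<in> U. c q \<in> T}" by simp
  then show ?thesis using U by (simp add: openin_open_subtopology)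
 qed
qed

lemma smooth_manifoldD:
 assumes "smooth_manifold M" "p \<in> points M"
 shows "(cdom M p, cmap M p) \<in> atlas M" "p \<in> cdom M p"
proof -
 have "p \<in> (\<Union>(U, c) \<in> atlas M. U)" using assms by (auto simp: smooth_manifold_def)
 then have "\<exists>C. C \<in> atlas M \<and> p \<in> fst C" by force
 from someI_ex[OF this] show "(cdom M p, cmap M p) \<in> atlas M" "p \<in> cdom M p"
  by (auto simp: cdom_def cmap_def pchart_def)
qed

lemma smooth_chart_pchart:
 assumes "smooth_manifold M" "p \<in> points M"
 shows "smooth_chart M (cdom M p) (cmap M p)"
 using assms smooth_manifoldD(1)[OF assms] unfolding smooth_chart_def smooth_manifold_def by fast

text \<open>A parametrization is the inverse \<open>F\<close> of a chart \<open>c\<close> with image \<open>W\<close>.\<close>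

definition param :: "('a, 'e::euclidean_space, 'z) manifold_scheme => 'e set => ('e => 'a) => ('a => 'e) => bool" where
 "param M W F c \<longleftrightarrow> open W \<and> (\<forall>x\<in>W. c (F x) = x) \<and> smooth_chart M (F ` W) c"

lemma param_of_chart:
 assumes "smooth_chart M U c"
 shows "param M (c ` U) (the_inv_into U c) c"
proof -
 have i: "inj_on c U" and o: "open (c ` U)"
  using assms top_chartD unfolding smooth_chart_def by blast+
 moreover have "the_inv_into U c ` (c ` U) = U"
  using i by (force simp: image_image the_inv_into_f_f)
 ultimately show ?thesis using assms unfolding param_def by (auto simp: the_inv_into_f_f)
qed

lemma param_cinv:
 assumes "smooth_manifold M" "p \<in> points M"
 shows "param M (cmap M p ` cdom M p) (cinv M p) (cmap M p)"
  and "q \<in> cdom M p ==> cinv M p (cmap M p q) = q" "cinv M p ` (cmap M p ` cdom M p) = cdom M p"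
proof -
 have s: "smooth_chart M (cdom M p) (cmap M p)" by (rule smooth_chart_pchart[OF assms])
 then have i: "inj_on (cmap M p) (cdom M p)"
  using top_chartD(3) unfolding smooth_chart_def by blast
 show "param M (cmap M p ` cdom M p) (cinv M p) (cmap M p)"
  unfolding cinv_def by (rule param_of_chart[OF s])
 show "q \<in> cdom M p ==> cinv M p (cmap M p q) = q"
  unfolding cinv_def by (rule the_inv_into_f_f[OF i])
 then show "cinv M p ` (cmap M p ` cdom M p) = cdom M p"
  unfolding cinv_def using i by (force simp: image_image the_inv_into_f_f)
qed

context
 fixes M :: "('a, 'e::euclidean_space, 'z) manifold_scheme"
 assumes M: "smooth_manifold M"
begin

lemma cdomD:
 assumes "p \<in> points M"
 shows "p \<in> cdom M p" "openin (mtop M) (cdom M p)" "cdom M p \<subseteq> points M"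
  "open (cmap M p ` cdom M p)"
 using smooth_manifoldD(2)[OF M assms] smooth_chart_pchart[OF M assms] top_chartD[of M "cdom M p" "cmap M p"]
 unfolding smooth_chart_def by auto

lemma paramD:
 assumes P: "param M W F c"
 shows "open W" "x \<in> W ==> c (F x) = x" "inj_on F W" "x \<in> W ==> F x \<in> points M"
  and "open T ==> T \<subseteq> W ==> openin (mtop M) (F ` T)"
  and "openin (mtop M) O' ==> open {x \<in> W. F x \<in> O'}"
  and "q \<in> F ` W ==> F (c q) = q" "q \<in> F ` W ==> c q \<in> W"
proof -
 have t: "top_chart M (F ` W) c" using P by (auto simp: param_def smooth_chart_def)
 show "open W" and c: "x \<in> W ==> c (F x) = x" for x using P by (auto simp: param_def)
 show "inj_on F W" by (metis c inj_onI)
 show "x \<in> W ==> F x \<in> points M" using top_chartD(4)[OF t] by auto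
 show "openin (mtop M) (F ` T)" if "open T" "T \<subseteq> W"
 proof -
  have "{q \<in> F ` W. c q \<in> T} = F ` T" using that c by (auto simp: subset_iff image_iff)
  then show ?thesis using top_chartD(6)[OF t that(1)] by simp
 qed
 show "open {x \<in> W. F x \<in> O'}" if "openin (mtop M) O'"
 proof -
  have "c ` (F ` W \<inter> O') = {x \<in> W. F x \<in> O'}" using c by force
  then show ?thesis using top_chartD(5)[OF t that] by simp
 qed
 show "q \<in> F ` W ==> F (c q) = q" "q \<in> F ` W ==> c q \<in> W" using c by auto
qed

lemma param_smooth:
 assumes P: "param M W F c" and a: "a \<in> points M"
 shows "smooth_on {x \<in> W. F x \<in> cdom M a} (%x. cmap M a (F x))"
  and "smooth_on {y \<in> cmap M a ` cdom M a. cinv M a y \<in> F ` W} (%y. c (cinv M a y))"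
  and "open {x \<in> W. F x \<in> cdom M a}" "open {y \<in> cmap M a ` cdom M a. cinv M a y \<in> F ` W}"
proof -
 have comp: "compatible_charts (F ` W) c (cdom M a) (cmap M a)"
  using P smooth_manifoldD(1)[OF M a] by (auto simp: param_def smooth_chart_def)
 have c: "c (F x) = x" if "x \<in> W" for x using paramD(2)[OF P that] .
 have ti: "the_inv_into (F ` W) c x = F x" if "x \<in> W" for x
  using P that c top_chartD(3) unfolding param_def smooth_chart_def
  by (intro the_inv_into_f_eq) auto
 show o1: "open {x \<in> W. F x \<in> cdom M a}" by (rule paramD(6)[OF P cdomD(2)[OF a]])
 have FW: "openin (mtop M) (F ` W)" using paramD(5)[OF P paramD(1)[OF P]] by simp
 note Pa = param_cinv[OF M a]
 show o2: "open {y \<in> cmap M a ` cdom M a. cinv M a y \<in> F ` W}" by (rule paramD(6)[OF Pa(1) FW])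
 have e1: "c ` (F ` W \<inter> cdom M a) = {x \<in> W. F x \<in> cdom M a}" using c by force
 have e2: "cmap M a ` (F ` W \<inter> cdom M a) = {y \<in> cmap M a ` cdom M a. cinv M a y \<in> F ` W}"
  using Pa(2) by (auto simp: image_iff)
 have "smooth_on {x \<in> W. F x \<in> cdom M a} (cmap M a \<circ> the_inv_into (F ` W) c)"
  using comp e1 by (simp add: compatible_charts_def)
 then show "smooth_on {x \<in> W. F x \<in> cdom M a} (%x. cmap M a (F x))"
  by (rule smooth_on_cong[OF o1, rotated]) (simp add: ti)
 show "smooth_on {y \<in> cmap M a ` cdom M a. cinv M a y \<in> F ` W} (%y. c (cinv M a y))"
  using comp e2 by (simp add: compatible_charts_def cinv_def o_def)
qed

lemma param_subset:
 assumes P: "param M W F c" and W': "open W'" "W' \<subseteq> W"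
 shows "param M W' F c"
proof -
 have t: "top_chart M (F ` W) c" using P by (auto simp: param_def smooth_chart_def)
 have c: "c (F x) = x" if "x \<in> W" for x using paramD(2)[OF P that] .
 have sub: "F ` W' \<subseteq> F ` W" using W' by auto
 have cW': "c ` F ` W' = W'" using c W'(2) by (force simp: image_image)
 have "homeomorphic_map (subtopology (mtop M) (F ` W)) (top_of_set (c ` F ` W)) c"
  using t by (simp add: top_chart_def)
 moreover have "c ` (topspace (subtopology (mtop M) (F ` W)) \<inter> F ` W') = topspace (top_of_set (c ` F ` W)) \<inter> c ` F ` W'"
 proof -
  have "points M \<inter> F ` W = F ` W" using top_chartD(4)[OF t] by (simp add: Int_absorb1)
  then show ?thesis using sub by (simp add: Int_absorb1 Int_absorb2 image_mono)
 qed
 ultimately have "homeomorphic_map (subtopology (subtopology (mtop M) (F ` W)) (F ` W')) (subtopology (top_of_set (c ` F ` W)) (c ` F ` W')) c"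
  by (rule homeomorphic_map_subtopologies)
 then have "homeomorphic_map (subtopology (mtop M) (F ` W')) (top_of_set (c ` F ` W')) c"
  using sub by (simp add: subtopology_subtopology Int_absorb1 image_mono)
 moreover have "openin (mtop M) (F ` W')" by (rule paramD(5)[OF P W'])
 ultimately have t': "top_chart M (F ` W') c" using cW' W'(1) by (simp add: top_chart_def)
 have ti: "the_inv_into (F ` V) c x = F x" if "x \<in> V" "V \<subseteq> W" for x V
  by (rule the_inv_into_f_eq[OF inj_on_subset[OF top_chartD(3)[OF t] image_mono[OF that(2)]]])
   (use that c in auto)
 have "compatible_charts (F ` W') c V d" if Vd: "(V, d) \<in> atlas M" for V d
 proof -
  have comp: "compatible_charts (F ` W) c V d" using P Vd by (auto simp: param_def smooth_chart_def)
  have tV: "top_chart M V d" using M Vd unfolding smooth_manifold_def by fast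
  have op: "open (c ` (F ` W' \<inter> V))" by (rule top_chartD(5)[OF t' top_chartD(1)[OF tV]])
  have "smooth_on (c ` (F ` W' \<inter> V)) (d \<circ> the_inv_into (F ` W) c)"
   by (rule smooth_on_subset[of "c ` (F ` W \<inter> V)"]) (use comp sub in \<open>auto simp: compatible_charts_def\<close>)
  then have "smooth_on (c ` (F ` W' \<inter> V)) (d \<circ> the_inv_into (F ` W') c)"
   by (rule smooth_on_cong[OF op, rotated]) (use W'(2) ti c in \<open>auto simp: subset_iff\<close>)
  moreover have "smooth_on (d ` (F ` W' \<inter> V)) (c \<circ> the_inv_into V d)"
   by (rule smooth_on_subset[of "d ` (F ` W \<inter> V)"]) (use comp sub in \<open>auto simp: compatible_charts_def\<close>)
  ultimately show ?thesis by (simp add: compatible_charts_def)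
 qed
 with t' show ?thesis using W' c by (auto simp: param_def smooth_chart_def)
qed

lemma param_reparam:
 assumes P: "param M W F c" and U: "open U" "U \<subseteq> W" "open V" and hom: "homeomorphism U V h g"
  and sm: "smooth_on U h" "smooth_on V g"
 shows "param M V (%y. F (g y)) (%q. h (c q))"
proof -
 have hg: "h x \<in> V" "g (h x) = x" if "x \<in> U" for x using hom that by (auto simp: homeomorphism_def)
 have gh: "g y \<in> U" "h (g y) = y" if "y \<in> V" for y using hom that by (auto simp: homeomorphism_def)
 have gV: "g ` V = U" using hom by (simp add: homeomorphism_def)
 have P': "param M U F c" by (rule param_subset[OF P U(1,2)])
 note c = paramD(2)[OF P']
 have FU: "(%y. F (g y)) ` V = F ` U" using gV by (metis image_image)
 have t: "top_chart M (F ` U) c" using P' by (auto simp: param_def smooth_chart_def)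
 have cU: "c ` F ` U = U" using c by (force simp: image_image)
 have hU: "h ` U = V" using hom by (simp add: homeomorphism_def)
 have "homeomorphic_map (top_of_set U) (top_of_set V) h"
 proof -
  have "homeomorphic_maps (top_of_set U) (top_of_set V) h g"
   using hom unfolding homeomorphic_maps_def homeomorphism_def
   by (auto simp: continuous_map_in_subtopology)
  then show ?thesis using homeomorphic_map_maps by blast
 qed
 then have "homeomorphic_map (subtopology (mtop M) (F ` U)) (top_of_set V) (h \<circ> c)"
  using t cU homeomorphic_map_compose unfolding top_chart_def by metis
 moreover have "(h \<circ> c) ` F ` U = V" using cU hU by (simp only: image_comp[symmetric])
 ultimately have t': "top_chart M (F ` U) (h \<circ> c)"
  using t U(3) by (simp add: top_chart_def)
 have c': "(h \<circ> c) q = (h \<circ> c) q' ==> q = q'" if "q \<in> F ` U" "q' \<in> F ` U" for q q'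
  using top_chartD(3)[OF t'] that by (meson inj_on_def)
 have ti: "the_inv_into (F ` U) (h \<circ> c) y = F (g y)" if "y \<in> V" for y
  using that gh c top_chartD(3)[OF t'] by (intro the_inv_into_f_eq) auto
 have "compatible_charts (F ` U) (h \<circ> c) V' d" if Vd: "(V', d) \<in> atlas M" for V' d
 proof -
  have comp: "compatible_charts (F ` U) c V' d" using P' Vd by (auto simp: param_def smooth_chart_def)
  have tV: "top_chart M V' d" using M Vd unfolding smooth_manifold_def by fast
  have o1: "open ((h \<circ> c) ` (F ` U \<inter> V'))" by (rule top_chartD(5)[OF t' top_chartD(1)[OF tV]])
  have o2: "open (c ` (F ` U \<inter> V'))" by (rule top_chartD(5)[OF t top_chartD(1)[OF tV]])
  have sub1: "(h \<circ> c) ` (F ` U \<inter> V') \<subseteq> V" using c hg by auto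
  have "smooth_on ((h \<circ> c) ` (F ` U \<inter> V')) (%y. (d \<circ> the_inv_into (F ` U) c) (g y))"
  proof (rule smooth_on_compose[where f=g and g="d \<circ> the_inv_into (F ` U) c", OF o1 o2])
   show "g ` (h \<circ> c) ` (F ` U \<inter> V') \<subseteq> c ` (F ` U \<inter> V')"
   proof
    fix z assume "z \<in> g ` (h \<circ> c) ` (F ` U \<inter> V')"
    then obtain u where u: "u \<in> U" "F u \<in> V'" "z = g (h (c (F u)))" by auto
    then have "z = c (F u)" using c hg by simp
    then show "z \<in> c ` (F ` U \<inter> V')" using u by blast
   qed
   show "smooth_on ((h \<circ> c) ` (F ` U \<inter> V')) g" by (rule smooth_on_subset[OF sm(2) sub1])
   show "smooth_on (c ` (F ` U \<inter> V')) (d \<circ> the_inv_into (F ` U) c)" using comp by (simp add: compatible_charts_def)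
  qed
  then have 1: "smooth_on ((h \<circ> c) ` (F ` U \<inter> V')) (d \<circ> the_inv_into (F ` U) (h \<circ> c))"
  proof (rule smooth_on_cong[OF o1, rotated])
   fix y assume "y \<in> (h \<circ> c) ` (F ` U \<inter> V')"
   then have "y \<in> V" using sub1 by blast
   moreover have "the_inv_into (F ` U) c (g y) = F (g y)"
    using gh(1)[OF \<open>y \<in> V\<close>] c top_chartD(3)[OF t] by (intro the_inv_into_f_eq) auto
   ultimately show "(d \<circ> the_inv_into (F ` U) c) (g y) = (d \<circ> the_inv_into (F ` U) (h \<circ> c)) y"
    using ti by simp
  qed
  have o3: "open (d ` (F ` U \<inter> V'))"
   using top_chartD(5)[OF tV top_chartD(1)[OF t]] by (simp add: Int_commute)
  have "smooth_on (d ` (F ` U \<inter> V')) (%y. h ((c \<circ> the_inv_into V' d) y))"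
  proof (rule smooth_on_compose[where f="c \<circ> the_inv_into V' d" and g=h, OF o3 U(1) _ _ sm(1)])
   show "smooth_on (d ` (F ` U \<inter> V')) (c \<circ> the_inv_into V' d)" using comp by (simp add: compatible_charts_def)
   show "(c \<circ> the_inv_into V' d) ` d ` (F ` U \<inter> V') \<subseteq> U"
    using c by (auto simp: the_inv_into_f_f[OF top_chartD(3)[OF tV]])
  qed
  with 1 show ?thesis by (simp add: compatible_charts_def o_def)
 qed
 with t' have "smooth_chart M (F ` U) (h \<circ> c)" by (auto simp: smooth_chart_def)
 then show ?thesis unfolding param_def FU using U(3) gh c by (auto simp: o_def)
qed

lemma coord_nbhd_preimage:
 assumes p: "p \<in> O'" and O': "openin (mtop M) O'"
 shows "coord_nbhd M O' p {y \<in> cmap M p ` cdom M p. cinv M p y \<in> O'}"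
proof -
 have pp: "p \<in> points M" using p O' openin_subset by blast
 note P = param_cinv[OF M pp]
 show ?thesis unfolding coord_nbhd_def
  using paramD(6)[OF P(1) O'] P(2) p cdomD(1)[OF pp] by (auto simp: image_iff)
qed

text \<open>The definitions differentiate in the preferred chart of the point itself. This chain
  rule is the passage from there to an arbitrary parametrization, in which all later computations
  are made.\<close>

lemma pref_chain:
 assumes P: "param M W F c" and x: "x \<in> W"
  and h: "(%y. h (cinv M (F x) y)) differentiable (at (cmap M (F x) (F x)))"
 shows "fd (%y. h (F y)) (at x) v = fd (%y. h (cinv M (F x) y))
   (at (cmap M (F x) (F x))) (fd (%y. cmap M (F x) (F y)) (at x) v)"
  and "(%y. h (F y)) differentiable (at x)"
proof -
 have q: "F x \<in> points M" by (rule paramD(4)[OF P x])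
 let ?T = "{y \<in> W. F y \<in> cdom M (F x)}"
 have T: "open ?T" "x \<in> ?T" using param_smooth(3)[OF P q] x cdomD(1)[OF q] by auto
 have d: "(%y. cmap M (F x) (F y)) differentiable (at x)"
  by (rule smooth_on_differentiable[OF param_smooth(1)[OF P q] T(2)])
 note ch = frechet_chain[OF d, of "%y. h (cinv M (F x) y)", OF h]
 have e: "h (cinv M (F x) (cmap M (F x) (F y))) = h (F y)" if "y \<in> ?T" for y
  using param_cinv(2)[OF M q, of "F y"] that by simp
 show "fd (%y. h (F y)) (at x) v = fd (%y. h (cinv M (F x) y))
   (at (cmap M (F x) (F x))) (fd (%y. cmap M (F x) (F y)) (at x) v)"
  using ch(1)[of v] frechet_derivative_cong_open(1)[OF T e] by simp
 show "(%y. h (F y)) differentiable (at x)"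
  using ch(2) frechet_derivative_cong_open(2)[OF T e] by simp
qed

lemma pref_diff:
 assumes P: "param M W F c" and x: "x \<in> W" and h: "(%y. h (F y)) differentiable (at x)"
 shows "(%y. h (cinv M (F x) y)) differentiable (at (cmap M (F x) (F x)))"
proof -
 have q: "F x \<in> points M" by (rule paramD(4)[OF P x])
 let ?T = "{y \<in> cmap M (F x) ` cdom M (F x). cinv M (F x) y \<in> F ` W}"
 have T: "open ?T" "cmap M (F x) (F x) \<in> ?T"
  using param_smooth(4)[OF P q] x cdomD(1)[OF q] param_cinv(2)[OF M q] by auto
 have d: "(%y. c (cinv M (F x) y)) differentiable (at (cmap M (F x) (F x)))"
  by (rule smooth_on_differentiable[OF param_smooth(2)[OF P q] T(2)])
 have cx: "c (cinv M (F x) (cmap M (F x) (F x))) = x"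
  using param_cinv(2)[OF M q cdomD(1)[OF q]] paramD(2)[OF P x] by simp
 have "(%y. h (F (c (cinv M (F x) y)))) differentiable (at (cmap M (F x) (F x)))"
  by (rule frechet_chain(2)[OF d, of "%y. h (F y)"]) (simp add: cx h)
 moreover have "h (F (c (cinv M (F x) y))) = h (cinv M (F x) y)" if "y \<in> ?T" for y
  using that paramD(7)[OF P] by simp
 ultimately show ?thesis using frechet_derivative_cong_open(2)[OF T] by (metis (mono_tags, lifting))
qed

text \<open>The differential of \<open>F\<close>, with tangent vectors at \<open>F x\<close> encoded
  by the preferred chart of that point.\<close>

definition dpar :: "('e => 'a) => 'e => 'e => 'e" where
 "dpar F x v = fd (%y. cmap M (F x) (F y)) (at x) v"

lemma dpar_bij:
 assumes P: "param M W F c" and x: "x \<in> W"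
 shows "linear (dpar F x)" "bij (dpar F x)"
proof -
 have q: "F x \<in> points M" by (rule paramD(4)[OF P x])
 let ?T = "{y \<in> W. F y \<in> cdom M (F x)}"
 have T: "open ?T" "x \<in> ?T" using param_smooth(3)[OF P q] x cdomD(1)[OF q] by auto
 show l: "linear (dpar F x)" unfolding dpar_def[abs_def]
  using smooth_on_has_derivative[OF param_smooth(1)[OF P q] T(2)] has_derivative_linear by blast
 have d: "(%y. c (cinv M (F x) y)) differentiable (at (cmap M (F x) (F x)))"
  using pref_diff[OF P x, of c] frechet_derivative_cong_open(2)[OF paramD(1)[OF P] x, of "%y. c (F y)" "%y. y"] paramD(2)[OF P] by auto
 have "fd (%y. c (F y)) (at x) = (%v. v)"
  using frechet_derivative_cong_open(1)[OF paramD(1)[OF P] x, of "%y. c (F y)" "%y. y"] paramD(2)[OF P] by simp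
 then have e: "fd (%y. c (cinv M (F x) y)) (at (cmap M (F x) (F x))) (dpar F x v) = v" for v
  using pref_chain(1)[OF P x d, of v] by (simp add: dpar_def)
 have dl: "linear (fd (%y. c (cinv M (F x) y)) (at (cmap M (F x) (F x))))"
  using d frechet_derivative_works has_derivative_linear by blast
 show "bij (dpar F x)"
  by (rule linear_bij_of_inj[OF l]) (metis e linear_0[OF dl])
qed

lemma fderiv_param:
 assumes P: "param M W F c" and x: "x \<in> W" and f: "(%y. f (F y)) differentiable (at x)"
 shows "fderiv M f (F x) (dpar F x v) = fd (%y. f (F y)) (at x) v"
 using pref_chain(1)[OF P x pref_diff[OF P x f]] by (simp add: fderiv_def dpar_def o_def)

lemma smooth_fun_param:
 assumes P: "param M W F c" and O': "openin (mtop M) O'"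
 shows "smooth_fun M O' f ==> smooth_on {x \<in> W. F x \<in> O'} (%x. f (F x))"
  and "smooth_on W (%x. f (F x)) ==> smooth_fun M (F ` W) f"
proof -
 show "smooth_on {x \<in> W. F x \<in> O'} (%x. f (F x))" if sf: "smooth_fun M O' f"
 proof (rule smooth_on_local)
  fix x assume "x \<in> {x \<in> W. F x \<in> O'}"
  then have x: "x \<in> W" "F x \<in> O'" by auto
  have q: "F x \<in> points M" by (rule paramD(4)[OF P x(1)])
  obtain S where S: "open S" "cmap M (F x) (F x) \<in> S" "S \<subseteq> cmap M (F x) ` (O' \<inter> cdom M (F x))"
    "smooth_on S (f \<circ> cinv M (F x))"
   using sf x(2) unfolding smooth_fun_def coord_nbhd_def by blast
  let ?T = "{y \<in> W. F y \<in> cdom M (F x)}"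
  have To: "open ?T" "smooth_on ?T (%y. cmap M (F x) (F y))" by (rule param_smooth[OF P q])+
  let ?T' = "?T \<inter> (%y. cmap M (F x) (F y)) -` S"
  have T': "open ?T'" using continuous_open_preimage[OF smooth_on_continuous[OF To(2)] To(1) S(1)] .
  have "smooth_on ?T' (%y. (f \<circ> cinv M (F x)) (cmap M (F x) (F y)))"
   by (rule smooth_on_compose[OF T' S(1) _ smooth_on_subset[OF To(2)] S(4)]) auto
  then have "smooth_on ?T' (%y. f (F y))"
   by (rule smooth_on_cong[OF T', rotated]) (simp add: param_cinv(2)[OF M q])
  moreover have "x \<in> ?T'" using x S(2) cdomD(1)[OF q] by auto
  ultimately show "\<exists>T. open T \<and> x \<in> T \<and> smooth_on T (%x. f (F x))" using T' by blast
 qed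
 show "smooth_fun M (F ` W) f" if sm: "smooth_on W (%x. f (F x))"
  unfolding smooth_fun_def
 proof
  fix p assume p: "p \<in> F ` W"
  then have q: "p \<in> points M" using paramD(4)[OF P] by auto
  have FW: "openin (mtop M) (F ` W)" using paramD(5)[OF P paramD(1)[OF P]] by simp
  let ?S = "{y \<in> cmap M p ` cdom M p. cinv M p y \<in> F ` W}"
  have "smooth_on ?S (%y. f (F (c (cinv M p y))))"
   by (rule smooth_on_compose[OF param_smooth(4)[OF P q] paramD(1)[OF P] _ param_smooth(2)[OF P q] sm])
    (use paramD(8)[OF P] in auto)
  then have "smooth_on ?S (f \<circ> cinv M p)"
   by (rule smooth_on_cong[OF param_smooth(4)[OF P q], rotated]) (simp add: paramD(7)[OF P])
  with coord_nbhd_preimage[OF p FW] show "\<exists>S. coord_nbhd M (F ` W) p S \<and> smooth_on S (f \<circ> cinv M p)" by blast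
 qed
qed

end

section \<open>Smooth maps and vector fields in charts\<close>

lemma open_near: "(\<And>x. x \<in> S ==> \<exists>T. open T \<and> x \<in> T \<and> T \<subseteq> S) ==> open S"
 by (subst open_subopen) blast

context
 fixes N :: "('b, 'm::euclidean_space, 'y) manifold_scheme"
  and M :: "('a, 'e::euclidean_space, 'z) manifold_scheme"
 assumes N: "smooth_manifold N" and M: "smooth_manifold M"
begin

text \<open>The neighbourhoods provided by \<open>smooth_map\<close> live in the preferred chart of
  \<open>F x\<close>; they are pulled back to the parameter domain along the transition map.\<close>

lemma smooth_map_near:
 assumes P: "param N W F c" and h: "smooth_map N M O' h" and x: "x \<in> W" "F x \<in> O'"
 obtains T where "open T" "x \<in> T" "T \<subseteq> W" "\<And>y. y \<in> T ==> F y \<in> O'" "\<And>y. y \<in> T ==> h (F y) \<in> cdom M (h (F x))"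
  "smooth_on T (%y. cmap M (h (F x)) (h (F y)))"
proof -
 have q: "F x \<in> points N" by (rule paramD(4)[OF N P x(1)])
 obtain S where S: "open S" "cmap N (F x) (F x) \<in> S"
  "S \<subseteq> cmap N (F x) ` (O' \<inter> h -` cdom M (h (F x)) \<inter> cdom N (F x))"
  "smooth_on S (cmap M (h (F x)) \<circ> h \<circ> cinv N (F x))"
  using h x(2) unfolding smooth_map_def coord_nbhd_def by blast
 let ?T = "{y \<in> W. F y \<in> cdom N (F x)}"
 have To: "open ?T" "smooth_on ?T (%y. cmap N (F x) (F y))" by (rule param_smooth[OF N P q])+
 let ?T' = "?T \<inter> (%y. cmap N (F x) (F y)) -` S"
 have T': "open ?T'" using continuous_open_preimage[OF smooth_on_continuous[OF To(2)] To(1) S(1)] .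
 have in_S: "F y \<in> O' \<and> h (F y) \<in> cdom M (h (F x))" if "y \<in> ?T'" for y
 proof -
  have "cmap N (F x) (F y) \<in> cmap N (F x) ` (O' \<inter> h -` cdom M (h (F x)) \<inter> cdom N (F x))" using that S(3) by auto
  then obtain q' where q': "q' \<in> O'" "h q' \<in> cdom M (h (F x))" "q' \<in> cdom N (F x)" "cmap N (F x) (F y) = cmap N (F x) q'" by auto
  have "F y = q'" using q'(3,4) that param_cinv(2)[OF N q, of q'] param_cinv(2)[OF N q, of "F y"] by auto
  then show ?thesis using q' by simp
 qed
 have "smooth_on ?T' (%y. (cmap M (h (F x)) \<circ> h \<circ> cinv N (F x)) (cmap N (F x) (F y)))"
  by (rule smooth_on_compose[OF T' S(1) _ smooth_on_subset[OF To(2)] S(4)]) auto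
 then have "smooth_on ?T' (%y. cmap M (h (F x)) (h (F y)))"
  by (rule smooth_on_cong[OF T', rotated]) (simp add: param_cinv(2)[OF N q])
 moreover have "x \<in> ?T'" using x S(2) cdomD(1)[OF N q] by auto
 ultimately show ?thesis using that[of ?T'] T' in_S by blast
qed

lemma smooth_map_points: "smooth_map N M O' h ==> q \<in> O' ==> h q \<in> points M"
 by (simp add: smooth_map_def)

lemma smooth_map_open:
 assumes P: "param N W F c" and h: "smooth_map N M O' h" and V: "openin (mtop M) V"
 shows "open {x \<in> W. F x \<in> O' \<and> h (F x) \<in> V}"
proof (rule open_near)
 fix x assume "x \<in> {x \<in> W. F x \<in> O' \<and> h (F x) \<in> V}"
 then have x: "x \<in> W" "F x \<in> O'" "h (F x) \<in> V" by auto
 have hp: "h (F x) \<in> points M" by (rule smooth_map_points[OF h x(2)])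
 obtain T where T: "open T" "x \<in> T" "T \<subseteq> W" "\<And>y. y \<in> T ==> F y \<in> O'" "\<And>y. y \<in> T ==> h (F y) \<in> cdom M (h (F x))"
  "smooth_on T (%y. cmap M (h (F x)) (h (F y)))" by (rule smooth_map_near[OF P h x(1,2)]) blast
 let ?V = "{z \<in> cmap M (h (F x)) ` cdom M (h (F x)). cinv M (h (F x)) z \<in> V}"
 have "open ?V" by (rule paramD(6)[OF M param_cinv(1)[OF M hp] V])
 from continuous_open_preimage[OF smooth_on_continuous[OF T(6)] T(1) this]
 have "open (T \<inter> (%y. cmap M (h (F x)) (h (F y))) -` ?V)" .
 moreover have "x \<in> T \<inter> (%y. cmap M (h (F x)) (h (F y))) -` ?V"
  using T(2) T(5)[OF T(2)] x(3) param_cinv(2)[OF M hp] by auto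
 moreover have "T \<inter> (%y. cmap M (h (F x)) (h (F y))) -` ?V \<subseteq> {x \<in> W. F x \<in> O' \<and> h (F x) \<in> V}"
 proof
  fix y assume y: "y \<in> T \<inter> (%y. cmap M (h (F x)) (h (F y))) -` ?V"
  then have "cinv M (h (F x)) (cmap M (h (F x)) (h (F y))) \<in> V" by simp
  then have "h (F y) \<in> V" using param_cinv(2)[OF M hp T(5)] y by simp
  then show "y \<in> {x \<in> W. F x \<in> O' \<and> h (F x) \<in> V}" using T(3,4) y by auto
 qed
 ultimately show "\<exists>T. open T \<and> x \<in> T \<and> T \<subseteq> {x \<in> W. F x \<in> O' \<and> h (F x) \<in> V}" by blast
qed

lemma smooth_map_param:
 assumes P: "param N W F c" and P2: "param M W2 F2 c2" and h: "smooth_map N M O' h"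
 shows "smooth_on {x \<in> W. F x \<in> O' \<and> h (F x) \<in> F2 ` W2} (%x. c2 (h (F x)))"
proof (rule smooth_on_local)
 fix x assume "x \<in> {x \<in> W. F x \<in> O' \<and> h (F x) \<in> F2 ` W2}"
 then have x: "x \<in> W" "F x \<in> O'" "h (F x) \<in> F2 ` W2" by auto
 have hp: "h (F x) \<in> points M" by (rule smooth_map_points[OF h x(2)])
 obtain T where T: "open T" "x \<in> T" "T \<subseteq> W" "\<And>y. y \<in> T ==> F y \<in> O'" "\<And>y. y \<in> T ==> h (F y) \<in> cdom M (h (F x))"
  "smooth_on T (%y. cmap M (h (F x)) (h (F y)))" by (rule smooth_map_near[OF P h x(1,2)]) blast
 let ?V = "{z \<in> cmap M (h (F x)) ` cdom M (h (F x)). cinv M (h (F x)) z \<in> F2 ` W2}"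
 note V = param_smooth(4,2)[OF M P2 hp]
 let ?T = "T \<inter> (%y. cmap M (h (F x)) (h (F y))) -` ?V"
 have To: "open ?T" by (rule continuous_open_preimage[OF smooth_on_continuous[OF T(6)] T(1) V(1)])
 have "smooth_on ?T (%y. c2 (cinv M (h (F x)) (cmap M (h (F x)) (h (F y)))))"
  by (rule smooth_on_compose[OF To V(1) _ smooth_on_subset[OF T(6)] V(2)]) auto
 then have "smooth_on ?T (%y. c2 (h (F y)))"
  by (rule smooth_on_cong[OF To, rotated]) (use T(5) param_cinv(2)[OF M hp] in auto)
 moreover have "x \<in> ?T" using T(2) T(5)[OF T(2)] x(3) param_cinv(2)[OF M hp] by auto
 ultimately show "\<exists>T. open T \<and> x \<in> T \<and> smooth_on T (%x. c2 (h (F x)))" using To by blast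
qed

lemma smooth_map_base:
 assumes P: "param N W F c" and h: "smooth_map N M O' h" and b: "b \<in> points M"
 shows "smooth_on {x \<in> W. F x \<in> O' \<and> h (F x) \<in> cdom M b} (%x. cmap M b (h (F x)))"
  "open {x \<in> W. F x \<in> O' \<and> h (F x) \<in> cdom M b}"
 using smooth_map_param[OF P param_cinv(1)[OF M b] h] param_cinv(3)[OF M b]
  smooth_map_open[OF P h cdomD(2)[OF M b]] by simp_all

lemma smooth_mapI:
 assumes P: "param N W F c" and P2: "param M W2 F2 c2"
  and hin: "\<And>x. x \<in> W ==> h (F x) \<in> F2 ` W2" and sm: "smooth_on W (%x. c2 (h (F x)))"
 shows "smooth_map N M (F ` W) h"
 unfolding smooth_map_def
proof (intro ballI conjI)
 fix p assume "p \<in> F ` W"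
 then obtain x where x: "x \<in> W" "p = F x" by blast
 have p: "p \<in> points N" using paramD(4)[OF N P x(1)] x(2) by simp
 obtain x2 where x2: "x2 \<in> W2" "h p = F2 x2" using hin[OF x(1)] x(2) by blast
 show hp: "h p \<in> points M" using paramD(4)[OF M P2 x2(1)] x2(2) by simp
 let ?R = "{y \<in> cmap N p ` cdom N p. cinv N p y \<in> F ` W}"
 note R = param_smooth(4,2)[OF N P p]
 have s1: "smooth_on ?R (%y. c2 (h (F (c (cinv N p y)))))"
  by (rule smooth_on_compose[OF R(1) paramD(1)[OF N P] _ R(2) sm]) (use paramD(8)[OF N P] in auto)
 let ?V = "{z \<in> W2. F2 z \<in> cdom M (h p)}"
 note V = param_smooth(3,1)[OF M P2 hp]
 let ?S = "?R \<inter> (%y. c2 (h (F (c (cinv N p y))))) -` ?V"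
 have So: "open ?S" by (rule continuous_open_preimage[OF smooth_on_continuous[OF s1] R(1) V(1)])
 have eq: "F (c (cinv N p y)) = cinv N p y" "F2 (c2 (h (cinv N p y))) = h (cinv N p y)" if "y \<in> ?R" for y
 proof -
  show e: "F (c (cinv N p y)) = cinv N p y" using that paramD(7)[OF N P] by auto
  have "c (cinv N p y) \<in> W" using that paramD(8)[OF N P] by auto
  from hin[OF this] show "F2 (c2 (h (cinv N p y))) = h (cinv N p y)" using paramD(7)[OF M P2] e by simp
 qed
 have "smooth_on ?S (%y. cmap M (h p) (F2 (c2 (h (F (c (cinv N p y)))))))"
  by (rule smooth_on_compose[OF So V(1) _ smooth_on_subset[OF s1] V(2)]) auto
 then have sS: "smooth_on ?S (cmap M (h p) \<circ> h \<circ> cinv N p)"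
  by (rule smooth_on_cong[OF So, rotated]) (use eq in auto)
 have "cmap N p p \<in> ?S"
  using cdomD(1)[OF N p] param_cinv(2)[OF N p] x hin[OF x(1)] paramD(2)[OF N P x(1)]
   x2 paramD(2)[OF M P2 x2(1)] cdomD(1)[OF M hp] by auto
 moreover have "?S \<subseteq> cmap N p ` ((F ` W \<inter> h -` cdom M (h p)) \<inter> cdom N p)"
 proof
  fix y assume y: "y \<in> ?S"
  then obtain q where q: "q \<in> cdom N p" "y = cmap N p q" by auto
  have iq: "cinv N p y = q" using q param_cinv(2)[OF N p] by simp
  have "h q \<in> cdom M (h p)" using y eq[of y] iq by auto
  then show "y \<in> cmap N p ` ((F ` W \<inter> h -` cdom M (h p)) \<inter> cdom N p)" using q y iq by auto
 qed
 ultimately show "\<exists>S. coord_nbhd N (F ` W \<inter> h -` cdom M (h p)) p S \<and> smooth_on S (cmap M (h p) \<circ> h \<circ> cinv N p)"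
  using So sS unfolding coord_nbhd_def by blast
qed

lemma smooth_map_local:
 assumes "\<And>p. p \<in> O' ==> \<exists>V. p \<in> V \<and> V \<subseteq> O' \<and> smooth_map N M V h"
 shows "smooth_map N M O' h"
 unfolding smooth_map_def
proof (intro ballI conjI)
 fix p assume "p \<in> O'"
 then obtain V where V: "p \<in> V" "V \<subseteq> O'" "smooth_map N M V h" using assms by blast
 then show "h p \<in> points M" by (simp add: smooth_map_def)
 from V obtain S where S: "coord_nbhd N (V \<inter> h -` cdom M (h p)) p S" "smooth_on S (cmap M (h p) \<circ> h \<circ> cinv N p)"
  unfolding smooth_map_def by blast
 have "coord_nbhd N (O' \<inter> h -` cdom M (h p)) p S" using S(1) V(2) unfolding coord_nbhd_def by blast
 with S(2) show "\<exists>S. coord_nbhd N (O' \<inter> h -` cdom M (h p)) p S \<and> smooth_on S (cmap M (h p) \<circ> h \<circ> cinv N p)" by blast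
qed

lemma mderiv_param:
 assumes P: "param N W F c" and x: "x \<in> W" and d: "(%y. cmap M (h (F x)) (h (F y))) differentiable (at x)"
 shows "mderiv N M h (F x) (dpar N F x u) = fd (%y. cmap M (h (F x)) (h (F y))) (at x) u"
 using pref_chain(1)[OF N P x pref_diff[OF N P x, of "%q. cmap M (h (F x)) (h q)", OF d], of u]
 by (simp add: mderiv_def dpar_def[OF N] o_def)

end

lemma smooth_map_ident:
 assumes M: "smooth_manifold M"
 shows "smooth_map M M (points M) (%p. p)"
proof (rule smooth_map_local[OF M M])
 fix p assume p: "p \<in> points M"
 note P = param_cinv[OF M p]
 have "smooth_map M M (cinv M p ` (cmap M p ` cdom M p)) (%p. p)"
  by (rule smooth_mapI[OF M M P(1) P(1)])
   (auto intro!: smooth_on_cong[OF _ _ smooth_on_id] simp: cdomD(4)[OF M p] P(2))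
 then show "\<exists>V. p \<in> V \<and> V \<subseteq> points M \<and> smooth_map M M V (%p. p)"
  using P(3) cdomD[OF M p] by auto
qed

context
 fixes A :: "('a, 'e::euclidean_space, 'z) manifold_scheme"
 assumes A: "smooth_manifold A"
begin

lemma trans_has_derivative:
 assumes "a \<in> points A" "b \<in> points A" "q \<in> cdom A a" "q \<in> cdom A b"
 shows "((%y. cmap A b (cinv A a y)) has_derivative trans A a b q) (at (cmap A a q))"
  and "linear (trans A a b q)"
proof -
 let ?T = "{y \<in> cmap A a ` cdom A a. cinv A a y \<in> cdom A b}"
 have "cmap A a q \<in> ?T" using assms param_cinv(2)[OF A assms(1)] by auto
 from smooth_on_has_derivative[OF param_smooth(1)[OF A param_cinv(1)[OF A assms(1)] assms(2)] this]
 show d: "((%y. cmap A b (cinv A a y)) has_derivative trans A a b q) (at (cmap A a q))"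
  by (simp add: trans_def[abs_def] o_def)
 show "linear (trans A a b q)" using d has_derivative_linear by blast
qed

lemma trans_refl:
 assumes "a \<in> points A" "q \<in> cdom A a"
 shows "trans A a a q v = v"
proof -
 let ?T = "cmap A a ` cdom A a"
 have "((%y. y) has_derivative trans A a a q) (at (cmap A a q))"
  by (rule has_derivative_transform_within_open[OF trans_has_derivative(1)[OF assms(1) assms(1) assms(2,2)], of ?T])
   (use assms cdomD(4)[OF A assms(1)] param_cinv(2)[OF A assms(1)] in auto)
 from has_derivative_unique[OF this has_derivative_ident] show ?thesis by metis
qed

lemma trans_trans:
 assumes "a \<in> points A" "b \<in> points A" "d \<in> points A" "q \<in> cdom A a" "q \<in> cdom A b" "q \<in> cdom A d"
 shows "trans A b d q (trans A a b q v) = trans A a d q v"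
proof -
 let ?T = "{y \<in> cmap A a ` cdom A a. cinv A a y \<in> cdom A b}"
 have T: "open ?T" "cmap A a q \<in> ?T"
  using param_smooth(3)[OF A param_cinv(1)[OF A assms(1)] assms(2)] assms param_cinv(2)[OF A assms(1)] by auto
 have e: "cmap A b (cinv A a (cmap A a q)) = cmap A b q" using param_cinv(2)[OF A assms(1)] assms by simp
 have "((%y. cmap A d (cinv A b (cmap A b (cinv A a y)))) has_derivative (%v. trans A b d q (trans A a b q v))) (at (cmap A a q))"
  by (rule has_derivative_compose[OF trans_has_derivative(1)[OF assms(1,2,4,5)], of "%z. cmap A d (cinv A b z)"])
   (simp only: e, rule trans_has_derivative(1)[OF assms(2,3,5,6)])
 then have "((%y. cmap A d (cinv A a y)) has_derivative (%v. trans A b d q (trans A a b q v))) (at (cmap A a q))"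
  by (rule has_derivative_transform_within_open[OF _ T]) (use param_cinv(2)[OF A assms(2)] in auto)
 from has_derivative_unique[OF this trans_has_derivative(1)[OF assms(1,3,4,6)]] show ?thesis by metis
qed

lemma smooth_on_trans:
 assumes "a \<in> points A" "b \<in> points A"
 shows "smooth_on {y \<in> cmap A a ` cdom A a. cinv A a y \<in> cdom A b} (%y. trans A a b (cinv A a y) v)"
proof -
 let ?T = "{y \<in> cmap A a ` cdom A a. cinv A a y \<in> cdom A b}"
 note s = param_smooth(1,3)[OF A param_cinv(1)[OF A assms(1)] assms(2)]
 show ?thesis
  by (rule smooth_on_cong[OF s(2) _ smooth_on_frechet[OF s(1), of v]])
   (auto simp: trans_def o_def param_cinv(2)[OF A assms(1)])
qed

lemma frechet_change_base:
 assumes "a \<in> points A" "b \<in> points A" "f x \<in> cdom A a" "f x \<in> cdom A b" "open T" "x \<in> T"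
  "\<And>y. y \<in> T ==> f y \<in> cdom A a" "(%y. cmap A a (f y)) differentiable (at x)"
 shows "fd (%y. cmap A b (f y)) (at x) u =
   trans A a b (f x) (fd (%y. cmap A a (f y)) (at x) u)"
  and "(%y. cmap A b (f y)) differentiable (at x)"
proof -
 have "((%y. cmap A b (cinv A a (cmap A a (f y)))) has_derivative
   (%u. trans A a b (f x) (fd (%y. cmap A a (f y)) (at x) u))) (at x)"
  by (rule has_derivative_compose[OF assms(8)[unfolded frechet_derivative_works] trans_has_derivative(1)[OF assms(1-4)]])
 then have d: "((%y. cmap A b (f y)) has_derivative
   (%u. trans A a b (f x) (fd (%y. cmap A a (f y)) (at x) u))) (at x)"
  by (rule has_derivative_transform_within_open[OF _ assms(5,6)]) (use assms(7) param_cinv(2)[OF A assms(1)] in auto)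
 show "fd (%y. cmap A b (f y)) (at x) u =
   trans A a b (f x) (fd (%y. cmap A a (f y)) (at x) u)"
  using frechet_derivative_at[OF d] by metis
 show "(%y. cmap A b (f y)) differentiable (at x)" using d differentiableI by blast
qed

end

text \<open>Coordinates in the preferred chart of \<open>b\<close> of a tangent vector given in the preferred chart of its
 base point \<open>q\<close>.\<close>

abbreviation rep :: "('a, 'e::euclidean_space, 'z) manifold_scheme => 'a => 'a => 'e => 'e" where
 "rep A b q v \<equiv> trans A q b q v"

text \<open>Formulated for bare manifolds, so that the identity of the ambient manifold is an
  instance too. \<open>ident_immersion\<close> provides it, for fields such as \<xi> that are given
  on the ambient space.\<close>

locale immersed_manifold =
 fixes M :: "('b, 'm::euclidean_space, 'y) manifold_scheme"
  and A :: "('a, 'e::euclidean_space, 'z) manifold_scheme"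
  and j :: "'b => 'a"
 assumes M: "smooth_manifold M" and A: "smooth_manifold A" and im: "immersion M A j"
begin

lemma smi: "smooth_map M A (points M) j"
 using im by (simp add: immersion_def)

lemma iota_points: "q \<in> points M ==> j q \<in> points A"
 by (rule smooth_map_points[OF M A smi])

lemma base_open:
 assumes P: "param M W F c" and b: "b \<in> points A"
 shows "open {x \<in> W. j (F x) \<in> cdom A b}" "smooth_on {x \<in> W. j (F x) \<in> cdom A b} (%x. cmap A b (j (F x)))"
proof -
 have "{x \<in> W. F x \<in> points M \<and> j (F x) \<in> cdom A b} = {x \<in> W. j (F x) \<in> cdom A b}"
  using paramD(4)[OF M P] by auto
 then show "open {x \<in> W. j (F x) \<in> cdom A b}" "smooth_on {x \<in> W. j (F x) \<in> cdom A b} (%x. cmap A b (j (F x)))"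
  using smooth_map_base[OF M A P smi b] by simp_all
qed

text \<open>The tangent vector \<open>j\<^sub>*(\<partial>\<^sub>u F)\<close>.\<close>

definition tvec :: "('m => 'b) => 'm => 'm => 'e" where
 "tvec F x u = fd (%y. cmap A (j (F x)) (j (F y))) (at x) u"

lemma tvec_diff:
 assumes P: "param M W F c" and x: "x \<in> W"
 shows "(%y. cmap A (j (F x)) (j (F y))) differentiable (at x)"
proof -
 have b: "j (F x) \<in> points A" using paramD(4)[OF M P x] iota_points by blast
 show ?thesis
  by (rule smooth_on_differentiable[OF base_open(2)[OF P b]]) (use x cdomD(1)[OF A b] in auto)
qed

lemma tvec_mderiv:
 assumes P: "param M W F c" and x: "x \<in> W"
 shows "mderiv M A j (F x) (dpar M F x u) = tvec F x u"
 unfolding tvec_def by (rule mderiv_param[OF M A P x tvec_diff[OF P x]])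

lemma linear_mderiv:
 assumes "p \<in> points M"
 shows "linear (mderiv M A j p)"
proof -
 note P = param_cinv[OF M assms]
 have x: "cmap M p p \<in> cmap M p ` cdom M p" using cdomD(1)[OF M assms] by auto
 have "(%y. cmap A (j p) (j (cinv M p y))) differentiable (at (cmap M p p))"
  using tvec_diff[OF P(1) x] P(2) cdomD(1)[OF M assms] by simp
 then show ?thesis
  unfolding mderiv_def[abs_def] o_def using frechet_derivative_works has_derivative_linear by blast
qed

lemma tvec_facts:
 assumes P: "param M W F c" and x: "x \<in> W"
 shows "linear (tvec F x)" "inj (tvec F x)" "range (tvec F x) = TM M A j (F x)"
  "intrinsic M A j (F x) (tvec F x u) = dpar M F x u"
proof -
 have q: "F x \<in> points M" by (rule paramD(4)[OF M P x])
 have t: "tvec F x = mderiv M A j (F x) \<circ> dpar M F x"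
  using tvec_mderiv[OF P x] by (auto simp: fun_eq_iff)
 have i: "inj (mderiv M A j (F x))" using im q by (simp add: immersion_def)
 show "linear (tvec F x)" unfolding t by (rule linear_compose[OF dpar_bij(1)[OF M P x] linear_mderiv[OF q]])
 show "inj (tvec F x)" unfolding t by (rule inj_compose[OF i bij_is_inj[OF dpar_bij(2)[OF M P x]]])
 show "range (tvec F x) = TM M A j (F x)"
  unfolding t TM_def using bij_is_surj[OF dpar_bij(2)[OF M P x]] by (metis image_comp)
 show "intrinsic M A j (F x) (tvec F x u) = dpar M F x u"
  unfolding intrinsic_def t o_def by (rule inv_f_f[OF i])
qed

lemma tvec_zero_iff: "param M W F c ==> x \<in> W ==> tvec F x u = 0 \<longleftrightarrow> u = 0"
 using tvec_facts(1,2) linear_injective_0 linear_0 by metis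

lemma dir_deriv_tvec:
 assumes P: "param M W F c" and x: "x \<in> W" and f: "(%y. f (F y)) differentiable (at x)"
 shows "dir_deriv M A j (F x) (tvec F x u) f = fd (%y. f (F y)) (at x) u"
 unfolding dir_deriv_def tvec_facts(4)[OF P x] by (rule fderiv_param[OF M P x f])

lemma rep_tvec:
 assumes P: "param M W F c" and y: "y \<in> W" and b: "b \<in> points A" "j (F y) \<in> cdom A b"
 shows "rep A b (j (F y)) (tvec F y u) = fd (%z. cmap A b (j (F z))) (at y) u"
proof -
 have a: "j (F y) \<in> points A" using paramD(4)[OF M P y] iota_points by blast
 let ?T = "{z \<in> W. j (F z) \<in> cdom A (j (F y))}"
 show ?thesis unfolding tvec_def
  by (rule frechet_change_base(1)[where f="%z. j (F z)" and x=y and T="?T", OF A a b(1) _ b(2), symmetric])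
   (use base_open(1)[OF P a] y cdomD(1)[OF A a] tvec_diff[OF P y] in auto)
qed

lemma smooth_rep_tvec:
 assumes P: "param M W F c" and b: "b \<in> points A"
 shows "smooth_on {x \<in> W. j (F x) \<in> cdom A b} (%x. rep A b (j (F x)) (tvec F x u))"
 by (rule smooth_on_cong[OF base_open(1)[OF P b] _ smooth_on_frechet[OF base_open(2)[OF P b], of u]])
  (simp add: rep_tvec[OF P _ b])

text \<open>\<open>smooth_along\<close> uses at each point the ambient chart of the image of that
  point; here one chart, that of \<open>b\<close>, serves for all. The two differ by a transition
  map that depends smoothly on the point.\<close>

lemma smooth_along_param:
 assumes P: "param M W F c" and b: "b \<in> points A" and V: "openin (mtop M) V" and Y: "smooth_along M A j V Y"
 shows "smooth_on {x \<in> W. F x \<in> V \<and> j (F x) \<in> cdom A b} (%x. rep A b (j (F x)) (Y (F x)))"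
proof (rule smooth_on_local)
 fix x assume "x \<in> {x \<in> W. F x \<in> V \<and> j (F x) \<in> cdom A b}"
 then have x: "x \<in> W" "F x \<in> V" "j (F x) \<in> cdom A b" by auto
 define q where "q = F x"
 have q: "q \<in> points M" unfolding q_def by (rule paramD(4)[OF M P x(1)])
 have a: "j q \<in> points A" by (rule iota_points[OF q])
 obtain S where S: "open S" "cmap M q q \<in> S" "S \<subseteq> cmap M q ` (V \<inter> j -` cdom A (j q) \<inter> cdom M q)"
  "smooth_on S (%x. let r = cinv M q x in trans A (j r) (j q) (j r) (Y r))"
  using Y x(2) unfolding smooth_along_def coord_nbhd_def q_def by blast
 let ?T = "{y \<in> W. F y \<in> cdom M q}"
 have To: "open ?T" "smooth_on ?T (%y. cmap M q (F y))" by (rule param_smooth[OF M P q])+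
 let ?T1 = "?T \<inter> (%y. cmap M q (F y)) -` S"
 let ?T' = "?T1 \<inter> {x \<in> W. j (F x) \<in> cdom A b}"
 have T': "open ?T'"
  by (intro open_Int continuous_open_preimage[OF smooth_on_continuous[OF To(2)] To(1) S(1)] base_open(1)[OF P b])
 have in_S: "j (F y) \<in> cdom A (j q) \<and> F y \<in> points M" if "y \<in> ?T'" for y
 proof -
  have "cmap M q (F y) \<in> cmap M q ` (V \<inter> j -` cdom A (j q) \<inter> cdom M q)" using that S(3) by auto
  then obtain q' where q': "j q' \<in> cdom A (j q)" "q' \<in> cdom M q" "cmap M q (F y) = cmap M q q'" by auto
  have "F y = q'" using q'(2,3) that param_cinv(2)[OF M q, of q'] param_cinv(2)[OF M q, of "F y"] by auto
  then show ?thesis using q' that paramD(4)[OF M P] by auto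
 qed
 have "smooth_on ?T' (%y. (%x. let r = cinv M q x in trans A (j r) (j q) (j r) (Y r)) (cmap M q (F y)))"
  by (rule smooth_on_compose[OF T' S(1) _ smooth_on_subset[OF To(2)] S(4)]) auto
 then have s1: "smooth_on ?T' (%y. rep A (j q) (j (F y)) (Y (F y)))"
  by (rule smooth_on_cong[OF T', rotated]) (simp add: param_cinv(2)[OF M q] Let_def)
 let ?R = "{y \<in> cmap A (j q) ` cdom A (j q). cinv A (j q) y \<in> cdom A b}"
 have s2: "smooth_on ?T' (%y. trans A (j q) b (j (F y)) v)" for v
 proof -
  have "smooth_on ?T' (%y. trans A (j q) b (cinv A (j q) (cmap A (j q) (j (F y)))) v)"
  proof (rule smooth_on_compose[OF T' param_smooth(3)[OF A param_cinv(1)[OF A a] b] _ _ smooth_on_trans[OF A a b]])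
   show "smooth_on ?T' (%y. cmap A (j q) (j (F y)))"
    by (rule smooth_on_subset[OF base_open(2)[OF P a]]) (use in_S in auto)
   show "(%y. cmap A (j q) (j (F y))) ` ?T' \<subseteq> ?R"
    using in_S param_cinv(2)[OF A a] by auto
  qed
  then show ?thesis
   by (rule smooth_on_cong[OF T', rotated]) (use in_S param_cinv(2)[OF A a] in auto)
 qed
 have "smooth_on ?T' (%y. trans A (j q) b (j (F y)) (rep A (j q) (j (F y)) (Y (F y))))"
  by (rule smooth_on_linear_family[OF T' _ s2 s1])
   (use in_S in \<open>auto intro!: trans_has_derivative(2)[OF A a b]\<close>)
 then have "smooth_on ?T' (%y. rep A b (j (F y)) (Y (F y)))"
  by (rule smooth_on_cong[OF T', rotated])
   (use in_S in \<open>auto intro!: trans_trans[OF A _ a b] iota_points cdomD(1)[OF A]\<close>)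
 moreover have "x \<in> ?T'" using x S(2) cdomD(1)[OF M q] by (auto simp: q_def)
 ultimately show "\<exists>T. open T \<and> x \<in> T \<and> smooth_on T (%x. rep A b (j (F x)) (Y (F x)))" using T' by blast
qed

text \<open>A converse of \<open>smooth_along_param\<close>: at each point any parametrization and
  any ambient chart will do, so constructions can choose convenient ones.\<close>

lemma smooth_alongI:
 assumes V: "openin (mtop M) V"
  and sm: "\<And>p. p \<in> V ==> \<exists>W F c b T. param M W F c \<and> b \<in> points A \<and> open T \<and> T \<subseteq> {x \<in> W. F x \<in> V \<and> j (F x) \<in> cdom A b} \<and>
   p \<in> F ` T \<and> smooth_on T (%x. rep A b (j (F x)) (Y (F x)))"
 shows "smooth_along M A j V Y"
 unfolding smooth_along_def
proof
 fix p assume "p \<in> V"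
 from sm[OF this] obtain W F c b T where P0: "param M W F c" and b: "b \<in> points A" and T: "open T"
   "T \<subseteq> {x \<in> W. F x \<in> V \<and> j (F x) \<in> cdom A b}" "p \<in> F ` T"
   and s: "smooth_on T (%x. rep A b (j (F x)) (Y (F x)))" by blast
 have P: "param M T F c" by (rule param_subset[OF M P0 T(1)]) (use T(2) in auto)
 have p: "p \<in> points M" using T(3) paramD(4)[OF M P] by auto
 have a: "j p \<in> points A" by (rule iota_points[OF p])
 have TV: "F y \<in> V" "j (F y) \<in> cdom A b" if "y \<in> T" for y using that T(2) by auto
 let ?R = "{y \<in> cmap M p ` cdom M p. cinv M p y \<in> F ` T}"
 note R = param_smooth(4,2)[OF M P p]
 let ?B = "{y \<in> cmap M p ` cdom M p. j (cinv M p y) \<in> cdom A (j p)}"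
 note B = base_open[OF param_cinv(1)[OF M p] a]
 define S where "S = ?R \<inter> ?B"
 have SR: "S \<subseteq> ?R" by (simp add: S_def)
 have So: "open S" unfolding S_def by (intro open_Int R(1) B(1))
 have r: "F (c (cinv M p y)) = cinv M p y" "c (cinv M p y) \<in> T" if "y \<in> S" for y
  using that paramD(7,8)[OF M P] by (auto simp: S_def)
 have "smooth_on S (%y. rep A b (j (F (c (cinv M p y)))) (Y (F (c (cinv M p y)))))"
  by (rule smooth_on_compose[OF So T(1) _ smooth_on_subset[OF R(2) SR] s]) (use r in auto)
 then have s1: "smooth_on S (%y. rep A b (j (cinv M p y)) (Y (cinv M p y)))"
  by (rule smooth_on_cong[OF So, rotated]) (simp add: r)
 have bS: "j (cinv M p y) \<in> cdom A b" "j (cinv M p y) \<in> cdom A (j p)" "cinv M p y \<in> points M" "cinv M p y \<in> V"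
  if y: "y \<in> S" for y
 proof -
  show "j (cinv M p y) \<in> cdom A b" "cinv M p y \<in> V" using TV[OF r(2)[OF y]] r(1)[OF y] by simp_all
  show "j (cinv M p y) \<in> cdom A (j p)" using y by (simp add: S_def)
  show "cinv M p y \<in> points M" using paramD(4)[OF M P r(2)[OF y]] r(1)[OF y] by simp
 qed
 have s2: "smooth_on S (%y. trans A b (j p) (j (cinv M p y)) v)" for v
 proof -
  have "smooth_on S (%y. trans A b (j p) (cinv A b (cmap A b (j (cinv M p y)))) v)"
  proof (rule smooth_on_compose[OF So param_smooth(3)[OF A param_cinv(1)[OF A b] a] _ _ smooth_on_trans[OF A b a]])
   show "smooth_on S (%y. cmap A b (j (cinv M p y)))"
    by (rule smooth_on_subset[OF base_open(2)[OF param_cinv(1)[OF M p] b]]) (use bS SR in auto)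
   show "(%y. cmap A b (j (cinv M p y))) ` S \<subseteq> {y \<in> cmap A b ` cdom A b. cinv A b y \<in> cdom A (j p)}"
    using bS param_cinv(2)[OF A b] by auto
  qed
  then show ?thesis
   by (rule smooth_on_cong[OF So, rotated]) (use bS param_cinv(2)[OF A b] in auto)
 qed
 have "smooth_on S (%y. trans A b (j p) (j (cinv M p y)) (rep A b (j (cinv M p y)) (Y (cinv M p y))))"
  by (rule smooth_on_linear_family[OF So _ s2 s1])
   (use bS in \<open>auto intro!: trans_has_derivative(2)[OF A b a]\<close>)
 then have "smooth_on S (%x. let q = cinv M p x in trans A (j q) (j p) (j q) (Y q))"
  by (rule smooth_on_cong[OF So, rotated])
   (use bS in \<open>auto simp: Let_def intro!: trans_trans[OF A _ b a] iota_points cdomD(1)[OF A]\<close>)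
 moreover have "coord_nbhd M (V \<inter> j -` cdom A (j p)) p S"
  unfolding coord_nbhd_def
 proof (intro conjI So)
  show "cmap M p p \<in> S"
   using T(3) param_cinv(2)[OF M p] cdomD(1)[OF M p] cdomD(1)[OF A a] by (auto simp: S_def)
  show "S \<subseteq> cmap M p ` (V \<inter> j -` cdom A (j p) \<inter> cdom M p)"
  proof
   fix y assume y: "y \<in> S"
   then obtain q where q: "q \<in> cdom M p" "y = cmap M p q" using SR by auto
   then have "cinv M p y = q" using param_cinv(2)[OF M p] by simp
   then show "y \<in> cmap M p ` (V \<inter> j -` cdom A (j p) \<inter> cdom M p)" using bS[OF y] q by auto
  qed
 qed
 ultimately show "\<exists>S. coord_nbhd M (V \<inter> j -` cdom A (j p)) p S \<and>
   smooth_on S (%x. let q = cinv M p x in trans A (j q) (j p) (j q) (Y q))" by blast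
qed

lemma nabla_param:
 assumes P: "param M W F c" and x: "x \<in> W"
  and d: "(%y. rep A (j (F x)) (j (F y)) (Y (F y))) differentiable (at x)"
 shows "nabla M A g j (F x) (intrinsic M A j (F x) (tvec F x u)) Y =
  fd (%y. rep A (j (F x)) (j (F y)) (Y (F y))) (at x) u
  + christoffel A g (j (F x)) (tvec F x u) (Y (F x))"
proof -
 let ?h = "%r. rep A (j (F x)) (j r) (Y r)"
 show ?thesis
  using pref_chain(1)[OF M P x pref_diff[OF M P x, of ?h, OF d], of u]
  by (simp add: nabla_def Let_def tvec_facts(4)[OF P x] tvec_mderiv[OF P x] dpar_def[OF M, symmetric])
qed

end

section \<open>Inner products and slant subspaces\<close>

definition inner_form :: "('e::euclidean_space => 'e => real) => bool" where
 "inner_form b \<longleftrightarrow> bilinear b \<and> (\<forall>u v. b u v = b v u) \<and> (\<forall>u. u \<noteq> 0 \<longrightarrow> b u u > 0)"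

context
 fixes b :: "'e::euclidean_space => 'e => real"
 assumes b: "inner_form b"
begin

lemma iform_lin: "linear (b u)" "linear (%u. b u v)"
 using b by (auto simp: inner_form_def bilinear_def)

lemma iform_simps:
 "b (u + u') v = b u v + b u' v" "b u (v + v') = b u v + b u v'"
 "b (u - u') v = b u v - b u' v" "b u (v - v') = b u v - b u v'"
 "b (c *\<^sub>R u) v = c * b u v" "b u (c *\<^sub>R v) = c * b u v"
 "b (- u) v = - b u v" "b u (- v) = - b u v" "b 0 v = 0" "b u 0 = 0"
 by (simp_all add: linear_add[OF iform_lin(1)] linear_diff[OF iform_lin(1)] linear_scale[OF iform_lin(1)]
   linear_neg[OF iform_lin(1)] linear_0[OF iform_lin(1)]
   linear_add[OF iform_lin(2)] linear_diff[OF iform_lin(2)] linear_scale[OF iform_lin(2)]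
   linear_neg[OF iform_lin(2)] linear_0[OF iform_lin(2)])

lemma iform_sym: "b u v = b v u" using b by (auto simp: inner_form_def)

lemma iform_pos: "u \<noteq> 0 ==> b u u > 0" using b by (auto simp: inner_form_def)

lemma iform_nonneg: "b u u \<ge> 0"
 using iform_pos[of u] by (cases "u = 0") (auto simp: iform_simps)

lemma iform_zero: "b u u = 0 ==> u = 0" using iform_pos[of u] by fastforce

lemma iform_eqI:
 assumes "subspace T" "u \<in> T" "v \<in> T" "\<And>w. w \<in> T ==> b u w = b v w"
 shows "u = v"
proof -
 have "u - v \<in> T" using assms subspace_diff by blast
 then have "b (u - v) (u - v) = 0" using assms(4)[of "u - v"] by (simp add: iform_simps(3))
 then show ?thesis using iform_zero by fastforce
qed

text \<open>The map from \<open>w\<close> to the tuple of values \<open>b w i\<close> is injective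
  because \<open>b\<close> is positive definite, hence bijective in finite dimension. This gives
  meaning to the definite descriptions of Christoffel symbols and shape operators.\<close>

lemma iform_riesz:
 assumes "linear L"
 shows "\<exists>!w. \<forall>z. b w z = L z"
proof -
 let ?B = "%w. \<Sum>i\<in>Basis. b w i *\<^sub>R i"
 have lB: "linear ?B"
  by (intro linear_compose_sum ballI linear_compose[OF iform_lin(2), unfolded o_def, of "%a. a *\<^sub>R _"])
   (simp add: linear_iff scaleR_left_distrib)
 have "w = 0" if "?B w = 0" for w
 proof -
  have "b w i = 0" if "i \<in> Basis" for i
   using arg_cong[OF \<open>?B w = 0\<close>, of "%v. v \<bullet> i"] that by (simp add: inner_sum_left inner_Basis sum.delta if_distrib cong: if_cong)
  then have "b w w = 0" using linear_Basis_expand[OF iform_lin(1), of w w] by simp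
  then show ?thesis by (rule iform_zero)
 qed
 then have "bij ?B" by (rule linear_bij_of_inj[OF lB])
 from surj_f_inv_f[OF bij_is_surj[OF this], of "\<Sum>i\<in>Basis. L i *\<^sub>R i"]
 obtain w where w: "?B w = (\<Sum>i\<in>Basis. L i *\<^sub>R i)" by auto
 have "b w i = L i" if "i \<in> Basis" for i
  using arg_cong[OF w, of "%v. v \<bullet> i"] that by (simp add: inner_sum_left inner_Basis sum.delta if_distrib cong: if_cong)
 then have "b w z = L z" for z
  unfolding linear_Basis_expand[OF iform_lin(1), of w z] linear_Basis_expand[OF assms, of z] by simp
 moreover have "w' = w" if "\<forall>z. b w' z = L z" for w'
  using iform_eqI[of UNIV w' w] that calculation by simp
 ultimately show ?thesis by blast
qed

text \<open>Gram-Schmidt: the projection onto the span of \<open>S\<close> is corrected along the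
  part of \<open>a\<close> orthogonal to that span.\<close>

lemma iform_proj_span:
 assumes "finite S" "independent S"
 shows "\<exists>w\<in>span S. \<forall>z\<in>span S. b (v - w) z = 0"
 using assms
proof (induction S arbitrary: v rule: finite_induct)
 case empty
 then show ?case by (auto simp: iform_simps)
next
 case (insert a S)
 then have ind: "independent S" "a \<notin> span S" by (auto simp: independent_insert)
 note IH = insert.IH[OF ind(1)]
 obtain p where p: "p \<in> span S" "\<forall>z\<in>span S. b (a - p) z = 0" using IH by blast
 define a' where "a' = a - p"
 have "a' \<noteq> 0" using p ind by (auto simp: a'_def)
 then have a'0: "b a' a' \<noteq> 0" using iform_zero by blast
 have a'o: "b a' z = 0" if "z \<in> span S" for z using p that by (simp add: a'_def)
 obtain w where w: "w \<in> span S" "\<forall>z\<in>span S. b (v - w) z = 0" using IH by blast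
 let ?w = "w + (b (v - w) a' / b a' a') *\<^sub>R a'"
 have sub: "span S \<subseteq> span (insert a S)" by (rule span_mono) auto
 have a's: "a' \<in> span (insert a S)" unfolding a'_def
  by (rule span_diff[OF span_base[OF insertI1] subsetD[OF sub p(1)]])
 have "?w \<in> span (insert a S)"
  by (rule span_add[OF subsetD[OF sub w(1)] span_scale[OF a's]])
 moreover have "b (v - ?w) z = 0" if z: "z \<in> span (insert a S)" for z
 proof -
  obtain k where k: "z - k *\<^sub>R a \<in> span S" using z by (auto simp: span_insert)
  have e: "z - k *\<^sub>R a' = (z - k *\<^sub>R a) + k *\<^sub>R p" by (simp add: a'_def algebra_simps)
  have s: "z - k *\<^sub>R a' \<in> span S" unfolding e by (rule span_add[OF k span_scale[OF p(1)]])
  define k' where "k' = b (v - w) a' / b a' a'"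
  have e2: "b (v - (w + k' *\<^sub>R a')) y = b (v - w) y - k' * b a' y" for y
   by (simp add: iform_simps(1,3,5) algebra_simps)
  have "b (v - w) (z - k *\<^sub>R a') = 0" "b a' (z - k *\<^sub>R a') = 0" using w(2) a'o s by blast+
  then have "b (v - ?w) (z - k *\<^sub>R a') = 0" unfolding k'_def[symmetric] e2 by simp
  moreover have "b (v - ?w) a' = 0" unfolding k'_def[symmetric] e2 using a'0 by (simp add: k'_def)
  ultimately show ?thesis by (simp add: iform_simps(4,6))
 qed
 ultimately show ?case by blast
qed

lemma orth_proj:
 assumes "subspace T"
 shows "orth_proj b T v \<in> T" "\<And>z. z \<in> T ==> b (v - orth_proj b T v) z = 0"
  and "\<And>z. z \<in> T ==> b (orth_proj b T v) z = b v z"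
  and "\<And>w. w \<in> T ==> (\<And>z. z \<in> T ==> b w z = b v z) ==> orth_proj b T v = w"
proof -
 obtain B where B: "B \<subseteq> T" "independent B" "T \<subseteq> span B" "finite B"
  using basis_exists[of T] finiteI_independent by metis
 have "span B = T" using B assms by (metis span_minimal subset_antisym)
 then have ex: "\<exists>w. w \<in> T \<and> (\<forall>z\<in>T. b (v - w) z = 0)" using iform_proj_span[OF B(4,2), of v] by auto
 have un: "w = w'" if "w \<in> T" "w' \<in> T" "\<forall>z\<in>T. b (v - w) z = 0" "\<forall>z\<in>T. b (v - w') z = 0" for w w'
  by (rule iform_eqI[OF assms that(1,2)]) (use that(3,4) in \<open>auto simp: iform_simps\<close>)
 from ex un have "\<exists>!w. w \<in> T \<and> (\<forall>z\<in>T. b (v - w) z = 0)" by blast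
 from theI'[OF this] show *: "orth_proj b T v \<in> T" "\<And>z. z \<in> T ==> b (v - orth_proj b T v) z = 0"
  unfolding orth_proj_def by auto
 then show "\<And>z. z \<in> T ==> b (orth_proj b T v) z = b v z" by (simp add: iform_simps)
 show "orth_proj b T v = w" if "w \<in> T" "\<And>z. z \<in> T ==> b w z = b v z" for w
  by (rule un[OF *(1) that(1)]) (use * that in \<open>auto simp: iform_simps\<close>)
qed

lemma orth_proj_linear:
 assumes "subspace T"
 shows "linear (orth_proj b T)"
proof
 show "orth_proj b T (u + v) = orth_proj b T u + orth_proj b T v" for u v
  by (rule orth_proj(4)[OF assms]) (simp_all add: subspace_add[OF assms] orth_proj[OF assms] iform_simps)
 show "orth_proj b T (k *\<^sub>R v) = k *\<^sub>R orth_proj b T v" for k v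
  by (rule orth_proj(4)[OF assms]) (simp_all add: subspace_scale[OF assms] orth_proj[OF assms] iform_simps)
qed

end

text \<open>The almost contact metric structure of a single tangent space; slant angles and the
  uniqueness of the splitting are linear algebra here, free of charts.\<close>

locale acm_point =
 fixes b :: "'e::euclidean_space => 'e => real" and \<phi> :: "'e => 'e" and \<eta> :: "'e => real" and \<xi> :: 'e
 assumes b: "inner_form b" and lin\<phi>: "linear \<phi>" and lin\<eta>: "linear \<eta>"
  and \<phi>\<phi>: "\<phi> (\<phi> u) = - u + \<eta> u *\<^sub>R \<xi>" and \<eta>\<xi>: "\<eta> \<xi> = 1" and \<phi>\<xi>: "\<phi> \<xi> = 0" and \<eta>\<phi>: "\<eta> (\<phi> u) = 0"
  and b\<phi>: "b (\<phi> u) (\<phi> v) = b u v - \<eta> u * \<eta> v"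
begin

lemmas bs = iform_simps[OF b] and bsym = iform_sym[OF b]

text \<open>Compatibility of the metric with \<open>v = \<xi>\<close> has vanishing left side, as
  \<open>\<phi> \<xi> = 0\<close>.\<close>

lemma b_\<xi>: "b u \<xi> = \<eta> u" "b \<xi> u = \<eta> u"
 using b\<phi>[of u \<xi>] bsym[of u \<xi>] by (simp_all add: \<phi>\<xi> \<eta>\<xi> bs)

lemma \<phi>_skew: "b (\<phi> u) v = - b u (\<phi> v)"
 using b\<phi>[of u "\<phi> v"] by (simp add: \<phi>\<phi> \<eta>\<phi> bs b_\<xi>)

text \<open>In the application \<open>T\<close> is the tangent space, \<open>H\<close> is D \<oplus>
  \<langle>\<xi>\<rangle> and \<open>K\<close> is D\<theta>. Placing \<xi> in \<open>H\<close> makes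
  the splitting match that by the leaves of a warped product, whose first factor carries
  \<xi>.\<close>

definition slant_split :: "'e set => 'e set => 'e set => real => bool" where
 "slant_split T H K \<alpha> \<longleftrightarrow> subspace H \<and> subspace K \<and> T = {h + k |h k. h \<in> H \<and> k \<in> K} \<and>
  (\<forall>h\<in>H. \<forall>k\<in>K. b h k = 0) \<and> \<phi> ` H \<subseteq> H \<and> \<xi> \<in> H \<and> (\<forall>z\<in>K. z \<noteq> 0 \<longrightarrow> angle_to b (\<phi> z) K = \<alpha>)"

lemma slant_splitD:
 assumes S: "slant_split T H K \<alpha>"
 shows "subspace H" "subspace K" "subspace T" "H \<subseteq> T" "K \<subseteq> T" "\<xi> \<in> H"
  "h \<in> H ==> k \<in> K ==> b h k = 0" "h \<in> H ==> k \<in> K ==> b k h = 0" "h \<in> H ==> \<phi> h \<in> H" "z \<in> K ==> \<eta> z = 0"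
  "t \<in> T ==> \<exists>h k. t = h + k \<and> h \<in> H \<and> k \<in> K"
proof -
 show H: "subspace H" and K: "subspace K" and x: "\<xi> \<in> H" using S by (auto simp: slant_split_def)
 have T: "T = {h + k |h k. h \<in> H \<and> k \<in> K}" using S by (simp add: slant_split_def)
 show "subspace T" unfolding T by (rule subspace_sums[OF H K])
 show "H \<subseteq> T" "K \<subseteq> T" unfolding T using subspace_0[OF H] subspace_0[OF K] by force+
 show o: "b h k = 0" if "h \<in> H" "k \<in> K" for h k using S that by (simp add: slant_split_def)
 show "b k h = 0" if "h \<in> H" "k \<in> K" for h k using o[OF that] bsym by simp
 show "h \<in> H ==> \<phi> h \<in> H" using S by (auto simp: slant_split_def)
 show "\<eta> z = 0" if "z \<in> K" for z using o[OF x that] by (simp add: b_\<xi>)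
 show "t \<in> T ==> \<exists>h k. t = h + k \<and> h \<in> H \<and> k \<in> K" unfolding T by blast
qed

text \<open>As \<phi> is skew and preserves \<open>H\<close>, the image of \<open>K\<close> under
  \<phi> is orthogonal to \<open>H\<close>; the tangential part of \<open>\<phi> z\<close> is thus
  its projection to \<open>K\<close>, whose length the angle determines. Polarizing this length
  identity and using skewness once more gives P^2 = -cos^2 on \<open>K\<close>.\<close>

lemma slant_split_P:
 assumes S: "slant_split T H K \<alpha>"
 shows "h \<in> H ==> orth_proj b T (\<phi> h) = \<phi> h"
  and "z \<in> K ==> orth_proj b T (\<phi> z) = orth_proj b K (\<phi> z)"
  and "z \<in> K ==> orth_proj b T (\<phi> z) \<in> K"
  and "z \<in> K ==> b (orth_proj b T (\<phi> z)) (orth_proj b T (\<phi> z)) = (cos \<alpha>)\<^sup>2 * b z z"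
  and "z \<in> K ==> orth_proj b T (\<phi> (orth_proj b T (\<phi> z))) = - ((cos \<alpha>)\<^sup>2 *\<^sub>R z)"
  and "K \<noteq> {0} ==> 0 \<le> \<alpha> \<and> \<alpha> \<le> pi / 2"
proof -
 note D = slant_splitD[OF S]
 let ?P = "%z. orth_proj b T (\<phi> z)"
 show "?P h = \<phi> h" if "h \<in> H"
  by (rule orth_proj(4)[OF b D(3)]) (use D(4,9) that in auto)
 show PK: "?P z = orth_proj b K (\<phi> z)" if "z \<in> K" for z
 proof (rule orth_proj(4)[OF b D(3)])
  show "orth_proj b K (\<phi> z) \<in> T" using orth_proj(1)[OF b D(2)] D(5) by blast
  fix t assume "t \<in> T"
  then obtain h k where t: "t = h + k" "h \<in> H" "k \<in> K" using D(11) by blast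
  have "b (orth_proj b K (\<phi> z)) h = 0" using D(8)[OF t(2) orth_proj(1)[OF b D(2)]] .
  moreover have "b (\<phi> z) h = 0" using D(8)[OF D(9)[OF t(2)] that] by (simp add: \<phi>_skew)
  moreover have "b (orth_proj b K (\<phi> z)) k = b (\<phi> z) k" by (rule orth_proj(3)[OF b D(2) t(3)])
  ultimately show "b (orth_proj b K (\<phi> z)) t = b (\<phi> z) t" by (simp add: t bs)
 qed
 show Pin: "?P z \<in> K" if "z \<in> K" for z using PK[OF that] orth_proj(1)[OF b D(2)] by simp
 have \<phi>n: "b (\<phi> z) (\<phi> z) = b z z" if "z \<in> K" for z using b\<phi>[of z z] D(10)[OF that] by simp
 have PP: "b (?P z) (?P z) = b (\<phi> z) (?P z)" if "z \<in> K" for z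
  using orth_proj(3)[OF b D(3) orth_proj(1)[OF b D(3)]] .
 have le: "b (?P z) (?P z) \<le> b (\<phi> z) (\<phi> z)" if "z \<in> K" for z
 proof -
  have "0 \<le> b (\<phi> z - ?P z) (\<phi> z - ?P z)" by (rule iform_nonneg[OF b])
  then show ?thesis using PP[OF that] bsym[of "\<phi> z" "?P z"] by (simp add: bs)
 qed
 have ang: "\<alpha> = arccos (sqrt (b (?P z) (?P z)) / sqrt (b z z))" if "z \<in> K" "z \<noteq> 0" for z
  using S that PK[OF that(1)] \<phi>n[OF that(1)] unfolding slant_split_def angle_to_def gnorm_def by auto
 have rat: "0 \<le> sqrt (b (?P z) (?P z)) / sqrt (b z z)" "sqrt (b (?P z) (?P z)) / sqrt (b z z) \<le> 1" if "z \<in> K" "z \<noteq> 0" for z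
  using le[OF that(1)] \<phi>n[OF that(1)] iform_nonneg[OF b] iform_pos[OF b that(2)] by (auto simp: field_simps)
 show nrm: "b (?P z) (?P z) = (cos \<alpha>)\<^sup>2 * b z z" if "z \<in> K" for z
 proof (cases "z = 0")
  case True
  then have "?P z = 0" using Pin[OF that]
   by (simp add: linear_0[OF lin\<phi>] linear_0[OF orth_proj_linear[OF b D(3)]])
  then show ?thesis using True by (simp add: bs)
 next
  case False
  then have "cos \<alpha> = sqrt (b (?P z) (?P z)) / sqrt (b z z)"
   using ang[OF that False] rat[OF that False] by simp
  then have "(cos \<alpha>)\<^sup>2 = b (?P z) (?P z) / b z z"
   using iform_nonneg[OF b] by (simp add: power_divide)
  then show ?thesis using iform_pos[OF b False] by simp
 qed
 show "0 \<le> \<alpha> \<and> \<alpha> \<le> pi / 2" if "K \<noteq> {0}"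
 proof -
  have "\<exists>z\<in>K. z \<noteq> 0" using that subspace_0[OF D(2)] by (auto simp: set_eq_iff)
  then obtain z where z: "z \<in> K" "z \<noteq> 0" by blast
  show ?thesis
   using ang[OF z] arccos_lbound[OF order_trans[OF _ rat(1)[OF z]] rat(2)[OF z]] arccos_le_pi2[OF rat[OF z]] by simp
 qed
 show "?P (?P z) = - ((cos \<alpha>)\<^sup>2 *\<^sub>R z)" if z: "z \<in> K" for z
 proof (rule iform_eqI[OF b D(2) Pin[OF Pin[OF z]]])
  show "- ((cos \<alpha>)\<^sup>2 *\<^sub>R z) \<in> K" using z D(2) by (simp add: subspace_neg subspace_scale)
  fix w assume w: "w \<in> K"
  have lP: "?P (z + w) = ?P z + ?P w"
   by (simp add: linear_add[OF lin\<phi>] linear_add[OF orth_proj_linear[OF b D(3)]])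
  have "b (?P z) (?P w) = (cos \<alpha>)\<^sup>2 * b z w"
   using nrm[OF subspace_add[OF D(2) z w]] nrm[OF z] nrm[OF w] bsym[of "?P w" "?P z"] bsym[of w z]
   unfolding lP by (simp add: bs algebra_simps)
  moreover have "b (?P (?P z)) w = b (\<phi> (?P z)) w"
   using orth_proj(3)[OF b D(3)] w D(5) by blast
  moreover have "b (?P z) (?P w) = b (?P z) (\<phi> w)"
   using orth_proj(3)[OF b D(3), of "?P z" "\<phi> w"] orth_proj(1)[OF b D(3)] bsym by metis
  ultimately show "b (?P (?P z)) w = b (- ((cos \<alpha>)\<^sup>2 *\<^sub>R z)) w" by (simp add: \<phi>_skew bs)
 qed
qed

lemma cos_sq_inj:
 fixes x y :: real
 assumes "0 \<le> x" "x \<le> pi / 2" "0 \<le> y" "y \<le> pi / 2" "(cos x)\<^sup>2 = (cos y)\<^sup>2"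
 shows "x = y"
proof -
 have "0 \<le> cos x" "0 \<le> cos y" using assms by (auto intro!: cos_ge_zero)
 then have "cos x = cos y" using assms(5) by (simp add: power2_eq_iff_nonneg)
 then show ?thesis by (rule cos_inj_pi[rotated 4]) (use assms in auto)
qed

text \<open>The splitting is recovered from \<open>P\<^sup>2\<close>: its eigenvalue on the kernel of \<open>\<eta>\<close> in \<open>H\<close> is \<open>-1\<close>, on \<open>K\<close> it
 is \<open>-cos\<^sup>2\<close> of the slant angle.\<close>

lemma slant_split_unique:
 assumes S: "slant_split T H K \<alpha>" and S': "slant_split T H' K' \<alpha>'" and K': "K' \<noteq> {0}" "\<alpha>' \<noteq> 0"
 shows "H' = H" "K' = K" "\<alpha>' = \<alpha>"
proof -
 note D = slant_splitD[OF S] and D' = slant_splitD[OF S']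
 note P = slant_split_P[OF S] and P' = slant_split_P[OF S']
 let ?P = "%z. orth_proj b T (\<phi> z)"
 have lP: "linear ?P" using linear_compose[OF lin\<phi> orth_proj_linear[OF b D(3)]] by (simp add: o_def)
 have a': "0 \<le> \<alpha>'" "\<alpha>' \<le> pi / 2" using P'(6)[OF K'(1)] by auto
 have c': "(cos \<alpha>')\<^sup>2 \<noteq> 1"
  using cos_sq_inj[of \<alpha>' 0] a' K'(2) by auto
 have P2: "?P (?P (h + k)) = - h + \<eta> h *\<^sub>R \<xi> - (cos \<alpha>)\<^sup>2 *\<^sub>R k" if "h \<in> H" "k \<in> K" for h k
  using P(1)[OF that(1)] P(1)[OF D(9)[OF that(1)]] P(5)[OF that(2)] by (simp add: linear_add[OF lP] \<phi>\<phi>)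
 have KK: "K' \<subseteq> K"
 proof
  fix z assume z: "z \<in> K'"
  then obtain h k where hk: "z = h + k" "h \<in> H" "k \<in> K" using D(11) D'(5) by blast
  have "\<eta> h = 0" using D'(10)[OF z] D(10)[OF hk(3)] by (simp add: hk(1) linear_add[OF lin\<eta>])
  then have "- h - (cos \<alpha>)\<^sup>2 *\<^sub>R k = - ((cos \<alpha>')\<^sup>2 *\<^sub>R (h + k))"
   using P2[OF hk(2,3)] P'(5)[OF z] hk(1) by simp
  \<comment> \<open>Pairing with \<open>h\<close> removes \<open>k\<close> and leaves the factor
    \<open>(cos \<alpha>')\<^sup>2 - 1\<close>, which is nonzero since
    \<open>\<alpha>' \<noteq> 0\<close>.\<close>
  then have "b (- h - (cos \<alpha>)\<^sup>2 *\<^sub>R k) h = b (- ((cos \<alpha>')\<^sup>2 *\<^sub>R (h + k))) h" by simp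
  then have "b h h * ((cos \<alpha>')\<^sup>2 - 1) = 0"
   using D(8)[OF hk(2,3)] by (simp add: bs algebra_simps)
  then have "h = 0" using c' iform_zero[OF b] by simp
  then show "z \<in> K" using hk by simp
 qed
 have "\<exists>z\<in>K'. z \<noteq> 0" using K'(1) subspace_0[OF D'(2)] by (auto simp: set_eq_iff)
 then obtain z where z: "z \<in> K'" "z \<noteq> 0" by blast
 have zK: "z \<in> K" using z KK by blast
 then have "K \<noteq> {0}" using z by blast
 from P(6)[OF this] have a: "0 \<le> \<alpha>" "\<alpha> \<le> pi / 2" by auto
 have "(cos \<alpha>)\<^sup>2 *\<^sub>R z = (cos \<alpha>')\<^sup>2 *\<^sub>R z" using P(5)[OF zK] P'(5)[OF z(1)] by (metis neg_equal_iff_equal)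
 then have cc: "(cos \<alpha>)\<^sup>2 = (cos \<alpha>')\<^sup>2" using z by simp
 then show "\<alpha>' = \<alpha>" using cos_sq_inj[of \<alpha> \<alpha>'] a a' by simp
 have HH: "H' \<subseteq> H"
 proof
  fix z assume z: "z \<in> H'"
  then obtain h k where hk: "z = h + k" "h \<in> H" "k \<in> K" using D(11) D'(4) by blast
  have "\<eta> z = \<eta> h" using D(10)[OF hk(3)] by (simp add: hk(1) linear_add[OF lin\<eta>])
  moreover have "?P (?P z) = - z + \<eta> z *\<^sub>R \<xi>" using P'(1)[OF z] P'(1)[OF D'(9)[OF z]] by (simp add: \<phi>\<phi>)
  ultimately have "- h + \<eta> h *\<^sub>R \<xi> - (cos \<alpha>)\<^sup>2 *\<^sub>R k = - (h + k) + \<eta> h *\<^sub>R \<xi>"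
   using P2[OF hk(2,3)] hk(1) by simp
  then have "(1 - (cos \<alpha>)\<^sup>2) *\<^sub>R k = 0" by (simp add: algebra_simps)
  then have "k = 0" using c' cc by simp
  then show "z \<in> H" using hk by simp
 qed
 show "H' = H"
 proof
  show "H \<subseteq> H'"
  proof
   fix h assume h: "h \<in> H"
   then obtain h' k' where hk: "h = h' + k'" "h' \<in> H'" "k' \<in> K'" using D'(11) D(4) by blast
   have "b h k' = 0" using D(7)[OF h] hk KK by blast
   then have "k' = 0" using D'(7)[OF hk(2,3)] iform_zero[OF b, of k'] by (simp add: hk(1) bs)
   then show "h \<in> H'" using hk by simp
  qed
 qed (rule HH)
 show "K' = K"
 proof
  show "K \<subseteq> K'"
  proof
   fix k assume k: "k \<in> K"
   then obtain h' k' where hk: "k = h' + k'" "h' \<in> H'" "k' \<in> K'" using D'(11) D(5) by blast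
   have "b h' k = 0" using D(7)[OF _ k] hk HH by blast
   then have "h' = 0" using D'(7)[OF hk(2,3)] iform_zero[OF b, of h'] by (simp add: hk(1) bs)
   then show "k \<in> K'" using hk by simp
  qed
 qed (rule KK)
qed

end

section \<open>The ambient connection along the submanifold\<close>

text \<open>The mean value theorem twice: in direction \<open>u\<close> for the difference over the
  step in direction \<open>v\<close>, then in direction \<open>v\<close> for the derivative along
  \<open>u\<close>.\<close>

lemma mixed_difference:
 fixes f :: "'m::euclidean_space => real"
 assumes T: "open T" "smooth_on T f" and box: "\<And>s t. 0 \<le> s ==> s \<le> h ==> 0 \<le> t ==> t \<le> h ==> x + s *\<^sub>R u + t *\<^sub>R v \<in> T"
  and h: "0 < h"
 shows "\<exists>s t. 0 < s \<and> s < h \<and> 0 < t \<and> t < h \<and>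
  f (x + h *\<^sub>R u + h *\<^sub>R v) - f (x + h *\<^sub>R u) - f (x + h *\<^sub>R v) + f x =
  h * h * fd (%y. fd f (at y) u) (at (x + s *\<^sub>R u + t *\<^sub>R v)) v"
proof -
 let ?D = "%y. fd f (at y) u"
 have lin: "fd p (at y) (r *\<^sub>R w) = r * fd p (at y) w"
  if "smooth_on T p" "y \<in> T" for p :: "'m => real" and y r w
  using linear_scale[OF has_derivative_linear[OF smooth_on_has_derivative[OF that]]] by simp
 have line: "((%s. p (a + s *\<^sub>R w)) has_derivative (%r. r * fd p (at (a + s *\<^sub>R w)) w)) (at s within S)"
  if p: "smooth_on T p" and m: "a + s *\<^sub>R w \<in> T" for p :: "'m => real" and a w s S
 proof -
  have "((%s. a + s *\<^sub>R w) has_derivative (%r. r *\<^sub>R w)) (at s)"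
   by (auto intro!: derivative_eq_intros)
  from has_derivative_compose[OF this smooth_on_has_derivative[OF p m]]
  have "((%s. p (a + s *\<^sub>R w)) has_derivative (%r. r * fd p (at (a + s *\<^sub>R w)) w)) (at s)"
   by (simp add: lin[OF p m])
  then show ?thesis by (rule has_derivative_at_withinI)
 qed
 have box0: "x + s *\<^sub>R u \<in> T" if "0 \<le> s" "s \<le> h" for s using box[of s 0] that h by simp
 define G where "G s = f ((x + h *\<^sub>R v) + s *\<^sub>R u) - f (x + s *\<^sub>R u)" for s
 have G: "(G has_derivative (%r. r * ?D ((x + h *\<^sub>R v) + s *\<^sub>R u) - r * ?D (x + s *\<^sub>R u))) (at s within {0..h})" if "s \<in> {0..h}" for s
  unfolding G_def[abs_def]
  by (intro has_derivative_diff line T(2)) (use box[of s h] box0[of s] that h in \<open>auto simp: ac_simps\<close>)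
 obtain s where s: "s \<in> {0<..<h}" "G h - G 0 = (h - 0) * ?D ((x + h *\<^sub>R v) + s *\<^sub>R u) - (h - 0) * ?D (x + s *\<^sub>R u)"
  using mvt_simple[OF h G] by auto
 have H: "((%t. ?D ((x + s *\<^sub>R u) + t *\<^sub>R v)) has_derivative
   (%r. r * fd ?D (at ((x + s *\<^sub>R u) + t *\<^sub>R v)) v)) (at t within {0..h})" if "t \<in> {0..h}" for t
  by (intro line smooth_on_frechet T(2) box) (use that s in auto)
 obtain t where t: "t \<in> {0<..<h}" "?D ((x + s *\<^sub>R u) + h *\<^sub>R v) - ?D ((x + s *\<^sub>R u) + 0 *\<^sub>R v) =
   (h - 0) * fd ?D (at ((x + s *\<^sub>R u) + t *\<^sub>R v)) v"
  using mvt_simple[OF h H] by auto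
 have "G h - G 0 = h * (?D ((x + s *\<^sub>R u) + h *\<^sub>R v) - ?D ((x + s *\<^sub>R u) + 0 *\<^sub>R v))"
  using s(2) by (simp add: ac_simps right_diff_distrib)
 also have "\<dots> = h * (h * fd ?D (at ((x + s *\<^sub>R u) + t *\<^sub>R v)) v)" unfolding t(2) by simp
 finally have "f (x + h *\<^sub>R u + h *\<^sub>R v) - f (x + h *\<^sub>R u) - f (x + h *\<^sub>R v) + f x =
  h * h * fd ?D (at (x + s *\<^sub>R u + t *\<^sub>R v)) v"
  by (simp add: G_def ac_simps)
 then show ?thesis using s(1) t(1) by auto
qed

text \<open>The second difference is symmetric in \<open>u\<close> and \<open>v\<close>, so the two
  mixed derivatives share a value at points arbitrarily near \<open>x\<close>; continuity does the
  rest.\<close>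

lemma second_derivative_symmetric_real:
 fixes f :: "'m::euclidean_space => real"
 assumes T: "open T" "smooth_on T f" "x \<in> T"
 shows "fd (%y. fd f (at y) u) (at x) v =
  fd (%y. fd f (at y) v) (at x) u"
proof -
 let ?A = "%u v y. fd (%y. fd f (at y) u) (at y) v"
 have c: "isCont (?A u v) x" for u v
  using smooth_on_continuous[OF smooth_on_frechet[OF smooth_on_frechet[OF T(2)]]] T(1,3)
  by (metis continuous_on_eq_continuous_at)
 have "\<bar>?A u v x - ?A v u x\<bar> < e" if e: "0 < e" for e
 proof -
  obtain d1 where d1: "d1 > 0" "\<And>y. dist y x < d1 ==> dist (?A u v y) (?A u v x) < e/2"
   using c[of u v] e unfolding continuous_at_eps_delta dist_norm by (meson half_gt_zero)
  obtain d2 where d2: "d2 > 0" "\<And>y. dist y x < d2 ==> dist (?A v u y) (?A v u x) < e/2"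
   using c[of v u] e unfolding continuous_at_eps_delta dist_norm by (meson half_gt_zero)
  obtain d3 where d3: "d3 > 0" "ball x d3 \<subseteq> T" using T open_contains_ball by blast
  define d where "d = min d1 (min d2 d3)"
  \<comment> \<open>Small enough for the parallelogram spanned by \<open>h *\<^sub>R u\<close> and
    \<open>h *\<^sub>R v\<close> at \<open>x\<close> to stay within distance \<open>d\<close>; the
    summand 1 keeps the denominator positive.\<close>
  define h where "h = d / (2 * (norm u + norm v + 1))"
  have d: "d > 0" using d1 d2 d3 by (simp add: d_def)
  have h: "h > 0" unfolding h_def using d by (intro divide_pos_pos mult_pos_pos) (auto intro: add_nonneg_pos)
  have near: "dist (x + s *\<^sub>R u + t *\<^sub>R v) x < d" if "0 \<le> s" "s \<le> h" "0 \<le> t" "t \<le> h" for s t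
  proof -
   have "norm (s *\<^sub>R u + t *\<^sub>R v) \<le> s * norm u + t * norm v"
    using norm_triangle_ineq[of "s *\<^sub>R u" "t *\<^sub>R v"] that by simp
   also have "\<dots> \<le> h * norm u + h * norm v" using that by (intro add_mono mult_right_mono) auto
   also have "\<dots> \<le> h * (norm u + norm v + 1)" using h by (simp add: algebra_simps)
   also have "\<dots> = d / 2" unfolding h_def by (simp add: field_simps add_nonneg_eq_0_iff)
   also have "\<dots> < d" using d by simp
   finally show ?thesis by (simp add: dist_norm add.assoc)
  qed
  have inT: "x + s *\<^sub>R u + t *\<^sub>R v \<in> T" if "0 \<le> s" "s \<le> h" "0 \<le> t" "t \<le> h" for s t
   using near[OF that] d3(2) by (auto simp: d_def dist_commute subset_iff)
  have inT': "x + s *\<^sub>R v + t *\<^sub>R u \<in> T" if "0 \<le> s" "s \<le> h" "0 \<le> t" "t \<le> h" for s t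
   using inT[OF that(3,4,1,2)] by (simp add: ac_simps)
  obtain s t where st: "0 < s" "s < h" "0 < t" "t < h"
   "f (x + h *\<^sub>R u + h *\<^sub>R v) - f (x + h *\<^sub>R u) - f (x + h *\<^sub>R v) + f x = h * h * ?A u v (x + s *\<^sub>R u + t *\<^sub>R v)"
   using mixed_difference[OF T(1,2) inT h] by blast
  obtain s' t' where st': "0 < s'" "s' < h" "0 < t'" "t' < h"
   "f (x + h *\<^sub>R v + h *\<^sub>R u) - f (x + h *\<^sub>R v) - f (x + h *\<^sub>R u) + f x = h * h * ?A v u (x + s' *\<^sub>R v + t' *\<^sub>R u)"
   using mixed_difference[OF T(1,2) inT' h] by blast
  have "h * h * ?A u v (x + s *\<^sub>R u + t *\<^sub>R v) = h * h * ?A v u (x + s' *\<^sub>R v + t' *\<^sub>R u)"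
  proof -
   have c: "x + h *\<^sub>R v + h *\<^sub>R u = x + h *\<^sub>R u + h *\<^sub>R v" by (simp add: ac_simps)
   show ?thesis using st(5) st'(5)[unfolded c] by linarith
  qed
  then have e1: "?A u v (x + s *\<^sub>R u + t *\<^sub>R v) = ?A v u (x + s' *\<^sub>R v + t' *\<^sub>R u)" using h by simp
  have "dist (x + s *\<^sub>R u + t *\<^sub>R v) x < d" "dist (x + t' *\<^sub>R u + s' *\<^sub>R v) x < d"
   using near[of s t] near[of t' s'] st st' by auto
  then have near1: "dist (x + s *\<^sub>R u + t *\<^sub>R v) x < d1" and near2: "dist (x + s' *\<^sub>R v + t' *\<^sub>R u) x < d2"
   by (auto simp: d_def ac_simps)
  have tri: "\<bar>p - r\<bar> < e" if "dist q p < e/2" "dist q r < e/2" for p q r :: real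
   using that dist_triangle_half_r[of q p e r] by (simp add: dist_real_def)
  show ?thesis by (rule tri[OF d1(2)[OF near1, unfolded e1] d2(2)[OF near2]])
 qed
 then show ?thesis by (metis abs_le_zero_iff eq_iff_diff_eq_0 less_irrefl not_less)
qed

lemma second_derivative_symmetric:
 fixes f :: "'m::euclidean_space => 'e::euclidean_space"
 assumes T: "open T" "smooth_on T f" "x \<in> T"
 shows "fd (%y. fd f (at y) u) (at x) v =
  fd (%y. fd f (at y) v) (at x) u"
proof (rule euclidean_eqI)
 fix i :: 'e
 have bl: "bounded_linear (%w::'e. w \<bullet> i)" by (rule bounded_linear_inner_left)
 have 1: "fd (%y. f y \<bullet> i) (at y) u = fd f (at y) u \<bullet> i" if "y \<in> T" for y u
  by (rule frechet_bounded_linear[OF bl smooth_on_differentiable[OF T(2) that]])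
 have 2: "fd (%y. fd (%y. f y \<bullet> i) (at y) u) (at x) v =
   fd (%y. fd f (at y) u) (at x) v \<bullet> i" for u v
 proof -
  have "fd (%y. fd (%y. f y \<bullet> i) (at y) u) (at x) =
    fd (%y. fd f (at y) u \<bullet> i) (at x)"
   by (rule frechet_derivative_cong_open(1)[OF T(1,3)]) (rule 1)
  moreover have "fd (%y. fd f (at y) u \<bullet> i) (at x) v =
    fd (%y. fd f (at y) u) (at x) v \<bullet> i"
   by (rule frechet_bounded_linear[OF bl smooth_on_differentiable[OF smooth_on_frechet[OF T(2)] T(3)]])
  ultimately show ?thesis by simp
 qed
 show "fd (%y. fd f (at y) u) (at x) v \<bullet> i =
  fd (%y. fd f (at y) v) (at x) u \<bullet> i"
  using second_derivative_symmetric_real[OF T(1) smooth_on_bounded_linear[OF bl T(1,2)] T(3), where u=u and v=v] by (simp only: 2)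
qed

locale cosymplectic_immersion =
 fixes A :: "('a, 'e::euclidean_space) acm" and M :: "('b, 'm::euclidean_space) manifold" and j :: "'b => 'a"
 assumes cos: "cosymplectic A" and M: "smooth_manifold M" and im: "immersion M A j"

sublocale cosymplectic_immersion \<subseteq> immersed_manifold M A j
 using cos M im by unfold_locales (auto simp: cosymplectic_def almost_contact_metric_def)

context cosymplectic_immersion
begin

lemma acm: "almost_contact_metric A" using cos by (simp add: cosymplectic_def)

lemma acm_at:
 assumes "r \<in> points A"
 shows "acm_point (met A r) (phi A r) (eta A r) (xi A r)"
proof -
 have "riemannian_metric A (met A)" using acm unfolding almost_contact_metric_def by blast
 then have "inner_form (met A r)" using assms unfolding riemannian_metric_def inner_form_def by blast
 then show ?thesis using acm assms unfolding almost_contact_metric_def acm_point_def by auto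
qed

lemma met_form: "r \<in> points A ==> inner_form (met A r)"
 using acm_at acm_point.b by blast

lemma met_in_smooth: "b \<in> points A ==> smooth_on (cmap A b ` cdom A b) (%z. met_in A (met A) b z u v)"
 using acm unfolding almost_contact_metric_def riemannian_metric_def by blast

lemma phi_smooth: "b \<in> points A ==>
 smooth_on (cmap A b ` cdom A b) (%x. let r = cinv A b x in trans A r b r (phi A r (trans A b r r u)))"
 using acm unfolding almost_contact_metric_def by blast

lemma xi_smooth: "smooth_along A A (%p. p) (points A) (xi A)"
 using acm unfolding almost_contact_metric_def by blast

lemma rep_inverse:
 assumes "b \<in> points A" "r \<in> cdom A b"
 shows "trans A b r r (rep A b r u) = u" "rep A b r (trans A b r r u) = u" "linear (rep A b r)" "linear (trans A b r r)"
proof -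
 have r: "r \<in> points A" using assms cdomD(3)[OF A assms(1)] by auto
 note rr = cdomD(1)[OF A r]
 show "trans A b r r (rep A b r u) = u"
  using trans_trans[OF A r assms(1) r rr assms(2) rr] trans_refl[OF A r rr] by simp
 show "rep A b r (trans A b r r u) = u"
  using trans_trans[OF A assms(1) r assms(1) assms(2) rr assms(2)] trans_refl[OF A assms] by simp
 show "linear (rep A b r)" "linear (trans A b r r)"
  using trans_has_derivative(2)[OF A r assms(1) rr assms(2)] trans_has_derivative(2)[OF A assms(1) r assms(2) rr] by auto
qed

lemma met_rep:
 assumes "b \<in> points A" "r \<in> cdom A b"
 shows "met A r u v = met_in A (met A) b (cmap A b r) (rep A b r u) (rep A b r v)"
 unfolding met_in_def Let_def param_cinv(2)[OF A assms] by (simp add: rep_inverse[OF assms])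

lemma met_in_bilinear:
 assumes "b \<in> points A" "z \<in> cmap A b ` cdom A b"
 shows "linear (met_in A (met A) b z u)" "linear (%u. met_in A (met A) b z u v)" "met_in A (met A) b z u v = met_in A (met A) b z v u"
proof -
 obtain r where r: "r \<in> cdom A b" "z = cmap A b r" using assms by auto
 have rp: "r \<in> points A" using r cdomD(3)[OF A assms(1)] by auto
 have e: "met_in A (met A) b z u v = met A r (trans A b r r u) (trans A b r r v)" for u v
  by (simp add: met_in_def Let_def r(2) param_cinv(2)[OF A assms(1) r(1)])
 note l = linear_compose[OF rep_inverse(4)[OF assms(1) r(1)], unfolded o_def]
 show "linear (met_in A (met A) b z u)" "linear (%u. met_in A (met A) b z u v)"
  unfolding e[abs_def] by (rule l[OF iform_lin(1)[OF met_form[OF rp]]], rule l[OF iform_lin(2)[OF met_form[OF rp]]])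
 show "met_in A (met A) b z u v = met_in A (met A) b z v u" unfolding e by (rule iform_sym[OF met_form[OF rp]])
qed

lemma met_in_self:
 assumes "b \<in> points A"
 shows "met_in A (met A) b (cmap A b b) u v = met A b u v"
 using met_rep[OF assms cdomD(1)[OF A assms], of u v] trans_refl[OF A assms cdomD(1)[OF A assms]] by simp

definition dmet :: "'a => 'e => 'e => 'e => real" where
 "dmet b w u v = fd (%x. met_in A (met A) b x u v) (at (cmap A b b)) w"

lemma dmet_facts:
 assumes b: "b \<in> points A"
 shows "linear (%w. dmet b w u v)" "linear (dmet b w u)" "dmet b w u v = dmet b w v u"
proof -
 let ?S = "cmap A b ` cdom A b"
 have S: "open ?S" "cmap A b b \<in> ?S" using cdomD[OF A b] by auto
 show "linear (%w. dmet b w u v)"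
  unfolding dmet_def using smooth_on_has_derivative[OF met_in_smooth[OF b] S(2)] has_derivative_linear by blast
 show "linear (dmet b w u)" unfolding dmet_def[abs_def]
  by (rule linear_family_has_derivative(2)[OF S met_in_bilinear(1)[OF b] met_in_smooth[OF b] has_derivative_const])
 have "met_in A (met A) b z u v = met_in A (met A) b z v u" if "z \<in> ?S" for z
  by (rule met_in_bilinear(3)[OF b that])
 from frechet_derivative_cong_open(1)[OF S this] show "dmet b w u v = dmet b w v u"
  unfolding dmet_def by simp
qed

lemma christoffel:
 assumes b: "b \<in> points A"
 shows "met A b (christoffel A (met A) b u v) z = (dmet b u v z + dmet b v u z - dmet b z u v) / 2"
proof -
 note f = dmet_facts[OF b]
 have lin: "linear (%z. (dmet b u v z + dmet b v u z - dmet b z u v) / 2)"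
  using linear_compose_scale_right[OF linear_compose_sub[OF linear_compose_add[OF f(2)[of u v] f(2)[of v u]] f(1)[of u v]], of "1/2"]
  by simp
 have "christoffel A (met A) b u v = (THE w. \<forall>z. met A b w z = (dmet b u v z + dmet b v u z - dmet b z u v) / 2)"
  by (simp add: christoffel_def dmet_def)
 with theI'[OF iform_riesz[OF met_form[OF b] lin]] show ?thesis by simp
qed

lemma christoffel_sym:
 assumes b: "b \<in> points A"
 shows "christoffel A (met A) b u v = christoffel A (met A) b v u"
 by (rule iform_eqI[OF met_form[OF b] subspace_UNIV UNIV_I UNIV_I])
  (simp add: christoffel[OF b] dmet_facts(3)[OF b, of _ u v])

text \<open>In the sum of the two Koszul expressions all derivatives of the metric cancel except the
  one along \<open>w\<close>.\<close>

lemma christoffel_metric: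
 assumes b: "b \<in> points A"
 shows "met A b (christoffel A (met A) b w u) v + met A b u (christoffel A (met A) b w v) = dmet b w u v"
proof -
 have s: "met A b u (christoffel A (met A) b w v) = met A b (christoffel A (met A) b w v) u"
  by (rule iform_sym[OF met_form[OF b]])
 show ?thesis unfolding s christoffel[OF b] dmet_facts(3)[OF b, of w v u] by (simp add: add_divide_distrib diff_divide_distrib)
qed

definition phi_in :: "'a => 'e => 'e => 'e" where
 "phi_in b z u = (let r = cinv A b z in trans A r b r (phi A r (trans A b r r u)))"

lemma phi_in_facts:
 assumes b: "b \<in> points A"
 shows "r \<in> cdom A b ==> phi_in b (cmap A b r) (rep A b r u) = rep A b r (phi A r u)"
  and "z \<in> cmap A b ` cdom A b ==> linear (phi_in b z)"
  and "smooth_on (cmap A b ` cdom A b) (%z. phi_in b z u)"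
proof -
 show "r \<in> cdom A b ==> phi_in b (cmap A b r) (rep A b r u) = rep A b r (phi A r u)"
  unfolding phi_in_def Let_def by (simp add: param_cinv(2)[OF A b] rep_inverse[OF b])
 show "linear (phi_in b z)" if z: "z \<in> cmap A b ` cdom A b"
 proof -
  obtain r where r: "r \<in> cdom A b" "z = cmap A b r" using z by auto
  have rp: "r \<in> points A" using r cdomD(3)[OF A b] by auto
  have "phi_in b z = rep A b r \<circ> (phi A r \<circ> trans A b r r)"
   unfolding phi_in_def[abs_def] Let_def r(2) by (simp add: param_cinv(2)[OF A b r(1)] o_def)
  then show ?thesis
   using rep_inverse(3,4)[OF b r(1)] acm_point.lin\<phi>[OF acm_at[OF rp]] by (simp add: linear_compose)
 qed
 show "smooth_on (cmap A b ` cdom A b) (%z. phi_in b z u)"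
  unfolding phi_in_def by (rule phi_smooth[OF b])
qed

definition nab :: "'b => 'e => ('b => 'e) => 'e" where
 "nab q X Y = nabla M A (met A) j q (intrinsic M A j q X) Y"

abbreviation sect where "sect \<equiv> is_section A M j"

abbreviation g where "g q \<equiv> met A (j q)"

context
 fixes W F c x
 assumes P: "param M W F c" and x: "x \<in> W"
begin

lemma Fx: "F x \<in> points M" "j (F x) \<in> points A"
 using paramD(4)[OF M P x] iota_points by auto

lemma rep_smooth_near:
 assumes V: "openin (mtop M) V" "F x \<in> V"
 obtains T where "open T" "x \<in> T" "T \<subseteq> W" "\<And>y. y \<in> T ==> F y \<in> V" "\<And>y. y \<in> T ==> j (F y) \<in> cdom A (j (F x))"
  "smooth_on T (%y. cmap A (j (F x)) (j (F y)))"
  "\<And>Y. smooth_along M A j V Y ==> smooth_on T (%y. rep A (j (F x)) (j (F y)) (Y (F y)))"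
proof -
 let ?T = "{y \<in> W. j (F y) \<in> cdom A (j (F x))} \<inter> {y \<in> W. F y \<in> V}"
 have e: "?T = {y \<in> W. F y \<in> V \<and> j (F y) \<in> cdom A (j (F x))}" by auto
 show ?thesis
 proof (rule that[of ?T])
  show "open ?T" by (intro open_Int base_open(1)[OF P Fx(2)] paramD(6)[OF M P V(1)])
  show "x \<in> ?T" using x V cdomD(1)[OF A Fx(2)] by simp
  show "smooth_on ?T (%y. cmap A (j (F x)) (j (F y)))"
   by (rule smooth_on_subset[OF base_open(2)[OF P Fx(2)]]) blast
  show "smooth_on ?T (%y. rep A (j (F x)) (j (F y)) (Y (F y)))" if "smooth_along M A j V Y" for Y
   unfolding e by (rule smooth_along_param[OF P Fx(2) V(1) that])
 qed auto
qed

lemma rep_self: "rep A (j (F x)) (j (F x)) v = v"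
 by (rule trans_refl[OF A Fx(2) cdomD(1)[OF A Fx(2)]])

lemma nab_tvec:
 assumes V: "openin (mtop M) V" "F x \<in> V" and Y: "smooth_along M A j V Y"
 shows "((%y. rep A (j (F x)) (j (F y)) (Y (F y))) has_derivative
  (%u. nab (F x) (tvec F x u) Y - christoffel A (met A) (j (F x)) (tvec F x u) (Y (F x)))) (at x)"
proof -
 let ?T = "{y \<in> W. F y \<in> V \<and> j (F y) \<in> cdom A (j (F x))}"
 have "x \<in> ?T" using x V(2) cdomD(1)[OF A Fx(2)] by simp
 from smooth_on_differentiable[OF smooth_along_param[OF P Fx(2) V(1) Y] this]
 have d: "(%y. rep A (j (F x)) (j (F y)) (Y (F y))) differentiable (at x)" .
 show ?thesis
  using d unfolding frechet_derivative_works nab_def nabla_param[OF P x d] by simp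
qed

lemma J_has_derivative: "((%y. cmap A (j (F x)) (j (F y))) has_derivative tvec F x) (at x)"
 using tvec_diff[OF P x] unfolding frechet_derivative_works tvec_def[abs_def] by simp

text \<open>The product rule produces the derivative of the metric coefficients along the immersion;
  by \<open>christoffel_metric\<close> it equals the Christoffel terms contained in the two
  covariant derivatives.\<close>

lemma nab_metric:
 assumes V: "openin (mtop M) V" "F x \<in> V" and Y: "smooth_along M A j V Y" and Z: "smooth_along M A j V Z"
 shows "((%y. g (F y) (Y (F y)) (Z (F y))) has_derivative
  (%u. g (F x) (nab (F x) (tvec F x u) Y) (Z (F x)) + g (F x) (Y (F x)) (nab (F x) (tvec F x u) Z))) (at x)"
proof -
 define b where "b = j (F x)"
 have b: "b \<in> points A" using Fx by (simp add: b_def)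
 let ?S = "cmap A b ` cdom A b"
 have S: "open ?S" by (rule cdomD(4)[OF A b])
 obtain T where T: "open T" "x \<in> T" "T \<subseteq> W" "\<And>y. y \<in> T ==> F y \<in> V" "\<And>y. y \<in> T ==> j (F y) \<in> cdom A b"
  "smooth_on T (%y. cmap A b (j (F y)))"
  "\<And>Y. smooth_along M A j V Y ==> smooth_on T (%y. rep A b (j (F y)) (Y (F y)))"
  unfolding b_def by (rule rep_smooth_near[OF V]) blast
 define J where "J y = cmap A b (j (F y))" for y
 define R where "R Y y = rep A b (j (F y)) (Y (F y))" for Y y
 have JS: "J y \<in> ?S" if "y \<in> T" for y using T(5)[OF that] by (simp add: J_def)
 have Js: "smooth_on T J" using T(6) by (simp add: J_def[abs_def])
 have Rs: "smooth_on T (R Y)" "smooth_on T (R Z)" using T(7)[OF Y] T(7)[OF Z] by (simp_all add: R_def[abs_def])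
 have s0: "smooth_on T (%y. met_in A (met A) b (J y) u v)" for u v
  by (rule smooth_on_compose[OF T(1) S _ Js met_in_smooth[OF b]]) (use JS in auto)
 have l2: "linear (%u. met_in A (met A) b (J y) u v)" if "y \<in> T" for y v
  by (rule met_in_bilinear(2)[OF b JS[OF that]])
 have l1: "linear (%v. met_in A (met A) b (J y) (R Y y) v)" if "y \<in> T" for y
  by (rule met_in_bilinear(1)[OF b JS[OF that]])
 have s1: "smooth_on T (%y. met_in A (met A) b (J y) (R Y y) v)" for v
  by (rule smooth_on_linear_family[where L="%y u. met_in A (met A) b (J y) u v", OF T(1) l2 s0 Rs(1)])
 have Yd: "(R Y has_derivative (%u. nab (F x) (tvec F x u) Y - christoffel A (met A) b (tvec F x u) (Y (F x)))) (at x)"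
  and Zd: "(R Z has_derivative (%u. nab (F x) (tvec F x u) Z - christoffel A (met A) b (tvec F x u) (Z (F x)))) (at x)"
  unfolding R_def[abs_def] b_def by (rule nab_tvec[OF V Y], rule nab_tvec[OF V Z])
 have Rx: "R Y x = Y (F x)" "R Z x = Z (F x)" unfolding R_def b_def by (simp_all add: rep_self)
 have Jx: "J x = cmap A b b" by (simp add: J_def b_def)
 have d0: "((%y. met_in A (met A) b (J y) u v) has_derivative (%w. dmet b (tvec F x w) u v)) (at x)" for u v
 proof -
  have "(J has_derivative tvec F x) (at x)" using J_has_derivative by (simp add: J_def[abs_def] b_def)
  moreover have "((%z. met_in A (met A) b z u v) has_derivative (%w. dmet b w u v)) (at (J x))"
   unfolding dmet_def Jx using smooth_on_has_derivative[OF met_in_smooth[OF b]] JS[OF T(2)] Jx by simp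
  ultimately show ?thesis by (rule has_derivative_compose)
 qed
 have d1: "((%y. met_in A (met A) b (J y) (R Y y) v) has_derivative
  (%w. dmet b (tvec F x w) (Y (F x)) v + met A b (nab (F x) (tvec F x w) Y - christoffel A (met A) b (tvec F x w) (Y (F x))) v)) (at x)" for v
  using linear_family_has_derivative(1)[where L="%y u. met_in A (met A) b (J y) u v", OF T(1,2) l2 s0 Yd]
  unfolding Rx Jx met_in_self[OF b] frechet_derivative_at[OF d0, symmetric] .
 have d2: "((%y. met_in A (met A) b (J y) (R Y y) (R Z y)) has_derivative
  (%w. (dmet b (tvec F x w) (Y (F x)) (Z (F x)) + met A b (nab (F x) (tvec F x w) Y - christoffel A (met A) b (tvec F x w) (Y (F x))) (Z (F x)))
   + met A b (Y (F x)) (nab (F x) (tvec F x w) Z - christoffel A (met A) b (tvec F x w) (Z (F x))))) (at x)"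
  using linear_family_has_derivative(1)[where L="%y v. met_in A (met A) b (J y) (R Y y) v", OF T(1,2) l1 s1 Zd]
  unfolding Rx Jx met_in_self[OF b] frechet_derivative_at[OF d1, symmetric] .
 have eq: "met_in A (met A) b (J y) (R Y y) (R Z y) = g (F y) (Y (F y)) (Z (F y))" if "y \<in> T" for y
  unfolding J_def R_def by (rule met_rep[OF b T(5)[OF that], symmetric])
 note mf = iform_simps[OF met_form[OF b]]
 have d2': "((%y. met_in A (met A) b (J y) (R Y y) (R Z y)) has_derivative
  (%u. g (F x) (nab (F x) (tvec F x u) Y) (Z (F x)) + g (F x) (Y (F x)) (nab (F x) (tvec F x u) Z))) (at x)"
  using d2
 proof (rule has_derivative_eq_rhs, intro ext)
  fix u
  show "dmet b (tvec F x u) (Y (F x)) (Z (F x)) + met A b (nab (F x) (tvec F x u) Y - christoffel A (met A) b (tvec F x u) (Y (F x))) (Z (F x))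
   + met A b (Y (F x)) (nab (F x) (tvec F x u) Z - christoffel A (met A) b (tvec F x u) (Z (F x)))
   = g (F x) (nab (F x) (tvec F x u) Y) (Z (F x)) + g (F x) (Y (F x)) (nab (F x) (tvec F x u) Z)"
   unfolding christoffel_metric[OF b, symmetric] mf(3) mf(4) b_def[symmetric] by linarith
 qed
 show "((%y. g (F y) (Y (F y)) (Z (F y))) has_derivative
  (%u. g (F x) (nab (F x) (tvec F x u) Y) (Z (F x)) + g (F x) (Y (F x)) (nab (F x) (tvec F x u) Z))) (at x)"
  by (rule has_derivative_transform_within_open[OF d2' T(1,2)]) (rule eq)
qed

lemma met_smooth:
 assumes b: "b \<in> points A" and T: "open T" "T \<subseteq> W" "\<And>y. y \<in> T ==> j (F y) \<in> cdom A b"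
  and Y: "smooth_on T (%y. rep A b (j (F y)) (Y y))" and Z: "smooth_on T (%y. rep A b (j (F y)) (Z y))"
 shows "smooth_on T (%y. g (F y) (Y y) (Z y))"
proof -
 let ?S = "cmap A b ` cdom A b"
 have S: "open ?S" by (rule cdomD(4)[OF A b])
 define J where "J y = cmap A b (j (F y))" for y
 have JS: "J y \<in> ?S" if "y \<in> T" for y using T(3)[OF that] by (simp add: J_def)
 have Js: "smooth_on T J" unfolding J_def[abs_def]
  by (rule smooth_on_subset[OF base_open(2)[OF P b]]) (use T(2,3) in auto)
 have s0: "smooth_on T (%y. met_in A (met A) b (J y) u v)" for u v
  by (rule smooth_on_compose[OF T(1) S _ Js met_in_smooth[OF b]]) (use JS in auto)
 have s1: "smooth_on T (%y. met_in A (met A) b (J y) (rep A b (j (F y)) (Y y)) v)" for v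
  by (rule smooth_on_linear_family[where L="%y u. met_in A (met A) b (J y) u v", OF T(1) met_in_bilinear(2)[OF b JS] s0 Y])
 have "smooth_on T (%y. met_in A (met A) b (J y) (rep A b (j (F y)) (Y y)) (rep A b (j (F y)) (Z y)))"
  by (rule smooth_on_linear_family[where L="%y v. met_in A (met A) b (J y) (rep A b (j (F y)) (Y y)) v", OF T(1) met_in_bilinear(1)[OF b JS] s1 Z])
 then show ?thesis
  by (rule smooth_on_cong[OF T(1), rotated]) (simp only: J_def met_rep[OF b T(3)])
qed

lemma phi_smooth_rep:
 assumes b: "b \<in> points A" and T: "open T" "T \<subseteq> W" "\<And>y. y \<in> T ==> j (F y) \<in> cdom A b"
  and Y: "smooth_on T (%y. rep A b (j (F y)) (Y y))"
 shows "smooth_on T (%y. rep A b (j (F y)) (phi A (j (F y)) (Y y)))"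
proof -
 let ?S = "cmap A b ` cdom A b"
 have S: "open ?S" by (rule cdomD(4)[OF A b])
 define J where "J y = cmap A b (j (F y))" for y
 have JS: "J y \<in> ?S" if "y \<in> T" for y using T(3)[OF that] by (simp add: J_def)
 have Js: "smooth_on T J" unfolding J_def[abs_def]
  by (rule smooth_on_subset[OF base_open(2)[OF P b]]) (use T(2,3) in auto)
 have s0: "smooth_on T (%y. phi_in b (J y) u)" for u
  by (rule smooth_on_compose[OF T(1) S _ Js phi_in_facts(3)[OF b]]) (use JS in auto)
 have "smooth_on T (%y. phi_in b (J y) (rep A b (j (F y)) (Y y)))"
  by (rule smooth_on_linear_family[where L="%y. phi_in b (J y)", OF T(1) phi_in_facts(2)[OF b JS] s0 Y])
 then show ?thesis
  by (rule smooth_on_cong[OF T(1), rotated]) (simp only: J_def phi_in_facts(1)[OF b T(3)])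
qed

end

lemma smooth_along_near:
 assumes V: "openin (mtop M) V"
  and sm: "\<And>W F c x T b. param M W F c ==> x \<in> W ==> open T ==> x \<in> T ==> T \<subseteq> W ==> b \<in> points A ==>
   (\<And>y. y \<in> T ==> F y \<in> V) ==> (\<And>y. y \<in> T ==> j (F y) \<in> cdom A b) ==>
   (\<And>Y. smooth_along M A j V Y ==> smooth_on T (%y. rep A b (j (F y)) (Y (F y)))) ==>
   smooth_on T (%y. rep A b (j (F y)) (Z (F y)))"
 shows "smooth_along M A j V Z"
proof (rule smooth_alongI[OF V])
 fix p assume p: "p \<in> V"
 have pM: "p \<in> points M" using p openin_subset[OF V] by blast
 note Pc = param_cinv[OF M pM]
 let ?x = "cmap M p p"
 have x: "?x \<in> cmap M p ` cdom M p" "cinv M p ?x = p" using cdomD(1)[OF M pM] Pc(2) by auto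
 have b: "j p \<in> points A" by (rule iota_points[OF pM])
 obtain T where T: "open T" "?x \<in> T" "T \<subseteq> cmap M p ` cdom M p" "\<And>y. y \<in> T ==> cinv M p y \<in> V"
  "\<And>y. y \<in> T ==> j (cinv M p y) \<in> cdom A (j p)"
  "\<And>Y. smooth_along M A j V Y ==> smooth_on T (%y. rep A (j p) (j (cinv M p y)) (Y (cinv M p y)))"
  by (rule rep_smooth_near[OF Pc(1) x(1) V]) (use x(2) p in auto)
 have "smooth_on T (%y. rep A (j p) (j (cinv M p y)) (Z (cinv M p y)))"
  by (rule sm[OF Pc(1) x(1) T(1,2,3) b T(4,5,6)])
 moreover have "p \<in> cinv M p ` T" using T(2) x(2) by force
 moreover have "T \<subseteq> {x \<in> cmap M p ` cdom M p. cinv M p x \<in> V \<and> j (cinv M p x) \<in> cdom A (j p)}" using T(3,4,5) by auto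
 ultimately show "\<exists>W F c b T. param M W F c \<and> b \<in> points A \<and> open T \<and> T \<subseteq> {x \<in> W. F x \<in> V \<and> j (F x) \<in> cdom A b} \<and>
   p \<in> F ` T \<and> smooth_on T (%x. rep A b (j (F x)) (Z (F x)))"
  using Pc(1) b T(1) by blast
qed

lemma smooth_along_phi:
 assumes V: "openin (mtop M) V" and Y: "smooth_along M A j V Y"
 shows "smooth_along M A j V (%q. phi A (j q) (Y q))"
 by (rule smooth_along_near[OF V]) (rule phi_smooth_rep; use Y in blast)

lemma mderiv_ident:
 assumes p: "p \<in> points A"
 shows "mderiv A A (%p. p) p u = u"
proof -
 have "fd (%y. cmap A p (cinv A p y)) (at (cmap A p p)) = fd (%y. y) (at (cmap A p p))"
  by (rule frechet_derivative_cong_open(1)[OF cdomD(4)[OF A p]])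
   (use cdomD(1)[OF A p] param_cinv(2)[OF A p] in auto)
 then show ?thesis by (simp add: mderiv_def o_def)
qed

lemma ident_immersion: "immersed_manifold A A (%p. p)"
proof
 show "immersion A A (%p. p)"
  unfolding immersion_def using smooth_map_ident[OF A] mderiv_ident by (simp add: inj_on_def)
qed (rule A)+

lemma smooth_along_xi: "smooth_along M A j (points M) (%q. xi A (j q))"
proof (rule smooth_along_near)
 fix W F c x T b
 assume h: "param M W F c" "open T" "T \<subseteq> W" "b \<in> points A" "\<And>y. y \<in> T ==> j (F y) \<in> cdom A b"
 note Pb = param_cinv[OF A h(4)]
 let ?S = "cmap A b ` cdom A b"
 have "{z \<in> ?S. cinv A b z \<in> points A \<and> cinv A b z \<in> cdom A b} = ?S"
  using Pb(2) cdomD(3)[OF A h(4)] by auto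
 then have s: "smooth_on ?S (%z. rep A b (cinv A b z) (xi A (cinv A b z)))"
  using immersed_manifold.smooth_along_param[OF ident_immersion Pb(1) h(4) _ xi_smooth] by simp
 have "smooth_on T (%y. rep A b (cinv A b (cmap A b (j (F y)))) (xi A (cinv A b (cmap A b (j (F y))))))"
  by (rule smooth_on_compose[OF h(2) cdomD(4)[OF A h(4)] _ smooth_on_subset[OF base_open(2)[OF h(1) h(4)]] s])
   (use h in auto)
 then show "smooth_on T (%y. rep A b (j (F y)) (xi A (j (F y))))"
  by (rule smooth_on_cong[OF h(2), rotated]) (simp add: Pb(2)[OF h(5)])
qed simp

text \<open>\<nabla>\<phi> = 0 tested on a field with constant coordinates \<open>w\<close> near
  \<open>p\<close>: the derivative of the field drops out, and that of the matrix of \<phi>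
  remains.\<close>

lemma phi_in_derivative:
 assumes p: "p \<in> points A"
 shows "fd (%z. phi_in p z w) (at (cmap A p p)) u + christoffel A (met A) p u (phi A p w)
  = phi A p (christoffel A (met A) p u w)"
proof -
 interpret AA: immersed_manifold A A "%p. p" by (rule ident_immersion)
 note Pc = param_cinv[OF A p] and pc = cdomD[OF A p]
 define Yc where "Yc q = trans A p q q w" for q
 have rep_Yc: "rep A p q (Yc q) = w" if "q \<in> cdom A p" for q
  unfolding Yc_def by (rule rep_inverse(2)[OF p that])
 have "smooth_along A A (%q. q) (cdom A p) Yc"
 proof (rule AA.smooth_alongI[OF pc(2)])
  fix q assume q: "q \<in> cdom A p"
  let ?S = "cmap A p ` cdom A p"
  have "smooth_on ?S (%x. rep A p (cinv A p x) (Yc (cinv A p x)))"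
   by (rule smooth_on_cong[OF pc(4) _ smooth_on_const[of _ w]]) (auto simp: Pc(2) rep_Yc)
  moreover have "q \<in> cinv A p ` ?S" using Pc(3) q by simp
  moreover have "?S \<subseteq> {x \<in> ?S. cinv A p x \<in> cdom A p \<and> cinv A p x \<in> cdom A p}" using Pc(2) by auto
  ultimately show "\<exists>W F c b T. param A W F c \<and> b \<in> points A \<and> open T \<and> T \<subseteq> {x \<in> W. F x \<in> cdom A p \<and> F x \<in> cdom A b} \<and>
   q \<in> F ` T \<and> smooth_on T (%x. rep A b (F x) (Yc (F x)))"
   using Pc(1) p pc(4) by blast
 qed
 then have "nabla A A (met A) (%q. q) p u (%q. phi A q (Yc q)) = phi A p (nabla A A (met A) (%q. q) p u Yc)"
  using cos p pc(1,2) unfolding cosymplectic_def by blast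
 moreover have "fd (%x. rep A p (cinv A p x) (Yc (cinv A p x))) (at (cmap A p p)) =
   fd (%x. w) (at (cmap A p p))"
  by (rule frechet_derivative_cong_open(1)[OF pc(4)]) (use pc(1) Pc(2) rep_Yc in auto)
 moreover have "Yc p = w" unfolding Yc_def by (rule trans_refl[OF A p pc(1)])
 moreover have "(%x. rep A p (cinv A p x) (phi A (cinv A p x) (Yc (cinv A p x)))) = (%z. phi_in p z w)"
  by (simp add: phi_in_def Yc_def Let_def fun_eq_iff)
 ultimately show ?thesis by (simp add: nabla_def Let_def mderiv_ident[OF p])
qed

text \<open>The cosymplectic condition speaks of fields on the ambient manifold, whereas
  \<open>Y\<close> is given only along the immersion and need not extend. The coordinate form
  \<open>phi_in_derivative\<close> involves values only, so the product rule carries it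
  over.\<close>

lemma nab_phi:
 assumes P: "param M W F c" and x: "x \<in> W"
  and V: "openin (mtop M) V" "F x \<in> V" and Y: "smooth_along M A j V Y"
 shows "nab (F x) (tvec F x u) (%q. phi A (j q) (Y q)) = phi A (j (F x)) (nab (F x) (tvec F x u) Y)"
proof -
 define b where "b = j (F x)"
 have b: "b \<in> points A" using Fx[OF P x] by (simp add: b_def)
 let ?S = "cmap A b ` cdom A b"
 have S: "open ?S" by (rule cdomD(4)[OF A b])
 obtain T where T: "open T" "x \<in> T" "T \<subseteq> W" "\<And>y. y \<in> T ==> F y \<in> V" "\<And>y. y \<in> T ==> j (F y) \<in> cdom A b"
  "smooth_on T (%y. cmap A b (j (F y)))"
  "\<And>Y. smooth_along M A j V Y ==> smooth_on T (%y. rep A b (j (F y)) (Y (F y)))"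
  unfolding b_def by (rule rep_smooth_near[OF P x V]) blast
 define J where "J y = cmap A b (j (F y))" for y
 define R where "R y = rep A b (j (F y)) (Y (F y))" for y
 have JS: "J y \<in> ?S" if "y \<in> T" for y using T(5)[OF that] by (simp add: J_def)
 have Js: "smooth_on T J" using T(6) by (simp add: J_def[abs_def])
 have Jx: "J x = cmap A b b" by (simp add: J_def b_def)
 have Rx: "R x = Y (F x)" unfolding R_def b_def by (simp add: rep_self[OF P x])
 have s0: "smooth_on T (%y. phi_in b (J y) u)" for u
  by (rule smooth_on_compose[OF T(1) S _ Js phi_in_facts(3)[OF b]]) (use JS in auto)
 have Yd: "(R has_derivative (%u. nab (F x) (tvec F x u) Y - christoffel A (met A) b (tvec F x u) (Y (F x)))) (at x)"
  unfolding R_def[abs_def] b_def by (rule nab_tvec[OF P x V Y])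
 have d0: "((%y. phi_in b (J y) w) has_derivative (%u. fd (%z. phi_in b z w) (at (cmap A b b)) (tvec F x u))) (at x)" for w
 proof -
  have "(J has_derivative tvec F x) (at x)" using J_has_derivative[OF P x] by (simp add: J_def[abs_def] b_def)
  moreover have "((%z. phi_in b z w) has_derivative fd (%z. phi_in b z w) (at (cmap A b b))) (at (J x))"
   unfolding Jx using smooth_on_has_derivative[OF phi_in_facts(3)[OF b]] JS[OF T(2)] Jx by simp
  ultimately show ?thesis by (rule has_derivative_compose)
 qed
 have pb: "phi_in b (J x) w = phi A b w" for w
  using phi_in_facts(1)[OF b cdomD(1)[OF A b], of w] trans_refl[OF A b cdomD(1)[OF A b]] by (simp add: Jx)
 have l\<phi>: "linear (phi A b)" using acm_point.lin\<phi>[OF acm_at[OF b]] .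
 have "((%y. phi_in b (J y) (R y)) has_derivative
  (%u. fd (%z. phi_in b z (Y (F x))) (at (cmap A b b)) (tvec F x u) +
    phi A b (nab (F x) (tvec F x u) Y - christoffel A (met A) b (tvec F x u) (Y (F x))))) (at x)"
  using linear_family_has_derivative(1)[where L="%y. phi_in b (J y)", OF T(1,2) phi_in_facts(2)[OF b JS] s0 Yd]
  unfolding Rx pb frechet_derivative_at[OF d0, symmetric] .
 then have "((%y. rep A b (j (F y)) (phi A (j (F y)) (Y (F y)))) has_derivative
  (%u. fd (%z. phi_in b z (Y (F x))) (at (cmap A b b)) (tvec F x u) +
    phi A b (nab (F x) (tvec F x u) Y - christoffel A (met A) b (tvec F x u) (Y (F x))))) (at x)"
  by (rule has_derivative_transform_within_open[OF _ T(1,2)]) (simp only: J_def R_def phi_in_facts(1)[OF b T(5)])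
 from has_derivative_unique[OF this nab_tvec[OF P x V smooth_along_phi[OF V(1) Y], folded b_def]]
 have "fd (%z. phi_in b z (Y (F x))) (at (cmap A b b)) (tvec F x u) +
    phi A b (nab (F x) (tvec F x u) Y - christoffel A (met A) b (tvec F x u) (Y (F x))) =
   nab (F x) (tvec F x u) (%q. phi A (j q) (Y q)) - christoffel A (met A) b (tvec F x u) (phi A b (Y (F x)))"
  by (simp add: fun_eq_iff b_def)
 with phi_in_derivative[OF b, of "Y (F x)" "tvec F x u"] show ?thesis
  by (simp add: linear_diff[OF l\<phi>] b_def[symmetric] algebra_simps)
qed

definition cfield :: "('m => 'b) => ('b => 'm) => ('m => 'm) => 'b => 'e" where
 "cfield F c X q = tvec F (c q) (X (c q))"

lemma cfield_F: "param M W F c ==> x \<in> W ==> cfield F c X (F x) = tvec F x (X x)"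
 by (simp add: cfield_def paramD(2)[OF M])

lemma rep_cfield_smooth:
 assumes P: "param M W F c" and T: "open T" "T \<subseteq> W" and X: "smooth_on T X"
  and b: "b \<in> points A" "\<And>y. y \<in> T ==> j (F y) \<in> cdom A b"
 shows "smooth_on T (%y. rep A b (j (F y)) (tvec F y (X y)))"
proof (rule smooth_on_linear_family[where L="%y u. rep A b (j (F y)) (tvec F y u)", OF T(1) _ _ X])
 show "linear (%u. rep A b (j (F y)) (tvec F y u))" if "y \<in> T" for y
  using linear_compose[OF tvec_facts(1)[OF P subsetD[OF T(2) that]] rep_inverse(3)[OF b(1) b(2)[OF that]]]
  by (simp add: o_def)
 show "smooth_on T (%y. rep A b (j (F y)) (tvec F y u))" for u
  by (rule smooth_on_subset[OF smooth_rep_tvec[OF P b(1)]]) (use T b in auto)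
qed

lemma smooth_along_cfield:
 assumes P: "param M W F c" and T: "open T" "T \<subseteq> W" and X: "smooth_on T X"
 shows "smooth_along M A j (F ` T) (cfield F c X)"
proof (rule smooth_alongI[OF paramD(5)[OF M P T]])
 fix p assume "p \<in> F ` T"
 then obtain x where x: "x \<in> T" "p = F x" by blast
 have xW: "x \<in> W" using x T by auto
 define T' where "T' = T \<inter> {y \<in> W. j (F y) \<in> cdom A (j p)}"
 have b: "j p \<in> points A" using Fx[OF P xW] x by simp
 have T'o: "open T'" unfolding T'_def by (intro open_Int T(1) base_open(1)[OF P b])
 have "smooth_on T' (%y. rep A (j p) (j (F y)) (tvec F y (X y)))"
  by (rule rep_cfield_smooth[OF P T'o _ smooth_on_subset[OF X] b]) (use T in \<open>auto simp: T'_def\<close>)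
 then have "smooth_on T' (%y. rep A (j p) (j (F y)) (cfield F c X (F y)))"
  by (rule smooth_on_cong[OF T'o, rotated]) (simp add: cfield_F[OF P] T'_def)
 moreover have "p \<in> F ` T'" using x xW cdomD(1)[OF A b] by (auto simp: T'_def)
 moreover have "T' \<subseteq> {y \<in> W. F y \<in> F ` T \<and> j (F y) \<in> cdom A (j p)}" using T by (auto simp: T'_def)
 ultimately show "\<exists>W Fa ca b Ta. param M W Fa ca \<and> b \<in> points A \<and> open Ta \<and>
   Ta \<subseteq> {x \<in> W. Fa x \<in> F ` T \<and> j (Fa x) \<in> cdom A b} \<and> p \<in> Fa ` Ta \<and>
   smooth_on Ta (%x. rep A b (j (Fa x)) (cfield F c X (Fa x)))"
  using P b T'o by blast
qed

text \<open>Second derivatives of the immersion and Christoffel symbols are both symmetric and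
  cancel; the bracket of the coefficient fields is left.\<close>

lemma nab_torsion:
 assumes P: "param M W F c" and T: "open T" "T \<subseteq> W" and x: "x \<in> T" and X: "smooth_on T X" and Y: "smooth_on T Y"
 shows "nab (F x) (tvec F x (X x)) (cfield F c Y) - nab (F x) (tvec F x (Y x)) (cfield F c X) =
  tvec F x (fd Y (at x) (X x) - fd X (at x) (Y x))"
proof -
 have xW: "x \<in> W" using x T by auto
 define b where "b = j (F x)"
 have b: "b \<in> points A" using Fx[OF P xW] by (simp add: b_def)
 have FT: "openin (mtop M) (F ` T)" "F x \<in> F ` T" using paramD(5)[OF M P T] x by auto
 define T' where "T' = T \<inter> {y \<in> W. j (F y) \<in> cdom A b}"
 have T'o: "open T'" unfolding T'_def by (intro open_Int T(1) base_open(1)[OF P b])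
 have xT': "x \<in> T'" using x xW cdomD(1)[OF A b] by (simp add: T'_def b_def)
 define J where "J y = cmap A b (j (F y))" for y
 have Js: "smooth_on T' J" unfolding J_def[abs_def]
  by (rule smooth_on_subset[OF base_open(2)[OF P b]]) (auto simp: T'_def)
 have rJ: "rep A b (j (F y)) (tvec F y u) = fd J (at y) u" if "y \<in> T'" for y u
  unfolding J_def[abs_def] by (rule rep_tvec[OF P _ b]) (use that in \<open>auto simp: T'_def\<close>)
 have Jl: "linear (fd J (at y))" if "y \<in> T'" for y
  using smooth_on_has_derivative[OF Js that] has_derivative_linear by blast
 have Jx: "fd J (at x) = tvec F x" unfolding tvec_def[abs_def] J_def[abs_def] b_def by simp
 have key: "nab (F x) (tvec F x u) (cfield F c Z) - christoffel A (met A) b (tvec F x u) (tvec F x (Z x)) =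
   fd (%y. fd J (at y) (Z x)) (at x) u + tvec F x (fd Z (at x) u)"
  if Z: "smooth_on T Z" for Z u
 proof -
  have "((%y. fd J (at y) (Z y)) has_derivative
   (%u. fd (%y. fd J (at y) (Z x)) (at x) u + tvec F x (fd Z (at x) u))) (at x)"
   using linear_family_has_derivative(1)[OF T'o xT' Jl smooth_on_frechet[OF Js] smooth_on_has_derivative[OF Z x]]
   unfolding Jx .
  then have "((%y. rep A b (j (F y)) (cfield F c Z (F y))) has_derivative
   (%u. fd (%y. fd J (at y) (Z x)) (at x) u + tvec F x (fd Z (at x) u))) (at x)"
   by (rule has_derivative_transform_within_open[OF _ T'o xT']) (use rJ in \<open>auto simp: cfield_F[OF P] T'_def\<close>)
  from has_derivative_unique[OF this nab_tvec[OF P xW FT smooth_along_cfield[OF P T Z], folded b_def]]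
  show ?thesis by (simp add: fun_eq_iff cfield_F[OF P xW])
 qed
 show ?thesis
  using key[OF Y, of "X x"] key[OF X, of "Y x"]
   second_derivative_symmetric[OF T'o Js xT', of "X x" "Y x"]
   christoffel_sym[OF b, of "tvec F x (X x)" "tvec F x (Y x)"]
  by (simp add: linear_diff[OF tvec_facts(1)[OF P xW]] algebra_simps)
qed

end

section \<open>The submanifold in one chart: covariant derivative, tangential projection, shape
  operator\<close>

locale immersed_chart = cosymplectic_immersion A M j
 for A :: "('a, 'e::euclidean_space) acm" and M :: "('b, 'm::euclidean_space) manifold" and j :: "'b => 'a" +
 fixes W :: "'m set" and F :: "'m => 'b" and c :: "'b => 'm"
 assumes P: "param M W F c"
begin

lemmas W_open = paramD(1)[OF M P] and cF = paramD(2)[OF M P] and F_points = paramD(4)[OF M P]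

lemma FW_open: "openin (mtop M) (F ` W)"
 using paramD(5)[OF M P W_open] by simp

lemma iF: "x \<in> W ==> j (F x) \<in> points A"
 using F_points iota_points by blast

text \<open>Smooth fields along the immersion as functions of the coordinates. Vectors at different
  points are comparable only in a common ambient chart, hence the condition for every base point
  \<open>b\<close>.\<close>

definition sfield :: "('m => 'e) => bool" where
 "sfield Y \<longleftrightarrow> (\<forall>b\<in>points A. smooth_on {y \<in> W. j (F y) \<in> cdom A b} (%y. rep A b (j (F y)) (Y y)))"

lemma sfield_along: 
 assumes "sfield Y"
 shows "smooth_along M A j (F ` W) (%q. Y (c q))"
proof (rule smooth_alongI[OF FW_open])
 fix p assume "p \<in> F ` W"
 then obtain x where x: "x \<in> W" "p = F x" by blast
 have b: "j p \<in> points A" using iF x by simp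
 define T where "T = {y \<in> W. j (F y) \<in> cdom A (j p)}"
 have T: "open T" unfolding T_def by (rule base_open(1)[OF P b])
 have "smooth_on T (%y. rep A (j p) (j (F y)) (Y y))" using assms b by (simp add: sfield_def T_def)
 then have "smooth_on T (%y. rep A (j p) (j (F y)) (Y (c (F y))))"
  by (rule smooth_on_cong[OF T, rotated]) (simp add: cF T_def)
 moreover have "p \<in> F ` T" using x cdomD(1)[OF A b] by (auto simp: T_def)
 moreover have "T \<subseteq> {y \<in> W. F y \<in> F ` W \<and> j (F y) \<in> cdom A (j p)}" by (auto simp: T_def)
 ultimately show "\<exists>Wa Fa ca b T. param M Wa Fa ca \<and> b \<in> points A \<and> open T \<and>
   T \<subseteq> {x \<in> Wa. Fa x \<in> F ` W \<and> j (Fa x) \<in> cdom A b} \<and> p \<in> Fa ` T \<and>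
   smooth_on T (%x. rep A b (j (Fa x)) (Y (c (Fa x))))"
  using P b T by blast
qed

lemma along_sfield:
 assumes "openin (mtop M) V" "smooth_along M A j V Y" "F ` W \<subseteq> V"
 shows "sfield (%y. Y (F y))"
 unfolding sfield_def
proof
 fix b assume b: "b \<in> points A"
 have "{x \<in> W. F x \<in> V \<and> j (F x) \<in> cdom A b} = {x \<in> W. j (F x) \<in> cdom A b}" using assms(3) by auto
 with smooth_along_param[OF P b assms(1,2)]
 show "smooth_on {y \<in> W. j (F y) \<in> cdom A b} (%y. rep A b (j (F y)) (Y (F y)))" by simp
qed

lemma sfield_cong: "(\<And>y. y \<in> W ==> Y y = Z y) ==> sfield Y ==> sfield Z"
 unfolding sfield_def
proof
 fix b assume eq: "\<And>y. y \<in> W ==> Y y = Z y" and b: "b \<in> points A"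
  and Y: "\<forall>b\<in>points A. smooth_on {y \<in> W. j (F y) \<in> cdom A b} (%y. rep A b (j (F y)) (Y y))"
 have "smooth_on {y \<in> W. j (F y) \<in> cdom A b} (%y. rep A b (j (F y)) (Y y))" using Y b by blast
 then show "smooth_on {y \<in> W. j (F y) \<in> cdom A b} (%y. rep A b (j (F y)) (Z y))"
  by (rule smooth_on_cong[OF base_open(1)[OF P b], rotated]) (simp add: eq)
qed

lemma sfield_tvec: "smooth_on W X ==> sfield (%y. tvec F y (X y))"
 unfolding sfield_def
 by (intro ballI rep_cfield_smooth[OF P base_open(1)[OF P]]) (auto intro: smooth_on_subset)

lemma sfield_phi: "sfield Y ==> sfield (%y. phi A (j (F y)) (Y y))"
 unfolding sfield_def
proof
 fix b assume Y: "\<forall>b\<in>points A. smooth_on {y \<in> W. j (F y) \<in> cdom A b} (%y. rep A b (j (F y)) (Y y))" and b: "b \<in> points A"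
 show "smooth_on {y \<in> W. j (F y) \<in> cdom A b} (%y. rep A b (j (F y)) (phi A (j (F y)) (Y y)))"
 proof (cases "W = {}")
  case False
  then obtain x where x: "x \<in> W" by blast
  show ?thesis by (rule phi_smooth_rep[OF P x b base_open(1)[OF P b]]) (use Y b in auto)
 next
  case True
  show ?thesis unfolding True by (rule smooth_on_cong[OF _ _ smooth_on_const]) auto
 qed
qed

lemma sfield_xi: "sfield (%y. xi A (j (F y)))"
 using along_sfield[OF openin_topspace smooth_along_xi] F_points by auto

lemma sfield_met:
 assumes "sfield Y" "sfield Z"
 shows "smooth_on W (%y. g (F y) (Y y) (Z y))"
proof (rule smooth_on_local)
 fix x assume x: "x \<in> W"
 have b: "j (F x) \<in> points A" using iF x by simp
 define T where "T = {y \<in> W. j (F y) \<in> cdom A (j (F x))}"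
 have T: "open T" unfolding T_def by (rule base_open(1)[OF P b])
 have "smooth_on T (%y. g (F y) (Y y) (Z y))"
  by (rule met_smooth[OF P x b T]) (use assms b in \<open>auto simp: sfield_def T_def\<close>)
 then show "\<exists>T. open T \<and> x \<in> T \<and> smooth_on T (%y. g (F y) (Y y) (Z y))"
  using T x cdomD(1)[OF A b] by (auto simp: T_def)
qed

definition nb :: "'m => 'm => ('m => 'e) => 'e" where
 "nb x u Y = nab (F x) (tvec F x u) (%q. Y (c q))"

lemma nb_met:
 assumes x: "x \<in> W" and Y: "sfield Y" and Z: "sfield Z"
 shows "((%y. g (F y) (Y y) (Z y)) has_derivative
  (%u. g (F x) (nb x u Y) (Z x) + g (F x) (Y x) (nb x u Z))) (at x)"
proof -
 have "((%y. g (F y) (Y (c (F y))) (Z (c (F y)))) has_derivative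
  (%u. g (F x) (nb x u Y) (Z x) + g (F x) (Y x) (nb x u Z))) (at x)"
  using nab_metric[OF P x FW_open imageI[OF x] sfield_along[OF Y] sfield_along[OF Z]]
  by (simp add: cF[OF x] nb_def)
 then show ?thesis by (rule has_derivative_transform_within_open[OF _ W_open x]) (simp add: cF)
qed

lemma nab_cong:
 assumes x: "x \<in> W" and Y: "openin (mtop M) V" "F x \<in> V" "smooth_along M A j V Y"
  and Z: "openin (mtop M) V'" "F x \<in> V'" "smooth_along M A j V' Z"
  and eq: "\<And>q. q \<in> V \<inter> V' ==> Y q = Z q"
 shows "nab (F x) (tvec F x u) Y = nab (F x) (tvec F x u) Z"
proof -
 let ?T = "{y \<in> W. F y \<in> V \<inter> V'}"
 have T: "open ?T" "x \<in> ?T" using paramD(6)[OF M P openin_Int[OF Y(1) Z(1)]] x Y(2) Z(2) by auto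
 have "((%y. rep A (j (F x)) (j (F y)) (Z (F y))) has_derivative
  (%u. nab (F x) (tvec F x u) Y - christoffel A (met A) (j (F x)) (tvec F x u) (Y (F x)))) (at x)"
  by (rule has_derivative_transform_within_open[OF nab_tvec[OF P x Y] T]) (simp add: eq)
 from has_derivative_unique[OF this nab_tvec[OF P x Z]] eq[of "F x"] Y(2) Z(2)
 show ?thesis by (simp add: fun_eq_iff)
qed

lemma nb_cong:
 assumes x: "x \<in> W" and Y: "sfield Y" and eq: "\<And>y. y \<in> W ==> Y y = Z y"
 shows "nb x u Y = nb x u Z"
 unfolding nb_def
 by (rule nab_cong[OF x FW_open imageI[OF x] sfield_along[OF Y] FW_open imageI[OF x] sfield_along[OF sfield_cong[OF eq Y]]])
  (use eq paramD(8)[OF M P] in auto)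

lemma nb_phi:
 assumes x: "x \<in> W" and Y: "sfield Y"
 shows "nb x u (%y. phi A (j (F y)) (Y y)) = phi A (j (F x)) (nb x u Y)"
proof -
 have "nb x u (%y. phi A (j (F y)) (Y y)) = nab (F x) (tvec F x u) (%q. phi A (j q) (Y (c q)))"
  unfolding nb_def
  by (rule nab_cong[OF x FW_open imageI[OF x] sfield_along[OF sfield_phi[OF Y]] FW_open imageI[OF x]
     smooth_along_phi[OF FW_open sfield_along[OF Y]]])
   (use paramD(7)[OF M P] in auto)
 also have "\<dots> = phi A (j (F x)) (nb x u Y)"
  unfolding nb_def by (rule nab_phi[OF P x FW_open imageI[OF x] sfield_along[OF Y]])
 finally show ?thesis .
qed

lemma nb_torsion:
 assumes x: "x \<in> W" and X: "smooth_on W X" and Y: "smooth_on W Y"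
 shows "nb x (X x) (%y. tvec F y (Y y)) - nb x (Y x) (%y. tvec F y (X y)) =
  tvec F x (fd Y (at x) (X x) - fd X (at x) (Y x))"
 using nab_torsion[OF P W_open subset_refl x X Y] by (simp add: nb_def cfield_def[abs_def])

definition gm :: "'m => 'm => 'm => real" where
 "gm x u v = g (F x) (tvec F x u) (tvec F x v)"

lemma gm_form: "x \<in> W ==> inner_form (gm x)"
proof -
 assume x: "x \<in> W"
 note mf = met_form[OF iF[OF x]] and l = tvec_facts(1)[OF P x]
 have "linear (gm x u)" "linear (%u. gm x u v)" for u v
  unfolding gm_def[abs_def]
  using linear_compose[OF l iform_lin(1)[OF mf]] linear_compose[OF l iform_lin(2)[OF mf]] by (simp_all add: o_def)
 then show ?thesis
  unfolding inner_form_def bilinear_def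
  using iform_sym[OF mf] iform_pos[OF mf] tvec_zero_iff[OF P x] by (auto simp: gm_def)
qed

lemma gm_smooth: "smooth_on W X ==> smooth_on W Y ==> smooth_on W (%x. gm x (X x) (Y x))"
 unfolding gm_def by (intro sfield_met sfield_tvec)

text \<open>Coordinates of the tangential projection, by inversion of the Gram matrix.
  \<open>tan_proj\<close> is a definite description; this formula is what shows that it depends
  smoothly on the point.\<close>

definition tan_coord :: "('m => 'e) => 'm => 'm" where
 "tan_coord Y x = inv (%u. \<Sum>i\<in>Basis. gm x u i *\<^sub>R i) (\<Sum>i\<in>Basis. g (F x) (Y x) (tvec F x i) *\<^sub>R i)"

lemma TM_range: "x \<in> W ==> TM M A j (F x) = range (tvec F x)"
 using tvec_facts(3)[OF P] by simp

lemma TM_subspace: "x \<in> W ==> subspace (TM M A j (F x))"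
 unfolding TM_range by (rule linear_subspace_image[OF tvec_facts(1)[OF P] subspace_UNIV])

abbreviation gmap where "gmap x \<equiv> (%u. \<Sum>i\<in>Basis. gm x u i *\<^sub>R i)"

lemma gmap_component:
 assumes "gmap x u = (\<Sum>i\<in>Basis. a i *\<^sub>R i)" "i \<in> Basis"
 shows "gm x u i = a i"
proof -
 have "gmap x u \<bullet> i = (\<Sum>i\<in>Basis. a i *\<^sub>R i) \<bullet> i" using assms(1) by simp
 then show ?thesis using assms(2) by (simp add: inner_sum_left inner_Basis sum.delta if_distrib cong: if_cong)
qed

lemma gmap_linear: "x \<in> W ==> linear (gmap x)"
 by (intro linear_compose_sum ballI linear_compose[OF iform_lin(2)[OF gm_form], unfolded o_def, of _ "%a. a *\<^sub>R _"])
  (simp_all add: linear_iff scaleR_left_distrib)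

lemma gmap_inj:
 assumes "x \<in> W" "gmap x u = 0"
 shows "u = 0"
proof -
 have "gm x u i = 0" if "i \<in> Basis" for i
  using gmap_component[of x u "%_. 0" i] that assms(2) by simp
 then have "gm x u u = 0" using linear_Basis_expand[OF iform_lin(1)[OF gm_form[OF assms(1)]], of u u] by simp
 then show ?thesis using iform_zero[OF gm_form[OF assms(1)]] by simp
qed

lemma tan_coord_smooth:
 assumes Y: "sfield Y"
 shows "smooth_on W (tan_coord Y)"
 unfolding tan_coord_def[abs_def]
proof (rule smooth_on_linear_family[where L="%x. inv (gmap x)", OF W_open])
 show "linear (inv (gmap x))" if "x \<in> W" for x
  by (rule inj_linear_imp_inv_linear[OF gmap_linear[OF that] bij_is_inj[OF linear_bij_of_inj[OF gmap_linear[OF that] gmap_inj[OF that]]]])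
 show "smooth_on W (%x. inv (gmap x) v)" for v
 proof (rule smooth_on_inv_family[OF W_open gmap_linear gmap_inj])
  show "smooth_on W (%x. gmap x v)" for v
   by (intro smooth_on_sum smooth_on_scaleR W_open gm_smooth smooth_on_const)
 qed
 show "smooth_on W (%x. \<Sum>i\<in>Basis. g (F x) (Y x) (tvec F x i) *\<^sub>R i)"
  by (intro smooth_on_sum smooth_on_scaleR W_open sfield_met Y sfield_tvec smooth_on_const)
qed

lemma tan_coord:
 assumes x: "x \<in> W"
 shows "tvec F x (tan_coord Y x) = tan_proj A M j (F x) (Y x)"
 unfolding tan_proj_def
proof (rule orth_proj(4)[OF met_form[OF iF[OF x]] TM_subspace[OF x], symmetric])
 have surj: "gmap x (inv (gmap x) v) = v" for v
  by (rule surj_f_inv_f[OF bij_is_surj[OF linear_bij_of_inj[OF gmap_linear[OF x] gmap_inj[OF x]]]])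
 show "tvec F x (tan_coord Y x) \<in> TM M A j (F x)" by (simp add: TM_range[OF x])
 fix z assume "z \<in> TM M A j (F x)"
 then obtain v where v: "z = tvec F x v" by (auto simp: TM_range[OF x])
 have "gm x (tan_coord Y x) i = g (F x) (Y x) (tvec F x i)" if "i \<in> Basis" for i
  unfolding tan_coord_def
  by (rule gmap_component[where a="%i. g (F x) (Y x) (tvec F x i)", OF surj that])
 moreover have "linear (%v. g (F x) (Y x) (tvec F x v))"
  using linear_compose[OF tvec_facts(1)[OF P x] iform_lin(1)[OF met_form[OF iF[OF x]]]] by (simp add: o_def)
 ultimately have "gm x (tan_coord Y x) v = g (F x) (Y x) (tvec F x v)"
  using linear_Basis_expand[OF iform_lin(1)[OF gm_form[OF x]], of "tan_coord Y x" v]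
   linear_Basis_expand[of "%v. g (F x) (Y x) (tvec F x v)" v] by simp
 then show "g (F x) (tvec F x (tan_coord Y x)) z = g (F x) (Y x) z" by (simp add: gm_def v)
qed

lemma sfield_tan: "sfield Y ==> sfield (%x. tan_proj A M j (F x) (Y x))"
 by (rule sfield_cong[OF tan_coord sfield_tvec[OF tan_coord_smooth]])

text \<open>Tangent fields come from coordinate vector fields, and for these the difference is the
  image of their bracket. This is the symmetry of the second fundamental form.\<close>

lemma nb_symmetric:
 assumes x: "x \<in> W" and X: "sfield X" "\<And>y. y \<in> W ==> X y \<in> TM M A j (F y)"
  and Y: "sfield Y" "\<And>y. y \<in> W ==> Y y \<in> TM M A j (F y)"
  and u: "X x = tvec F x u" "Y x = tvec F x v"
 shows "nb x u Y - nb x v X \<in> TM M A j (F x)"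
proof -
 have t: "tvec F y (tan_coord Z y) = Z y" if "y \<in> W" "Z y \<in> TM M A j (F y)" for Z y
  unfolding tan_coord[OF that(1)] tan_proj_def
  by (rule orth_proj(4)[OF met_form[OF iF[OF that(1)]] TM_subspace[OF that(1)] that(2) refl])
 have i: "inj (tvec F x)" by (rule tvec_facts(2)[OF P x])
 have Xu: "tan_coord X x = u" "tan_coord Y x = v"
  using t[of x X, OF x X(2)[OF x]] t[of x Y, OF x Y(2)[OF x]] u injD[OF i] by auto
 have "nb x u Y = nb x u (%y. tvec F y (tan_coord Y y))" "nb x v X = nb x v (%y. tvec F y (tan_coord X y))"
  using nb_cong[OF x Y(1), of "%y. tvec F y (tan_coord Y y)"] nb_cong[OF x X(1), of "%y. tvec F y (tan_coord X y)"]
   t X(2) Y(2) by auto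
 then show ?thesis
  using nb_torsion[OF x tan_coord_smooth[OF X(1)] tan_coord_smooth[OF Y(1)]]
  unfolding Xu TM_range[OF x] by simp
qed

lemma nb_linear:
 assumes x: "x \<in> W" and Y: "sfield Y"
 shows "linear (%u. nb x u Y)"
proof -
 let ?b = "j (F x)"
 have b: "?b \<in> points A" by (rule iF[OF x])
 note f = dmet_facts[OF b]
 have l3: "linear (%u. dmet ?b w u z)" for w z
  using f(2)[of w z] f(3)[of w _ z] by simp
 have cl: "linear (%u. christoffel A (met A) ?b u v)" for v
 proof
  show "christoffel A (met A) ?b (u + u') v = christoffel A (met A) ?b u v + christoffel A (met A) ?b u' v" for u u'
   by (rule iform_eqI[OF met_form[OF b] subspace_UNIV UNIV_I UNIV_I])
    (simp add: christoffel[OF b] iform_simps[OF met_form[OF b]] linear_add[OF f(1)] linear_add[OF f(2)] linear_add[OF l3] add_divide_distrib diff_divide_distrib)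
  show "christoffel A (met A) ?b (r *\<^sub>R u) v = r *\<^sub>R christoffel A (met A) ?b u v" for r u
   by (rule iform_eqI[OF met_form[OF b] subspace_UNIV UNIV_I UNIV_I])
    (simp add: christoffel[OF b] iform_simps[OF met_form[OF b]] linear_scale[OF f(1)] linear_scale[OF f(2)] linear_scale[OF l3] algebra_simps)
 qed
 have "linear (%u. nb x u Y - christoffel A (met A) ?b (tvec F x u) (Y x))"
  using has_derivative_linear[OF nab_tvec[OF P x FW_open imageI[OF x] sfield_along[OF Y]]] by (simp add: nb_def cF[OF x])
 from linear_compose_add[OF this linear_compose[OF tvec_facts(1)[OF P x] cl, unfolded o_def, of "Y x"]]
 show ?thesis by simp
qed

text \<open>Symmetry of the second fundamental form moves the derivative from the test field onto
  \<open>X\<close>, so the defining values depend only on the value of the test field at the point.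
  Riesz then yields existence, and coordinate fields, being admissible tests, yield
  uniqueness.\<close>

lemma shape_op:
 assumes x: "x \<in> W" and N: "\<And>t. t \<in> TM M A j (F x) ==> g (F x) t N = 0"
  and X: "sfield X" "\<And>y. y \<in> W ==> X y \<in> TM M A j (F y)"
 shows "shape_op A M j (F x) N (X x) \<in> TM M A j (F x)"
  and "g (F x) (shape_op A M j (F x) N (X x)) (tvec F x v) = g (F x) (nb x v X) N"
proof -
 note mf = met_form[OF iF[OF x]] and sub = TM_subspace[OF x]
 note ms = iform_simps[OF mf]
 define S where "S a \<longleftrightarrow> a \<in> TM M A j (F x) \<and>
  (\<forall>V Y. openin (mtop M) V \<and> F x \<in> V \<and> sect V (TM M A j) Y \<longrightarrow>
    g (F x) a (Y (F x)) = g (F x) (second_ff A M j (F x) (X x) Y) N)" for a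
 obtain u where u: "X x = tvec F x u" using X(2)[OF x] TM_range[OF x] by auto
 have val: "g (F x) (second_ff A M j (F x) (X x) Y) N = g (F x) (nb x v X) N"
  if V: "openin (mtop M) V" "F x \<in> V" and Y: "sect V (TM M A j) Y" and v: "Y (F x) = tvec F x v" for V Y v
 proof -
  have Ys: "smooth_along M A j V Y" "\<And>q. q \<in> V ==> Y q \<in> TM M A j q" using Y by (auto simp: is_section_def)
  \<comment> \<open>\<open>X\<close> lives on the whole chart, the test field on \<open>V\<close>
    only; on the overlap both are fields in one chart and symmetry applies.\<close>
  define W' where "W' = {y \<in> W. F y \<in> V}"
  have W': "open W'" "W' \<subseteq> W" "x \<in> W'" using paramD(6)[OF M P V(1)] x V(2) by (auto simp: W'_def)
  interpret I: immersed_chart A M j W' F c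
   by unfold_locales (rule param_subset[OF M P W'(1,2)])
  have XI: "I.sfield X"
   unfolding I.sfield_def
  proof
   fix b assume b: "b \<in> points A"
   show "smooth_on {y \<in> W'. j (F y) \<in> cdom A b} (%y. rep A b (j (F y)) (X y))"
    by (rule smooth_on_subset[of "{y \<in> W. j (F y) \<in> cdom A b}"]) (use X(1) b W'(2) in \<open>auto simp: sfield_def\<close>)
  qed
  have YI: "I.sfield (%y. Y (F y))" by (rule I.along_sfield[OF V(1) Ys(1)]) (auto simp: W'_def)
  have "I.nb x u (%y. Y (F y)) - I.nb x v X \<in> TM M A j (F x)"
   by (rule I.nb_symmetric[OF W'(3) XI _ YI _ u v]) (use X(2) W'(2) Ys(2) in \<open>auto simp: W'_def\<close>)
  moreover have "I.nb x u (%y. Y (F y)) = nab (F x) (tvec F x u) Y"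
   unfolding I.nb_def
   by (rule nab_cong[OF x I.FW_open imageI[OF W'(3)] I.sfield_along[OF YI] V Ys(1)])
    (use paramD(7)[OF M I.P] in auto)
  moreover have "I.nb x v X = nb x v X" unfolding I.nb_def nb_def ..
  ultimately have "g (F x) (nab (F x) (tvec F x u) Y - nb x v X) N = 0" using N by simp
  moreover have "second_ff A M j (F x) (X x) Y = nab (F x) (tvec F x u) Y - tan_proj A M j (F x) (nab (F x) (tvec F x u) Y)"
   unfolding second_ff_def Let_def nab_def u ..
  moreover have "g (F x) (tan_proj A M j (F x) (nab (F x) (tvec F x u) Y)) N = 0"
   unfolding tan_proj_def by (rule N[OF orth_proj(1)[OF mf sub]])
  ultimately show ?thesis by (simp add: ms)
 qed
 have sec: "sect (F ` W) (TM M A j) (cfield F c (%_. v))" "cfield F c (%_. v) (F x) = tvec F x v" for v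
  unfolding is_section_def
  using smooth_along_cfield[OF P W_open subset_refl smooth_on_const] TM_range
  by (auto simp: cfield_def cF x)
 have "linear (%v. g (F x) (nb x v X) N)"
  using linear_compose[OF nb_linear[OF x X(1)] iform_lin(2)[OF mf]] by (simp add: o_def)
 from iform_riesz[OF gm_form[OF x] this] obtain a where a: "\<And>v. gm x a v = g (F x) (nb x v X) N" by blast
 have ex: "S (tvec F x a)"
  unfolding S_def
 proof (intro conjI allI impI)
  show "tvec F x a \<in> TM M A j (F x)" by (simp add: TM_range[OF x])
  fix V Y assume Y: "openin (mtop M) V \<and> F x \<in> V \<and> sect V (TM M A j) Y"
  then have "Y (F x) \<in> TM M A j (F x)" by (simp add: is_section_def)
  then obtain v where v: "Y (F x) = tvec F x v" by (auto simp: TM_range[OF x])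
  show "g (F x) (tvec F x a) (Y (F x)) = g (F x) (second_ff A M j (F x) (X x) Y) N"
   using val[of V Y v] v Y a[of v] by (simp add: gm_def)
 qed
 have un: "a = a'" if "S a" "S a'" for a a'
 proof (rule iform_eqI[OF mf sub])
  show "a \<in> TM M A j (F x)" "a' \<in> TM M A j (F x)" using that by (auto simp: S_def)
  fix w assume "w \<in> TM M A j (F x)"
  then obtain v where v: "w = tvec F x v" by (auto simp: TM_range[OF x])
  show "g (F x) a w = g (F x) a' w"
   using that sec[of v] FW_open imageI[OF x, of F] unfolding S_def v by metis
 qed
 have "\<exists>!a. S a" using ex un by blast
 moreover have "shape_op A M j (F x) N (X x) = (THE a. S a)" by (simp add: shape_op_def S_def)
 ultimately have S: "S (shape_op A M j (F x) N (X x))" using theI'[of S] by simp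
 then show "shape_op A M j (F x) N (X x) \<in> TM M A j (F x)" by (simp add: S_def)
 have "F x \<in> F ` W" using x by blast
 then have "g (F x) (shape_op A M j (F x) N (X x)) (cfield F c (%_. v) (F x)) =
   g (F x) (second_ff A M j (F x) (X x) (cfield F c (%_. v))) N"
  using S sec(1)[of v] FW_open unfolding S_def by blast
 then show "g (F x) (shape_op A M j (F x) N (X x)) (tvec F x v) = g (F x) (nb x v X) N"
  using val[OF FW_open imageI[OF x] sec(1) sec(2)] by (simp add: sec(2))
qed

text \<open>The key identity: with \<open>\<phi>X\<close> again tangent and \<open>\<nabla>\<phi> = 0\<close>, the shape operators in the theorem reduce to the
 connection.\<close>

lemma shape_difference:
 assumes x: "x \<in> W" and S: "acm_point.slant_split (g (F x)) (phi A (j (F x))) (xi A (j (F x))) (TM M A j (F x)) H K \<alpha>"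
  and X: "sfield X" "\<And>y. y \<in> W ==> X y \<in> TM M A j (F y)" "\<And>y. y \<in> W ==> phi A (j (F y)) (X y) \<in> TM M A j (F y)"
  and w: "w \<in> K"
 shows "shape_op A M j (F x) (F_op A M j (F x) w) (phi A (j (F x)) (X x))
   - shape_op A M j (F x) (F_op A M j (F x) (P_op A M j (F x) w)) (X x) \<in> TM M A j (F x)"
  and "g (F x) (shape_op A M j (F x) (F_op A M j (F x) w) (phi A (j (F x)) (X x))
   - shape_op A M j (F x) (F_op A M j (F x) (P_op A M j (F x) w)) (X x)) (tvec F x v)
   = (sin \<alpha>)\<^sup>2 * g (F x) (nb x v X) w"
proof -
 interpret a: acm_point "g (F x)" "phi A (j (F x))" "eta A (j (F x))" "xi A (j (F x))"
  by (rule acm_at[OF iF[OF x]])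
 note D = a.slant_splitD[OF S] and SP = a.slant_split_P[OF S]
 let ?P = "P_op A M j (F x)"
 have Pdef: "?P z = orth_proj (g (F x)) (TM M A j (F x)) (phi A (j (F x)) z)" for z
  by (simp add: P_op_def tan_proj_def)
 have normal: "g (F x) t (F_op A M j (F x) z) = 0" if "t \<in> TM M A j (F x)" for t z
  using orth_proj(2)[OF a.b D(3) that, of "phi A (j (F x)) z"] a.bsym by (simp add: F_op_def Pdef)
 have PK: "?P w \<in> K" using SP(3)[OF w] by (simp add: Pdef)
 note s1 = shape_op[OF x normal sfield_phi[OF X(1)] X(3)] and s2 = shape_op[OF x normal X(1,2)]
 show "shape_op A M j (F x) (F_op A M j (F x) w) (phi A (j (F x)) (X x))
   - shape_op A M j (F x) (F_op A M j (F x) (P_op A M j (F x) w)) (X x) \<in> TM M A j (F x)"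
  by (rule subspace_diff[OF D(3) s1(1) s2(1)])
 let ?n = "nb x v X"
 \<comment> \<open>By \<open>\<phi> w = P w + F w\<close> and compatibility of the metric, with
   \<eta> vanishing on \<open>w\<close>. The second identity uses that F P w is \<phi> P w plus
   cos^2 times \<open>w\<close>. The terms with \<open>P w\<close> cancel in the difference and
   leave 1 - cos^2.\<close>
 have 1: "g (F x) (phi A (j (F x)) ?n) (F_op A M j (F x) w) = g (F x) ?n w - g (F x) (phi A (j (F x)) ?n) (?P w)"
  using a.b\<phi>[of ?n w] D(10)[OF w] by (simp add: F_op_def a.bs)
 have 2: "g (F x) ?n (F_op A M j (F x) (?P w)) = - g (F x) (phi A (j (F x)) ?n) (?P w) + (cos \<alpha>)\<^sup>2 * g (F x) ?n w"
  using SP(5)[OF w] a.\<phi>_skew[of ?n "?P w"] by (simp add: F_op_def a.bs Pdef)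
 show "g (F x) (shape_op A M j (F x) (F_op A M j (F x) w) (phi A (j (F x)) (X x))
   - shape_op A M j (F x) (F_op A M j (F x) (P_op A M j (F x) w)) (X x)) (tvec F x v)
   = (sin \<alpha>)\<^sup>2 * g (F x) (nb x v X) w"
  using s1(2)[of w v] s2(2)[of "?P w" v]
  by (simp add: a.bs(3) nb_phi[OF x X(1)] 1 2 sin_squared_eq algebra_simps)
qed

end

section \<open>Pointwise semi-slant submanifolds\<close>

lemma distributionD:
 assumes "distribution A M j E" "p \<in> points M"
 shows "subspace (E p)" "p' \<in> points M ==> dim (E p) = dim (E p')"
  "v \<in> E p ==> \<exists>V X. openin (mtop M) V \<and> p \<in> V \<and> is_section A M j V E X \<and> X p = v"
proof -
 from assms(1) obtain k where k: "\<forall>p\<in>points M. subspace (E p) \<and> E p \<subseteq> TM M A j p \<and> dim (E p) = k \<and>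
   (\<forall>v \<in> E p. \<exists>V X. openin (mtop M) V \<and> p \<in> V \<and> is_section A M j V E X \<and> X p = v)"
  unfolding distribution_def by (elim exE)
 note kp = bspec[OF k assms(2)]
 show "subspace (E p)" using kp by (rule conjunct1)
 show "dim (E p) = dim (E p')" if "p' \<in> points M" using kp bspec[OF k that] by simp
 show "v \<in> E p ==> \<exists>V X. openin (mtop M) V \<and> p \<in> V \<and> is_section A M j V E X \<and> X p = v"
  using kp by (elim conjE) (rule bspec)
qed

locale semi_slant =
 fixes A :: "('a, 'e::euclidean_space) acm" and M :: "('b, 'm::euclidean_space) manifold" and j :: "'b => 'a"
  and D D\<theta> :: "'b => 'e set" and \<theta> :: "'b => real"
 assumes cosym: "cosymplectic A" and pss: "pointwise_semi_slant A M j D D\<theta> \<theta>"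

sublocale semi_slant \<subseteq> cosymplectic_immersion A M j
 using cosym pss by unfold_locales (auto simp: pointwise_semi_slant_def)

context semi_slant
begin

abbreviation shape_eq where "shape_eq \<mu> X Z q \<equiv>
  shape_op A M j q (F_op A M j q (Z q)) (phi A (j q) (X q))
   - shape_op A M j q (F_op A M j q (P_op A M j q (Z q))) (X q)
  = ((sin (\<theta> q))\<^sup>2 * dir_deriv M A j q (X q) \<mu>) *\<^sub>R Z q"

abbreviation H where "H \<equiv> plus_xi A j D"

abbreviation split_at where
 "split_at q \<equiv> acm_point.slant_split (g q) (phi A (j q)) (xi A (j q)) (TM M A j q)"

lemma acm_q: "q \<in> points M ==> acm_point (g q) (phi A (j q)) (eta A (j q)) (xi A (j q))"
 by (rule acm_at[OF iota_points])

lemma dist: "distribution A M j D" "distribution A M j D\<theta>"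
 using pss by (simp_all add: pointwise_semi_slant_def)

lemma split:
 assumes q: "q \<in> points M"
 shows "split_at q (H q) (D\<theta> q) (\<theta> q)"
proof -
 interpret a: acm_point "g q" "phi A (j q)" "eta A (j q)" "xi A (j q)" by (rule acm_q[OF q])
 have D: "subspace (D q)" "subspace (D\<theta> q)"
  by (rule distributionD(1)[OF dist(1) q], rule distributionD(1)[OF dist(2) q])
 note h0 = pss[unfolded pointwise_semi_slant_def, THEN conjunct2, THEN conjunct2, THEN conjunct2, THEN conjunct2,
   THEN bspec, OF q]
 have h: "TM M A j q = {x + z + c *\<^sub>R xi A (j q) | x z c. x \<in> D q \<and> z \<in> D\<theta> q}"
  "\<forall>x \<in> D q. \<forall>z \<in> D\<theta> q. g q x z = 0" "\<forall>z \<in> D\<theta> q. g q z (xi A (j q)) = 0" "phi A (j q) ` D q = D q"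
  "\<forall>z \<in> D\<theta> q. z \<noteq> 0 \<longrightarrow> angle_to (g q) (phi A (j q) z) (D\<theta> q) = \<theta> q"
  by (fact h0[THEN conjunct1], fact h0[THEN conjunct2, THEN conjunct1],
    fact h0[THEN conjunct2, THEN conjunct2, THEN conjunct2, THEN conjunct1],
    fact h0[THEN conjunct2, THEN conjunct2, THEN conjunct2, THEN conjunct2, THEN conjunct1],
    fact h0[THEN conjunct2, THEN conjunct2, THEN conjunct2, THEN conjunct2, THEN conjunct2])
 have "H q = {x + y |x y. x \<in> D q \<and> y \<in> span {xi A (j q)}}"
  unfolding plus_xi_def by (auto simp: span_singleton)
 then have "subspace (H q)" using subspace_sums[OF D(1) subspace_span] by simp
 moreover have "TM M A j q = {h + k |h k. h \<in> H q \<and> k \<in> D\<theta> q}"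
 proof (intro equalityI subsetI)
  fix t assume "t \<in> TM M A j q"
  then obtain x z c where t: "t = x + z + c *\<^sub>R xi A (j q)" "x \<in> D q" "z \<in> D\<theta> q" unfolding h(1) by blast
  have "t = (x + c *\<^sub>R xi A (j q)) + z" unfolding t(1) by (simp add: ac_simps)
  moreover have "x + c *\<^sub>R xi A (j q) \<in> H q" unfolding plus_xi_def using t(2) by blast
  ultimately show "t \<in> {h + k |h k. h \<in> H q \<and> k \<in> D\<theta> q}" using t(3) by blast
 next
  fix t assume "t \<in> {h + k |h k. h \<in> H q \<and> k \<in> D\<theta> q}"
  then obtain h k where hk: "t = h + k" "h \<in> H q" "k \<in> D\<theta> q" by blast
  then obtain x c where xc: "h = x + c *\<^sub>R xi A (j q)" "x \<in> D q" unfolding plus_xi_def by blast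
  have "t = x + k + c *\<^sub>R xi A (j q)" unfolding hk(1) xc(1) by (simp add: ac_simps)
  then show "t \<in> TM M A j q" unfolding h(1) using xc(2) hk(3) by blast
 qed
 moreover have "\<forall>h\<in>H q. \<forall>k\<in>D\<theta> q. g q h k = 0"
  using h(2,3) a.bsym[of "xi A (j q)"] by (auto simp: plus_xi_def a.bs)
 moreover have "phi A (j q) ` H q \<subseteq> H q"
 proof (rule image_subsetI)
  fix t assume "t \<in> H q"
  then obtain x c where t: "t = x + c *\<^sub>R xi A (j q)" "x \<in> D q" unfolding plus_xi_def by blast
  have "phi A (j q) t = phi A (j q) x + 0 *\<^sub>R xi A (j q)" by (simp add: t linear_add[OF a.lin\<phi>] linear_scale[OF a.lin\<phi>] a.\<phi>\<xi>)
  moreover have "phi A (j q) x \<in> D q" using h(4) t(2) by blast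
  ultimately show "phi A (j q) t \<in> H q" unfolding plus_xi_def by blast
 qed
 moreover have "xi A (j q) \<in> H q"
 proof -
  have "xi A (j q) = 0 + 1 *\<^sub>R xi A (j q)" by simp
  then show ?thesis using subspace_0[OF D(1)] unfolding plus_xi_def by blast
 qed
 ultimately show ?thesis unfolding a.slant_split_def using D(2) h(5) by simp
qed

lemma K_nonzero: "q \<in> points M ==> q' \<in> points M ==> D\<theta> q \<noteq> {0} ==> D\<theta> q' \<noteq> {0}"
proof -
 assume q: "q \<in> points M" "q' \<in> points M" "D\<theta> q \<noteq> {0}"
 have d: "dim (D\<theta> q) = dim (D\<theta> q')" "subspace (D\<theta> q)"
  by (rule distributionD(2)[OF dist(2) q(1,2)], rule distributionD(1)[OF dist(2) q(1)])
 have "dim (D\<theta> q) \<noteq> 0" using q(3) subspace_0[OF d(2)] by (auto simp: dim_eq_0)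
 then show "D\<theta> q' \<noteq> {0}" using d(1) by auto
qed

text \<open>The angle condition constrains \<open>\<theta>\<close> only where the slant fibre is
  nonzero, so properness includes that this fibre does not vanish.\<close>

definition proper_at :: "'b set => bool" where
 "proper_at V \<longleftrightarrow> (\<forall>q\<in>V. D\<theta> q \<noteq> {0} \<and> \<theta> q \<noteq> 0 \<and> \<theta> q \<noteq> pi / 2)"

lemma theta_bounds:
 assumes q: "q \<in> points M" and p: "proper_at V" "q \<in> V"
 shows "0 < \<theta> q" "\<theta> q < pi / 2" "0 < cos (\<theta> q)" "cos (\<theta> q) < 1" "(cos (\<theta> q))\<^sup>2 < 1" "sin (\<theta> q) \<noteq> 0"
proof -
 have "0 \<le> \<theta> q \<and> \<theta> q \<le> pi / 2"
  using acm_point.slant_split_P(6)[OF acm_q[OF q] split[OF q]] p by (simp add: proper_at_def)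
 then show t: "0 < \<theta> q" "\<theta> q < pi / 2" using p by (force simp: proper_at_def)+
 show c0: "0 < cos (\<theta> q)" using t by (intro cos_gt_zero_pi) auto
 show s: "sin (\<theta> q) \<noteq> 0" using sin_gt_zero[of "\<theta> q"] t pi_gt_zero by auto
 have "(cos (\<theta> q))\<^sup>2 = 1 - (sin (\<theta> q))\<^sup>2" by (rule cos_squared_eq)
 then show c2: "(cos (\<theta> q))\<^sup>2 < 1" using s by simp
 then show "cos (\<theta> q) < 1" using c0 by (smt (verit) one_power2 power_mono)
qed

text \<open>Straight coordinate lines realize every vector of \<open>L\<close>. Conversely, the
  coordinates of a curve in the slice stay in the translate of \<open>L\<close> through
  \<open>x\<close> for small times, which puts their derivative into \<open>L\<close>.\<close>

lemma T_sub_slice: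
 assumes P: "param M W F c" and x: "x \<in> W" and L: "subspace L"
  and S: "S \<inter> F ` W = F ` {y \<in> W. y - x \<in> L}"
 shows "T_sub A M j S (F x) = tvec F x ` L"
proof (intro equalityI subsetI)
 have q: "F x \<in> points M" and b: "j (F x) \<in> points A" using Fx[OF P x] by auto
 fix w assume "w \<in> tvec F x ` L"
 then obtain u where u: "u \<in> L" "w = tvec F x u" by blast
 obtain e where e: "e > 0" "ball x e \<subseteq> W" using paramD(1)[OF M P] x open_contains_ball by blast
 \<comment> \<open>Keeps the line inside the ball of radius \<open>e\<close>; the summand 1 covers
   \<open>u = 0\<close>.\<close>
 define e' where "e' = e / (norm u + 1)"
 have e': "e' > 0" unfolding e'_def using e by (intro divide_pos_pos) (auto intro: add_nonneg_pos)
 define l where "l t = x + t *\<^sub>R u" for t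
 have lW: "l t \<in> W" if "t \<in> {-e'<..<e'}" for t
 proof -
  have "\<bar>t\<bar> * norm u \<le> \<bar>t\<bar> * (norm u + 1)" by (intro mult_left_mono) auto
  also have "\<dots> < e' * (norm u + 1)" using that by (intro mult_strict_right_mono) (auto intro: add_nonneg_pos)
  also have "\<dots> = e" unfolding e'_def by (simp add: add_nonneg_eq_0_iff)
  finally have "l t \<in> ball x e" by (simp add: l_def dist_norm)
  then show ?thesis using e by auto
 qed
 define cv where "cv t = F (l t)" for t
 have lsm: "smooth_on UNIV l" unfolding l_def[abs_def]
  by (intro smooth_on_add smooth_on_const smooth_on_scaleR smooth_on_id open_UNIV)
 have ld: "(l has_derivative (%h. h *\<^sub>R u)) (at t)" for t
  unfolding l_def[abs_def] by (auto intro!: derivative_eq_intros)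
 have "smooth_curve M {-e'<..<e'} cv"
  unfolding smooth_curve_def
 proof (intro ballI conjI)
  fix t assume t: "t \<in> {-e'<..<e'}"
  show ct: "cv t \<in> points M" unfolding cv_def by (rule paramD(4)[OF M P lW[OF t]])
  let ?V = "{y \<in> W. F y \<in> cdom M (cv t)}"
  note V = param_smooth(3,1)[OF M P ct]
  define T where "T = {-e'<..<e'} \<inter> l -` ?V"
  have T: "open T" unfolding T_def
   by (intro open_Int open_greaterThanLessThan open_vimage V(1) smooth_on_continuous lsm)
  have "smooth_on T (%s. cmap M (cv t) (F (l s)))"
   by (rule smooth_on_compose[OF T V(1) _ smooth_on_subset[OF lsm] V(2)]) (auto simp: T_def)
  moreover have "t \<in> T" using t lW[OF t] cdomD(1)[OF M ct] by (simp add: T_def cv_def)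
  moreover have "cv ` T \<subseteq> cdom M (cv t)" by (auto simp: T_def cv_def)
  ultimately show "\<exists>T. open T \<and> t \<in> T \<and> T \<subseteq> {-e'<..<e'} \<and> cv ` T \<subseteq> cdom M (cv t) \<and> smooth_on T (cmap M (cv t) \<circ> cv)"
   using T unfolding o_def cv_def by (intro exI[of _ T]) (auto simp: T_def)
 qed
 moreover have "cv ` {-e'<..<e'} \<subseteq> S"
 proof (rule image_subsetI)
  fix t assume t: "t \<in> {-e'<..<e'}"
  have "l t \<in> {y \<in> W. y - x \<in> L}" using lW[OF t] subspace_scale[OF L u(1)] by (simp add: l_def)
  then show "cv t \<in> S" using S unfolding cv_def by blast
 qed
 moreover have "velocity A (j \<circ> cv) 0 = w"
 proof -
  have "((%t. cmap A (j (F x)) (j (F (l t)))) has_derivative (%h. tvec F x (h *\<^sub>R u))) (at 0)"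
   by (rule has_derivative_compose[OF ld]) (use J_has_derivative[OF P x] in \<open>simp add: l_def\<close>)
  then have "((%t. cmap A (j (F x)) (j (F (l t)))) has_vector_derivative w) (at 0)"
   by (simp add: has_vector_derivative_def linear_scale[OF tvec_facts(1)[OF P x]] u(2))
  from vector_derivative_at[OF this] show ?thesis by (simp add: velocity_def o_def cv_def l_def)
 qed
 moreover have "cv 0 = F x" by (simp add: cv_def l_def)
 ultimately show "w \<in> T_sub A M j S (F x)" unfolding T_sub_def using e' by blast
next
 have q: "F x \<in> points M" and b: "j (F x) \<in> points A" using Fx[OF P x] by auto
 fix w assume "w \<in> T_sub A M j S (F x)"
 then obtain cv e where e: "e > 0" "smooth_curve M {-e<..<e} cv" "cv 0 = F x" "cv ` {-e<..<e} \<subseteq> S" "w = velocity A (j \<circ> cv) 0"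
  unfolding T_sub_def by auto
 have "0 \<in> {-e<..<e}" using e(1) by simp
 then obtain T where T: "open T" "0 \<in> T" "T \<subseteq> {-e<..<e}" "cv ` T \<subseteq> cdom M (F x)" "smooth_on T (cmap M (F x) \<circ> cv)"
  using e(2,3) unfolding smooth_curve_def by metis
 let ?R = "{y \<in> cmap M (F x) ` cdom M (F x). cinv M (F x) y \<in> F ` W}"
 note R = param_smooth(4,2)[OF M P q]
 define T' where "T' = T \<inter> (cmap M (F x) \<circ> cv) -` ?R"
 have T'o: "open T'" unfolding T'_def
  by (rule continuous_open_preimage[OF smooth_on_continuous[OF T(5)] T(1) R(1)])
 have ci: "cinv M (F x) (cmap M (F x) (cv t)) = cv t" if "t \<in> T" for t
  using param_cinv(2)[OF M q] T(4) that by blast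
 have 0: "0 \<in> T'" unfolding T'_def using T(2) ci[OF T(2)] e(3) x cdomD(1)[OF M q] by auto
 have inW: "cv t \<in> F ` W" if "t \<in> T'" for t using that ci[of t] by (auto simp: T'_def)
 define y where "y t = c (cv t)" for t
 have "smooth_on T' (%t. c (cinv M (F x) ((cmap M (F x) \<circ> cv) t)))"
  by (rule smooth_on_compose[OF T'o R(1) _ smooth_on_subset[OF T(5)] R(2)]) (auto simp: T'_def)
 then have ysm: "smooth_on T' y" unfolding y_def[abs_def]
  by (rule smooth_on_cong[OF T'o, rotated]) (use ci in \<open>auto simp: T'_def\<close>)
 have y0: "y 0 = x" by (simp add: y_def e(3) paramD(2)[OF M P x])
 have yL: "y t - x \<in> L" if "t \<in> T'" for t
 proof -
  have "cv t \<in> S \<inter> F ` W" using inW[OF that] e(4) T(3) that by (auto simp: T'_def)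
  then obtain z where z: "z \<in> W" "z - x \<in> L" "cv t = F z" unfolding S by blast
  then show ?thesis by (simp add: y_def paramD(2)[OF M P])
 qed
 have yd: "(y has_vector_derivative fd y (at 0) 1) (at 0)"
  unfolding has_vector_derivative_def
 proof (rule has_derivative_eq_rhs[OF smooth_on_has_derivative[OF ysm 0]], rule ext)
  fix h :: real
  have "linear (fd y (at 0))"
   by (rule has_derivative_linear[OF smooth_on_has_derivative[OF ysm 0]])
  from linear_scale[OF this, of h 1]
  show "fd y (at 0) h = h *\<^sub>R fd y (at 0) 1" by simp
 qed
 have uL: "fd y (at 0) 1 \<in> L"
 proof -
  have inn: "inner_form (%u v::'m. u \<bullet> v)"
   using bounded_bilinear_inner[where 'a='m] unfolding inner_form_def bilinear_conv_bounded_bilinear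
   by (auto simp: inner_commute)
  \<comment> \<open>A linear map with kernel exactly \<open>L\<close>: along the coordinate curve,
    shifted by \<open>x\<close>, it is constantly zero, hence so is its derivative.\<close>
  define R where "R v = v - orth_proj (%u v. u \<bullet> v) L v" for v
  have Rl: "linear R" unfolding R_def[abs_def] by (intro linear_compose_sub linear_ident orth_proj_linear[OF inn L])
  have R0: "R v = 0 \<longleftrightarrow> v \<in> L" for v
   using orth_proj(1)[OF inn L, of v] orth_proj(4)[OF inn L, of v v] by (auto simp: R_def)
  have "((%t. R (y t - x)) has_derivative (%h. R (h *\<^sub>R fd y (at 0) 1 - 0))) (at 0)"
   by (rule bounded_linear.has_derivative[OF Rl[unfolded linear_conv_bounded_linear]])
    (intro has_derivative_diff has_derivative_const yd[unfolded has_vector_derivative_def])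
  then have "((%t. 0) has_derivative (%h. R (h *\<^sub>R fd y (at 0) 1 - 0))) (at 0)"
   by (rule has_derivative_transform_within_open[OF _ T'o 0]) (use yL R0 in auto)
  from has_derivative_unique[OF this has_derivative_const]
  have "R (1 *\<^sub>R fd y (at 0) 1 - 0) = 0" by metis
  then show ?thesis using R0 by simp
 qed
 have eq: "(j \<circ> cv) t = j (F (y t))" if "t \<in> T'" for t
  using paramD(7)[OF M P inW[OF that]] by (simp add: y_def)
 have "((%t. cmap A (j (F x)) (j (F (y t)))) has_derivative (%h. tvec F x (h *\<^sub>R fd y (at 0) 1))) (at 0)"
  by (rule has_derivative_compose[OF yd[unfolded has_vector_derivative_def]])
   (use J_has_derivative[OF P x] in \<open>simp add: y0\<close>)
 then have "((%t. cmap A (j (F x)) ((j \<circ> cv) t)) has_derivative (%h. tvec F x (h *\<^sub>R fd y (at 0) 1))) (at 0)"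
  by (rule has_derivative_transform_within_open[OF _ T'o 0]) (simp add: eq[simplified])
 then have "((%t. cmap A (j (F x)) ((j \<circ> cv) t)) has_vector_derivative tvec F x (fd y (at 0) 1)) (at 0)"
  by (simp add: has_vector_derivative_def linear_scale[OF tvec_facts(1)[OF P x]])
 from vector_derivative_at[OF this] have "w = tvec F x (fd y (at 0) 1)"
  by (simp add: e(3,5) velocity_def o_def)
 then show "w \<in> tvec F x ` L" using uL by blast
qed

lemma param_translate:
 assumes P: "param M W F c"
 shows "param M ((%y. y - v) ` W) (%y. F (y + v)) (%q. c q - v)"
proof -
 have W: "open W" by (rule paramD(1)[OF M P])
 have oV: "open ((%y. y - v) ` W)" using open_translation[OF W, of "- v"] by (simp add: image_def algebra_simps)
 have "homeomorphism W ((%y. y - v) ` W) (%y. y - v) (%y. y + v)"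
  by (auto simp: homeomorphism_def image_image intro!: continuous_intros)
 from param_reparam[OF M P W subset_refl oV this] show ?thesis
  by (simp add: smooth_on_diff smooth_on_add smooth_on_id smooth_on_const W oV)
qed

text \<open>Slice charts ask for a linear subspace, so the chart is translated by \<open>v\<close>
  to move the affine slice to the origin.\<close>

lemma embedded_slice:
 assumes P: "param M W F c" and L: "subspace L" and S: "S = F ` {y \<in> W. y - v \<in> L}"
 shows "embedded_submanifold M S"
 unfolding embedded_submanifold_def
proof (intro conjI exI[of _ "dim L"] ballI)
 show "S \<subseteq> points M" using S paramD(4)[OF M P] by auto
 fix p assume p: "p \<in> S"
 note P' = param_translate[OF P, of v]
 have V: "(%y. F (y + v)) ` (%y. y - v) ` W = F ` W" by (simp add: image_image)
 have sc: "smooth_chart M (F ` W) (%q. c q - v)" using P' V unfolding param_def by simp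
 have c: "c (F y) = y" if "y \<in> W" for y by (rule paramD(2)[OF M P that])
 have SV: "S \<inter> F ` W = S" using S by auto
 have "(%q. c q - v) ` S = (%q. c q - v) ` F ` W \<inter> L"
 proof (intro equalityI subsetI)
  fix z assume "z \<in> (%q. c q - v) ` S" then show "z \<in> (%q. c q - v) ` F ` W \<inter> L" using S c by auto
 next
  fix z assume "z \<in> (%q. c q - v) ` F ` W \<inter> L"
  then obtain y where y: "y \<in> W" "z = y - v" "z \<in> L" using c by auto
  then have "F y \<in> S" "z = c (F y) - v" using S c by auto
  then show "z \<in> (%q. c q - v) ` S" by blast
 qed
 then show "\<exists>V c L'. smooth_chart M V c \<and> p \<in> V \<and> subspace L' \<and> dim L' = dim L \<and> c ` (S \<inter> V) = c ` V \<inter> L'"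
  using sc p S L by (intro exI[of _ "F ` W"] exI[of _ "%q. c q - v"] exI[of _ L]) (auto simp: SV)
qed

end

section \<open>The slant angle and the projection to D\<theta> in a chart\<close>

locale semi_slant_chart = semi_slant A M j D D\<theta> \<theta>
 for A :: "('a, 'e::euclidean_space) acm" and M :: "('b, 'm::euclidean_space) manifold" and j :: "'b => 'a"
  and D D\<theta> :: "'b => 'e set" and \<theta> :: "'b => real" +
 fixes W :: "'m set" and F :: "'m => 'b" and c :: "'b => 'm"
 assumes Pc: "param M W F c"

sublocale semi_slant_chart \<subseteq> immersed_chart A M j W F c
 by unfold_locales (rule Pc)

context semi_slant_chart
begin

text \<open>For a local section \<open>Z\<close> without zeros, cos^2 \<theta> is the quotient of
  the squared lengths of P Z and Z. No smoothness of \<theta> is part of the definition of a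
  pointwise semi-slant submanifold; it has to be derived from this quotient.\<close>

lemma cos_theta_smooth:
 assumes pr: "proper_at (F ` W)"
 shows "smooth_on W (%x. (cos (\<theta> (F x)))\<^sup>2)"
proof (rule smooth_on_local)
 fix x assume x: "x \<in> W"
 have q: "F x \<in> points M" by (rule F_points[OF x])
 have Ks: "subspace (D\<theta> (F x))" using acm_point.slant_splitD(2)[OF acm_q[OF q] split[OF q]] .
 have "\<exists>z\<in>D\<theta> (F x). z \<noteq> 0" using pr x subspace_0[OF Ks] by (auto simp: proper_at_def set_eq_iff)
 then obtain z where z: "z \<in> D\<theta> (F x)" "z \<noteq> 0" by blast
 from distributionD(3)[OF dist(2) q z(1)]
 obtain V Z where V: "openin (mtop M) V" "F x \<in> V" "sect V D\<theta> Z" "Z (F x) = z" by blast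
 define W' where "W' = {y \<in> W. F y \<in> V}"
 have W': "open W'" "W' \<subseteq> W" "x \<in> W'" using paramD(6)[OF M P V(1)] x V(2) by (auto simp: W'_def)
 interpret I: immersed_chart A M j W' F c
  by unfold_locales (rule param_subset[OF M P W'(1,2)])
 have Zf: "I.sfield (%y. Z (F y))"
  by (rule I.along_sfield[OF V(1)]) (use V(3) in \<open>auto simp: is_section_def W'_def\<close>)
 let ?PZ = "%y. tan_proj A M j (F y) (phi A (j (F y)) (Z (F y)))"
 have s: "smooth_on W' (%y. g (F y) (?PZ y) (?PZ y))" "smooth_on W' (%y. g (F y) (Z (F y)) (Z (F y)))"
  using I.sfield_met[OF I.sfield_tan[OF I.sfield_phi[OF Zf]] I.sfield_tan[OF I.sfield_phi[OF Zf]]] I.sfield_met[OF Zf Zf] by auto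
 define T where "T = W' \<inter> (%y. g (F y) (Z (F y)) (Z (F y))) -` {0<..}"
 have T: "open T" unfolding T_def
  by (rule continuous_open_preimage[OF smooth_on_continuous[OF s(2)] W'(1) open_greaterThan])
 have xT: "x \<in> T" using W'(3) z(2) V(4) iform_pos[OF met_form[OF iF[OF x]]] by (simp add: T_def)
 have TW: "T \<subseteq> W'" by (auto simp: T_def)
 have "smooth_on T (%y. g (F y) (?PZ y) (?PZ y) * inverse (g (F y) (Z (F y)) (Z (F y))))"
  by (intro smooth_on_mult smooth_on_inverse T smooth_on_subset[OF s(1) TW] smooth_on_subset[OF s(2) TW])
   (auto simp: T_def)
 then have "smooth_on T (%x. (cos (\<theta> (F x)))\<^sup>2)"
 proof (rule smooth_on_cong[OF T, rotated])
  fix y assume y: "y \<in> T"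
  then have yW: "y \<in> W" and yq: "F y \<in> points M" and pos: "g (F y) (Z (F y)) (Z (F y)) > 0"
   using TW W' F_points by (auto simp: T_def)
  have "Z (F y) \<in> D\<theta> (F y)" using V(3) y TW by (auto simp: is_section_def W'_def)
  from acm_point.slant_split_P(4)[OF acm_q[OF yq] split[OF yq] this] pos
  show "g (F y) (?PZ y) (?PZ y) * inverse (g (F y) (Z (F y)) (Z (F y))) = (cos (\<theta> (F y)))\<^sup>2"
   by (simp add: tan_proj_def)
 qed
 then show "\<exists>T. open T \<and> x \<in> T \<and> smooth_on T (%x. (cos (\<theta> (F x)))\<^sup>2)" using T xT by blast
qed

text \<open>\<theta> is recovered as the arccosine of the square root of cos^2 \<theta>; strictly
  between 0 and \<pi>/2 both functions are differentiable.\<close>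

lemma theta_differentiable:
 assumes pr: "proper_at (F ` W)" and x: "x \<in> W"
 shows "(%y. \<theta> (F y)) differentiable (at x)"
  and "fd (%y. (cos (\<theta> (F y)))\<^sup>2) (at x) v =
   - (2 * cos (\<theta> (F x)) * sin (\<theta> (F x))) * fd (%y. \<theta> (F y)) (at x) v"
proof -
 have tb: "0 < \<theta> (F y)" "\<theta> (F y) < pi / 2" "0 < cos (\<theta> (F y))" "cos (\<theta> (F y)) < 1" if "y \<in> W" for y
  using theta_bounds[OF F_points[OF that] pr] that by auto
 let ?C = "%y. (cos (\<theta> (F y)))\<^sup>2"
 have Cd: "?C differentiable (at x)" by (rule smooth_on_differentiable[OF cos_theta_smooth[OF pr] x])
 have r: "(%t. arccos (sqrt t)) differentiable (at (?C x))"
 proof -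
  have 1: "(sqrt has_real_derivative inverse (sqrt (?C x)) / 2) (at (?C x))"
   by (rule DERIV_real_sqrt) (use tb(3)[OF x] in simp)
  have s: "sqrt (?C x) = cos (\<theta> (F x))" using tb(3)[OF x] by simp
  have 2: "(arccos has_real_derivative inverse (- sqrt (1 - (sqrt (?C x))\<^sup>2))) (at (sqrt (?C x)))"
   unfolding s by (rule DERIV_arccos) (use tb(3,4)[OF x] in auto)
  from DERIV_chain2[OF 2 1] show ?thesis by (auto simp: has_field_derivative_def differentiable_def)
 qed
 have e: "arccos (sqrt (?C y)) = \<theta> (F y)" if "y \<in> W" for y
  using tb[OF that] pi_gt_zero by (simp add: arccos_cos)
 have "(%y. arccos (sqrt (?C y))) differentiable (at x)"
  by (rule frechet_chain(2)[OF Cd r])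
 then show td: "(%y. \<theta> (F y)) differentiable (at x)"
  using frechet_derivative_cong_open(2)[OF W_open x, of "%y. arccos (sqrt (?C y))" "%y. \<theta> (F y)"] e by simp
 have "((%t. (cos t)\<^sup>2) has_real_derivative - (2 * cos (\<theta> (F x)) * sin (\<theta> (F x)))) (at (\<theta> (F x)))"
  by (auto intro!: derivative_eq_intros)
 then have "((%t. (cos t)\<^sup>2) has_derivative (%h. - (2 * cos (\<theta> (F x)) * sin (\<theta> (F x))) * h)) (at (\<theta> (F x)))"
  unfolding has_field_derivative_def by (rule has_derivative_eq_rhs) auto
 from has_derivative_compose[OF td[unfolded frechet_derivative_works] this]
 have "(?C has_derivative (%v. - (2 * cos (\<theta> (F x)) * sin (\<theta> (F x))) * fd (%y. \<theta> (F y)) (at x) v)) (at x)" .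
 from frechet_derivative_at[OF this] show "fd ?C (at x) v =
   - (2 * cos (\<theta> (F x)) * sin (\<theta> (F x))) * fd (%y. \<theta> (F y)) (at x) v"
  by metis
qed

text \<open>The projection to \<open>D\<theta>\<close> along \<open>D \<oplus> \<langle>\<xi>\<rangle>\<close> in coordinates; it is smooth because it is
 \<open>(1 + P\<^sup>2 - \<eta> \<otimes> \<xi>) / sin\<^sup>2 \<theta>\<close>.\<close>

definition kp :: "'m => 'm => 'm" where
 "kp x u = inverse (1 - (cos (\<theta> (F x)))\<^sup>2) *\<^sub>R
  (u + tan_coord (%y. phi A (j (F y)) (tvec F y (tan_coord (%y. phi A (j (F y)) (tvec F y u)) y))) x
  - g (F x) (tvec F x u) (xi A (j (F x))) *\<^sub>R tan_coord (%y. xi A (j (F y))) x)"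

lemma kp_component:
 assumes pr: "proper_at (F ` W)" and x: "x \<in> W" and u: "tvec F x u = h + k" "h \<in> H (F x)" "k \<in> D\<theta> (F x)"
 shows "tvec F x (kp x u) = k"
proof -
 have q: "F x \<in> points M" by (rule F_points[OF x])
 interpret a: acm_point "g (F x)" "phi A (j (F x))" "eta A (j (F x))" "xi A (j (F x))" by (rule acm_q[OF q])
 note S = split[OF q]
 note SD = a.slant_splitD[OF S] and SP = a.slant_split_P[OF S]
 have lt: "linear (tvec F x)" by (rule tvec_facts(1)[OF P x])
 let ?P = "%z. orth_proj (g (F x)) (TM M A j (F x)) (phi A (j (F x)) z)"
 have lP: "linear ?P" using linear_compose[OF a.lin\<phi> orth_proj_linear[OF a.b SD(3)]] by (simp add: o_def)
 have xiT: "orth_proj (g (F x)) (TM M A j (F x)) (xi A (j (F x))) = xi A (j (F x))"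
  by (rule orth_proj(4)[OF a.b SD(3)]) (use SD(4,6) in auto)
 have "tvec F x (kp x u) = inverse (1 - (cos (\<theta> (F x)))\<^sup>2) *\<^sub>R (h + k + ?P (?P (h + k)) - eta A (j (F x)) (h + k) *\<^sub>R xi A (j (F x)))"
  by (simp add: kp_def linear_scale[OF lt] linear_add[OF lt] linear_diff[OF lt] tan_coord[OF x] tan_proj_def u(1) a.b_\<xi> xiT)
 also have "?P (?P (h + k)) = - h + eta A (j (F x)) h *\<^sub>R xi A (j (F x)) - (cos (\<theta> (F x)))\<^sup>2 *\<^sub>R k"
  using SP(1)[OF u(2)] SP(1)[OF SD(9)[OF u(2)]] SP(5)[OF u(3)] by (simp add: linear_add[OF lP] a.\<phi>\<phi>)
 also have "h + k + (- h + eta A (j (F x)) h *\<^sub>R xi A (j (F x)) - (cos (\<theta> (F x)))\<^sup>2 *\<^sub>R k) - eta A (j (F x)) (h + k) *\<^sub>R xi A (j (F x))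
   = (1 - (cos (\<theta> (F x)))\<^sup>2) *\<^sub>R k"
  using SD(10)[OF u(3)] by (simp add: linear_add[OF a.lin\<eta>] algebra_simps)
 finally show ?thesis using theta_bounds(5)[OF q pr] x by simp
qed

lemma kp_facts:
 assumes pr: "proper_at (F ` W)" and x: "x \<in> W"
 shows "linear (kp x)" "kp x (kp x u) = kp x u" "kp x u = u \<longleftrightarrow> tvec F x u \<in> D\<theta> (F x)" "kp x u = 0 \<longleftrightarrow> tvec F x u \<in> H (F x)"
  "tvec F x (kp x u) \<in> D\<theta> (F x)" "tvec F x (u - kp x u) \<in> H (F x)"
proof -
 have q: "F x \<in> points M" by (rule F_points[OF x])
 interpret a: acm_point "g (F x)" "phi A (j (F x))" "eta A (j (F x))" "xi A (j (F x))" by (rule acm_q[OF q])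
 note SD = a.slant_splitD[OF split[OF q]]
 have lt: "linear (tvec F x)" and it: "inj (tvec F x)" by (rule tvec_facts[OF P x])+
 have dec: "\<exists>h k. tvec F x u = h + k \<and> h \<in> H (F x) \<and> k \<in> D\<theta> (F x)" for u
  by (rule SD(11)) (simp add: TM_range[OF x])
 note comp = kp_component[OF pr x]
 have K: "tvec F x (kp x u) \<in> D\<theta> (F x)" "tvec F x (u - kp x u) \<in> H (F x)" for u
 proof -
  obtain h k where d: "tvec F x u = h + k" "h \<in> H (F x)" "k \<in> D\<theta> (F x)" using dec by blast
  show "tvec F x (kp x u) \<in> D\<theta> (F x)" "tvec F x (u - kp x u) \<in> H (F x)"
   using comp[OF d] d by (simp_all add: linear_diff[OF lt])
 qed
 then show "tvec F x (kp x u) \<in> D\<theta> (F x)" "tvec F x (u - kp x u) \<in> H (F x)" by auto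
 have fixK: "kp x u = u" if "tvec F x u \<in> D\<theta> (F x)" for u
  using comp[of u 0 "tvec F x u"] subspace_0[OF SD(1)] that injD[OF it] by simp
 then show "kp x (kp x u) = kp x u" using K(1) by simp
 show "kp x u = u \<longleftrightarrow> tvec F x u \<in> D\<theta> (F x)" using fixK K(1)[of u] by auto
 have zero: "kp x u = 0" if "tvec F x u \<in> H (F x)"
  using comp[of u "tvec F x u" 0] subspace_0[OF SD(2)] that tvec_zero_iff[OF P x] by simp
 show "kp x u = 0 \<longleftrightarrow> tvec F x u \<in> H (F x)" using zero K(2)[of u] by auto
 show "linear (kp x)"
 proof
  fix u v
  obtain h k h' k' where d: "tvec F x u = h + k" "h \<in> H (F x)" "k \<in> D\<theta> (F x)"
   "tvec F x v = h' + k'" "h' \<in> H (F x)" "k' \<in> D\<theta> (F x)" using dec by metis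
  have "tvec F x (kp x (u + v)) = k + k'"
   by (rule comp[of _ "h + h'"]) (auto simp: linear_add[OF lt] d subspace_add SD(1,2))
  then show "kp x (u + v) = kp x u + kp x v"
   using comp[OF d(1-3)] comp[OF d(4-6)] by (intro injD[OF it]) (simp add: linear_add[OF lt])
 next
  fix r u
  obtain h k where d: "tvec F x u = h + k" "h \<in> H (F x)" "k \<in> D\<theta> (F x)" using dec by blast
  have "tvec F x (kp x (r *\<^sub>R u)) = r *\<^sub>R k"
   by (rule comp[of _ "r *\<^sub>R h"]) (auto simp: linear_scale[OF lt] d scaleR_add_right subspace_scale SD(1,2))
  then show "kp x (r *\<^sub>R u) = r *\<^sub>R kp x u"
   using comp[OF d] by (intro injD[OF it]) (simp add: linear_scale[OF lt])
 qed
qed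

lemma kp_smooth:
 assumes pr: "proper_at (F ` W)"
 shows "smooth_on W (%x. kp x u)"
 unfolding kp_def
proof (intro smooth_on_scaleR smooth_on_inverse smooth_on_diff smooth_on_add W_open smooth_on_const
  cos_theta_smooth[OF pr] tan_coord_smooth sfield_phi sfield_tvec sfield_xi sfield_met)
 show "1 - (cos (\<theta> (F x)))\<^sup>2 \<noteq> 0" if "x \<in> W" for x
  using theta_bounds(5)[OF F_points[OF that] pr] that by simp
qed

end

lemma has_derivative_const_on_open:
 assumes "(f has_derivative f') (at x)" "open S" "x \<in> S" "\<And>y. y \<in> S ==> f y = k"
 shows "f' u = 0"
proof -
 have "((%y. k) has_derivative f') (at x)"
  by (rule has_derivative_transform_within_open[OF assms(1-3)]) (simp add: assms(4))
 from has_derivative_unique[OF this has_derivative_const] show ?thesis by metis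
qed

section \<open>Extending sections, the shape condition as a condition on the connection,
  involutivity\<close>

context semi_slant_chart
begin

lemma F_continuous: "continuous_map (top_of_set W) (mtop M) F"
 unfolding continuous_map_def
proof (intro conjI allI impI)
 show "F \<in> topspace (top_of_set W) \<rightarrow> points M" using F_points by auto
 fix U assume "openin (mtop M) U"
 from paramD(6)[OF M P this] show "openin (top_of_set W) {x \<in> topspace (top_of_set W). F x \<in> U}"
  by (simp add: open_subset)
qed

lemma compact_image_closed:
 assumes "compact S" "S \<subseteq> W"
 shows "closedin (mtop M) (F ` S)"
proof -
 note F_continuous
 moreover have "compactin (top_of_set W) S" using assms by (simp add: compactin_subtopology)
 ultimately have "compactin (mtop M) (F ` S)" by (rule image_compactin[rotated])
 moreover have "Hausdorff_space (mtop M)" using M by (simp add: smooth_manifold_def)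
 ultimately show ?thesis using compactin_imp_closedin by blast
qed

text \<open>The shape condition quantifies over sections on all of \<open>V\<close>, while
  coordinate fields exist on one chart. A bump function extends them by zero; its support has
  compact image, which is closed because the manifold is Hausdorff, so the extension is
  smooth.\<close>

lemma extend_section:
 assumes V: "openin (mtop M) V" "F ` W \<subseteq> V" and x0: "x0 \<in> W" and X: "smooth_on W X"
  and E: "\<And>q. q \<in> V ==> subspace (E q)" and XE: "\<And>y. y \<in> W ==> tvec F y (X y) \<in> E (F y)"
 obtains Z where "sect V E Z" "Z (F x0) = tvec F x0 (X x0)"
proof -
 obtain R where R: "R > 0" "cball x0 R \<subseteq> W" using W_open x0 open_contains_cball by blast
 obtain \<psi> :: "'m => real" where \<psi>: "smooth_on UNIV \<psi>" "\<And>y. dist x0 y \<le> R/3 ==> \<psi> y = 1" "\<And>y. dist x0 y \<ge> R/2 ==> \<psi> y = 0"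
  by (rule smooth_bump[of "R/3" "R/2" x0]) (use R(1) in auto)
 define C where "C = F ` cball x0 (R/2)"
 have C: "closedin (mtop M) C" unfolding C_def
  by (rule compact_image_closed) (use R in \<open>auto simp: subset_iff\<close>)
 have CW: "C \<subseteq> F ` W" unfolding C_def using R by (auto simp: subset_iff)
 define Z where "Z q = (if q \<in> F ` W then tvec F (c q) (\<psi> (c q) *\<^sub>R X (c q)) else 0)" for q
 have Z0: "Z q = 0" if "q \<notin> C" for q
 proof (cases "q \<in> F ` W")
  case True
  then obtain y where y: "y \<in> W" "q = F y" by blast
  then have "\<not> dist x0 y \<le> R/2" using that by (auto simp: C_def)
  then have "\<psi> (c q) = 0" using \<psi>(3)[of y] y by (simp add: cF)
  then show ?thesis using y linear_0[OF tvec_facts(1)[OF P y(1)]] by (simp add: Z_def cF)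
 qed (simp add: Z_def)
 have ZF: "Z (F y) = tvec F y (\<psi> y *\<^sub>R X y)" if "y \<in> W" for y using that by (simp add: Z_def cF)
 have "smooth_along M A j V Z"
 proof (rule smooth_alongI[OF V(1)])
  fix p assume p: "p \<in> V"
  have pM: "p \<in> points M" using p V(1) openin_subset by blast
  have b: "j p \<in> points A" by (rule iota_points[OF pM])
  show "\<exists>W F c b T. param M W F c \<and> b \<in> points A \<and> open T \<and> T \<subseteq> {x \<in> W. F x \<in> V \<and> j (F x) \<in> cdom A b} \<and>
   p \<in> F ` T \<and> smooth_on T (%x. rep A b (j (F x)) (Z (F x)))"
  proof (cases "p \<in> F ` W")
   case True
   then obtain x where x: "x \<in> W" "p = F x" by blast
   define T where "T = {y \<in> W. j (F y) \<in> cdom A (j p)}"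
   have T: "open T" unfolding T_def by (rule base_open(1)[OF P b])
   have "smooth_on T (%y. rep A (j p) (j (F y)) (tvec F y (\<psi> y *\<^sub>R X y)))"
    by (rule rep_cfield_smooth[OF P T _ smooth_on_scaleR[OF T smooth_on_subset[OF \<psi>(1)] smooth_on_subset[OF X]] b])
     (auto simp: T_def)
   then have "smooth_on T (%y. rep A (j p) (j (F y)) (Z (F y)))"
    by (rule smooth_on_cong[OF T, rotated]) (simp add: ZF T_def)
   moreover have "p \<in> F ` T" using x cdomD(1)[OF A b] by (auto simp: T_def)
   moreover have "T \<subseteq> {x \<in> W. F x \<in> V \<and> j (F x) \<in> cdom A (j p)}" using V(2) by (auto simp: T_def)
   ultimately show ?thesis using P b T by blast
  next
   case False
   note Pp = param_cinv[OF M pM]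
   define T where "T = {y \<in> cmap M p ` cdom M p. cinv M p y \<in> V - C} \<inter> {y \<in> cmap M p ` cdom M p. j (cinv M p y) \<in> cdom A (j p)}"
   have T: "open T" unfolding T_def
    by (intro open_Int paramD(6)[OF M Pp(1)] openin_diff V(1) C base_open(1)[OF Pp(1) b])
   have "smooth_on T (%y. rep A (j p) (j (cinv M p y)) (Z (cinv M p y)))"
   proof (rule smooth_on_cong[OF T _ smooth_on_const[of _ 0]])
    fix y assume "y \<in> T"
    then have "j (cinv M p y) \<in> cdom A (j p)" "Z (cinv M p y) = 0" using Z0 by (auto simp: T_def)
    then show "0 = rep A (j p) (j (cinv M p y)) (Z (cinv M p y))"
     using linear_0[OF rep_inverse(3)[OF b]] by simp
   qed
   moreover have "p \<in> cinv M p ` T"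
    using p False CW Pp(2) cdomD(1)[OF M pM] cdomD(1)[OF A b] by (intro image_eqI[of _ _ "cmap M p p"]) (auto simp: T_def)
   moreover have "T \<subseteq> {x \<in> cmap M p ` cdom M p. cinv M p x \<in> V \<and> j (cinv M p x) \<in> cdom A (j p)}" by (auto simp: T_def)
   ultimately show ?thesis using Pp(1) b T by blast
  qed
 qed
 moreover have "Z q \<in> E q" if q: "q \<in> V" for q
 proof (cases "q \<in> F ` W")
  case True
  then obtain y where y: "y \<in> W" "q = F y" by blast
  then show ?thesis
   using subspace_scale[OF E[OF q] XE[OF y(1), folded y(2)], of "\<psi> y"] ZF[OF y(1)] linear_scale[OF tvec_facts(1)[OF P y(1)]] by simp
 qed (simp add: Z_def subspace_0[OF E[OF q]])
 moreover have "Z (F x0) = tvec F x0 (X x0)" using ZF[OF x0] \<psi>(2)[of x0] R(1) by simp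
 ultimately show ?thesis using that unfolding is_section_def by blast
qed

text \<open>The shape operator condition in terms of the connection.\<close>

definition umbilic :: "('b => real) => bool" where
 "umbilic \<mu> \<longleftrightarrow> (\<forall>x\<in>W. \<forall>X. sfield X \<longrightarrow> (\<forall>y\<in>W. X y \<in> H (F y)) \<longrightarrow> (\<forall>a v. \<forall>w\<in>D\<theta> (F x). X x = tvec F x a \<longrightarrow>
  g (F x) (nb x v X) w = fd (%y. \<mu> (F y)) (at x) a * g (F x) (tvec F x v) w))"

lemma split_facts:
 assumes x: "x \<in> W"
 shows "subspace (H (F x))" "subspace (D\<theta> (F x))" "H (F x) \<subseteq> TM M A j (F x)" "D\<theta> (F x) \<subseteq> TM M A j (F x)"
  "h \<in> H (F x) ==> k \<in> D\<theta> (F x) ==> g (F x) h k = 0" "h \<in> H (F x) ==> phi A (j (F x)) h \<in> H (F x)"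
  "inner_form (g (F x))"
 using acm_point.slant_splitD[OF acm_q[OF F_points[OF x]] split[OF F_points[OF x]]] met_form[OF iF[OF x]] by auto

text \<open>The hypothesis is applied to sections on \<open>V\<close> with prescribed values at
  \<open>F x\<close>. This suffices because the shape operators and the derivative of \<mu> take
  only these values as arguments. Properness enters when sin^2 \<theta> is cancelled.\<close>

lemma umbilic_of_shape:
 assumes V: "openin (mtop M) V" "F ` W \<subseteq> V" and pr: "proper_at V" and \<mu>: "smooth_on W (%x. \<mu> (F x))"
  and eq: "\<And>X Z q. sect V H X ==> sect V D\<theta> Z ==> q \<in> V ==>
   shape_eq \<mu> X Z q"
 shows "umbilic \<mu>"
 unfolding umbilic_def
proof (intro ballI allI impI)
 fix x X a v w
 assume x: "x \<in> W" and X: "sfield X" "\<forall>y\<in>W. X y \<in> H (F y)" and w: "w \<in> D\<theta> (F x)" and a: "X x = tvec F x a"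
 have q: "F x \<in> points M" by (rule F_points[OF x])
 have pW: "proper_at (F ` W)" using pr V(2) by (auto simp: proper_at_def)
 have Vp: "q \<in> points M" if "q \<in> V" for q using V(1) openin_subset that by blast
 note sf = split_facts[OF x] and kp = kp_facts[OF pW]
 have subH: "subspace (H q)" and subK: "subspace (D\<theta> q)" if "q \<in> V" for q
  using acm_point.slant_splitD(1,2)[OF acm_q[OF Vp[OF that]] split[OF Vp[OF that]]] by auto
 obtain b where b: "w = tvec F x b" using w sf(4) TM_range[OF x] by blast
 have ka: "kp x a = 0" using kp(4)[OF x] a X(2) x by auto
 have kb: "kp x b = b" using kp(3)[OF x] b w by auto
 obtain X' where X': "sect V H X'" "X' (F x) = tvec F x (a - kp x a)"
  by (rule extend_section[OF V x smooth_on_diff[OF W_open smooth_on_const kp_smooth[OF pW]] subH]) (use kp(6) in auto)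
 obtain Z' where Z': "sect V D\<theta> Z'" "Z' (F x) = tvec F x (kp x b)"
  by (rule extend_section[OF V x kp_smooth[OF pW] subK]) (use kp(5) in auto)
 have vals: "X' (F x) = X x" "Z' (F x) = w" using X'(2) Z'(2) a b ka kb by auto
 have "F x \<in> V" using V(2) x by blast
 note e = eq[OF X'(1) Z'(1) this, unfolded vals]
 have dd: "dir_deriv M A j (F x) (X x) \<mu> = fd (%y. \<mu> (F y)) (at x) a"
  unfolding a by (rule dir_deriv_tvec[OF P x smooth_on_differentiable[OF \<mu> x]])
 have XT: "X y \<in> TM M A j (F y)" "phi A (j (F y)) (X y) \<in> TM M A j (F y)" if "y \<in> W" for y
  using X(2) that split_facts(3,6)[OF that] by blast+
 have "(sin (\<theta> (F x)))\<^sup>2 * g (F x) (nb x v X) w =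
   g (F x) (((sin (\<theta> (F x)))\<^sup>2 * fd (%y. \<mu> (F y)) (at x) a) *\<^sub>R w) (tvec F x v)"
  using shape_difference(2)[OF x split[OF q] X(1) XT w, of v] unfolding e dd by simp
 moreover have "sin (\<theta> (F x)) \<noteq> 0" using theta_bounds(6)[OF q pW] x by simp
 ultimately show "g (F x) (nb x v X) w = fd (%y. \<mu> (F y)) (at x) a * g (F x) (tvec F x v) w"
  by (simp add: iform_simps[OF sf(7)] iform_sym[OF sf(7), of w])
qed

context
 fixes \<mu>
 assumes pr: "proper_at (F ` W)" and um: "umbilic \<mu>"
begin

lemma umbilicD:
 assumes "x \<in> W" "sfield X" "\<And>y. y \<in> W ==> X y \<in> H (F y)" "w \<in> D\<theta> (F x)" "X x = tvec F x a"
 shows "g (F x) (nb x v X) w = fd (%y. \<mu> (F y)) (at x) a * g (F x) (tvec F x v) w"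
proof -
 have "\<forall>a v. \<forall>w\<in>D\<theta> (F x). X x = tvec F x a \<longrightarrow>
  g (F x) (nb x v X) w = fd (%y. \<mu> (F y)) (at x) a * g (F x) (tvec F x v) w"
  using um assms(1-3) unfolding umbilic_def by blast
 then show ?thesis using assms(4,5) by blast
qed

text \<open>For \<open>h\<close> in \<open>H\<close>, differentiating orthogonality turns the
  \<open>h\<close>-component of \<nabla>_u v into -h(\<mu>) g(u, v), which is symmetric in
  \<open>u\<close> and \<open>v\<close>. The bracket is therefore orthogonal to
  \<open>H\<close>.\<close>

lemma kp_involutive_K:
 assumes x: "x \<in> W" and u: "kp x u = u" and v: "kp x v = v"
 shows "kp x (fd (%y. kp y v) (at x) u - fd (%y. kp y u) (at x) v) =
  fd (%y. kp y v) (at x) u - fd (%y. kp y u) (at x) v" (is "kp x ?E = ?E")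
proof -
 note sf = split_facts[OF x] and kp = kp_facts[OF pr]
 note gs = iform_simps[OF sf(7)] and gsym = iform_sym[OF sf(7)]
 have t: "nb x u (%y. tvec F y (kp y v)) - nb x v (%y. tvec F y (kp y u)) = tvec F x ?E"
  using nb_torsion[OF x kp_smooth[OF pr, of u] kp_smooth[OF pr, of v]] unfolding u v .
 have perp: "g (F x) (tvec F x ?E) h = 0" if h: "h \<in> H (F x)" for h
 proof -
  obtain a where a: "h = tvec F x a" using h sf(3) TM_range[OF x] by blast
  have ka: "kp x a = 0" using kp(4)[OF x] a h by auto
  define Z where "Z y = tvec F y (a - kp y a)" for y
  have Zs: "sfield Z" unfolding Z_def[abs_def]
   by (intro sfield_tvec smooth_on_diff W_open smooth_on_const kp_smooth pr)
  have ZH: "Z y \<in> H (F y)" if "y \<in> W" for y unfolding Z_def by (rule kp(6)[OF that])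
  have Zx: "Z x = tvec F x a" by (simp add: Z_def ka)
  have *: "g (F x) (nb x r (%y. tvec F y (kp y s))) h =
    - (fd (%y. \<mu> (F y)) (at x) a * g (F x) (tvec F x r) (tvec F x s))" if "kp x s = s" for r s
  proof -
   have "g (F y) (tvec F y (kp y s)) (Z y) = 0" if "y \<in> W" for y
    using split_facts(5)[OF that ZH[OF that] kp(5)[OF that]] iform_sym[OF split_facts(7)[OF that]] by simp
   from has_derivative_const_on_open[OF nb_met[OF x sfield_tvec[OF kp_smooth[OF pr]] Zs] W_open x this, of r]
   have "g (F x) (nb x r (%y. tvec F y (kp y s))) h + g (F x) (tvec F x s) (nb x r Z) = 0"
    unfolding Zx a that .
   moreover have "g (F x) (nb x r Z) (tvec F x s) = fd (%y. \<mu> (F y)) (at x) a * g (F x) (tvec F x r) (tvec F x s)"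
    by (rule umbilicD[OF x Zs ZH _ Zx]) (use kp(3)[OF x] that in auto)
   ultimately show ?thesis using gsym[of "tvec F x s" "nb x r Z"] by linarith
  qed
  show ?thesis unfolding t[symmetric] gs(3) *[OF u] *[OF v] using gsym[of "tvec F x u" "tvec F x v"] by simp
 qed
 have "tvec F x (?E - kp x ?E) \<in> H (F x)" by (rule kp(6)[OF x])
 moreover have d: "tvec F x ?E = tvec F x (?E - kp x ?E) + tvec F x (kp x ?E)"
  by (simp add: linear_diff[OF tvec_facts(1)[OF P x]])
 moreover have "g (F x) (tvec F x ?E) (tvec F x (?E - kp x ?E)) = g (F x) (tvec F x (?E - kp x ?E)) (tvec F x (?E - kp x ?E))
   + g (F x) (tvec F x (kp x ?E)) (tvec F x (?E - kp x ?E))"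
  by (subst d) (rule gs(1))
 ultimately have "g (F x) (tvec F x (?E - kp x ?E)) (tvec F x (?E - kp x ?E)) = 0"
  using perp[of "tvec F x (?E - kp x ?E)"] sf(5)[OF _ kp(5)[OF x, of ?E], of "tvec F x (?E - kp x ?E)"]
   gsym[of "tvec F x (kp x ?E)" "tvec F x (?E - kp x ?E)"] by linarith
 then have "tvec F x (?E - kp x ?E) = 0" by (rule iform_zero[OF sf(7)])
 then show ?thesis using tvec_zero_iff[OF P x] by simp
qed

text \<open>For \<open>u\<close> in \<open>H\<close> the umbilicity condition has the factor g(u, w)
  = 0 on the right. So derivatives of sections of \<open>H\<close> along \<open>H\<close> have no
  component in D\<theta>, and neither has the bracket.\<close>

lemma kp_involutive_H:
 assumes x: "x \<in> W" and u: "kp x u = 0" and v: "kp x v = 0"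
 shows "kp x (fd (%y. v - kp y v) (at x) u - fd (%y. u - kp y u) (at x) v) = 0"
proof -
 note sf = split_facts[OF x] and kp = kp_facts[OF pr]
 note gs = iform_simps[OF sf(7)] and gsym = iform_sym[OF sf(7)]
 let ?E = "fd (%y. v - kp y v) (at x) u - fd (%y. u - kp y u) (at x) v"
 have s: "smooth_on W (%y. r - kp y r)" for r by (intro smooth_on_diff W_open smooth_on_const kp_smooth pr)
 have t: "nb x u (%y. tvec F y (v - kp y v)) - nb x v (%y. tvec F y (u - kp y u)) = tvec F x ?E"
  using nb_torsion[OF x s[of u] s[of v]] unfolding u v by simp
 have uH: "tvec F x u \<in> H (F x)" "tvec F x v \<in> H (F x)" using kp(4)[OF x] u v by auto
 have perp: "g (F x) (tvec F x ?E) w = 0" if w: "w \<in> D\<theta> (F x)" for w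
 proof -
  have "g (F x) (nb x r (%y. tvec F y (s - kp y s))) w = 0" if "kp x s = 0" "tvec F x r \<in> H (F x)" for r s
  proof -
   have "g (F x) (nb x r (%y. tvec F y (s - kp y s))) w = fd (%y. \<mu> (F y)) (at x) s * g (F x) (tvec F x r) w"
    by (rule umbilicD[OF x sfield_tvec[OF s] kp(6) w]) (use that in auto)
   then show ?thesis using sf(5)[OF that(2) w] by simp
  qed
  from this[OF v uH(1)] this[OF u uH(2)] show ?thesis unfolding t[symmetric] gs(3) by simp
 qed
 have d: "tvec F x ?E = tvec F x (?E - kp x ?E) + tvec F x (kp x ?E)"
  by (simp add: linear_diff[OF tvec_facts(1)[OF P x]])
 have "g (F x) (tvec F x ?E) (tvec F x (kp x ?E)) = g (F x) (tvec F x (?E - kp x ?E)) (tvec F x (kp x ?E))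
   + g (F x) (tvec F x (kp x ?E)) (tvec F x (kp x ?E))"
  by (subst d) (rule gs(1))
 then have "g (F x) (tvec F x (kp x ?E)) (tvec F x (kp x ?E)) = 0"
  using perp[OF kp(5)[OF x, of ?E]] sf(5)[OF kp(6)[OF x, of ?E] kp(5)[OF x, of ?E]] by linarith
 then have "tvec F x (kp x ?E) = 0" by (rule iform_zero[OF sf(7)])
 then show ?thesis using tvec_zero_iff[OF P x] by simp
qed

text \<open>Frobenius for both distributions.\<close>

lemma adapted_coordinates:
 assumes x0: "x0 \<in> W"
 obtains U V f h where "open U" "x0 \<in> U" "U \<subseteq> W" "open V" "homeomorphism U V f h" "smooth_on U f" "smooth_on V h"
  "\<And>y u. y \<in> V ==> kp x0 u = u ==> tvec F (h y) (fd h (at y) u) \<in> D\<theta> (F (h y))"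
  "\<And>y u. y \<in> V ==> kp x0 u = 0 ==> tvec F (h y) (fd h (at y) u) \<in> H (F (h y))"
proof -
 note kp = kp_facts[OF pr]
 define kq where "kq x u = u - kp x u" for x u
 have kql: "linear (kq x)" if "x \<in> W" for x unfolding kq_def[abs_def] by (intro linear_compose_sub linear_ident kp(1)[OF that])
 have kqs: "smooth_on W (%x. kq x u)" for u unfolding kq_def by (intro smooth_on_diff W_open smooth_on_const kp_smooth pr)
 have kqi: "kq x (kq x u) = kq x u" if "x \<in> W" for x u
  unfolding kq_def using kp(2)[OF that] by (simp add: linear_diff[OF kp(1)[OF that]])
 show ?thesis
 proof (rule frobenius[where \<rho>=kp, OF W_open x0 kp(1) kp_smooth[OF pr] kp(2) kp_involutive_K], assumption+)
  fix U2 f2 assume U2: "open U2" "x0 \<in> U2" "U2 \<subseteq> W" "smooth_on U2 f2" "\<And>x. x \<in> U2 ==> kp x0 (f2 x) = 0"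
   "\<And>x v. x \<in> U2 ==> fd f2 (at x) v = 0 \<longleftrightarrow> kp x v = v"
  have invH: "kq x (fd (%y. kq y v) (at x) u - fd (%y. kq y u) (at x) v) =
   fd (%y. kq y v) (at x) u - fd (%y. kq y u) (at x) v"
   if "x \<in> W" "kq x u = u" "kq x v = v" for x u v
   using kp_involutive_H[OF that(1), of u v] that(2,3) unfolding kq_def by simp
  show thesis
  proof (rule frobenius[where \<rho>=kq, OF W_open x0 kql kqs kqi invH], assumption+)
   fix U1 f1 assume U1: "open U1" "x0 \<in> U1" "U1 \<subseteq> W" "smooth_on U1 f1" "\<And>x. x \<in> U1 ==> kq x0 (f1 x) = 0"
    "\<And>x v. x \<in> U1 ==> fd f1 (at x) v = 0 \<longleftrightarrow> kq x v = v"
   define S where "S = U1 \<inter> U2"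
   have S: "open S" "x0 \<in> S" "S \<subseteq> W" using U1 U2 by (auto simp: S_def)
   \<comment> \<open>\<open>f1\<close> takes values in the range of \<open>kp x0\<close> and is
     constant along \<open>H\<close>; \<open>f2\<close> takes values in its kernel and is constant
     along D\<theta>. Their sum straightens both distributions at once.\<close>
   define f where "f x = f1 x + f2 x" for x
   have f12: "smooth_on S f1" "smooth_on S f2"
    using smooth_on_subset[OF U1(4)] smooth_on_subset[OF U2(4)] by (auto simp: S_def)
   have fsm: "smooth_on S f" unfolding f_def[abs_def] by (intro smooth_on_add S(1) f12)
   note Ql = kp(1)[OF x0]
   note Qb = Ql[unfolded linear_conv_bounded_linear]
   have Qf: "kp x0 (f x) = f1 x" if "x \<in> S" for x
    using U2(5)[of x] U1(5)[of x] that unfolding f_def kq_def S_def by (simp add: linear_add[OF Ql])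
   have fd: "f differentiable (at x)" if "x \<in> S" for x by (rule smooth_on_differentiable[OF fsm that])
   have d1: "fd f1 (at x) v = kp x0 (fd f (at x) v)" if "x \<in> S" for x v
    using frechet_derivative_cong_open(1)[OF S(1) that Qf] frechet_bounded_linear[OF Qb fd[OF that], of v] by simp
   have d2: "fd f2 (at x) v = fd f (at x) v - kp x0 (fd f (at x) v)" if "x \<in> S" for x v
   proof -
    have "(f has_derivative (%v. fd f1 (at x) v + fd f2 (at x) v)) (at x)"
     unfolding f_def[abs_def]
     by (intro has_derivative_add smooth_on_has_derivative[OF f12(1) that] smooth_on_has_derivative[OF f12(2) that])
    from frechet_derivative_at[OF this] have "fd f (at x) v = fd f1 (at x) v + fd f2 (at x) v"
     by metis
    then show ?thesis using d1[OF that, of v] by (simp add: algebra_simps)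
   qed
   have z1: "kp x0 (fd f (at x) v) = 0 \<longleftrightarrow> kp x v = 0" if "x \<in> S" for x v
    using U1(6)[of x v] d1[OF that, of v] that unfolding kq_def S_def by auto
   have z2: "kp x0 (fd f (at x) v) = fd f (at x) v \<longleftrightarrow> kp x v = v" if "x \<in> S" for x v
    using U2(6)[of x v] d2[OF that, of v] that unfolding S_def by auto
   have inj: "v = 0" if "fd f (at x0) v = 0" for v
    using z1[OF S(2), of v] z2[OF S(2), of v] that by (simp add: linear_0[OF Ql])
   show thesis
   proof (rule smooth_inverse_function[OF S(1) fsm S(2) inj], assumption)
    fix U V h assume U: "open U" "U \<subseteq> S" "x0 \<in> U" "open V" "homeomorphism U V f h" "smooth_on V h"
    have fU: "smooth_on U f" by (rule smooth_on_subset[OF fsm U(2)])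
    have hy: "h y \<in> S" if "y \<in> V" for y using U(2,5) that by (auto simp: homeomorphism_def)
    note inv = frechet_derivative_inverse(1)[OF U(1,4,5) fU U(6)]
    show thesis
    proof (rule that[OF U(1,3) _ U(4,5) fU U(6)])
     show "U \<subseteq> W" using U(2) S(3) by blast
     show "tvec F (h y) (fd h (at y) u) \<in> D\<theta> (F (h y))" if "y \<in> V" "kp x0 u = u" for y u
      using z2[OF hy[OF that(1)], of "fd h (at y) u"] kp(3)[of "h y" "fd h (at y) u"]
       hy[OF that(1)] S(3) that(2) inv[OF that(1), of u] by auto
     show "tvec F (h y) (fd h (at y) u) \<in> H (F (h y))" if "y \<in> V" "kp x0 u = 0" for y u
      using z1[OF hy[OF that(1)], of "fd h (at y) u"] kp(4)[of "h y" "fd h (at y) u"]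
       hy[OF that(1)] S(3) that(2) inv[OF that(1), of u] by auto
    qed
   qed
  qed
 qed
qed

end

end

section \<open>Adapted charts\<close>

lemma constant_on_segment:
 fixes f :: "'m::real_normed_vector => real"
 assumes S: "convex S" "y \<in> S" "z \<in> S" and d: "\<And>x. x \<in> S ==> (f has_derivative f' x) (at x)"
  and 0: "\<And>x. x \<in> S ==> f' x (y - z) = 0"
 shows "f y = f z"
proof -
 define l where "l t = z + t *\<^sub>R (y - z)" for t
 have lS: "l t \<in> S" if "t \<in> {0..1}" for t
  using convexD_alt[OF S(1,3,2), of t] that by (simp add: l_def algebra_simps)
 have "((%t. f (l t)) has_vector_derivative 0) (at t within {0..1})" if t: "t \<in> {0..1}" for t
 proof -
  have "(l has_derivative (%h. h *\<^sub>R (y - z))) (at t within {0..1})"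
   unfolding l_def[abs_def] by (auto intro!: derivative_eq_intros)
  from has_derivative_compose[OF this d[OF lS[OF t]]]
  have 1: "((%t. f (l t)) has_derivative (%h. f' (l t) (h *\<^sub>R (y - z)))) (at t within {0..1})" .
  have "f' (l t) (h *\<^sub>R (y - z)) = 0" for h
   using linear_scale[OF has_derivative_linear[OF d[OF lS[OF t]]], of h "y - z"] 0[OF lS[OF t]] by simp
  then show ?thesis using 1 by (simp add: has_vector_derivative_def)
 qed
 then obtain k where k: "\<And>t. t \<in> {0..1} ==> f (l t) = k"
  using has_vector_derivative_zero_constant[of "{0..1::real}" "%t. f (l t)"] by (metis convex_real_interval(5))
 show ?thesis using k[of 0] k[of 1] by (simp add: l_def)
qed

lemma derivative_zero_of_constant_line:
 fixes f :: "'m::real_normed_vector => real"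
 assumes d: "(f has_derivative f') (at x)" and S: "open S" "x \<in> S" and f: "\<And>t. x + t *\<^sub>R b \<in> S ==> f (x + t *\<^sub>R b) = f x"
 shows "f' b = 0"
proof -
 have l: "((%t. x + t *\<^sub>R b) has_derivative (%h. h *\<^sub>R b)) (at 0)" by (auto intro!: derivative_eq_intros)
 have 1: "((%t. f (x + t *\<^sub>R b)) has_derivative (%h. f' (h *\<^sub>R b))) (at 0)"
  by (rule has_derivative_compose[OF l]) (use d in simp)
 have T: "open ((%t. x + t *\<^sub>R b) -` S)" by (intro open_vimage S(1) continuous_intros)
 from has_derivative_const_on_open[OF 1 T, of "f x" 1] show ?thesis using f S(2) by simp
qed

context semi_slant_chart
begin

lemma sfield_const: "sfield (%y. tvec F y u)"
 by (rule sfield_tvec[OF smooth_on_const])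

lemma gm_deriv:
 assumes "x \<in> W"
 shows "((%y. gm y u v) has_derivative
  (%w. g (F x) (nb x w (%y. tvec F y u)) (tvec F x v) + g (F x) (tvec F x u) (nb x w (%y. tvec F y v)))) (at x)"
 unfolding gm_def by (rule nb_met[OF assms sfield_const sfield_const])

lemma nb_const_sym:
 assumes "x \<in> W"
 shows "nb x u (%y. tvec F y v) = nb x v (%y. tvec F y u)"
 using nb_torsion[OF assms smooth_on_const[of W u] smooth_on_const[of W v]] linear_0[OF tvec_facts(1)[OF P assms]]
 by simp

end

text \<open>In these coordinates D \<oplus> \<langle>\<xi>\<rangle> and D\<theta> are the constant
  subspaces kernel and range of \<open>Q\<close>. The condition \<open>box\<close> makes
  \<open>W\<close> a product for this splitting, so that transversal leaves meet; convexity supports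
  the arguments along segments. \<open>y0\<close> is the coordinate of the base point.\<close>

locale adapted_chart = semi_slant_chart A M j D D\<theta> \<theta> W F c
 for A :: "('a, 'e::euclidean_space) acm" and M :: "('b, 'm::euclidean_space) manifold" and j :: "'b => 'a"
  and D D\<theta> :: "'b => 'e set" and \<theta> :: "'b => real"
  and W :: "'m set" and F :: "'m => 'b" and c :: "'b => 'm" +
 fixes Q :: "'m => 'm" and y0 :: 'm
 assumes Q: "linear Q" "Q (Q v) = Q v"
  and QK: "x \<in> W ==> Q u = u ==> tvec F x u \<in> D\<theta> (F x)"
  and QH: "x \<in> W ==> Q u = 0 ==> tvec F x u \<in> H (F x)"
  and W_convex: "convex W" and box: "y \<in> W ==> z \<in> W ==> y - Q y + Q z \<in> W" and y0: "y0 \<in> W"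
begin

abbreviation kerQ where "kerQ \<equiv> {v. Q v = 0}"
abbreviation ranQ where "ranQ \<equiv> {v. Q v = v}"

lemma Q_simps: "Q (v - Q v) = 0" "Q (u + v) = Q u + Q v" "Q (u - v) = Q u - Q v" "Q 0 = 0" "Q (r *\<^sub>R v) = r *\<^sub>R Q v"
 using Q by (simp_all add: linear_diff linear_add linear_0 linear_scale)

lemma subspace_kerQ: "subspace kerQ" and subspace_ranQ: "subspace ranQ"
 by (auto simp: subspace_def Q_simps)

text \<open>One inclusion is assumed in the locale. For the other, a vector of one summand has no
  component in the second one, because the two meet only in 0.\<close>

lemma tvec_kerQ: "x \<in> W ==> tvec F x ` kerQ = H (F x)"
 and tvec_ranQ: "x \<in> W ==> tvec F x ` ranQ = D\<theta> (F x)"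
proof -
 assume x: "x \<in> W"
 note sp = split[OF F_points[OF x]] and SD = acm_point.slant_splitD[OF acm_q[OF F_points[OF x]] split[OF F_points[OF x]]]
 note sf = split_facts[OF x]
 have lt: "linear (tvec F x)" by (rule tvec_facts(1)[OF P x])
 have zero: "t = 0" if "t \<in> H (F x)" "t \<in> D\<theta> (F x)" for t using sf(5)[OF that] iform_zero[OF sf(7)] by simp
 have dec: "tvec F x v = tvec F x (v - Q v) + tvec F x (Q v)" for v by (simp add: linear_diff[OF lt])
 show "tvec F x ` kerQ = H (F x)"
 proof (intro equalityI subsetI)
  fix t assume t: "t \<in> H (F x)"
  then obtain v where v: "t = tvec F x v" using sf(3) TM_range[OF x] by blast
  have "tvec F x (Q v) = t - tvec F x (v - Q v)" using dec[of v] v by simp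
  then have "tvec F x (Q v) = 0"
   using zero[of "tvec F x (Q v)"] subspace_diff[OF SD(1) t QH[OF x Q_simps(1)[of v]]] QK[OF x Q(2)[of v]] by simp
  then have "Q v = 0" using tvec_zero_iff[OF P x] by simp
  then show "t \<in> tvec F x ` kerQ" using v by blast
 qed (use QH[OF x] in auto)
 show "tvec F x ` ranQ = D\<theta> (F x)"
 proof (intro equalityI subsetI)
  fix t assume t: "t \<in> D\<theta> (F x)"
  then obtain v where v: "t = tvec F x v" using sf(4) TM_range[OF x] by blast
  have "tvec F x (v - Q v) = t - tvec F x (Q v)" using dec[of v] v by simp
  then have "tvec F x (v - Q v) = 0"
   using zero[of "tvec F x (v - Q v)"] subspace_diff[OF SD(2) t QK[OF x Q(2)[of v]]] QH[OF x Q_simps(1)[of v]] by simp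
  then have "Q v = v" using tvec_zero_iff[OF P x] by simp
  then show "t \<in> tvec F x ` ranQ" using v by blast
 qed (use QK[OF x] in auto)
qed

lemma gm_orth: "x \<in> W ==> Q a = 0 ==> Q b = b ==> gm x a b = 0"
 unfolding gm_def using split_facts(5) QH QK by blast

context
 fixes \<mu>
 assumes pr: "proper_at (F ` W)" and um: "umbilic \<mu>" and \<mu>s: "smooth_on W (%y. \<mu> (F y))"
  and \<mu>K: "\<And>x b. x \<in> W ==> Q b = b ==> fd (%y. \<mu> (F y)) (at x) b = 0"
begin

abbreviation d\<mu> where "d\<mu> x a \<equiv> fd (%y. \<mu> (F y)) (at x) a"

text \<open>The second identity follows from the first by differentiating the orthogonality of
  \<open>a\<close> and \<open>b\<close>.\<close>

lemma nb_H:
 assumes x: "x \<in> W" and a: "Q a = 0" and b: "Q b = b"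
 shows "g (F x) (nb x v (%y. tvec F y a)) (tvec F x b) = d\<mu> x a * gm x v b"
  and "g (F x) (tvec F x a) (nb x v (%y. tvec F y b)) = - d\<mu> x a * gm x v b"
proof -
 show 1: "g (F x) (nb x v (%y. tvec F y a)) (tvec F x b) = d\<mu> x a * gm x v b"
  unfolding gm_def by (rule umbilicD[OF pr um x sfield_const _ QK[OF x b] refl]) (rule QH[OF _ a])
 have "g (F x) (nb x v (%y. tvec F y a)) (tvec F x b) + g (F x) (tvec F x a) (nb x v (%y. tvec F y b)) = 0"
  by (rule has_derivative_const_on_open[OF gm_deriv[OF x] W_open x]) (rule gm_orth[OF _ a b])
 with 1 show "g (F x) (tvec F x a) (nb x v (%y. tvec F y b)) = - d\<mu> x a * gm x v b" by simp
qed

lemma \<mu>_ranQ: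
 assumes "y \<in> W" "z \<in> W" "Q (y - z) = y - z"
 shows "\<mu> (F y) = \<mu> (F z)"
 by (rule constant_on_segment[OF W_convex assms(1,2) smooth_on_has_derivative[OF \<mu>s] \<mu>K[OF _ assms(3)]])

text \<open>Take a direction \<open>b\<close> in the range of \<open>Q\<close>. Coordinate fields
  commute, so \<nabla>_b a = \<nabla>_a b, and its \<open>a'\<close>-component is -d\<mu>(a') g(a,
  b) = 0.\<close>

lemma gm_kerQ:
 assumes a: "Q a = 0" "Q a' = 0" and y: "y \<in> W" "z \<in> W" "Q (y - z) = y - z"
 shows "gm y a a' = gm z a a'"
proof (rule constant_on_segment[OF W_convex y(1,2) gm_deriv])
 fix x assume x: "x \<in> W"
 note sym = iform_sym[OF split_facts(7)[OF x]]
 have 0: "g (F x) (tvec F x r) (nb x s (%y'. tvec F y' (y - z))) = 0" if "Q r = 0" "Q s = 0" for r s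
  using nb_H(2)[OF x that(1) y(3), of s] gm_orth[OF x that(2) y(3)] by simp
 show "g (F x) (nb x (y - z) (%y. tvec F y a)) (tvec F x a') + g (F x) (tvec F x a) (nb x (y - z) (%y. tvec F y a')) = 0"
  using 0[of a' a] 0[of a a'] a nb_const_sym[OF x, of "y - z"] sym[of "tvec F x a'"] by simp
qed

lemma exp_deriv:
 assumes x: "x \<in> W"
 shows "((%y. exp (k * \<mu> (F y))) has_derivative (%v. exp (k * \<mu> (F x)) * (k * d\<mu> x v))) (at x)"
 by (rule has_derivative_eq_rhs[OF has_derivative_exp[OF has_derivative_mult_right[OF smooth_on_has_derivative[OF \<mu>s x]]]]) (simp add: fun_eq_iff ac_simps)

text \<open>Along a direction \<open>a\<close> in the kernel of \<open>Q\<close>, \<nabla>_a b =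
  \<nabla>_b a has \<open>b'\<close>-component d\<mu>(a) g(b, b'). The two arguments together give
  the growth rate 2 d\<mu>(a), which the exponential compensates.\<close>

lemma gm_ranQ:
 assumes b: "Q b = b" "Q b' = b'" and y: "y \<in> W" "z \<in> W" "Q (y - z) = 0"
 shows "exp (- 2 * \<mu> (F y)) * gm y b b' = exp (- 2 * \<mu> (F z)) * gm z b b'"
proof (rule constant_on_segment[OF W_convex y(1,2) has_derivative_mult[OF exp_deriv gm_deriv]])
 fix x assume x: "x \<in> W"
 note sym = iform_sym[OF split_facts(7)[OF x]]
 have "g (F x) (nb x (y - z) (%y. tvec F y r)) (tvec F x s) = d\<mu> x (y - z) * gm x r s" if "Q r = r" "Q s = s" for r s
  using nb_H(1)[OF x y(3) that(2), of r] nb_const_sym[OF x, of "y - z" r] by simp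
 from this[OF b] this[OF b(2,1)] show "exp (- 2 * \<mu> (F x)) *
   (g (F x) (nb x (y - z) (%y. tvec F y b)) (tvec F x b') + g (F x) (tvec F x b) (nb x (y - z) (%y. tvec F y b'))) +
   exp (- 2 * \<mu> (F x)) * (- 2 * d\<mu> x (y - z)) * gm x b b' = 0"
  using sym[of "tvec F x b"] by (simp add: gm_def algebra_simps)
qed

text \<open>The fundamental 2-form is closed, so on \<open>D\<theta>\<close> it is constant along the leaves of \<open>D \<oplus> \<langle>\<xi>\<rangle>\<close>,
 while the metric is scaled by \<open>e\<^sup>2\<^sup>\<mu>\<close>.\<close>

lemma fundamental_form_ranQ:
 assumes b: "Q b = b" "Q b' = b'" and y: "y \<in> W" "z \<in> W" "Q (y - z) = 0"
 shows "g (F y) (phi A (j (F y)) (tvec F y b)) (tvec F y b') = g (F z) (phi A (j (F z)) (tvec F z b)) (tvec F z b')"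
proof (rule constant_on_segment[OF W_convex y(1,2) nb_met[OF _ sfield_phi[OF sfield_const] sfield_const]])
 fix x assume x: "x \<in> W"
 interpret a: acm_point "g (F x)" "phi A (j (F x))" "eta A (j (F x))" "xi A (j (F x))" by (rule acm_q[OF F_points[OF x]])
 let ?a = "y - z" and ?X = "%y'. phi A (j (F y')) (tvec F y' (y - z))"
 have XH: "?X y' \<in> H (F y')" if "y' \<in> W" for y' using split_facts(6)[OF that QH[OF that y(3)]] .
 obtain a' where a': "?X x = tvec F x a'" using XH[OF x] split_facts(3)[OF x] TM_range[OF x] by blast
 have u: "g (F x) (nb x v ?X) (tvec F x w) = d\<mu> x a' * gm x v w" if "Q w = w" for v w
  unfolding gm_def by (rule umbilicD[OF pr um x sfield_phi[OF sfield_const] XH QK[OF x that] a'])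
 \<comment> \<open>Commuting coordinate fields and \<nabla>\<phi> = 0 move the derivative onto
   \<open>?X\<close>, the image under \<phi> of a kernel field, which again lies in
   \<open>H\<close>. Umbilicity evaluates both terms, and they cancel by symmetry of the
   metric.\<close>
 have 1: "nb x ?a (%y. phi A (j (F y)) (tvec F y b)) = nb x b ?X"
  unfolding nb_phi[OF x sfield_const] nb_const_sym[OF x, of ?a] ..
 have "g (F x) (phi A (j (F x)) (tvec F x b)) (nb x ?a (%y. tvec F y b')) = - g (F x) (nb x b' ?X) (tvec F x b)"
  unfolding nb_const_sym[OF x, of ?a b'] nb_phi[OF x sfield_const, of b' ?a]
  using a.\<phi>_skew[of "tvec F x b"] a.bsym[of "tvec F x b"] by simp
 then show "g (F x) (nb x ?a (%y. phi A (j (F y)) (tvec F y b))) (tvec F x b') +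
   g (F x) (phi A (j (F x)) (tvec F x b)) (nb x ?a (%y. tvec F y b')) = 0"
  unfolding 1 u[OF b(2)] using u[OF b(1), of b'] a.bsym[of "tvec F x b'"] by (simp add: gm_def)
qed

text \<open>On D\<theta> the metric at \<open>y\<close> is \<open>s\<close> times that at
  \<open>z\<close>, while the fundamental form is the same in coordinates. Hence P at
  \<open>z\<close> is \<open>s\<close> times P at \<open>y\<close>, and comparing lengths makes
  cos^2 \<theta> at \<open>z\<close> equal to s^2 times its value at \<open>y\<close>.\<close>

lemma cos_theta_scaling:
 assumes y: "y \<in> W" "z \<in> W" "Q (y - z) = 0"
 shows "exp (4 * \<mu> (F y)) * (cos (\<theta> (F y)))\<^sup>2 = exp (4 * \<mu> (F z)) * (cos (\<theta> (F z)))\<^sup>2"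
proof -
 have p: "F y \<in> points M" "F z \<in> points M" using F_points y by auto
 interpret a: acm_point "g (F y)" "phi A (j (F y))" "eta A (j (F y))" "xi A (j (F y))" by (rule acm_q[OF p(1)])
 interpret b: acm_point "g (F z)" "phi A (j (F z))" "eta A (j (F z))" "xi A (j (F z))" by (rule acm_q[OF p(2)])
 note aP = a.slant_split_P[OF split[OF p(1)]] and bP = b.slant_split_P[OF split[OF p(2)]]
 note aD = a.slant_splitD[OF split[OF p(1)]] and bD = b.slant_splitD[OF split[OF p(2)]]
 define s where "s = exp (2 * (\<mu> (F y) - \<mu> (F z)))"
 have s: "s > 0" by (simp add: s_def)
 have sc: "gm y r t = s * gm z r t" if "Q r = r" "Q t = t" for r t
 proof -
  have "exp (2 * \<mu> (F y)) * (exp (- 2 * \<mu> (F y)) * gm y r t) = exp (2 * \<mu> (F y)) * (exp (- 2 * \<mu> (F z)) * gm z r t)"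
   using gm_ranQ[OF that y] by simp
  then show ?thesis by (simp add: s_def mult.assoc[symmetric] exp_add[symmetric] right_diff_distrib)
 qed
 have "D\<theta> (F y) \<noteq> {0}" using pr y(1) by (auto simp: proper_at_def)
 then obtain k where k: "k \<in> D\<theta> (F y)" "k \<noteq> 0" using subspace_0[OF aD(2)] by blast
 then obtain b where b: "Q b = b" "k = tvec F y b" using tvec_ranQ[OF y(1)] by blast
 have b0: "b \<noteq> 0" using k(2) unfolding b(2) by (rule contrapos_nn) (simp add: linear_0[OF tvec_facts(1)[OF P y(1)]])
 have "orth_proj (g (F y)) (TM M A j (F y)) (phi A (j (F y)) (tvec F y b)) \<in> tvec F y ` ranQ"
  unfolding tvec_ranQ[OF y(1)] by (rule aP(3)[OF QK[OF y(1) b(1)]])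
 then obtain b1 where b1: "orth_proj (g (F y)) (TM M A j (F y)) (phi A (j (F y)) (tvec F y b)) = tvec F y b1" "b1 \<in> ranQ" by (rule imageE)
 have b1Q: "Q b1 = b1" using b1(2) by simp
 have "orth_proj (g (F z)) (TM M A j (F z)) (phi A (j (F z)) (tvec F z b)) \<in> tvec F z ` ranQ"
  unfolding tvec_ranQ[OF y(2)] by (rule bP(3)[OF QK[OF y(2) b(1)]])
 then obtain b2 where b2: "orth_proj (g (F z)) (TM M A j (F z)) (phi A (j (F z)) (tvec F z b)) = tvec F z b2" "b2 \<in> ranQ" by (rule imageE)
 have b2Q: "Q b2 = b2" using b2(2) by simp
 have o1: "gm y b1 t = g (F y) (phi A (j (F y)) (tvec F y b)) (tvec F y t)" for t
  unfolding gm_def b1(1)[symmetric] by (rule orth_proj(3)[OF a.b aD(3)]) (simp add: TM_range[OF y(1)])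
 have o2: "gm z b2 t = g (F z) (phi A (j (F z)) (tvec F z b)) (tvec F z t)" for t
  unfolding gm_def b2(1)[symmetric] by (rule orth_proj(3)[OF b.b bD(3)]) (simp add: TM_range[OF y(2)])
 note fz = gm_form[OF y(2)]
 have "gm z b2 t = gm z (s *\<^sub>R b1) t" if "Q t = t" for t
  using o1[of t] o2[of t] fundamental_form_ranQ[OF b(1) that y] sc[OF b1Q that] by (simp add: iform_simps[OF fz])
 then have b2s: "b2 = s *\<^sub>R b1"
  by (intro iform_eqI[OF fz subspace_ranQ]) (simp_all add: b1Q b2Q Q_simps)
 have c1: "gm y b1 b1 = (cos (\<theta> (F y)))\<^sup>2 * gm y b b" using aP(4)[OF QK[OF y(1) b(1)]] by (simp add: gm_def b1(1))
 have c2: "gm z b2 b2 = (cos (\<theta> (F z)))\<^sup>2 * gm z b b" using bP(4)[OF QK[OF y(2) b(1)]] by (simp add: gm_def b2(1))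
 have "(cos (\<theta> (F z)))\<^sup>2 * gm z b b = s * (s * gm z b1 b1)" using c2 by (simp add: b2s iform_simps[OF fz])
 also have "\<dots> = s * ((cos (\<theta> (F y)))\<^sup>2 * (s * gm z b b))" using c1 sc[OF b1Q b1Q] sc[OF b(1) b(1)] by simp
 finally have "(cos (\<theta> (F z)))\<^sup>2 * gm z b b = (s * s * (cos (\<theta> (F y)))\<^sup>2) * gm z b b" by (simp add: ac_simps)
 then have "(cos (\<theta> (F z)))\<^sup>2 = s * s * (cos (\<theta> (F y)))\<^sup>2" using iform_pos[OF fz b0] by simp
 moreover have "exp (4 * \<mu> (F z)) * (s * s) = exp (4 * \<mu> (F y))"
  by (simp add: s_def exp_add[symmetric] algebra_simps)
 ultimately show ?thesis by (simp add: mult.assoc[symmetric])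
qed

end

end

section \<open>Leaves and the warped product on a coordinate box\<close>

context adapted_chart
begin

definition leaf :: "'m => 'm set => 'b set" where
 "leaf v L = F ` {y \<in> W. y - v \<in> L}"

lemma leaf_T_sub:
 assumes L: "subspace L" and x: "x \<in> W" "x - v \<in> L"
 shows "T_sub A M j (leaf v L) (F x) = tvec F x ` L"
proof (rule T_sub_slice[OF P x(1) L])
 have "y - v \<in> L \<longleftrightarrow> y - x \<in> L" for y
  using subspace_diff[OF L _ x(2), of "y - v"] subspace_add[OF L _ x(2), of "y - x"] by auto
 then show "leaf v L \<inter> F ` W = F ` {y \<in> W. y - x \<in> L}" unfolding leaf_def by auto
qed

lemma leaf_embedded: "subspace L ==> embedded_submanifold M (leaf v L)"
 by (rule embedded_slice[OF P _ leaf_def])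

lemma leaf_connected:
 assumes L: "subspace L"
 shows "connectedin (mtop M) (leaf v L)"
proof -
 have "{y \<in> W. y - v \<in> L} = W \<inter> (%y. v + y) ` L"
  by (auto simp: image_iff) (metis add_diff_cancel_left' add_diff_eq diff_add_cancel add.commute)
 then have "convex {y \<in> W. y - v \<in> L}"
  using convex_Int[OF W_convex convex_translation[OF subspace_imp_convex[OF L], of v]] by simp
 then have "connectedin (top_of_set W) {y \<in> W. y - v \<in> L}"
  using convex_connected by (auto simp: connectedin_subtopology)
 then show ?thesis unfolding leaf_def by (rule connectedin_continuous_map_image[OF F_continuous])
qed

lemma leaf_kerQ:
 shows "invariant_submanifold A M j (leaf v kerQ)"
  and "q \<in> leaf v kerQ ==> xi A (j q) \<in> T_sub A M j (leaf v kerQ) q"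
proof -
 have T: "\<exists>x\<in>W. q = F x \<and> T_sub A M j (leaf v kerQ) q = H q" if q: "q \<in> leaf v kerQ" for q
 proof -
  obtain x where x: "x \<in> W" "x - v \<in> kerQ" "q = F x" using q unfolding leaf_def by blast
  then show ?thesis using leaf_T_sub[OF subspace_kerQ x(1,2)] tvec_kerQ[OF x(1)] by auto
 qed
 show "invariant_submanifold A M j (leaf v kerQ)"
  unfolding invariant_submanifold_def
 proof (intro conjI ballI leaf_embedded[OF subspace_kerQ] image_subsetI)
  fix q t assume q: "q \<in> leaf v kerQ" and t: "t \<in> T_sub A M j (leaf v kerQ) q"
  obtain x where x: "x \<in> W" "q = F x" "T_sub A M j (leaf v kerQ) q = H q" using T[OF q] by blast
  show "phi A (j q) t \<in> T_sub A M j (leaf v kerQ) q"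
   using split_facts(6)[OF x(1), of t] t unfolding x(3) unfolding x(2) .
 qed
 show "xi A (j q) \<in> T_sub A M j (leaf v kerQ) q" if q: "q \<in> leaf v kerQ"
 proof -
  obtain x where x: "x \<in> W" "q = F x" "T_sub A M j (leaf v kerQ) q = H q" using T[OF q] by blast
  show ?thesis unfolding x(3) unfolding x(2)
   by (rule acm_point.slant_splitD(6)[OF acm_q[OF F_points[OF x(1)]] split[OF F_points[OF x(1)]]])
 qed
qed

lemma leaf_slant_function: "slant_function_of A M j (leaf v ranQ) \<theta>"
 unfolding slant_function_of_def
proof (intro ballI impI)
 fix q X assume q: "q \<in> leaf v ranQ" and X: "X \<in> T_sub A M j (leaf v ranQ) q" "X \<notin> span {xi A (j q)}"
 obtain x where x: "x \<in> W" "x - v \<in> ranQ" "q = F x" using q unfolding leaf_def by blast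
 have T: "T_sub A M j (leaf v ranQ) q = D\<theta> q"
  using leaf_T_sub[OF subspace_ranQ x(1,2)] tvec_ranQ[OF x(1)] x(3) by simp
 have "X \<noteq> 0" using X(2) span_zero by blast
 moreover have "split_at q (H q) (D\<theta> q) (\<theta> q)" using split[OF F_points[OF x(1)]] x(3) by simp
 ultimately show "angle_to (g q) (phi A (j q) X) (T_sub A M j (leaf v ranQ) q) = \<theta> q"
  using X(1) unfolding T acm_point.slant_split_def[OF acm_q[OF F_points[OF x(1)], folded x(3)]] by blast
qed

lemma mderiv_reparam:
 assumes y: "y \<in> W" and e: "\<And>z. z \<in> W ==> e z \<in> W" "(e has_derivative E) (at y)"
 shows "mderiv M A (j \<circ> (%q. F (e (c q)))) (F y) (dpar M F y u) = tvec F (e y) (E u)"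
proof -
 let ?h = "j \<circ> (%q. F (e (c q)))"
 have "((%z. cmap A (j (F (e y))) (j (F (e z)))) has_derivative (%u. tvec F (e y) (E u))) (at y)"
  by (rule has_derivative_compose[OF e(2)]) (use J_has_derivative[OF P e(1)[OF y]] in simp)
 then have "((%z. cmap A (?h (F y)) (?h (F z))) has_derivative (%u. tvec F (e y) (E u))) (at y)"
  by (rule has_derivative_transform_within_open[OF _ W_open y]) (simp add: cF y)
 then show ?thesis
  using mderiv_param[OF M A P y, of ?h u] frechet_derivative_at[of "%z. cmap A (?h (F y)) (?h (F z))" _ y]
  by (metis differentiableI)
qed

lemma smooth_map_reparam:
 assumes e: "\<And>z. z \<in> W ==> e z \<in> W" "smooth_on W e"
 shows "smooth_map M M (F ` W) (%q. F (e (c q)))"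
proof (rule smooth_mapI[OF M M P P])
 show "F (e (c (F x))) \<in> F ` W" if "x \<in> W" for x using e(1) that by (simp add: cF)
 show "smooth_on W (%x. c (F (e (c (F x)))))"
  by (rule smooth_on_cong[OF W_open _ e(2)]) (simp add: cF e(1))
qed

context
 fixes \<mu>
 assumes pr: "proper_at (F ` W)" and um: "umbilic \<mu>" and \<mu>s: "smooth_on W (%y. \<mu> (F y))"
  and \<mu>K: "\<And>x b. x \<in> W ==> Q b = b ==> fd (%y. \<mu> (F y)) (at x) b = 0"
  and nonconst: "\<not> \<mu> constant_on F ` W"
  and dens: "\<exists>q\<in>F ` W. \<exists>Z\<in>D\<theta> q. dir_deriv M A j q Z \<theta> \<noteq> 0"
begin

text \<open>If \<theta> were constant on one leaf of D\<theta>, the scaling law would make exp(4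
  \<mu>) cos^2 \<theta> constant on the whole box. As \<mu> is constant along the leaves of
  D\<theta>, so would be \<theta> on each of them, against \<open>dens\<close>.\<close>

lemma theta_not_constant:
 assumes v: "v \<in> W"
 shows "\<not> \<theta> constant_on leaf v ranQ"
proof
 assume "\<theta> constant_on leaf v ranQ"
 then obtain t where t: "\<And>y. y \<in> W ==> y - v \<in> ranQ ==> \<theta> (F y) = t" unfolding constant_on_def leaf_def by auto
 have k: "exp (4 * \<mu> (F y)) * (cos (\<theta> (F y)))\<^sup>2 = exp (4 * \<mu> (F v)) * (cos t)\<^sup>2" if y: "y \<in> W" for y
 proof -
  \<comment> \<open>The point of the given leaf with the same \<open>Q\<close>-part as
    \<open>y\<close>; it is joined to \<open>y\<close> within a leaf of \<open>H\<close>.\<close>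
  let ?z = "v - Q v + Q y"
  have z: "?z \<in> W" "Q (?z - v) = ?z - v" "Q (y - ?z) = 0" using box[OF v y] by (simp_all add: Q_simps Q(2))
  show ?thesis using cos_theta_scaling[OF pr um \<mu>s \<mu>K y z(1,3)] \<mu>_ranQ[OF pr um \<mu>s \<mu>K z(1) v z(2)] t[OF z(1)] z(2) by simp
 qed
 have th: "\<theta> (F y) = \<theta> (F z)" if y: "y \<in> W" "z \<in> W" "Q (y - z) = y - z" for y z
 proof (rule acm_point.cos_sq_inj[OF acm_q[OF F_points[OF y(1)]]])
  show "(cos (\<theta> (F y)))\<^sup>2 = (cos (\<theta> (F z)))\<^sup>2"
  proof -
   have "exp (4 * \<mu> (F z)) * (cos (\<theta> (F y)))\<^sup>2 = exp (4 * \<mu> (F z)) * (cos (\<theta> (F z)))\<^sup>2"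
    using k[OF y(1)] k[OF y(2)] \<mu>_ranQ[OF pr um \<mu>s \<mu>K y] by simp
   then show ?thesis by simp
  qed
 qed (use theta_bounds(1,2)[OF F_points pr] y in \<open>auto simp: less_imp_le\<close>)
 have "fd (%y. \<theta> (F y)) (at x) b = 0" if x: "x \<in> W" and b: "Q b = b" for x b
  by (rule derivative_zero_of_constant_line[OF theta_differentiable(1)[OF pr x, unfolded frechet_derivative_works] W_open x])
   (rule th[OF _ x], auto simp: Q_simps b)
 then have "dir_deriv M A j (F x) Z \<theta> = 0" if x: "x \<in> W" and Z: "Z \<in> D\<theta> (F x)" for x Z
  using Z dir_deriv_tvec[OF P x theta_differentiable(1)[OF pr x]] x unfolding tvec_ranQ[OF x, symmetric] by auto
 then show False using dens by auto
qed

lemma leaf_ranQ: "v \<in> W ==> proper_pointwise_slant A M j (leaf v ranQ)"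
 unfolding proper_pointwise_slant_def
 using leaf_embedded[OF subspace_ranQ] leaf_slant_function theta_not_constant pr
 by (intro conjI exI[of _ \<theta>]) (auto simp: proper_at_def leaf_def)

text \<open>Each projection replaces one of the two coordinate parts by that of \<open>y0\<close>.
  The exponent is normalized to vanish at the base point, since the second factor is the leaf
  through that point with its inherited metric.\<close>

lemma warped_piece:
 "warped_product_piece A M j (F ` W) (F y0) (leaf y0 kerQ) (leaf y0 ranQ) (%q. exp (\<mu> q - \<mu> (F y0)))
  (%q. F (c q - Q (c q) + Q y0)) (%q. F (y0 - Q y0 + Q (c q)))"
proof -
 define e1 where "e1 y = y - Q y + Q y0" for y
 define e2 where "e2 y = y0 - Q y0 + Q y" for y
 have eW: "e1 y \<in> W" "e2 y \<in> W" if "y \<in> W" for y using box that y0 by (auto simp: e1_def e2_def)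
 have Qb: "bounded_linear Q" using Q(1) by (simp add: linear_conv_bounded_linear)
 have es: "smooth_on W e1" "smooth_on W e2"
  unfolding e1_def[abs_def] e2_def[abs_def]
  by (intro smooth_on_add smooth_on_diff smooth_on_id smooth_on_const smooth_on_linear[OF Qb] W_open)+
 have Qd: "(Q has_derivative Q) (at y)" for y by (rule bounded_linear_imp_has_derivative[OF Qb])
 have ed: "(e1 has_derivative (%u. u - Q u)) (at y)" "(e2 has_derivative Q) (at y)" for y
  unfolding e1_def[abs_def] e2_def[abs_def] by (auto intro!: derivative_eq_intros Qd)
 define p1 where "p1 q = F (e1 (c q))" for q
 define p2 where "p2 q = F (e2 (c q))" for q
 have pF: "p1 (F y) = F (e1 y)" "p2 (F y) = F (e2 y)" if "y \<in> W" for y using that by (simp_all add: p1_def p2_def cF)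
 have m1: "mderiv M A (j \<circ> p1) (F y) (dpar M F y u) = tvec F (e1 y) (u - Q u)" if "y \<in> W" for y u
  unfolding p1_def[abs_def] using mderiv_reparam[OF that eW(1) ed(1), of u] .
 have m2: "mderiv M A (j \<circ> p2) (F y) (dpar M F y u) = tvec F (e2 y) (Q u)" if "y \<in> W" for y u
  unfolding p2_def[abs_def] using mderiv_reparam[OF that eW(2) ed(2), of u] .
 have in_leaf: "F y \<in> leaf v L \<longleftrightarrow> y - v \<in> L" if "y \<in> W" for y v L
  using that inj_onD[OF paramD(3)[OF M P]] unfolding leaf_def by auto
 have e1K: "e1 y - y0 \<in> kerQ" and e2R: "e2 y - y0 \<in> ranQ" for y by (simp_all add: e1_def e2_def Q_simps Q(2))
 have e1eq: "e1 z = x \<longleftrightarrow> z - x \<in> ranQ" if "x - y0 \<in> kerQ" for x z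
 proof -
  have "Q x = Q y0" using that by (simp add: Q_simps)
  then show ?thesis by (auto simp: e1_def Q_simps algebra_simps)
 qed
 have e2eq: "e2 z = x \<longleftrightarrow> z - x \<in> kerQ" if "x - y0 \<in> ranQ" for x z
 proof -
  have x: "x = y0 - Q y0 + Q x" using that by (simp add: Q_simps algebra_simps)
  show ?thesis
  proof
   assume "e2 z = x"
   then have "Q (e2 z) = Q x" by simp
   then show "z - x \<in> kerQ" by (simp add: e2_def Q_simps Q(2))
  next
   assume "z - x \<in> kerQ"
   then have "Q z = Q x" by (simp add: Q_simps)
   then show "e2 z = x" using x by (simp add: e2_def)
  qed
 qed
 have Finj: "F y = F z \<longleftrightarrow> y = z" if "y \<in> W" "z \<in> W" for y z using inj_onD[OF paramD(3)[OF M P]] that by auto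
 have fib1: "{q \<in> F ` W. p1 q = F x} = leaf x ranQ" if x: "x \<in> W" "x - y0 \<in> kerQ" for x
  unfolding leaf_def using e1eq[OF x(2)] Finj[OF eW(1) x(1)] pF by auto
 have fib2: "{q \<in> F ` W. p2 q = F x} = leaf x kerQ" if x: "x \<in> W" "x - y0 \<in> ranQ" for x
  unfolding leaf_def using e2eq[OF x(2)] Finj[OF eW(2) x(1)] pF by auto
 have dj: "\<exists>u. w = dpar M F y u" if "y \<in> W" for y w using dpar_bij(2)[OF M P that] by (metis bij_pointE)
 let ?MT = "leaf y0 kerQ" and ?MR = "leaf y0 ranQ" and ?f = "%q. exp (\<mu> q - \<mu> (F y0))"
 note T1 = leaf_T_sub[OF subspace_kerQ] and T2 = leaf_T_sub[OF subspace_ranQ]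
 have "warped_product_piece A M j (F ` W) (F y0) ?MT ?MR ?f p1 p2"
  unfolding warped_product_piece_def
 proof (intro conjI)
  show "embedded_submanifold M ?MT" "embedded_submanifold M ?MR"
   by (rule leaf_embedded[OF subspace_kerQ], rule leaf_embedded[OF subspace_ranQ])
  show "connectedin (mtop M) ?MT" "connectedin (mtop M) ?MR"
   by (rule leaf_connected[OF subspace_kerQ], rule leaf_connected[OF subspace_ranQ])
  show "?MT \<subseteq> F ` W" "?MR \<subseteq> F ` W" by (auto simp: leaf_def)
  show "F y0 \<in> ?MT" "F y0 \<in> ?MR" using y0 by (auto simp: in_leaf Q_simps)
  show "\<forall>x\<in>?MT. p1 x = x \<and> p2 x = F y0"
   unfolding leaf_def by (auto simp: pF e1_def e2_def Q_simps)
  show "\<forall>y\<in>?MR. p1 y = F y0 \<and> p2 y = y"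
   unfolding leaf_def by (auto simp: pF e1_def e2_def Q_simps algebra_simps intro!: arg_cong[of _ _ F])
  show "smooth_map M M (F ` W) p1" unfolding p1_def[abs_def] by (rule smooth_map_reparam[OF eW(1) es(1)])
  show "smooth_map M M (F ` W) p2" unfolding p2_def[abs_def] by (rule smooth_map_reparam[OF eW(2) es(2)])
  show "bij_betw (%q. (p1 q, p2 q)) (F ` W) (?MT \<times> ?MR)"
   unfolding bij_betw_def
  proof (intro conjI equalityI subsetI)
   show "inj_on (%q. (p1 q, p2 q)) (F ` W)"
   proof (rule inj_onI)
    fix q r assume qr: "q \<in> F ` W" "r \<in> F ` W" "(p1 q, p2 q) = (p1 r, p2 r)"
    then obtain y z where y: "y \<in> W" "q = F y" "z \<in> W" "r = F z" by blast
    then have "e1 y = e1 z" "e2 y = e2 z" using qr(3) Finj eW by (auto simp: pF)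
    then have "y = z" by (simp add: e1_def e2_def)
    then show "q = r" using y by simp
   qed
   fix s assume "s \<in> (%q. (p1 q, p2 q)) ` F ` W"
   then show "s \<in> ?MT \<times> ?MR" using eW e1K e2R by (auto simp: pF in_leaf)
  next
   fix s assume "s \<in> ?MT \<times> ?MR"
   then obtain x y where s: "s = (F x, F y)" "x \<in> W" "y \<in> W" "x - y0 \<in> kerQ" "y - y0 \<in> ranQ" unfolding leaf_def by auto
   let ?z = "x - Q x + Q y"
   have z: "?z \<in> W" by (rule box[OF s(2,3)])
   have "e1 ?z = x" "e2 ?z = y" unfolding e1eq[OF s(4)] e2eq[OF s(5)] by (simp_all add: Q_simps Q(2))
   then have "s = (p1 (F ?z), p2 (F ?z))" using z s(1) by (simp add: pF)
   then show "s \<in> (%q. (p1 q, p2 q)) ` F ` W" using z by blast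
  qed
  show "\<forall>q\<in>F ` W. bij_betw (%u. (mderiv M A (j \<circ> p1) q u, mderiv M A (j \<circ> p2) q u)) UNIV
       (T_sub A M j ?MT (p1 q) \<times> T_sub A M j ?MR (p2 q))"
  proof
   fix q assume "q \<in> F ` W"
   then obtain y where y: "y \<in> W" "q = F y" by blast
   have bij: "bij_betw ((%u. (mderiv M A (j \<circ> p1) q u, mderiv M A (j \<circ> p2) q u)) \<circ> dpar M F y) UNIV
    (tvec F (e1 y) ` kerQ \<times> tvec F (e2 y) ` ranQ)"
    unfolding bij_betw_def
   proof (intro conjI equalityI subsetI)
    show "inj ((%u. (mderiv M A (j \<circ> p1) q u, mderiv M A (j \<circ> p2) q u)) \<circ> dpar M F y)"
    proof (rule injI)
     fix u v assume "((%u. (mderiv M A (j \<circ> p1) q u, mderiv M A (j \<circ> p2) q u)) \<circ> dpar M F y) u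
      = ((%u. (mderiv M A (j \<circ> p1) q u, mderiv M A (j \<circ> p2) q u)) \<circ> dpar M F y) v"
     then have "u - Q u = v - Q v" "Q u = Q v"
      using injD[OF tvec_facts(2)[OF P eW(1)[OF y(1)]]] injD[OF tvec_facts(2)[OF P eW(2)[OF y(1)]]] m1[OF y(1)] m2[OF y(1)] y(2) by auto
     then show "u = v" by simp
    qed
    fix s assume "s \<in> range ((%u. (mderiv M A (j \<circ> p1) q u, mderiv M A (j \<circ> p2) q u)) \<circ> dpar M F y)"
    then show "s \<in> tvec F (e1 y) ` kerQ \<times> tvec F (e2 y) ` ranQ"
     using m1[OF y(1)] m2[OF y(1)] y(2) Q_simps(1) Q(2) by auto
   next
    fix s assume "s \<in> tvec F (e1 y) ` kerQ \<times> tvec F (e2 y) ` ranQ"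
    then obtain a b where s: "s = (tvec F (e1 y) a, tvec F (e2 y) b)" "Q a = 0" "Q b = b" by auto
    have "s = ((%u. (mderiv M A (j \<circ> p1) q u, mderiv M A (j \<circ> p2) q u)) \<circ> dpar M F y) (a + b)"
     using s y by (simp add: m1 m2 Q_simps)
    then show "s \<in> range ((%u. (mderiv M A (j \<circ> p1) q u, mderiv M A (j \<circ> p2) q u)) \<circ> dpar M F y)" by blast
   qed
   have Ts: "T_sub A M j ?MT (p1 q) = tvec F (e1 y) ` kerQ" "T_sub A M j ?MR (p2 q) = tvec F (e2 y) ` ranQ"
    unfolding y(2) pF[OF y(1)] by (rule T1[OF eW(1)[OF y(1)] e1K], rule T2[OF eW(2)[OF y(1)] e2R])
   show "bij_betw (%u. (mderiv M A (j \<circ> p1) q u, mderiv M A (j \<circ> p2) q u)) UNIV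
       (T_sub A M j ?MT (p1 q) \<times> T_sub A M j ?MR (p2 q))"
    unfolding Ts by (rule iffD2[OF bij_betw_comp_iff[OF dpar_bij(2)[OF M P y(1)]] bij])
  qed
  show "smooth_fun_sub M ?MT ?f"
   unfolding smooth_fun_sub_def
  proof (intro ballI exI conjI)
   fix p assume "p \<in> ?MT" then show "p \<in> F ` W" by (auto simp: leaf_def)
   show "smooth_fun M (F ` W) ?f"
    by (rule smooth_fun_param(2)[OF M P FW_open]) (intro smooth_on_exp smooth_on_diff \<mu>s smooth_on_const W_open)
  qed (use FW_open in auto)
  show "\<forall>x\<in>?MT. 0 < ?f x" by simp
  show "\<not> ?f constant_on ?MT"
  proof
   assume "?f constant_on ?MT"
   then obtain k where k: "\<And>q. q \<in> ?MT ==> ?f q = k" unfolding constant_on_def by blast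
   \<comment> \<open>\<mu> factors through the first projection, so constancy on the first factor
     would spread to the whole box.\<close>
   have "\<mu> (F y) = \<mu> (F y0)" if y: "y \<in> W" for y
   proof -
    have "F (e1 y) \<in> ?MT" "F y0 \<in> ?MT" using eW[OF y] e1K y0 by (auto simp: in_leaf Q_simps)
    from k[OF this(1)] k[OF this(2)] have "exp (\<mu> (F (e1 y)) - \<mu> (F y0)) = exp (\<mu> (F y0) - \<mu> (F y0))" by simp
    then have "\<mu> (F (e1 y)) = \<mu> (F y0)" by (simp only: exp_inj_iff)
    moreover have "\<mu> (F y) = \<mu> (F (e1 y))"
     by (rule \<mu>_ranQ[OF pr um \<mu>s \<mu>K y eW(1)[OF y]]) (simp_all add: e1_def Q_simps Q(2))
    ultimately show ?thesis by simp
   qed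
   then show False using nonconst by (auto simp: constant_on_def)
  qed
  show "\<forall>q\<in>F ` W. \<forall>u v. g q (mderiv M A j q u) (mderiv M A j q v) =
    g (p1 q) (mderiv M A (j \<circ> p1) q u) (mderiv M A (j \<circ> p1) q v)
   + (?f (p1 q))\<^sup>2 * g (p2 q) (mderiv M A (j \<circ> p2) q u) (mderiv M A (j \<circ> p2) q v)"
  proof (intro ballI allI)
   fix q u' v' assume "q \<in> F ` W"
   then obtain y where y: "y \<in> W" "q = F y" by blast
   obtain u v where u: "u' = dpar M F y u" "v' = dpar M F y v" using dj[OF y(1)] by blast
   note gf = iform_simps[OF gm_form[OF y(1)]]
   have "gm y ((u - Q u) + Q u) ((v - Q v) + Q v) = gm y (u - Q u) (v - Q v) + gm y (Q u) (Q v)"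
    unfolding gf(1,2) using gm_orth[OF y(1) Q_simps(1) Q(2), of u v] gm_orth[OF y(1) Q_simps(1) Q(2), of v u]
     iform_sym[OF gm_form[OF y(1)], of "Q u" "v - Q v"] by simp
   moreover have "gm y (u - Q u) (v - Q v) = gm (e1 y) (u - Q u) (v - Q v)"
    by (rule gm_kerQ[OF pr um \<mu>s \<mu>K Q_simps(1) Q_simps(1) y(1) eW(1)[OF y(1)]]) (simp_all add: e1_def Q_simps Q(2))
   moreover have "gm y (Q u) (Q v) = (?f (F (e1 y)))\<^sup>2 * gm (e2 y) (Q u) (Q v)"
   proof -
    have 1: "exp (- 2 * \<mu> (F y)) * gm y (Q u) (Q v) = exp (- 2 * \<mu> (F (e2 y))) * gm (e2 y) (Q u) (Q v)"
     by (rule gm_ranQ[OF pr um \<mu>s \<mu>K Q(2) Q(2) y(1) eW(2)[OF y(1)]]) (simp_all add: e2_def Q_simps Q(2))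
    have 2: "\<mu> (F y) = \<mu> (F (e1 y))" "\<mu> (F (e2 y)) = \<mu> (F y0)"
     by (rule \<mu>_ranQ[OF pr um \<mu>s \<mu>K y(1) eW(1)[OF y(1)]], simp_all add: e1_def Q_simps Q(2))
      (rule \<mu>_ranQ[OF pr um \<mu>s \<mu>K eW(2)[OF y(1)] y0], simp_all add: e2_def Q_simps Q(2))
    have "gm y (Q u) (Q v) = exp (2 * \<mu> (F y)) * (exp (- 2 * \<mu> (F y)) * gm y (Q u) (Q v))"
     by (simp add: mult.assoc[symmetric] exp_add[symmetric])
    also have "\<dots> = exp (2 * \<mu> (F (e1 y)) - 2 * \<mu> (F y0)) * gm (e2 y) (Q u) (Q v)"
     unfolding 1 2(2) unfolding 2(1) by (simp add: mult.assoc[symmetric] exp_add[symmetric])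
    also have "exp (2 * \<mu> (F (e1 y)) - 2 * \<mu> (F y0)) = (?f (F (e1 y)))\<^sup>2"
     by (simp add: power2_eq_square exp_add[symmetric])
    finally show ?thesis .
   qed
   ultimately show "g q (mderiv M A j q u') (mderiv M A j q v') =
    g (p1 q) (mderiv M A (j \<circ> p1) q u') (mderiv M A (j \<circ> p1) q v')
   + (?f (p1 q))\<^sup>2 * g (p2 q) (mderiv M A (j \<circ> p2) q u') (mderiv M A (j \<circ> p2) q v')"
    unfolding u y(2) m1[OF y(1)] m2[OF y(1)] pF[OF y(1)] tvec_mderiv[OF P y(1)] by (simp add: gm_def)
  qed
  show "\<forall>y\<in>?MR. let S = {q \<in> F ` W. p2 q = y} in
   invariant_submanifold A M j S \<and> (\<forall>q\<in>S. xi A (j q) \<in> T_sub A M j S q)"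
  proof
   fix r assume "r \<in> ?MR"
   then obtain x where x: "x \<in> W" "x - y0 \<in> ranQ" "r = F x" unfolding leaf_def by blast
   show "let S = {q \<in> F ` W. p2 q = r} in invariant_submanifold A M j S \<and> (\<forall>q\<in>S. xi A (j q) \<in> T_sub A M j S q)"
    unfolding x(3) fib2[OF x(1,2)] Let_def using leaf_kerQ by blast
  qed
  show "\<forall>x\<in>?MT. proper_pointwise_slant A M j {q \<in> F ` W. p1 q = x}"
  proof
   fix r assume "r \<in> ?MT"
   then obtain x where x: "x \<in> W" "x - y0 \<in> kerQ" "r = F x" unfolding leaf_def by blast
   show "proper_pointwise_slant A M j {q \<in> F ` W. p1 q = r}"
    unfolding x(3) fib1[OF x(1,2)] by (rule leaf_ranQ[OF x(1)])
  qed
 qed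
 then show ?thesis unfolding p1_def[abs_def] p2_def[abs_def] e1_def e2_def .
qed

end

end

text \<open>The box is the intersection of preimages of two balls, one under \<open>Q\<close> and
  one under its complement; \<open>y - Q y + Q z\<close> takes its \<open>Q\<close>-part from
  \<open>z\<close> and the other part from \<open>y\<close>.\<close>

lemma linear_box:
 fixes Q :: "'m::euclidean_space => 'm"
 assumes Q: "linear Q" "\<And>v. Q (Q v) = Q v" and V: "open V" "y0 \<in> V"
 obtains B where "open B" "y0 \<in> B" "B \<subseteq> V" "convex B" "\<And>y z. y \<in> B ==> z \<in> B ==> y - Q y + Q z \<in> B"
proof -
 obtain e where e: "e > 0" "ball y0 e \<subseteq> V" using V open_contains_ball by blast
 define R where "R y = y - Q y" for y
 have Rl: "linear R" unfolding R_def[abs_def] by (intro linear_compose_sub linear_ident Q(1))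
 define B where "B = Q -` ball (Q y0) (e/2) \<inter> R -` ball (R y0) (e/2)"
 note s = linear_add[OF Q(1)] linear_diff[OF Q(1)] linear_0[OF Q(1)]
 show ?thesis
 proof
  show "open B" unfolding B_def
   by (intro open_Int open_vimage open_ball linear_continuous_on Q(1)[unfolded linear_conv_bounded_linear] Rl[unfolded linear_conv_bounded_linear])
  show "y0 \<in> B" using e(1) by (simp add: B_def)
  show "convex B" unfolding B_def by (intro convex_Int convex_linear_vimage Q(1) Rl convex_ball)
  show "B \<subseteq> V"
  proof
   fix y assume "y \<in> B"
   then have b: "norm (Q y0 - Q y) < e/2" "norm (R y0 - R y) < e/2" by (auto simp: B_def dist_norm)
   have "y0 - y = (Q y0 - Q y) + (R y0 - R y)" by (simp add: R_def)
   then have "norm (y0 - y) \<le> norm (Q y0 - Q y) + norm (R y0 - R y)" by (metis norm_triangle_ineq)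
   then have "y \<in> ball y0 e" using b by (simp add: dist_norm)
   then show "y \<in> V" using e by blast
  qed
  show "y - Q y + Q z \<in> B" if "y \<in> B" "z \<in> B" for y z
   using that by (simp add: B_def R_def s Q(2))
 qed
qed

section \<open>From the shape operator condition to the warped product\<close>

context semi_slant
begin

text \<open>Somewhere a nonzero vector of the slant fibre is supplied by the density condition, and
  constant rank spreads nonvanishing of the fibre to all points.\<close>

lemma proper_slant_along_proper_at:
 assumes "proper_slant_along A M j D\<theta> \<theta>"
 shows "proper_at (points M)"
 unfolding proper_at_def
proof (intro ballI conjI)
 fix q assume q: "q \<in> points M"
 have "openin (mtop M) (points M) \<and> points M \<noteq> {}" using q by auto
 then obtain r Z where "r \<in> points M" "Z \<in> D\<theta> r" "Z \<noteq> 0" using assms unfolding proper_slant_along_def by blast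
 then show "D\<theta> q \<noteq> {0}" using K_nonzero[OF _ q, of r] by blast
qed (use assms in \<open>auto simp: proper_slant_along_def\<close>)

lemma tvec_reparam:
 assumes P: "param M W F c" and V: "open V" "y \<in> V" "h y \<in> W" and h: "smooth_on V h"
 shows "tvec (%y. F (h y)) y u = tvec F (h y) (fd h (at y) u)"
 using frechet_derivative_at[OF has_derivative_compose[OF smooth_on_has_derivative[OF h V(2)] J_has_derivative[OF P V(3)]]]
 unfolding tvec_def by metis

lemma warped_product_of_shape:
 assumes psa: "proper_slant_along A M j D\<theta> \<theta>" and p: "p \<in> points M"
  and V: "openin (mtop M) V" "p \<in> V" and \<mu>: "smooth_fun M V \<mu>"
  and nonconst: "\<And>W. openin (mtop M) W ==> W \<subseteq> V ==> W \<noteq> {} ==> \<not> \<mu> constant_on W"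
  and Z\<mu>: "\<And>Z q. sect V D\<theta> Z ==> q \<in> V ==> dir_deriv M A j q (Z q) \<mu> = 0"
  and eq: "\<And>X Z q. sect V H X ==> sect V D\<theta> Z ==> q \<in> V ==>
   shape_eq \<mu> X Z q"
  and V': "openin (mtop M) V'" "p \<in> V'"
 shows "\<exists>U MT M\<theta> f \<pi>1 \<pi>2. openin (mtop M) U \<and> p \<in> U \<and> U \<subseteq> V' \<and> warped_product_piece A M j U p MT M\<theta> f \<pi>1 \<pi>2"
proof -
 have prM: "proper_at (points M)" by (rule proper_slant_along_proper_at[OF psa])
 have VM: "V \<subseteq> points M" using V(1) openin_subset by blast
 have prV: "proper_at V" using prM VM by (auto simp: proper_at_def)
 define W0 where "W0 = cmap M p ` cdom M p"
 have P0: "param M W0 (cinv M p) (cmap M p)" unfolding W0_def by (rule param_cinv(1)[OF M p])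
 define W1 where "W1 = {y \<in> W0. cinv M p y \<in> V \<inter> V'}"
 have W1: "open W1" "W1 \<subseteq> W0" unfolding W1_def using paramD(6)[OF M P0 openin_Int[OF V(1) V'(1)]] by auto
 have P1: "param M W1 (cinv M p) (cmap M p)" by (rule param_subset[OF M P0 W1])
 define x0 where "x0 = cmap M p p"
 have x0: "x0 \<in> W1" "cinv M p x0 = p"
  unfolding W1_def W0_def x0_def using param_cinv(2)[OF M p] cdomD(1)[OF M p] V(2) V'(2) by auto
 interpret S: semi_slant_chart A M j D D\<theta> \<theta> W1 "cinv M p" "cmap M p"
  by unfold_locales (rule P1)
 have FV: "cinv M p ` W1 \<subseteq> V" "cinv M p ` W1 \<subseteq> V'" by (auto simp: W1_def)
 have \<mu>s: "smooth_on {x \<in> W. F x \<in> V} (%y. \<mu> (F y))" if "param M W F c" for W F c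
  by (rule smooth_fun_param(1)[OF M that V(1) \<mu>])
 have \<mu>1: "smooth_on W1 (%y. \<mu> (cinv M p y))"
  by (rule smooth_on_subset[OF \<mu>s[OF P1]]) (use FV in auto)
 have pr1: "proper_at (cinv M p ` W1)" using prV FV(1) by (auto simp: proper_at_def)
 have um1: "S.umbilic \<mu>" by (rule S.umbilic_of_shape[OF V(1) FV(1) prV \<mu>1]) (rule eq)
 show ?thesis
 proof (rule S.adapted_coordinates[OF pr1 um1 x0(1)])
  fix U2 V2 f h
  assume U2: "open U2" "x0 \<in> U2" "U2 \<subseteq> W1" "open V2" "homeomorphism U2 V2 f h" "smooth_on U2 f" "smooth_on V2 h"
   and K: "\<And>y u. y \<in> V2 ==> S.kp x0 u = u ==> tvec (cinv M p) (h y) (fd h (at y) u) \<in> D\<theta> (cinv M p (h y))"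
   and Hh: "\<And>y u. y \<in> V2 ==> S.kp x0 u = 0 ==> tvec (cinv M p) (h y) (fd h (at y) u) \<in> H (cinv M p (h y))"
  note kp = S.kp_facts[OF pr1 x0(1)]
  have P2: "param M V2 (%y. cinv M p (h y)) (%q. f (cmap M p q))"
   by (rule param_reparam[OF M P1 U2(1,3,4,5,6,7)])
  define y0 where "y0 = f x0"
  have y0: "y0 \<in> V2" "h y0 = x0" using U2(2,5) by (auto simp: y0_def homeomorphism_def)
  have hW: "h y \<in> W1" if "y \<in> V2" for y using that U2(3,5) by (auto simp: homeomorphism_def)
  show ?thesis
  proof (rule linear_box[OF kp(1) kp(2) U2(4) y0(1)])
   fix B assume B: "open B" "y0 \<in> B" "B \<subseteq> V2" "convex B" "\<And>y z. y \<in> B ==> z \<in> B ==> y - S.kp x0 y + S.kp x0 z \<in> B"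
   let ?F = "%y. cinv M p (h y)"
   have tv: "tvec ?F y u = tvec (cinv M p) (h y) (fd h (at y) u)" if "y \<in> B" for y u
    by (rule tvec_reparam[OF P1 U2(4) _ _ U2(7)]) (use that B(3) hW in auto)
   interpret C: adapted_chart A M j D D\<theta> \<theta> B ?F "%q. f (cmap M p q)" "S.kp x0" y0
   proof unfold_locales
    show "param M B ?F (%q. f (cmap M p q))" by (rule param_subset[OF M P2 B(1,3)])
    show "tvec ?F x u \<in> D\<theta> (?F x)" if "x \<in> B" "S.kp x0 u = u" for x u
     unfolding tv[OF that(1)] by (rule K) (use that B(3) in auto)
    show "tvec ?F x u \<in> H (?F x)" if "x \<in> B" "S.kp x0 u = 0" for x u
     unfolding tv[OF that(1)] by (rule Hh) (use that B(3) in auto)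
   qed (use linear_add[OF kp(1)] linear_scale[OF kp(1)] kp(2) B in auto)
   have FB: "?F ` B \<subseteq> V" "?F ` B \<subseteq> V'" using B(3) hW by (auto simp: W1_def)
   have prB: "proper_at (?F ` B)" using prV FB(1) by (auto simp: proper_at_def)
   have \<mu>B: "smooth_on B (%y. \<mu> (?F y))" by (rule smooth_on_subset[OF \<mu>s[OF C.P]]) (use FB in auto)
   \<comment> \<open>\<open>umbilic\<close> refers to fields in the given chart, so it is derived
     anew in the straightened one; in the first chart it served involutivity.\<close>
   have umB: "C.umbilic \<mu>" by (rule C.umbilic_of_shape[OF V(1) FB(1) prV \<mu>B]) (rule eq)
   have \<mu>K: "fd (%y. \<mu> (?F y)) (at x) b = 0" if x: "x \<in> B" and b: "S.kp x0 b = b" for x b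
   proof (rule C.extend_section[OF V(1) FB(1) x smooth_on_const])
    show "subspace (D\<theta> q)" if "q \<in> V" for q by (rule distributionD(1)[OF dist(2)]) (use that VM in auto)
    show "tvec ?F y b \<in> D\<theta> (?F y)" if "y \<in> B" for y by (rule C.QK[OF that b])
    fix Z assume Z: "sect V D\<theta> Z" "Z (?F x) = tvec ?F x b"
    have "?F x \<in> V" using x FB(1) by auto
    from Z\<mu>[OF Z(1) this] show "fd (%y. \<mu> (?F y)) (at x) b = 0"
     unfolding Z(2) dir_deriv_tvec[OF C.P x smooth_on_differentiable[OF \<mu>B x]] .
   qed
   have ne: "openin (mtop M) (?F ` B)" "?F ` B \<noteq> {}" using C.FW_open B(2) by auto
   have "\<exists>q\<in>?F ` B. \<exists>Z\<in>D\<theta> q. dir_deriv M A j q Z \<theta> \<noteq> 0"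
    using psa ne unfolding proper_slant_along_def by blast
   from C.warped_piece[OF prB umB \<mu>B \<mu>K nonconst[OF ne(1) FB(1) ne(2)] this]
   show ?thesis using ne(1) FB(2) B(2) y0(2) x0(2) by (metis (no_types, lifting) imageI)
  qed
 qed
qed

end

section \<open>From the warped product to the shape operator condition\<close>

lemma constant_on_connectedin:
 assumes S: "connectedin X S"
  and f: "\<And>q. q \<in> S ==> \<exists>O'. openin X O' \<and> q \<in> O' \<and> (\<forall>r\<in>S \<inter> O'. f r = f q)"
 shows "f constant_on S"
proof (cases "S = {}")
 case True then show ?thesis by (simp add: constant_on_def)
next
 case False
 then obtain s where s: "s \<in> S" by blast
 have "\<forall>q\<in>S. \<exists>O'. openin X O' \<and> q \<in> O' \<and> (\<forall>r\<in>S \<inter> O'. f r = f q)" using f by (intro ballI)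
 from bchoice[OF this] obtain N where N: "\<forall>q\<in>S. openin X (N q) \<and> q \<in> N q \<and> (\<forall>r\<in>S \<inter> N q. f r = f q)" ..
 define E1 where "E1 = \<Union>(N ` {q \<in> S. f q = f s})"
 define E2 where "E2 = \<Union>(N ` {q \<in> S. f q \<noteq> f s})"
 have E1: "f r = f s" if r: "r \<in> S" "r \<in> E1" for r
 proof -
  obtain q where q: "q \<in> S" "f q = f s" "r \<in> N q" using r(2) unfolding E1_def by blast
  then have "f r = f q" using N r(1) by blast
  then show ?thesis using q(2) by simp
 qed
 have E2: "f r \<noteq> f s" if r: "r \<in> S" "r \<in> E2" for r
 proof -
  obtain q where q: "q \<in> S" "f q \<noteq> f s" "r \<in> N q" using r(2) unfolding E2_def by blast
  then have "f r = f q" using N r(1) by blast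
  then show ?thesis using q(2) by simp
 qed
 have cover: "S \<subseteq> E1 \<union> E2" using N unfolding E1_def E2_def by blast
 have "openin X E1" "openin X E2" unfolding E1_def E2_def using N by (auto intro!: openin_Union)
 moreover have "E1 \<inter> E2 \<inter> S = {}" using E1 E2 by blast
 moreover have "E1 \<inter> S \<noteq> {}" using s N unfolding E1_def by blast
 ultimately have "E2 \<inter> S = {}" using S cover unfolding connectedin by blast
 then have "f q = f s" if "q \<in> S" for q using cover E1 that by blast
 then show ?thesis by (auto simp: constant_on_def)
qed

text \<open>The dimension \<open>k\<close> is fixed before the point and the neighbourhood. That all
  slices share it is used in \<open>slice_dim_nonzero\<close>, where \<open>k = 0\<close> makes
  every point isolated.\<close>

lemma slice_param:
 assumes M: "smooth_manifold M" and S: "embedded_submanifold M S"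
 shows "\<exists>k. \<forall>s V. s \<in> S \<longrightarrow> openin (mtop M) V \<longrightarrow> s \<in> V \<longrightarrow>
  (\<exists>W F c L. param M W F c \<and> s \<in> F ` W \<and> F ` W \<subseteq> V \<and> subspace L \<and> dim L = k \<and> S \<inter> F ` W = F ` (W \<inter> L))"
proof -
 obtain k where k: "\<forall>p\<in>S. \<exists>V c L. smooth_chart M V c \<and> p \<in> V \<and> subspace L \<and> dim L = k \<and> c ` (S \<inter> V) = c ` V \<inter> L"
  using S unfolding embedded_submanifold_def by blast
 show ?thesis
 proof (intro exI[of _ k] allI impI)
  fix s V assume s: "s \<in> S" and V: "openin (mtop M) V" "s \<in> V"
  obtain V0 c L where c: "smooth_chart M V0 c" "s \<in> V0" "subspace L" "dim L = k" "c ` (S \<inter> V0) = c ` V0 \<inter> L"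
   using k s by blast
  define F where "F = the_inv_into V0 c"
  have P0: "param M (c ` V0) F c" unfolding F_def by (rule param_of_chart[OF c(1)])
  have inj: "inj_on c V0" using c(1) top_chartD(3) unfolding smooth_chart_def by blast
  have Fc: "F (c q) = q" if "q \<in> V0" for q unfolding F_def by (rule the_inv_into_f_f[OF inj that])
  define W where "W = {x \<in> c ` V0. F x \<in> V}"
  have P: "param M W F c"
   by (rule param_subset[OF M P0]) (use paramD(6)[OF M P0 V(1)] in \<open>auto simp: W_def\<close>)
  have "S \<inter> F ` W = F ` (W \<inter> L)"
  proof (intro equalityI subsetI)
   fix q assume "q \<in> S \<inter> F ` W"
   then obtain r where r: "r \<in> V0" "q = F (c r)" "F (c r) \<in> V" "q \<in> S" unfolding W_def by blast
   then have qr: "q = r" using Fc by simp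
   then have "c r \<in> c ` V0 \<inter> L" using r c(5) by blast
   then have "c r \<in> W \<inter> L" using r by (simp add: W_def)
   then show "q \<in> F ` (W \<inter> L)" using r(2) by blast
  next
   fix q assume "q \<in> F ` (W \<inter> L)"
   then obtain x where x: "x \<in> c ` V0 \<inter> L" "F x \<in> V" "q = F x" "x \<in> W" unfolding W_def by blast
   then obtain r where r: "r \<in> S" "r \<in> V0" "x = c r" unfolding c(5)[symmetric] by blast
   then have "q = r" using x(3) Fc by simp
   then show "q \<in> S \<inter> F ` W" using r(1) x(3,4) by blast
  qed
  moreover have "s \<in> F ` W" using c(2) Fc V(2) by (force simp: W_def)
  moreover have "F ` W \<subseteq> V" by (auto simp: W_def)
  ultimately show "\<exists>W F c L. param M W F c \<and> s \<in> F ` W \<and> F ` W \<subseteq> V \<and> subspace L \<and> dim L = k \<and> S \<inter> F ` W = F ` (W \<inter> L)"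
   using P c(3,4) by blast
 qed
qed

context cosymplectic_immersion
begin

lemma mderiv_factor:
 assumes P0: "param M W0 F0 c0" and T: "open T" "x \<in> T" "T \<subseteq> W0" and P1: "param M W1 F1 c1"
  and a: "smooth_on T a" "a x \<in> W1" "\<And>y. y \<in> T ==> \<pi> (F0 y) = F1 (a y)"
 shows "mderiv M A (j \<circ> \<pi>) (F0 x) (dpar M F0 x u) = tvec F1 (a x) (fd a (at x) u)"
proof -
 let ?h = "j \<circ> \<pi>"
 have x: "x \<in> W0" using T by blast
 have hx: "?h (F0 x) = j (F1 (a x))" using a(3)[OF T(2)] by simp
 have "((%z. cmap A (j (F1 (a x))) (j (F1 (a z)))) has_derivative (%u. tvec F1 (a x) (fd a (at x) u))) (at x)"
  by (rule has_derivative_compose[OF smooth_on_has_derivative[OF a(1) T(2)] J_has_derivative[OF P1 a(2)]])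
 then have d: "((%z. cmap A (?h (F0 x)) (?h (F0 z))) has_derivative (%u. tvec F1 (a x) (fd a (at x) u))) (at x)"
  by (rule has_derivative_transform_within_open[OF _ T(1,2)]) (simp add: a(3) T(2))
 have "mderiv M A ?h (F0 x) (dpar M F0 x u) = fd (%z. cmap A (?h (F0 x)) (?h (F0 z))) (at x) u"
  by (rule mderiv_param[OF M A P0 x differentiableI[OF d]])
 then show ?thesis using frechet_derivative_at[OF d] by metis
qed

text \<open>A product decomposition \<open>(\<pi>1, \<pi>2)\<close> is linear in suitable coordinates.\<close>

lemma product_coordinates:
 assumes U: "openin (mtop M) U" "q0 \<in> U" and \<pi>: "smooth_map M M U \<pi>1" "smooth_map M M U \<pi>2"
  and P1: "param M W1 F1 c1" "\<pi>1 q0 \<in> F1 ` W1" and L1: "subspace L1" "S1 \<inter> F1 ` W1 = F1 ` (W1 \<inter> L1)"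
  and P2: "param M W2 F2 c2" "\<pi>2 q0 \<in> F2 ` W2" and L2: "subspace L2" "S2 \<inter> F2 ` W2 = F2 ` (W2 \<inter> L2)"
  and S: "\<And>q. q \<in> U ==> \<pi>1 q \<in> S1 \<and> \<pi>2 q \<in> S2"
  and bij: "bij_betw (%u. (mderiv M A (j \<circ> \<pi>1) q0 u, mderiv M A (j \<circ> \<pi>2) q0 u)) UNIV
   (T_sub A M j S1 (\<pi>1 q0) \<times> T_sub A M j S2 (\<pi>2 q0))"
  and T1: "T_sub A M j S1 (\<pi>1 q0) = tvec F1 (c1 (\<pi>1 q0)) ` L1"
  and T2: "T_sub A M j S2 (\<pi>2 q0) = tvec F2 (c2 (\<pi>2 q0)) ` L2"
  and N: "openin (mtop M) N" "q0 \<in> N"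
 obtains W F c Q \<Lambda>1 \<Lambda>2 y0 where "param M W F c" "y0 \<in> W" "F y0 = q0" "F ` W \<subseteq> U" "F ` W \<subseteq> N"
  "linear Q" "\<And>v. Q (Q v) = Q v" "convex W" "\<And>y z. y \<in> W ==> z \<in> W ==> y - Q y + Q z \<in> W"
  "linear \<Lambda>1" "linear \<Lambda>2" "\<And>v. \<Lambda>1 v = 0 \<longleftrightarrow> Q v = v" "\<And>v. \<Lambda>2 v = 0 \<longleftrightarrow> Q v = 0" "range \<Lambda>2 = L2"
  "\<And>y. y \<in> W ==> \<Lambda>1 y \<in> W1 \<and> \<pi>1 (F y) = F1 (\<Lambda>1 y)" "\<And>y. y \<in> W ==> \<Lambda>2 y \<in> W2 \<and> \<pi>2 (F y) = F2 (\<Lambda>2 y)"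
proof -
 have q0: "q0 \<in> points M" using U openin_subset by blast
 define W0 where "W0 = cmap M q0 ` cdom M q0"
 define F0 where "F0 = cinv M q0"
 define c0 where "c0 = cmap M q0"
 have P0: "param M W0 F0 c0" unfolding W0_def F0_def c0_def by (rule param_cinv(1)[OF M q0])
 define x0 where "x0 = c0 q0"
 have x0: "x0 \<in> W0" "F0 x0 = q0"
  unfolding W0_def x0_def F0_def c0_def using param_cinv(2)[OF M q0] cdomD(1)[OF M q0] by auto
 define Oset where "Oset = {x \<in> W0. F0 x \<in> U \<and> \<pi>1 (F0 x) \<in> F1 ` W1} \<inter> {x \<in> W0. F0 x \<in> U \<and> \<pi>2 (F0 x) \<in> F2 ` W2} \<inter> {x \<in> W0. F0 x \<in> N}"
 have oF: "openin (mtop M) (F1 ` W1)" "openin (mtop M) (F2 ` W2)"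
  using paramD(5)[OF M P1(1) paramD(1)[OF M P1(1)]] paramD(5)[OF M P2(1) paramD(1)[OF M P2(1)]] by auto
 have O1: "open Oset" unfolding Oset_def
  by (intro open_Int smooth_map_open[OF M M P0 \<pi>(1) oF(1)] smooth_map_open[OF M M P0 \<pi>(2) oF(2)] paramD(6)[OF M P0 N(1)])
 have O2: "x0 \<in> Oset" "Oset \<subseteq> W0" using x0 U(2) P1(2) P2(2) N(2) by (auto simp: Oset_def)
 define a1 where "a1 x = c1 (\<pi>1 (F0 x))" for x
 define a2 where "a2 x = c2 (\<pi>2 (F0 x))" for x
 have as: "smooth_on Oset a1" "smooth_on Oset a2" unfolding a1_def[abs_def] a2_def[abs_def]
  by (rule smooth_on_subset[OF smooth_map_param[OF M M P0 P1(1) \<pi>(1)]], force simp: Oset_def)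
   (rule smooth_on_subset[OF smooth_map_param[OF M M P0 P2(1) \<pi>(2)]], force simp: Oset_def)
 have a1: "a1 x \<in> W1 \<inter> L1 \<and> \<pi>1 (F0 x) = F1 (a1 x)" if "x \<in> Oset" for x
 proof -
  have "\<pi>1 (F0 x) \<in> S1 \<inter> F1 ` W1" using that S by (auto simp: Oset_def)
  then obtain y where y: "y \<in> W1 \<inter> L1" "\<pi>1 (F0 x) = F1 y" unfolding L1(2) by blast
  then show ?thesis using paramD(2)[OF M P1(1)] by (auto simp: a1_def)
 qed
 have a2: "a2 x \<in> W2 \<inter> L2 \<and> \<pi>2 (F0 x) = F2 (a2 x)" if "x \<in> Oset" for x
 proof -
  have "\<pi>2 (F0 x) \<in> S2 \<inter> F2 ` W2" using that S by (auto simp: Oset_def)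
  then obtain y where y: "y \<in> W2 \<inter> L2" "\<pi>2 (F0 x) = F2 y" unfolding L2(2) by blast
  then show ?thesis using paramD(2)[OF M P2(1)] by (auto simp: a2_def)
 qed
 define d1 where "d1 = fd a1 (at x0)"
 define d2 where "d2 = fd a2 (at x0)"
 have hd: "(a1 has_derivative d1) (at x0)" "(a2 has_derivative d2) (at x0)"
  unfolding d1_def d2_def using smooth_on_has_derivative[OF as(1) O2(1)] smooth_on_has_derivative[OF as(2) O2(1)] by auto
 have dl: "linear d1" "linear d2" using hd has_derivative_linear by blast+
 have xa: "c1 (\<pi>1 q0) = a1 x0" "c2 (\<pi>2 q0) = a2 x0" by (simp_all add: a1_def a2_def x0(2))
 have aW: "a1 x0 \<in> W1" "a2 x0 \<in> W2" using a1[OF O2(1)] a2[OF O2(1)] by auto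
 have m1: "mderiv M A (j \<circ> \<pi>1) q0 (dpar M F0 x0 u) = tvec F1 (a1 x0) (d1 u)" for u
  using mderiv_factor[OF P0 O1 O2 P1(1) as(1) aW(1), of \<pi>1 u] a1 x0(2) by (simp add: d1_def)
 have m2: "mderiv M A (j \<circ> \<pi>2) q0 (dpar M F0 x0 u) = tvec F2 (a2 x0) (d2 u)" for u
  using mderiv_factor[OF P0 O1 O2 P2(1) as(2) aW(2), of \<pi>2 u] a2 x0(2) by (simp add: d2_def)
 \<comment> \<open>By the bijectivity hypothesis \<open>D\<close> maps the parameter space
   isomorphically onto \<open>L1 \<times> L2\<close>.\<close>
 define D where "D u = (d1 u, d2 u)" for u
 have Dl: "linear D" unfolding D_def[abs_def] using dl by (simp add: linear_iff)
 have B: "bij_betw ((%u. (mderiv M A (j \<circ> \<pi>1) q0 u, mderiv M A (j \<circ> \<pi>2) q0 u)) \<circ> dpar M F0 x0) UNIV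
   (tvec F1 (a1 x0) ` L1 \<times> tvec F2 (a2 x0) ` L2)"
  by (rule bij_betw_trans[OF dpar_bij(2)[OF M P0 x0(1)]]) (use bij in \<open>simp add: T1 T2 xa\<close>)
 have B': "(%u. (mderiv M A (j \<circ> \<pi>1) q0 u, mderiv M A (j \<circ> \<pi>2) q0 u)) \<circ> dpar M F0 x0
   = (%u. (tvec F1 (a1 x0) (d1 u), tvec F2 (a2 x0) (d2 u)))" by (simp add: fun_eq_iff m1 m2)
 note i1 = injD[OF tvec_facts(2)[OF P1(1) aW(1)]] and i2 = injD[OF tvec_facts(2)[OF P2(1) aW(2)]]
 note Bij = B[unfolded B']
 have Dinj: "inj D"
 proof (rule injI)
  fix u v assume "D u = D v"
  then have "(tvec F1 (a1 x0) (d1 u), tvec F2 (a2 x0) (d2 u)) = (tvec F1 (a1 x0) (d1 v), tvec F2 (a2 x0) (d2 v))"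
   by (simp add: D_def)
  then show "u = v" using Bij unfolding bij_betw_def by (meson UNIV_I inj_onD)
 qed
 have Dran: "range D = L1 \<times> L2"
 proof (intro equalityI subsetI)
  fix w assume "w \<in> range D"
  then obtain u where u: "w = (d1 u, d2 u)" by (auto simp: D_def)
  have "(tvec F1 (a1 x0) (d1 u), tvec F2 (a2 x0) (d2 u)) \<in> tvec F1 (a1 x0) ` L1 \<times> tvec F2 (a2 x0) ` L2"
   using Bij unfolding bij_betw_def by blast
  then show "w \<in> L1 \<times> L2" using i1 i2 u by auto
 next
  fix w assume w: "w \<in> L1 \<times> L2"
  then have "(tvec F1 (a1 x0) (fst w), tvec F2 (a2 x0) (snd w)) \<in> range (%u. (tvec F1 (a1 x0) (d1 u), tvec F2 (a2 x0) (d2 u)))"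
   using Bij unfolding bij_betw_def by auto
  then obtain u where "tvec F1 (a1 x0) (fst w) = tvec F1 (a1 x0) (d1 u)" "tvec F2 (a2 x0) (snd w) = tvec F2 (a2 x0) (d2 u)" by blast
  then have "w = D u" using i1 i2 by (metis D_def prod.collapse)
  then show "w \<in> range D" by blast
 qed
 obtain G where G: "linear G" "G \<circ> D = id" using linear_injective_left_inverse[OF Dl Dinj] by blast
 have GD: "G (D v) = v" for v using G(2) by (metis comp_apply id_apply)
 have DG: "D (G w) = w" if "w \<in> L1 \<times> L2" for w using that GD unfolding Dran[symmetric] by auto
 have Gb: "bounded_linear G" using G(1) by (simp add: linear_conv_bounded_linear)
 \<comment> \<open>\<open>a1\<close> and \<open>a2\<close> are the two factors in slice coordinates.
   Composing with the left inverse \<open>G\<close> makes the derivative at \<open>x0\<close> the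
   identity, so \<open>\<psi>\<close> is a local change of coordinates.\<close>
 define \<psi> where "\<psi> x = G (a1 x, a2 x)" for x
 have \<psi>s: "smooth_on Oset \<psi>" unfolding \<psi>_def[abs_def]
  by (intro smooth_on_bounded_linear[OF Gb] O1 smooth_on_Pair as)
 have "(\<psi> has_derivative (%v. G (D v))) (at x0)" unfolding \<psi>_def[abs_def] D_def
  by (intro bounded_linear.has_derivative[OF Gb] has_derivative_Pair hd)
 then have "fd \<psi> (at x0) = (%v. v)" using frechet_derivative_at[of \<psi> "%v. G (D v)"] GD by simp
 then have \<psi>inj: "v = 0" if "fd \<psi> (at x0) v = 0" for v using that by simp
 \<comment> \<open>The projection that forgets the first factor: its range is the kernel of
   \<open>d1\<close>, its kernel that of \<open>d2\<close>.\<close>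
 define Q where "Q v = G (0, d2 v)" for v
 have r2: "(0, d2 v) \<in> L1 \<times> L2" "d1 v \<in> L1" "d2 v \<in> L2" for v
  using Dran subspace_0[OF L1(1)] by (auto simp: D_def)
 have DQ: "d1 (Q v) = 0" "d2 (Q v) = d2 v" for v using DG[OF r2(1)[of v]] by (simp_all add: Q_def D_def)
 have Ql: "linear Q" unfolding Q_def[abs_def]
  using linear_compose[of "%v. (0::'m, d2 v)" G] dl(2) G(1) by (simp add: o_def linear_iff)
 have QQ: "Q (Q v) = Q v" for v by (simp add: Q_def DQ(2)[unfolded Q_def])
 have QK: "d1 v = 0 \<longleftrightarrow> Q v = v" for v
 proof
  assume "d1 v = 0" then have "Q v = G (D v)" by (simp add: Q_def D_def)
  then show "Q v = v" by (simp add: GD)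
 qed (use DQ(1)[of v] in simp)
 have QH: "d2 v = 0 \<longleftrightarrow> Q v = 0" for v
  using DQ(2)[of v] linear_0[OF dl(2)] linear_0[OF G(1)] by (auto simp: Q_def zero_prod_def)
 have ran2: "range d2 = L2"
 proof (intro equalityI subsetI)
  fix w assume "w \<in> L2"
  then have "(0, w) \<in> range D" unfolding Dran using subspace_0[OF L1(1)] by simp
  then show "w \<in> range d2" by (auto simp: D_def)
 qed (use r2(3) in blast)
 show thesis
 proof (rule smooth_inverse_function[OF O1 \<psi>s O2(1) \<psi>inj], assumption)
  fix U' V' h assume U': "open U'" "U' \<subseteq> Oset" "x0 \<in> U'" "open V'" "homeomorphism U' V' \<psi> h" "smooth_on V' h"
  have P': "param M V' (%y. F0 (h y)) (%q. \<psi> (c0 q))"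
   by (rule param_reparam[OF M P0 U'(1) _ U'(4,5) smooth_on_subset[OF \<psi>s U'(2)] U'(6)]) (use U'(2) O2(2) in blast)
  have y0: "\<psi> x0 \<in> V'" "h (\<psi> x0) = x0" using U'(3,5) by (auto simp: homeomorphism_def)
  have hO: "h y \<in> Oset" "\<psi> (h y) = y" if "y \<in> V'" for y using U'(2,5) that by (auto simp: homeomorphism_def)
  \<comment> \<open>In the new coordinates the factors are exactly the linear maps \<open>d1\<close>
    and \<open>d2\<close>, beyond first order: the values of \<open>(a1, a2)\<close> lie in
    \<open>L1 \<times> L2\<close>, where \<open>G\<close> is a right inverse of \<open>D\<close> as
    well.\<close>
  have da: "d1 y = a1 (h y)" "d2 y = a2 (h y)" if "y \<in> V'" for y
  proof -
   have "(a1 (h y), a2 (h y)) \<in> L1 \<times> L2" using a1[OF hO(1)[OF that]] a2[OF hO(1)[OF that]] by simp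
   from DG[OF this] have "D y = (a1 (h y), a2 (h y))" using hO(2)[OF that] by (simp add: \<psi>_def)
   then show "d1 y = a1 (h y)" "d2 y = a2 (h y)" by (simp_all add: D_def)
  qed
  show thesis
  proof (rule linear_box[OF Ql QQ U'(4) y0(1)])
   fix B assume B: "open B" "\<psi> x0 \<in> B" "B \<subseteq> V'" "convex B" "\<And>y z. y \<in> B ==> z \<in> B ==> y - Q y + Q z \<in> B"
   show thesis
   proof (rule that[OF param_subset[OF M P' B(1,3)] B(2) _ _ _ Ql QQ B(4,5) dl QK QH ran2])
    show "F0 (h (\<psi> x0)) = q0" by (simp add: y0 x0)
    show "(%y. F0 (h y)) ` B \<subseteq> U" "(%y. F0 (h y)) ` B \<subseteq> N" using hO(1) B(3) by (auto simp: Oset_def)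
    show "d1 y \<in> W1 \<and> \<pi>1 (F0 (h y)) = F1 (d1 y)" if "y \<in> B" for y
     using a1[OF hO(1)] da(1) B(3) that by auto
    show "d2 y \<in> W2 \<and> \<pi>2 (F0 (h y)) = F2 (d2 y)" if "y \<in> B" for y
     using a2[OF hO(1)] da(2) B(3) that by auto
   qed
  qed
 qed
qed

end

context semi_slant_chart
begin

text \<open>Both sides are tangent, so pairing with tangent vectors decides equality, and there
  \<open>shape_difference\<close> reduces the left side to the connection.\<close>

lemma shape_of_umbilic:
 assumes V: "openin (mtop M) V" "F ` W \<subseteq> V" and pr: "proper_at (F ` W)" and um: "umbilic \<mu>" and \<mu>s: "smooth_on W (%y. \<mu> (F y))"
  and X: "sect V H X" and Z: "sect V D\<theta> Z" and x: "x \<in> W"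
 shows "shape_eq \<mu> X Z (F x)" (is "?L = ?R")
proof -
 have q: "F x \<in> points M" and xV: "F x \<in> V" using F_points[OF x] V(2) x by auto
 have Xs: "sfield (%y. X (F y))" by (rule along_sfield[OF V(1) _ V(2)]) (use X in \<open>simp add: is_section_def\<close>)
 have XH: "X (F y) \<in> H (F y)" if "y \<in> W" for y using X that V(2) by (auto simp: is_section_def)
 have w: "Z (F x) \<in> D\<theta> (F x)" using Z xV by (simp add: is_section_def)
 have XT: "X (F y) \<in> TM M A j (F y)" "phi A (j (F y)) (X (F y)) \<in> TM M A j (F y)" if "y \<in> W" for y
  using XH[OF that] split_facts(3,6)[OF that] by blast+
 note sd = shape_difference[OF x split[OF q] Xs XT w]
 note sf = split_facts[OF x]
 have "X (F x) \<in> range (tvec F x)" using XT(1)[OF x] TM_range[OF x] by simp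
 then obtain a where a: "X (F x) = tvec F x a" by (rule rangeE)
 have dd: "dir_deriv M A j (F x) (X (F x)) \<mu> = fd (%y. \<mu> (F y)) (at x) a"
  unfolding a by (rule dir_deriv_tvec[OF P x smooth_on_differentiable[OF \<mu>s x]])
 show ?thesis
 proof (rule iform_eqI[OF sf(7) TM_subspace[OF x] sd(1)])
  show "?R \<in> TM M A j (F x)" using sf(4) w subspace_scale[OF TM_subspace[OF x]] by blast
  fix t assume "t \<in> TM M A j (F x)"
  then have "t \<in> range (tvec F x)" using TM_range[OF x] by simp
  then obtain v where v: "t = tvec F x v" by (rule rangeE)
  have "g (F x) (nb x v (%y. X (F y))) (Z (F x)) = fd (%y. \<mu> (F y)) (at x) a * g (F x) (tvec F x v) (Z (F x))"
   by (rule umbilicD[OF pr um x Xs XH w a])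
  moreover have "g (F x) ?L (tvec F x v) = (sin (\<theta> (F x)))\<^sup>2 * g (F x) (nb x v (%y. X (F y))) (Z (F x))" by (rule sd(2))
  moreover have "g (F x) ?R (tvec F x v) = (sin (\<theta> (F x)))\<^sup>2 * dir_deriv M A j (F x) (X (F x)) \<mu> * g (F x) (Z (F x)) (tvec F x v)"
   by (rule iform_simps(5)[OF sf(7)])
  ultimately show "g (F x) ?L t = g (F x) ?R t"
   unfolding v dd using iform_sym[OF sf(7), of "tvec F x v" "Z (F x)"] by simp
 qed
qed

end

context adapted_chart
begin

text \<open>Koszul's formula for the coordinate fields.\<close>

lemma umbilic_of_metric:
 assumes \<mu>s: "smooth_on W (%y. \<mu> (F y))"
  and 1: "\<And>y z. y \<in> W ==> z \<in> W ==> Q (y - z) = y - z ==> \<mu> (F y) = \<mu> (F z)"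
  and 2: "\<And>y z a a'. y \<in> W ==> z \<in> W ==> Q (y - z) = y - z ==> Q a = 0 ==> Q a' = 0 ==> gm y a a' = gm z a a'"
  and 3: "\<And>y z b b'. y \<in> W ==> z \<in> W ==> Q (y - z) = 0 ==> Q b = b ==> Q b' = b' ==>
   exp (- 2 * \<mu> (F y)) * gm y b b' = exp (- 2 * \<mu> (F z)) * gm z b b'"
 shows "umbilic \<mu>" and "x \<in> W ==> Q b = b ==> fd (%y. \<mu> (F y)) (at x) b = 0"
proof -
 show "fd (%y. \<mu> (F y)) (at x) b = 0" if x: "x \<in> W" and b: "Q b = b" for x b
  by (rule derivative_zero_of_constant_line[OF smooth_on_has_derivative[OF \<mu>s x] W_open x])
   (rule 1[OF _ x], simp_all add: b Q_simps)
 let ?d = "%x. fd (%y. \<mu> (F y)) (at x)"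
 have const: "g (F x) (nb x v (%y. tvec F y a)) (tvec F x b) = ?d x a * gm x v b"
  if x: "x \<in> W" and a: "Q a = 0" and b: "Q b = b" for x v a b
 proof -
  define N where "N v u w = g (F x) (nb x v (%y. tvec F y u)) (tvec F x w)" for v u w
  have Nsym: "N v u w = N u v w" for u v w unfolding N_def nb_const_sym[OF x, of v u] ..
  note gf = iform_simps[OF gm_form[OF x]] and gs = iform_sym[OF split_facts(7)[OF x]]
  have G: "((%y. gm y u w) has_derivative (%v. N v u w + N v w u)) (at x)" for u w
   using gm_deriv[OF x, of u w] unfolding N_def gs[of "tvec F x u"] .
  have G0: "N v a b + N v b a = 0" if "Q a = 0" "Q b = b" for v a b
   by (rule has_derivative_const_on_open[OF G W_open x]) (rule gm_orth[OF _ that])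
  have G1: "N b a a' + N b a' a = 0" if "Q a = 0" "Q a' = 0" "Q b = b" for a a' b
   by (rule derivative_zero_of_constant_line[OF G W_open x]) (rule 2[OF _ x _ that(1,2)], simp_all add: that(3) Q_simps)
  have G2: "N a b b' + N a b' b = 2 * ?d x a * gm x b b'" if "Q a = 0" "Q b = b" "Q b' = b'" for a b b'
  proof -
   have e: "((%y. exp (- 2 * \<mu> (F y))) has_derivative (%v. exp (- 2 * \<mu> (F x)) * (- 2 * ?d x v))) (at x)"
    by (rule has_derivative_eq_rhs[OF has_derivative_exp[OF has_derivative_mult_right[OF smooth_on_has_derivative[OF \<mu>s x]]]]) (simp add: fun_eq_iff ac_simps)
   have "exp (- 2 * \<mu> (F x)) * (N a b b' + N a b' b) + exp (- 2 * \<mu> (F x)) * (- 2 * ?d x a) * gm x b b' = 0"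
    by (rule derivative_zero_of_constant_line[OF has_derivative_mult[OF e G] W_open x])
     (rule 3[OF _ x _ that(2,3)], simp_all add: that(1) Q_simps)
   then have "exp (- 2 * \<mu> (F x)) * (N a b b' + N a b' b - 2 * ?d x a * gm x b b') = 0" by (simp add: algebra_simps)
   then show ?thesis by simp
  qed
  \<comment> \<open>\<open>N\<close> is symmetric in its first two arguments, while
    \<open>G0\<close>, \<open>G1\<close> and \<open>G2\<close> are the known derivatives of the
    metric coefficients. These relations are solved for \<open>N v a b\<close>, separately for the
    range part and the kernel part of \<open>v\<close>.\<close>
  have "N (Q v) a b = ?d x a * gm x (Q v) b"
   using G2[OF a Q(2)[of v] b] G0[OF a b, of "Q v"] G0[OF a Q(2)[of v], of b]
    Nsym[of b "Q v" a] Nsym[of a b "Q v"] Nsym[of a "Q v" b] by simp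
  moreover have "N (v - Q v) a b = 0"
   using G1[OF a Q_simps(1)[of v] b] G0[OF a b, of "v - Q v"] G0[OF Q_simps(1)[of v] b, of a]
    Nsym[of a b "v - Q v"] Nsym[of "v - Q v" b a] Nsym[of a "v - Q v" b] by simp
  moreover have "N v a b = N (v - Q v) a b + N (Q v) a b"
   unfolding N_def using linear_add[OF nb_linear[OF x sfield_const], of "v - Q v" "Q v" a]
    iform_simps(1)[OF split_facts(7)[OF x]] by simp
  moreover have "gm x v b = gm x (v - Q v) b + gm x (Q v) b" using gf(1)[of "v - Q v" "Q v" b] by simp
  ultimately show ?thesis using gm_orth[OF x Q_simps(1)[of v] b] by (simp add: N_def)
 qed
 show "umbilic \<mu>"
  unfolding umbilic_def
 proof (intro ballI allI impI)
  fix x X a v w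
  assume x: "x \<in> W" and X: "sfield X" "\<forall>y\<in>W. X y \<in> H (F y)" and w: "w \<in> D\<theta> (F x)" and a: "X x = tvec F x a"
  have "w \<in> tvec F x ` ranQ" using w tvec_ranQ[OF x] by simp
  then obtain b where b: "w = tvec F x b" "b \<in> ranQ" by (rule imageE)
  then have bQ: "Q b = b" by simp
  have "tvec F x a \<in> tvec F x ` kerQ" using X(2) x a tvec_kerQ[OF x] by metis
  then have aQ: "Q a = 0" using injD[OF tvec_facts(2)[OF P x]] by auto
  \<comment> \<open>The passage from coordinate fields to an arbitrary \<open>X\<close> with values
    in \<open>H\<close>: differentiating its orthogonality to \<open>b\<close> shows that the
    \<open>b\<close>-component of its derivative depends only on the value of \<open>X\<close> at
    \<open>x\<close>.\<close>
  have "g (F y) (X y) (tvec F y b) = 0" if "y \<in> W" for y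
   by (rule split_facts(5)[OF that _ QK[OF that bQ]]) (use X(2) that in blast)
  from has_derivative_const_on_open[OF nb_met[OF x X(1) sfield_const] W_open x this, of v]
  have "g (F x) (nb x v X) w + g (F x) (tvec F x a) (nb x v (%y. tvec F y b)) = 0" unfolding b(1)[symmetric] a .
  moreover have "g (F x) (nb x v (%y. tvec F y a)) (tvec F x b) + g (F x) (tvec F x a) (nb x v (%y. tvec F y b)) = 0"
   by (rule has_derivative_const_on_open[OF gm_deriv[OF x] W_open x]) (rule gm_orth[OF _ aQ bQ])
  ultimately show "g (F x) (nb x v X) w = ?d x a * g (F x) (tvec F x v) w"
   using const[OF x aQ bQ, of v] by (simp add: gm_def b(1))
 qed
qed

end

context semi_slant
begin

lemma T_sub_slice_param:
 assumes P: "param M W F c" and L: "subspace L" and S: "S \<inter> F ` W = F ` (W \<inter> L)" and s: "s \<in> S" "s \<in> F ` W"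
 shows "T_sub A M j S s = tvec F (c s) ` L"
proof -
 have "s \<in> F ` (W \<inter> L)" using s S by blast
 then obtain x where x: "x \<in> W" "x \<in> L" "s = F x" by blast
 have "y \<in> L \<longleftrightarrow> y - x \<in> L" for y
  using subspace_diff[OF L _ x(2), of y] subspace_add[OF L _ x(2), of "y - x"] by auto
 then have "S \<inter> F ` W = F ` {y \<in> W. y - x \<in> L}" unfolding S by auto
 from T_sub_slice[OF P x(1) L this] show ?thesis using paramD(2)[OF M P x(1)] x(3) by simp
qed

context
 fixes U p MT M\<theta> f \<pi>1 \<pi>2
 assumes U: "openin (mtop M) U" and piece: "warped_product_piece A M j U p MT M\<theta> f \<pi>1 \<pi>2"
begin

lemmas piece' = piece[unfolded warped_product_piece_def]
lemmas c1 = piece'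
lemmas c2 = c1[THEN conjunct2]
lemmas c3 = c2[THEN conjunct2]
lemmas c4 = c3[THEN conjunct2]
lemmas c5 = c4[THEN conjunct2]
lemmas c6 = c5[THEN conjunct2]
lemmas c7 = c6[THEN conjunct2]
lemmas c8 = c7[THEN conjunct2]
lemmas c9 = c8[THEN conjunct2]
lemmas c10 = c9[THEN conjunct2]
lemmas c11 = c10[THEN conjunct2]
lemmas c12 = c11[THEN conjunct2]
lemmas c13 = c12[THEN conjunct2]
lemmas c14 = c13[THEN conjunct2]
lemmas c15 = c14[THEN conjunct2]
lemmas c16 = c15[THEN conjunct2]
lemmas c17 = c16[THEN conjunct2]
lemmas c18 = c17[THEN conjunct2]
lemmas c19 = c18[THEN conjunct2]
lemmas c20 = c19[THEN conjunct2]
lemmas pc = c1[THEN conjunct1] c2[THEN conjunct1] c3[THEN conjunct1] c4[THEN conjunct1] c5[THEN conjunct1] c6[THEN conjunct1] c7[THEN conjunct1] c8[THEN conjunct1] c9[THEN conjunct1] c10[THEN conjunct1] c11[THEN conjunct1] c12[THEN conjunct1] c13[THEN conjunct1] c14[THEN conjunct1] c15[THEN conjunct1] c16[THEN conjunct1] c17[THEN conjunct1] c18[THEN conjunct1] c19[THEN conjunct1] c20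

text \<open>Items 8 and 9 give \<pi>1 on the two factors, 10 to 12 smoothness and bijectivity of the
  decomposition, 13 to 15 smoothness, positivity and non-constancy of \<open>f\<close>, and 16 the
  value of \<pi>2 on the second factor.\<close>

lemmas pieceD = pc(1-7) bspec[OF pc(9), THEN conjunct1] bspec[OF pc(10), THEN conjunct1] pc(11-13,15) bspec[OF pc(16)] pc(17)
 bspec[OF pc(10), THEN conjunct2]

lemma pieceD2:
 assumes q: "q \<in> U"
 shows "bij_betw (%u. (mderiv M A (j \<circ> \<pi>1) q u, mderiv M A (j \<circ> \<pi>2) q u)) UNIV
   (T_sub A M j MT (\<pi>1 q) \<times> T_sub A M j M\<theta> (\<pi>2 q))"
  "g q (mderiv M A j q u) (mderiv M A j q v) =
    g (\<pi>1 q) (mderiv M A (j \<circ> \<pi>1) q u) (mderiv M A (j \<circ> \<pi>1) q v)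
   + (f (\<pi>1 q))\<^sup>2 * g (\<pi>2 q) (mderiv M A (j \<circ> \<pi>2) q u) (mderiv M A (j \<circ> \<pi>2) q v)"
  "\<pi>1 q \<in> MT" "\<pi>2 q \<in> M\<theta>"
  "invariant_submanifold A M j {r \<in> U. \<pi>2 r = \<pi>2 q}" "xi A (j q) \<in> T_sub A M j {r \<in> U. \<pi>2 r = \<pi>2 q} q"
  "proper_pointwise_slant A M j {r \<in> U. \<pi>1 r = \<pi>1 q}"
proof -
 show m: "\<pi>1 q \<in> MT" "\<pi>2 q \<in> M\<theta>" using pieceD(12) q unfolding bij_betw_def by blast+
 show "bij_betw (%u. (mderiv M A (j \<circ> \<pi>1) q u, mderiv M A (j \<circ> \<pi>2) q u)) UNIV
   (T_sub A M j MT (\<pi>1 q) \<times> T_sub A M j M\<theta> (\<pi>2 q))" by (rule bspec[OF pc(14) q])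
 show "g q (mderiv M A j q u) (mderiv M A j q v) =
    g (\<pi>1 q) (mderiv M A (j \<circ> \<pi>1) q u) (mderiv M A (j \<circ> \<pi>1) q v)
   + (f (\<pi>1 q))\<^sup>2 * g (\<pi>2 q) (mderiv M A (j \<circ> \<pi>2) q u) (mderiv M A (j \<circ> \<pi>2) q v)"
  by (rule bspec[OF pc(18) q, rule_format])
 have "let S = {r \<in> U. \<pi>2 r = \<pi>2 q} in invariant_submanifold A M j S \<and> (\<forall>q\<in>S. xi A (j q) \<in> T_sub A M j S q)"
  by (rule bspec[OF pc(19) m(2)])
 then show "invariant_submanifold A M j {r \<in> U. \<pi>2 r = \<pi>2 q}" "xi A (j q) \<in> T_sub A M j {r \<in> U. \<pi>2 r = \<pi>2 q} q"
  using q by (auto simp: Let_def)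
 show "proper_pointwise_slant A M j {r \<in> U. \<pi>1 r = \<pi>1 q}" by (rule bspec[OF pc(20) m(1)])
qed

text \<open>For \<open>q\<close> in the left side, \<open>q\<close> and \<open>\<pi>2 q\<close> have
  the same image under the product decomposition, which is injective.\<close>

lemma leaf_through_p: "{q \<in> U. \<pi>1 q = p} = M\<theta>"
proof (intro equalityI subsetI)
 fix q assume q: "q \<in> {q \<in> U. \<pi>1 q = p}"
 then have r: "\<pi>2 q \<in> M\<theta>" using pieceD2(4) by blast
 have "q = \<pi>2 q"
  by (rule inj_onD[OF bij_betw_imp_inj_on[OF pieceD(12)]]) (use q r pieceD(6,9,16) in auto)
 then show "q \<in> M\<theta>" using r by simp
qed (use pieceD(6,9) in auto)

text \<open>In dimension 0 the second factor would be discrete, so each function on it locally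
  constant and, by connectedness, constant; its slant function is not. The result makes the slant
  part nonzero, as \<open>slant_split_unique\<close> requires.\<close>

lemma slice_dim_nonzero:
 "\<exists>k\<noteq>0. \<forall>s V. s \<in> M\<theta> \<longrightarrow> openin (mtop M) V \<longrightarrow> s \<in> V \<longrightarrow>
  (\<exists>W F c L. param M W F c \<and> s \<in> F ` W \<and> F ` W \<subseteq> V \<and> subspace L \<and> dim L = k \<and> M\<theta> \<inter> F ` W = F ` (W \<inter> L))"
proof -
 from slice_param[OF M pieceD(2)] obtain k where k: "\<forall>s V. s \<in> M\<theta> \<longrightarrow> openin (mtop M) V \<longrightarrow> s \<in> V \<longrightarrow>
  (\<exists>W F c L. param M W F c \<and> s \<in> F ` W \<and> F ` W \<subseteq> V \<and> subspace L \<and> dim L = k \<and> M\<theta> \<inter> F ` W = F ` (W \<inter> L))"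
  by (rule exE)
 have p: "p \<in> U" "\<pi>1 p = p" using pieceD(5,7,8) by auto
 have "proper_pointwise_slant A M j M\<theta>" using pieceD2(7)[OF p(1)] unfolding p(2) leaf_through_p .
 then obtain t :: "'b => real" where t: "\<not> t constant_on M\<theta>" unfolding proper_pointwise_slant_def by (elim exE conjE) (rule that)
 have "k \<noteq> 0"
 proof
  assume k0: "k = 0"
  have "t constant_on M\<theta>"
  proof (rule constant_on_connectedin[OF pieceD(4)])
   fix q assume q: "q \<in> M\<theta>"
   have qM: "q \<in> points M" using q pieceD(6) U openin_subset by blast
   obtain W F c L where c: "param M W F c" "q \<in> F ` W" "subspace L" "dim L = k" "M\<theta> \<inter> F ` W = F ` (W \<inter> L)"
    using k[rule_format, OF q openin_topspace qM] by (elim exE conjE) (rule that, assumption+)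
   have "L = {0}" using c(3,4) k0 subspace_0 by (auto simp: dim_eq_0)
   then have "F ` (W \<inter> L) \<subseteq> {F 0}" by auto
   then have sub: "M\<theta> \<inter> F ` W \<subseteq> {F 0}" unfolding c(5) .
   have q0: "q = F 0" by (rule singletonD[OF subsetD[OF sub IntI[OF q c(2)]]])
   have "r = q" if "r \<in> M\<theta> \<inter> F ` W" for r unfolding q0 by (rule singletonD[OF subsetD[OF sub that]])
   then have "\<forall>r\<in>M\<theta> \<inter> F ` W. t r = t q" by simp
   then show "\<exists>O'. openin (mtop M) O' \<and> q \<in> O' \<and> (\<forall>r\<in>M\<theta> \<inter> O'. t r = t q)"
    using paramD(5)[OF M c(1) paramD(1)[OF M c(1)]] c(2) by blast
  qed
  then show False using t by simp
 qed
 then show ?thesis using k by (intro exI[of _ k] conjI)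
qed

end

end

lemma exp_scaling: "0 < r ==> exp (- 2 * ln r) * (r\<^sup>2 * k) = (k::real)"
proof -
 assume r: "0 < r"
 have "exp (- 2 * ln r) = inverse (exp (ln r + ln r))" by (simp add: exp_minus[symmetric])
 also have "\<dots> = inverse (r\<^sup>2)" unfolding exp_add exp_ln[OF r] by (simp add: power2_eq_square)
 finally show ?thesis using r by simp
qed

context semi_slant
begin

lemma dir_deriv_constant:
 assumes O': "openin (mtop M) O'" "q \<in> O'" and c: "\<And>r. r \<in> O' ==> \<mu> r = k"
 shows "dir_deriv M A j q v \<mu> = 0"
proof -
 have q: "q \<in> points M" using O' openin_subset by blast
 let ?T = "{y \<in> cmap M q ` cdom M q. cinv M q y \<in> O'}"
 have T: "open ?T" by (rule paramD(6)[OF M param_cinv(1)[OF M q] O'(1)])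
 have x: "cmap M q q \<in> ?T" using param_cinv(2)[OF M q] cdomD(1)[OF M q] O'(2) by auto
 have "fd (\<mu> \<circ> cinv M q) (at (cmap M q q)) = fd (%_. k) (at (cmap M q q))"
  by (rule frechet_derivative_cong_open(1)[OF T x]) (simp add: c)
 then show ?thesis by (simp add: dir_deriv_def fderiv_def)
qed

context
 fixes U p MT M\<theta> f \<pi>1 \<pi>2
 assumes U: "openin (mtop M) U" and piece: "warped_product_piece A M j U p MT M\<theta> f \<pi>1 \<pi>2"
begin

lemmas D1 = pieceD[OF U piece] and D2 = pieceD2[OF U piece]

text \<open>In product coordinates the tangent spaces of the leaves are kernel and range of
  \<open>Q\<close>; with the slant function of the leaf they form a splitting of the tangent space,
  and uniqueness identifies them with \<open>H\<close>, D\<theta> and \<theta>. The metric then has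
  the shape that \<open>umbilic_of_metric\<close> expects, with ln(f \<circ> \<pi>1) as
  \<mu>.\<close>

lemma piece_chart:
 assumes q0: "q0 \<in> U" and N: "openin (mtop M) N" "q0 \<in> N"
 obtains W F c Q y0 where "adapted_chart A M j D D\<theta> \<theta> W F c Q y0" "F y0 = q0" "F ` W \<subseteq> U" "F ` W \<subseteq> N" "proper_at (F ` W)"
  "smooth_on W (%y. ln (f (\<pi>1 (F y))))"
  "\<And>y z. y \<in> W ==> z \<in> W ==> \<pi>1 (F y) = \<pi>1 (F z) ==> Q (y - z) = y - z"
  "\<And>x b. x \<in> W ==> Q b = b ==> fd (%y. ln (f (\<pi>1 (F y)))) (at x) b = 0"
  "\<And>V X Z x. openin (mtop M) V ==> F ` W \<subseteq> V ==> sect V H X ==> sect V D\<theta> Z ==> x \<in> W ==>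
   shape_eq (%q. ln (f (\<pi>1 q))) X Z (F x)"
  "\<And>y t. y \<in> W ==> slant_function_of A M j {r \<in> U. \<pi>1 r = \<pi>1 (F y)} t ==> t (F y) \<noteq> 0 ==> t (F y) = \<theta> (F y)"
proof -
 have UM: "U \<subseteq> points M" by (rule openin_subset[OF U])
 \<comment> \<open>\<open>f\<close> is smooth on the first factor as a restriction of a function
   \<open>Fe\<close> on an open set; smoothness of ln(f \<circ> \<pi>1) in coordinates is taken from
   \<open>Fe\<close>.\<close>
 obtain V3 Fe where V3: "openin (mtop M) V3" "\<pi>1 q0 \<in> V3" "smooth_fun M V3 Fe" "\<forall>q \<in> MT \<inter> V3. Fe q = f q"
  using D1(13)[unfolded smooth_fun_sub_def, rule_format, OF D2(3)[OF q0]] by (elim exE conjE) (rule that, assumption+)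
 obtain k1 where k1: "\<forall>s V. s \<in> MT \<longrightarrow> openin (mtop M) V \<longrightarrow> s \<in> V \<longrightarrow>
  (\<exists>W F c L. param M W F c \<and> s \<in> F ` W \<and> F ` W \<subseteq> V \<and> subspace L \<and> dim L = k1 \<and> MT \<inter> F ` W = F ` (W \<inter> L))"
  using slice_param[OF M D1(1)] by (rule exE)
 obtain W1 F1 c1 L1 where P1: "param M W1 F1 c1" "\<pi>1 q0 \<in> F1 ` W1" "F1 ` W1 \<subseteq> V3" "subspace L1" "MT \<inter> F1 ` W1 = F1 ` (W1 \<inter> L1)"
  using k1[rule_format, OF D2(3)[OF q0] V3(1,2)] by (elim exE conjE) (rule that, assumption+)
 obtain k2 where k2: "k2 \<noteq> 0" "\<forall>s V. s \<in> M\<theta> \<longrightarrow> openin (mtop M) V \<longrightarrow> s \<in> V \<longrightarrow>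
  (\<exists>W F c L. param M W F c \<and> s \<in> F ` W \<and> F ` W \<subseteq> V \<and> subspace L \<and> dim L = k2 \<and> M\<theta> \<inter> F ` W = F ` (W \<inter> L))"
  using slice_dim_nonzero[OF U piece] by (elim exE conjE) (rule that, assumption+)
 have s2: "\<pi>2 q0 \<in> M\<theta>" "\<pi>2 q0 \<in> points M" using D2(4)[OF q0] D1(6) UM by auto
 obtain W2 F2 c2 L2 where P2: "param M W2 F2 c2" "\<pi>2 q0 \<in> F2 ` W2" "subspace L2" "dim L2 = k2" "M\<theta> \<inter> F2 ` W2 = F2 ` (W2 \<inter> L2)"
  using k2(2)[rule_format, OF s2(1) openin_topspace s2(2)] by (elim exE conjE) (rule that, assumption+)
 note T1 = T_sub_slice_param[OF P1(1,4,5) D2(3)[OF q0] P1(2)] and T2 = T_sub_slice_param[OF P2(1,3,5) s2(1) P2(2)]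
 show thesis
 proof (rule product_coordinates[OF U q0 D1(10,11) P1(1,2,4,5) P2(1,2,3,5) _ D2(1)[OF q0] T1 T2 N])
  show "\<pi>1 q \<in> MT \<and> \<pi>2 q \<in> M\<theta>" if "q \<in> U" for q using D2(3,4)[OF that] by simp
 next
  fix W F c Q \<Lambda>1 \<Lambda>2 y0
  assume P: "param M W F c" and y0: "y0 \<in> W" "F y0 = q0" and FU: "F ` W \<subseteq> U" and FN: "F ` W \<subseteq> N"
   and Q: "linear Q" "\<And>v. Q (Q v) = Q v" and conv: "convex W" and box: "\<And>y z. y \<in> W ==> z \<in> W ==> y - Q y + Q z \<in> W"
   and l: "linear \<Lambda>1" "linear \<Lambda>2" and K: "\<And>v. \<Lambda>1 v = 0 \<longleftrightarrow> Q v = v" "\<And>v. \<Lambda>2 v = 0 \<longleftrightarrow> Q v = 0" and ran: "range \<Lambda>2 = L2"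
   and e1: "\<And>y. y \<in> W ==> \<Lambda>1 y \<in> W1 \<and> \<pi>1 (F y) = F1 (\<Lambda>1 y)" and e2: "\<And>y. y \<in> W ==> \<Lambda>2 y \<in> W2 \<and> \<pi>2 (F y) = F2 (\<Lambda>2 y)"
  have W: "open W" by (rule paramD(1)[OF M P])
  have Fy: "F y \<in> U" "F y \<in> points M" if "y \<in> W" for y using FU UM that by auto
  have b: "bounded_linear \<Lambda>1" "bounded_linear \<Lambda>2" using l by (simp_all add: linear_conv_bounded_linear)
  have fr: "fd \<Lambda>1 (at y) = \<Lambda>1" "fd \<Lambda>2 (at y) = \<Lambda>2" for y
   using frechet_derivative_at[OF bounded_linear_imp_has_derivative[OF b(1)], of y]
    frechet_derivative_at[OF bounded_linear_imp_has_derivative[OF b(2)], of y] by simp_all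
  have m1: "mderiv M A (j \<circ> \<pi>1) (F y) (dpar M F y u) = tvec F1 (\<Lambda>1 y) (\<Lambda>1 u)" if "y \<in> W" for y u
   using mderiv_factor[OF P W that subset_refl P1(1) smooth_on_linear[OF b(1) W] conjunct1[OF e1[OF that]] conjunct2[OF e1], of u]
   unfolding fr .
  have m2: "mderiv M A (j \<circ> \<pi>2) (F y) (dpar M F y u) = tvec F2 (\<Lambda>2 y) (\<Lambda>2 u)" if "y \<in> W" for y u
   using mderiv_factor[OF P W that subset_refl P2(1) smooth_on_linear[OF b(2) W] conjunct1[OF e2[OF that]] conjunct2[OF e2], of u]
   unfolding fr .
  have met: "g (F y) (tvec F y u) (tvec F y v) = g (F1 (\<Lambda>1 y)) (tvec F1 (\<Lambda>1 y) (\<Lambda>1 u)) (tvec F1 (\<Lambda>1 y) (\<Lambda>1 v))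
    + (f (\<pi>1 (F y)))\<^sup>2 * g (F2 (\<Lambda>2 y)) (tvec F2 (\<Lambda>2 y) (\<Lambda>2 u)) (tvec F2 (\<Lambda>2 y) (\<Lambda>2 v))" if y: "y \<in> W" for y u v
   using D2(2)[OF Fy(1)[OF y], of "dpar M F y u" "dpar M F y v"]
   unfolding m1[OF y] m2[OF y] tvec_mderiv[OF P y] conjunct2[OF e2[OF y]] using conjunct2[OF e1[OF y]] by simp
  have form: "inner_form (g (F1 (\<Lambda>1 y)))" "inner_form (g (F2 (\<Lambda>2 y)))" if "y \<in> W" for y
   using Fx(2)[OF P1(1)] Fx(2)[OF P2(1)] e1[OF that] e2[OF that] met_form by auto
  have z: "tvec F1 (\<Lambda>1 y) 0 = 0" "tvec F2 (\<Lambda>2 y) 0 = 0" if "y \<in> W" for y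
   using linear_0[OF tvec_facts(1)[OF P1(1)]] linear_0[OF tvec_facts(1)[OF P2(1)]] e1[OF that] e2[OF that] by auto
  have metH: "g (F y) (tvec F y a) (tvec F y a') = g (F1 (\<Lambda>1 y)) (tvec F1 (\<Lambda>1 y) (\<Lambda>1 a)) (tvec F1 (\<Lambda>1 y) (\<Lambda>1 a'))"
   if y: "y \<in> W" and a: "Q a = 0" "Q a' = 0" for y a a'
   using met[OF y, of a a'] K(2)[of a] a(1) z(2)[OF y] iform_simps(9)[OF form(2)[OF y]] by simp
  have metK: "g (F y) (tvec F y b) (tvec F y b') = (f (\<pi>1 (F y)))\<^sup>2 * g (F2 (\<Lambda>2 y)) (tvec F2 (\<Lambda>2 y) (\<Lambda>2 b)) (tvec F2 (\<Lambda>2 y) (\<Lambda>2 b'))"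
   if y: "y \<in> W" and b: "Q b = b" "Q b' = b'" for y b b'
   using met[OF y, of b b'] K(1)[of b] b(1) z(1)[OF y] iform_simps(9)[OF form(1)[OF y]] by simp
  have metO: "g (F y) (tvec F y a) (tvec F y b) = 0" if y: "y \<in> W" and a: "Q a = 0" "Q b = b" for y a b
   using met[OF y, of a b] K(1)[of b] K(2)[of a] a z[OF y] iform_simps(9)[OF form(2)[OF y]] iform_simps(10)[OF form(1)[OF y]] by simp
  have pi1: "\<pi>1 (F w) = \<pi>1 (F y) \<longleftrightarrow> Q (w - y) = w - y" if "w \<in> W" "y \<in> W" for w y
   using e1[OF that(1)] e1[OF that(2)] inj_onD[OF paramD(3)[OF M P1(1)], of "\<Lambda>1 w" "\<Lambda>1 y"] K(1)[of "w - y"]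
   by (auto simp: linear_diff[OF l(1)])
  have pi2: "\<pi>2 (F w) = \<pi>2 (F y) \<longleftrightarrow> Q (w - y) = 0" if "w \<in> W" "y \<in> W" for w y
   using e2[OF that(1)] e2[OF that(2)] inj_onD[OF paramD(3)[OF M P2(1)], of "\<Lambda>2 w" "\<Lambda>2 y"] K(2)[of "w - y"]
   by (auto simp: linear_diff[OF l(2)])
  have sub: "subspace {v. Q v = 0}" "subspace {v. Q v = v}"
   by (auto simp: subspace_def linear_add[OF Q(1)] linear_scale[OF Q(1)] linear_0[OF Q(1)])
  have TH: "T_sub A M j {r \<in> U. \<pi>2 r = \<pi>2 (F y)} (F y) = tvec F y ` {v. Q v = 0}" if y: "y \<in> W" for y
   by (rule T_sub_slice[OF P y sub(1)]) (use pi2[OF _ y] Fy(1) in auto)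
  have TK: "T_sub A M j {r \<in> U. \<pi>1 r = \<pi>1 (F y)} (F y) = tvec F y ` {v. Q v = v}" if y: "y \<in> W" for y
   by (rule T_sub_slice[OF P y sub(2)]) (use pi1[OF _ y] Fy(1) in auto)
  \<comment> \<open>Exists because \<open>L2\<close>, the range of \<open>\<Lambda>2\<close>, has
    nonzero dimension.\<close>
  obtain v0 where v0: "Q v0 \<noteq> 0"
  proof -
   have "\<not> L2 \<subseteq> {0}" using P2(4) k2(1) dim_eq_0[of L2] by simp
   then obtain v where "\<Lambda>2 v \<noteq> 0" unfolding ran[symmetric] by auto
   then show thesis using that[of v] K(2)[of v] by simp
  qed
  have uniq: "tvec F y ` {v. Q v = 0} = H (F y)" "tvec F y ` {v. Q v = v} = D\<theta> (F y)" "t (F y) = \<theta> (F y)" "D\<theta> (F y) \<noteq> {0}"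
   if y: "y \<in> W" and t: "slant_function_of A M j {r \<in> U. \<pi>1 r = \<pi>1 (F y)} t" "t (F y) \<noteq> 0" for y t
  proof -
   have lt: "linear (tvec F y)" by (rule tvec_facts(1)[OF P y])
   interpret a: acm_point "g (F y)" "phi A (j (F y))" "eta A (j (F y))" "xi A (j (F y))" by (rule acm_q[OF Fy(2)[OF y]])
   have orth: "g (F y) h k = 0" if "h \<in> tvec F y ` {v. Q v = 0}" "k \<in> tvec F y ` {v. Q v = v}" for h k
    using metO[OF y] that by auto
   have xi: "xi A (j (F y)) \<in> tvec F y ` {v. Q v = 0}" using D2(6)[OF Fy(1)[OF y]] unfolding TH[OF y] .
   have S: "split_at (F y) (tvec F y ` {v. Q v = 0}) (tvec F y ` {v. Q v = v}) (t (F y))"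
    unfolding a.slant_split_def
   proof (intro conjI ballI impI orth xi linear_subspace_image[OF lt] sub; assumption?)
    show "TM M A j (F y) = {h + k |h k. h \<in> tvec F y ` {v. Q v = 0} \<and> k \<in> tvec F y ` {v. Q v = v}}"
    proof (intro equalityI subsetI)
     fix s assume "s \<in> TM M A j (F y)"
     then have "s \<in> range (tvec F y)" using tvec_facts(3)[OF P y] by simp
     then obtain v where v: "s = tvec F y v" by (rule rangeE)
     have "s = tvec F y (v - Q v) + tvec F y (Q v)" by (simp add: v linear_diff[OF lt])
     moreover have "Q (v - Q v) = 0" by (simp add: linear_diff[OF Q(1)] Q(2))
     ultimately show "s \<in> {h + k |h k. h \<in> tvec F y ` {v. Q v = 0} \<and> k \<in> tvec F y ` {v. Q v = v}}" using Q(2)[of v] by blast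
    next
     fix s assume "s \<in> {h + k |h k. h \<in> tvec F y ` {v. Q v = 0} \<and> k \<in> tvec F y ` {v. Q v = v}}"
     then obtain a' b' where "s = tvec F y a' + tvec F y b'" by blast
     then have "s = tvec F y (a' + b')" by (simp add: linear_add[OF lt])
     then show "s \<in> TM M A j (F y)" using tvec_facts(3)[OF P y] by (metis rangeI)
    qed
    have "F y \<in> {r \<in> U. \<pi>2 r = \<pi>2 (F y)}" using Fy(1)[OF y] by simp
    from bspec[OF conjunct2[OF D2(5)[OF Fy(1)[OF y], unfolded invariant_submanifold_def]] this]
    show "phi A (j (F y)) ` tvec F y ` {v. Q v = 0} \<subseteq> tvec F y ` {v. Q v = 0}" unfolding TH[OF y] .
    fix X assume X: "X \<in> tvec F y ` {v. Q v = v}" "X \<noteq> 0"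
    \<comment> \<open>The slant function of a leaf says nothing about multiples of \<xi>; a nonzero
      vector of the second summand is orthogonal to \<xi> and hence not among them.\<close>
    have "X \<notin> span {xi A (j (F y))}"
    proof
     assume "X \<in> span {xi A (j (F y))}"
     then obtain r where "X = r *\<^sub>R xi A (j (F y))" by (auto simp: span_singleton)
     then have "g (F y) X X = r * g (F y) (xi A (j (F y))) X" by (metis a.bs(5))
     then show False using orth[OF xi X(1)] iform_zero[OF a.b, of X] X(2) by simp
    qed
    moreover have "F y \<in> {r \<in> U. \<pi>1 r = \<pi>1 (F y)}" using Fy(1)[OF y] by simp
    ultimately show "angle_to (g (F y)) (phi A (j (F y)) X) (tvec F y ` {v. Q v = v}) = t (F y)"
     using t(1) X(1) unfolding slant_function_of_def TK[OF y, symmetric] by blast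
   qed
   have ne: "tvec F y ` {v. Q v = v} \<noteq> {0}"
   proof
    assume "tvec F y ` {v. Q v = v} = {0}"
    moreover have "tvec F y (Q v0) \<in> tvec F y ` {v. Q v = v}" using Q(2) by blast
    ultimately have "tvec F y (Q v0) = 0" by simp
    then show False using v0 tvec_zero_iff[OF P y] by simp
   qed
   note u = a.slant_split_unique[OF split[OF Fy(2)[OF y]] S ne t(2)]
   show "tvec F y ` {v. Q v = 0} = H (F y)" "tvec F y ` {v. Q v = v} = D\<theta> (F y)" "t (F y) = \<theta> (F y)" by (rule u)+
   show "D\<theta> (F y) \<noteq> {0}" using ne u(2) by simp
  qed
  have ex: "\<exists>t. slant_function_of A M j {r \<in> U. \<pi>1 r = \<pi>1 (F y)} t \<and> t (F y) \<noteq> 0 \<and> t (F y) \<noteq> pi / 2" if y: "y \<in> W" for y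
   using D2(7)[OF Fy(1)[OF y]] Fy(1)[OF y] unfolding proper_pointwise_slant_def by auto
  have eqs: "tvec F y ` {v. Q v = 0} = H (F y)" "tvec F y ` {v. Q v = v} = D\<theta> (F y)"
   "D\<theta> (F y) \<noteq> {0} \<and> \<theta> (F y) \<noteq> 0 \<and> \<theta> (F y) \<noteq> pi / 2" if y: "y \<in> W" for y
  proof -
   obtain t where t: "slant_function_of A M j {r \<in> U. \<pi>1 r = \<pi>1 (F y)} t" "t (F y) \<noteq> 0" "t (F y) \<noteq> pi / 2"
    using ex[OF y] by (elim exE conjE) (rule that, assumption+)
   note u = uniq[OF y t(1,2)]
   show "tvec F y ` {v. Q v = 0} = H (F y)" "tvec F y ` {v. Q v = v} = D\<theta> (F y)" by (rule u)+
   show "D\<theta> (F y) \<noteq> {0} \<and> \<theta> (F y) \<noteq> 0 \<and> \<theta> (F y) \<noteq> pi / 2" using u(3,4) t(2,3) by simp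
  qed
  have pr: "proper_at (F ` W)" using eqs(3) by (auto simp: proper_at_def)
  interpret C: adapted_chart A M j D D\<theta> \<theta> W F c Q y0
  proof unfold_locales
   show "tvec F x u \<in> D\<theta> (F x)" if "x \<in> W" "Q u = u" for x u using eqs(2)[OF that(1)] that(2) by blast
   show "tvec F x u \<in> H (F x)" if "x \<in> W" "Q u = 0" for x u using eqs(1)[OF that(1)] that(2) by blast
  qed (use P Q linear_add[OF Q(1)] linear_scale[OF Q(1)] conv box y0 in auto)
  let ?\<mu> = "%q. ln (f (\<pi>1 q))"
  have fpos: "f (\<pi>1 (F y)) > 0" if "y \<in> W" for y by (rule D1(14)[OF D2(3)[OF Fy(1)[OF that]]])
  have \<mu>s: "smooth_on W (%y. ?\<mu> (F y))"
  proof (rule smooth_on_ln[OF W _ fpos])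
   have Fs: "smooth_on W1 (%x. Fe (F1 x))"
    by (rule smooth_on_subset[OF smooth_fun_param(1)[OF M P1(1) V3(1,3)]]) (use P1(3) in auto)
   have "smooth_on W (%y. Fe (F1 (\<Lambda>1 y)))"
    by (rule smooth_on_compose[OF W paramD(1)[OF M P1(1)] _ smooth_on_linear[OF b(1) W] Fs]) (use e1 in auto)
   then show "smooth_on W (%y. f (\<pi>1 (F y)))"
   proof (rule smooth_on_cong[OF W, rotated])
    fix y assume y: "y \<in> W"
    have "\<pi>1 (F y) \<in> MT \<inter> V3" using D2(3)[OF Fy(1)[OF y]] e1[OF y] P1(3) by auto
    then show "Fe (F1 (\<Lambda>1 y)) = f (\<pi>1 (F y))" using V3(4) e1[OF y] by auto
   qed
  qed
  have h1: "?\<mu> (F y) = ?\<mu> (F w)" if "y \<in> W" "w \<in> W" "Q (y - w) = y - w" for y w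
   using pi1[OF that(1,2)] that(3) by simp
  have L: "Q (y - w) = y - w ==> \<Lambda>1 y = \<Lambda>1 w" "Q (y - w) = 0 ==> \<Lambda>2 y = \<Lambda>2 w" for y w
   using K(1)[of "y - w"] K(2)[of "y - w"] by (auto simp: linear_diff[OF l(1)] linear_diff[OF l(2)])
  have h2: "C.gm y a a' = C.gm w a a'" if "y \<in> W" "w \<in> W" "Q (y - w) = y - w" "Q a = 0" "Q a' = 0" for y w a a'
   unfolding C.gm_def metH[OF that(1,4,5)] metH[OF that(2,4,5)] L(1)[OF that(3)] ..
  have h3: "exp (- 2 * ?\<mu> (F y)) * C.gm y b b' = exp (- 2 * ?\<mu> (F w)) * C.gm w b b'"
   if "y \<in> W" "w \<in> W" "Q (y - w) = 0" "Q b = b" "Q b' = b'" for y w b b'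
   unfolding C.gm_def metK[OF that(1,4,5)] metK[OF that(2,4,5)] L(2)[OF that(3)]
    exp_scaling[OF fpos[OF that(1)]] exp_scaling[OF fpos[OF that(2)]] ..
  have um: "C.umbilic ?\<mu>" by (rule C.umbilic_of_metric(1)[OF \<mu>s h1 h2 h3])
  show thesis
  proof (rule that[OF C.adapted_chart_axioms y0(2) FU FN pr \<mu>s])
   show "Q (y - w) = y - w" if "y \<in> W" "w \<in> W" "\<pi>1 (F y) = \<pi>1 (F w)" for y w using pi1 that by simp
   show "fd (%y. ?\<mu> (F y)) (at x) b = 0" if "x \<in> W" "Q b = b" for x b
    by (rule C.umbilic_of_metric(2)[OF \<mu>s h1 h2 h3 that])
   show "shape_eq ?\<mu> X Z (F x)"
    if "openin (mtop M) V" "F ` W \<subseteq> V" "sect V H X" "sect V D\<theta> Z" "x \<in> W" for V X Z x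
    by (rule C.shape_of_umbilic[OF that(1,2) pr um \<mu>s that(3-5)])
   show "t (F y) = \<theta> (F y)" if "y \<in> W" "slant_function_of A M j {r \<in> U. \<pi>1 r = \<pi>1 (F y)} t" "t (F y) \<noteq> 0" for y t
    by (rule uniq(3)[OF that])
  qed
 qed
qed

end

end

context semi_slant
begin

context
 fixes U p MT M\<theta> f \<pi>1 \<pi>2
 assumes U: "openin (mtop M) U" and piece: "warped_product_piece A M j U p MT M\<theta> f \<pi>1 \<pi>2"
begin

lemmas E1 = pieceD[OF U piece] and E2 = pieceD2[OF U piece]

abbreviation lnf where "lnf \<equiv> %q. ln (f (\<pi>1 q))"

lemma piece_shape:
 assumes q: "q \<in> U" and V: "openin (mtop M) V" "q \<in> V"
  and X: "sect V H X" and Z: "sect V D\<theta> Z"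
 shows "shape_eq lnf X Z q"
proof (rule piece_chart[OF U piece q V])
 fix W F c Q y0
 assume C: "adapted_chart A M j D D\<theta> \<theta> W F c Q y0" and y0: "F y0 = q" and FV: "F ` W \<subseteq> V"
  and sh: "\<And>V X Z x. openin (mtop M) V ==> F ` W \<subseteq> V ==> sect V H X ==> sect V D\<theta> Z ==> x \<in> W ==>
   shape_eq lnf X Z (F x)"
 from sh[OF V(1) FV X Z adapted_chart.y0[OF C]] show ?thesis unfolding y0 .
qed

lemma piece_smooth: "smooth_fun M U lnf"
 unfolding smooth_fun_def
proof
 fix q assume q: "q \<in> U"
 show "\<exists>S. coord_nbhd M U q S \<and> smooth_on S (lnf \<circ> cinv M q)"
 proof (rule piece_chart[OF U piece q U q])
  fix W F c Q y0
  assume C: "adapted_chart A M j D D\<theta> \<theta> W F c Q y0" and y0: "F y0 = q" and FU: "F ` W \<subseteq> U"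
   and s: "smooth_on W (%y. lnf (F y))"
  interpret C: adapted_chart A M j D D\<theta> \<theta> W F c Q y0 by (rule C)
  have "smooth_fun M (F ` W) lnf" by (rule smooth_fun_param(2)[OF M C.P C.FW_open s])
  then obtain S where S: "coord_nbhd M (F ` W) q S" "smooth_on S (lnf \<circ> cinv M q)"
   using C.y0 y0 unfolding smooth_fun_def by blast
  have "coord_nbhd M U q S" using S(1) FU unfolding coord_nbhd_def by blast
  then show ?thesis using S(2) by blast
 qed
qed

lemma piece_K:
 assumes q: "q \<in> U"
 shows "Z \<in> D\<theta> q ==> dir_deriv M A j q Z lnf = 0" "D\<theta> q \<noteq> {0} \<and> \<theta> q \<noteq> 0 \<and> \<theta> q \<noteq> pi / 2"
  "slant_function_of A M j {r \<in> U. \<pi>1 r = \<pi>1 q} t ==> t q \<noteq> 0 ==> t q = \<theta> q"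
proof -
 have "(Z \<in> D\<theta> q \<longrightarrow> dir_deriv M A j q Z lnf = 0) \<and> (D\<theta> q \<noteq> {0} \<and> \<theta> q \<noteq> 0 \<and> \<theta> q \<noteq> pi / 2) \<and>
  (slant_function_of A M j {r \<in> U. \<pi>1 r = \<pi>1 q} t \<longrightarrow> t q \<noteq> 0 \<longrightarrow> t q = \<theta> q)"
 proof (rule piece_chart[OF U piece q U q])
  fix W F c Q y0
  assume C: "adapted_chart A M j D D\<theta> \<theta> W F c Q y0" and y0: "F y0 = q" and pr: "proper_at (F ` W)"
   and s: "smooth_on W (%y. lnf (F y))"
   and K: "\<And>x b. x \<in> W ==> Q b = b ==> fd (%y. lnf (F y)) (at x) b = 0"
   and t: "\<And>y t. y \<in> W ==> slant_function_of A M j {r \<in> U. \<pi>1 r = \<pi>1 (F y)} t ==> t (F y) \<noteq> 0 ==> t (F y) = \<theta> (F y)"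
  interpret C: adapted_chart A M j D D\<theta> \<theta> W F c Q y0 by (rule C)
  note y = C.y0
  show ?thesis
  proof (intro conjI impI)
   assume "Z \<in> D\<theta> q"
   then have "Z \<in> tvec F y0 ` C.ranQ" unfolding C.tvec_ranQ[OF y] y0 .
   then obtain b where b: "Z = tvec F y0 b" "b \<in> C.ranQ" by (rule imageE)
   then show "dir_deriv M A j q Z lnf = 0"
    using dir_deriv_tvec[OF C.P y smooth_on_differentiable[OF s y], of b] K[OF y, of b] unfolding y0 b(1) by simp
  next
   assume "slant_function_of A M j {r \<in> U. \<pi>1 r = \<pi>1 q} t" "t q \<noteq> 0"
   then show "t q = \<theta> q" using t[OF y, of t] unfolding y0 by simp
  qed (use pr y y0 in \<open>auto simp: proper_at_def\<close>)
 qed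
 then show "Z \<in> D\<theta> q ==> dir_deriv M A j q Z lnf = 0" "D\<theta> q \<noteq> {0} \<and> \<theta> q \<noteq> 0 \<and> \<theta> q \<noteq> pi / 2"
  "slant_function_of A M j {r \<in> U. \<pi>1 r = \<pi>1 q} t ==> t q \<noteq> 0 ==> t q = \<theta> q" by auto
qed

text \<open>Otherwise \<theta> would be locally constant along the second factor, hence constant on
  it by connectedness. But there it coincides with the slant function of that leaf, which is not
  constant.\<close>

lemma piece_theta:
 shows "\<exists>q\<in>U. \<exists>Z\<in>D\<theta> q. Z \<noteq> 0 \<and> dir_deriv M A j q Z \<theta> \<noteq> 0"
proof (rule ccontr)
 assume "\<not> ?thesis"
 then have zero: "dir_deriv M A j q Z \<theta> = 0" if "q \<in> U" "Z \<in> D\<theta> q" "Z \<noteq> 0" for q Z using that by blast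
 have "\<theta> constant_on M\<theta>"
 proof (rule constant_on_connectedin[OF E1(4)])
  fix q assume qM: "q \<in> M\<theta>"
  have q: "q \<in> U" using qM E1(6) by blast
  show "\<exists>O'. openin (mtop M) O' \<and> q \<in> O' \<and> (\<forall>r\<in>M\<theta> \<inter> O'. \<theta> r = \<theta> q)"
  proof (rule piece_chart[OF U piece q U q])
   fix W F c Q y0
   assume C: "adapted_chart A M j D D\<theta> \<theta> W F c Q y0" and y0: "F y0 = q" and FU: "F ` W \<subseteq> U" and pr: "proper_at (F ` W)"
    and p1: "\<And>y z. y \<in> W ==> z \<in> W ==> \<pi>1 (F y) = \<pi>1 (F z) ==> Q (y - z) = y - z"
   interpret C: adapted_chart A M j D D\<theta> \<theta> W F c Q y0 by (rule C)
   note td = C.theta_differentiable(1)[OF pr]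
   have d0: "fd (%y. \<theta> (F y)) (at x) b = 0" if x: "x \<in> W" and b: "Q b = b" for x b
   proof (cases "b = 0")
    case True
    then show ?thesis using linear_0[OF has_derivative_linear[OF td[OF x, unfolded frechet_derivative_works]]] by simp
   next
    case False
    have "F x \<in> U" using x FU by blast
    from zero[OF this C.QK[OF x b]] False tvec_zero_iff[OF C.P x]
    have "dir_deriv M A j (F x) (tvec F x b) \<theta> = 0" by blast
    then show ?thesis unfolding dir_deriv_tvec[OF C.P x td[OF x]] .
   qed
   have "\<theta> r = \<theta> q" if r: "r \<in> M\<theta>" "r \<in> F ` W" for r
   proof -
    obtain z where z: "z \<in> W" "r = F z" using r(2) by blast
    have "\<pi>1 (F z) = \<pi>1 (F y0)" using E1(9)[OF r(1)] E1(9)[OF qM] z(2) y0 by simp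
    from p1[OF z(1) C.y0 this] have "\<theta> (F z) = \<theta> (F y0)"
     by (intro constant_on_segment[OF C.W_convex z(1) C.y0 td[unfolded frechet_derivative_works]] d0)
    then show ?thesis using z(2) y0 by simp
   qed
   then show ?thesis using C.FW_open C.y0 y0 by (intro exI[of _ "F ` W"]) auto
  qed
 qed
 moreover have "\<exists>t :: 'b => real. slant_function_of A M j M\<theta> t \<and> (\<forall>q\<in>M\<theta>. t q \<noteq> 0 \<and> t q \<noteq> pi / 2) \<and> \<not> t constant_on M\<theta>"
 proof -
  have p: "p \<in> U" "\<pi>1 p = p" using E1(5,7,8) by auto
  show ?thesis using E2(7)[OF p(1)] unfolding p(2) leaf_through_p[OF U piece] proper_pointwise_slant_def by (rule conjunct2)
 qed
 then obtain t :: "'b => real" where t: "slant_function_of A M j M\<theta> t" "\<forall>q\<in>M\<theta>. t q \<noteq> 0 \<and> t q \<noteq> pi / 2" "\<not> t constant_on M\<theta>"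
  by (elim exE conjE) (rule that, assumption+)
 have "t q = \<theta> q" if q: "q \<in> M\<theta>" for q
 proof (rule piece_K(3))
  show "q \<in> U" using q E1(6) by blast
  have "{r \<in> U. \<pi>1 r = \<pi>1 q} = M\<theta>" unfolding E1(9)[OF q] by (rule leaf_through_p[OF U piece])
  then show "slant_function_of A M j {r \<in> U. \<pi>1 r = \<pi>1 q} t" using t(1) by simp
 qed (use t(2) q in blast)
 ultimately show False using t(3) by (simp add: constant_on_def)
qed

text \<open>If the left side vanished, ln(f \<circ> \<pi>1) would have zero derivative along
  \<open>H\<close> by the shape condition, and along D\<theta> in any case, so \<open>f\<close>
  would be constant on the connected first factor. The hypothesis does not mention \<open>f\<close>,
  which allows pieces with different warping functions to be compared.\<close>

lemma piece_shape_nonzero: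
 assumes "\<And>X Z q. sect U H X ==> sect U D\<theta> Z ==> q \<in> U ==>
  shape_op A M j q (F_op A M j q (Z q)) (phi A (j q) (X q))
   - shape_op A M j q (F_op A M j q (P_op A M j q (Z q))) (X q) = 0"
 shows False
proof -
 have UM: "U \<subseteq> points M" by (rule openin_subset[OF U])
 have "f constant_on MT"
 proof (rule constant_on_connectedin[OF E1(3)])
  fix q assume qM: "q \<in> MT"
  have q: "q \<in> U" using qM E1(5) by blast
  show "\<exists>O'. openin (mtop M) O' \<and> q \<in> O' \<and> (\<forall>r\<in>MT \<inter> O'. f r = f q)"
  proof (rule piece_chart[OF U piece q U q])
   fix W F c Q y0
   assume C: "adapted_chart A M j D D\<theta> \<theta> W F c Q y0" and y0: "F y0 = q" and FU: "F ` W \<subseteq> U" and pr: "proper_at (F ` W)"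
    and s: "smooth_on W (%y. lnf (F y))"
    and K: "\<And>x b. x \<in> W ==> Q b = b ==> fd (%y. lnf (F y)) (at x) b = 0"
   interpret C: adapted_chart A M j D D\<theta> \<theta> W F c Q y0 by (rule C)
   let ?d = "%x. fd (%y. lnf (F y)) (at x)"
   have subH: "subspace (H r)" and subK: "subspace (D\<theta> r)" if "r \<in> U" for r
    using acm_point.slant_splitD(1,2)[OF acm_q split, of r] UM that by auto
   have dH: "?d x a = 0" if x: "x \<in> W" and a: "Q a = 0" for x a
   proof -
    have xU: "F x \<in> U" using x FU by blast
    have "D\<theta> (F x) \<noteq> {0}" using piece_K(2)[OF xU] by simp
    then obtain w where w: "w \<in> D\<theta> (F x)" "w \<noteq> 0" using subspace_0[OF subK[OF xU]] by blast
    have "w \<in> tvec F x ` C.ranQ" using w(1) unfolding C.tvec_ranQ[OF x] .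
    then obtain b where b: "w = tvec F x b" "b \<in> C.ranQ" by (rule imageE)
    show ?thesis
    proof (rule C.extend_section[OF U FU x smooth_on_const[of W a] subH], assumption)
     show "tvec F y a \<in> H (F y)" if "y \<in> W" for y by (rule C.QH[OF that a])
     fix X assume X: "sect U H X" "X (F x) = tvec F x a"
     show ?thesis
     proof (rule C.extend_section[OF U FU x smooth_on_const[of W b] subK], assumption)
      show "tvec F y b \<in> D\<theta> (F y)" if "y \<in> W" for y by (rule C.QK[OF that]) (use b(2) in simp)
      fix Z assume Z: "sect U D\<theta> Z" "Z (F x) = tvec F x b"
      have "((sin (\<theta> (F x)))\<^sup>2 * dir_deriv M A j (F x) (X (F x)) lnf) *\<^sub>R Z (F x) = 0"
       unfolding piece_shape[OF xU U xU X(1) Z(1), symmetric] by (rule assms[OF X(1) Z(1) xU])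
      then have "(sin (\<theta> (F x)))\<^sup>2 * dir_deriv M A j (F x) (X (F x)) lnf = 0" using Z(2) b(1) w(2) by simp
      moreover have "sin (\<theta> (F x)) \<noteq> 0" by (rule theta_bounds(6)[OF C.F_points[OF x] pr imageI[OF x]])
      ultimately have "dir_deriv M A j (F x) (X (F x)) lnf = 0" by simp
      then show ?thesis unfolding X(2) dir_deriv_tvec[OF C.P x smooth_on_differentiable[OF s x]] .
     qed
    qed
   qed
   have d0: "?d x v = 0" if x: "x \<in> W" for x v
   proof -
    have "?d x ((v - Q v) + Q v) = ?d x (v - Q v) + ?d x (Q v)"
     by (rule linear_add[OF has_derivative_linear[OF smooth_on_has_derivative[OF s x]]])
    then show ?thesis using dH[OF x C.Q_simps(1)[of v]] K[OF x C.Q(2)[of v]] by simp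
   qed
   have "f r = f q" if r: "r \<in> MT" "r \<in> F ` W" for r
   proof -
    obtain z where z: "z \<in> W" "r = F z" using r(2) by blast
    have "lnf (F z) = lnf (F y0)"
     by (rule constant_on_segment[OF C.W_convex z(1) C.y0 smooth_on_has_derivative[OF s] d0])
    then have "ln (f r) = ln (f q)" using z(2) y0 E1(8)[OF r(1)] E1(8)[OF qM] by simp
    then show ?thesis using E1(14)[OF r(1)] E1(14)[OF qM] by simp
   qed
   then show ?thesis using C.FW_open C.y0 y0 by (intro exI[of _ "F ` W"]) auto
  qed
 qed
 then show False using E1(15) by simp
qed

end

lemma proper_slant_along_of_warped:
 assumes lw: "locally_warped_product A M j"
 shows "proper_slant_along A M j D\<theta> \<theta>"
 unfolding proper_slant_along_def
proof (intro conjI ballI allI impI)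
 fix p assume p: "p \<in> points M"
 obtain U MT M\<theta> f \<pi>1 \<pi>2 where U: "openin (mtop M) U" "p \<in> U" "warped_product_piece A M j U p MT M\<theta> f \<pi>1 \<pi>2"
  using lw[unfolded locally_warped_product_def, rule_format, OF p conjI[OF openin_topspace p]]
  by (elim exE conjE) (rule that, assumption+)
 show "\<theta> p \<noteq> 0" "\<theta> p \<noteq> pi / 2" using piece_K(2)[OF U(1,3,2)] by auto
next
 fix V assume V: "openin (mtop M) V \<and> V \<noteq> {}"
 then obtain p where p: "p \<in> V" "p \<in> points M" using openin_subset by blast
 obtain U MT M\<theta> f \<pi>1 \<pi>2 where U: "openin (mtop M) U" "U \<subseteq> V" "warped_product_piece A M j U p MT M\<theta> f \<pi>1 \<pi>2"
  using lw[unfolded locally_warped_product_def, rule_format, OF p(2) conjI[OF conjunct1[OF V] p(1)]]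
  by (elim exE conjE) (rule that, assumption+)
 show "\<exists>q\<in>V. \<exists>Z\<in>D\<theta> q. Z \<noteq> 0 \<and> dir_deriv M A j q Z \<theta> \<noteq> 0" using piece_theta[OF U(1,3)] U(2) by blast
qed

lemma shape_of_warped_product:
 assumes lw: "locally_warped_product A M j" and p: "p \<in> points M"
 shows "\<exists>V \<mu>. openin (mtop M) V \<and> p \<in> V \<and> smooth_fun M V \<mu> \<and>
   (\<forall>W. openin (mtop M) W \<and> W \<subseteq> V \<and> W \<noteq> {} \<longrightarrow> \<not> \<mu> constant_on W) \<and>
   (\<forall>Z. sect V D\<theta> Z \<longrightarrow> (\<forall>q\<in>V. dir_deriv M A j q (Z q) \<mu> = 0)) \<and>
   (\<forall>X W. sect V H X \<and> sect V D\<theta> W \<longrightarrow>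
     (\<forall>q\<in>V.
      shape_eq \<mu> X W q))"
proof -
 obtain U MT M\<theta> f \<pi>1 \<pi>2 where U: "openin (mtop M) U" "p \<in> U" and piece: "warped_product_piece A M j U p MT M\<theta> f \<pi>1 \<pi>2"
  using lw[unfolded locally_warped_product_def, rule_format, OF p conjI[OF openin_topspace p]]
  by (elim exE conjE) (rule that, assumption+)
 let ?\<mu> = "%q. ln (f (\<pi>1 q))"
 show ?thesis
 proof (intro exI[of _ U] exI[of _ ?\<mu>] conjI allI impI ballI U piece_smooth[OF U(1) piece])
  show "dir_deriv M A j q (Z q) ?\<mu> = 0" if "sect U D\<theta> Z" "q \<in> U" for Z q
   by (rule piece_K(1)[OF U(1) piece that(2)]) (use that in \<open>simp add: is_section_def\<close>)
  show "shape_eq ?\<mu> X W q"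
   if "sect U H X \<and> sect U D\<theta> W" "q \<in> U" for X W q
   by (rule piece_shape[OF U(1) piece that(2) U(1) that(2)]) (use that(1) in auto)
  fix W assume W: "openin (mtop M) W \<and> W \<subseteq> U \<and> W \<noteq> {}"
  show "\<not> ?\<mu> constant_on W"
  proof
   assume "?\<mu> constant_on W"
   then obtain k where k: "\<And>r. r \<in> W ==> ?\<mu> r = k" unfolding constant_on_def by blast
   obtain q where q: "q \<in> W" "q \<in> points M" using W openin_subset by blast
   \<comment> \<open>A second piece inside \<open>W\<close>, with its own warping function. On it
     the shape condition of the first piece has right side zero, as \<mu> is constant there; this
     contradicts \<open>piece_shape_nonzero\<close> for the second piece.\<close>
   obtain U' MT' M\<theta>' f' \<pi>1' \<pi>2' where U': "openin (mtop M) U'" "U' \<subseteq> W" and piece': "warped_product_piece A M j U' q MT' M\<theta>' f' \<pi>1' \<pi>2'"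
    using lw[unfolded locally_warped_product_def, rule_format, OF q(2) conjI[OF conjunct1[OF W] q(1)]]
    by (elim exE conjE) (rule that, assumption+)
   show False
   proof (rule piece_shape_nonzero[OF U'(1) piece'])
    fix X Z r assume s: "sect U' H X" "sect U' D\<theta> Z" "r \<in> U'"
    have r: "r \<in> W" "r \<in> U" using s(3) U'(2) W by auto
    have "dir_deriv M A j r (X r) ?\<mu> = 0" by (rule dir_deriv_constant[OF conjunct1[OF W] r(1) k])
    then show "shape_op A M j r (F_op A M j r (Z r)) (phi A (j r) (X r))
     - shape_op A M j r (F_op A M j r (P_op A M j r (Z r))) (X r) = 0"
     using piece_shape[OF U(1) piece r(2) U'(1) s(3) s(1,2)] by simp
   qed
  qed
 qed
qed

end

theorem theorem4p5:
  fixes A :: "('a, 'e::euclidean_space) acm"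
    and M :: "('b, 'm::euclidean_space) manifold"
    and \<iota> :: "'b \<Rightarrow> 'a"
    and D D\<theta> :: "'b \<Rightarrow> 'e set"
    and \<theta> :: "'b \<Rightarrow> real"
  assumes "cosymplectic A"
    and "pointwise_semi_slant A M \<iota> D D\<theta> \<theta>"
  shows "locally_warped_product A M \<iota> \<longleftrightarrow>
    proper_slant_along A M \<iota> D\<theta> \<theta> \<and>
    (\<forall>p \<in> points M. \<exists>V \<mu>.
       openin (mtop M) V \<and> p \<in> V \<and> smooth_fun M V \<mu> \<and>
       (\<forall>W. openin (mtop M) W \<and> W \<subseteq> V \<and> W \<noteq> {} \<longrightarrow> \<not> \<mu> constant_on W) \<and>
       (\<forall>Z. is_section A M \<iota> V D\<theta> Z \<longrightarrow> (\<forall>q\<in>V. dir_deriv M A \<iota> q (Z q) \<mu> = 0)) \<and>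
       (\<forall>X W. is_section A M \<iota> V (plus_xi A \<iota> D) X \<and> is_section A M \<iota> V D\<theta> W \<longrightarrow>
          (\<forall>q\<in>V.
             shape_op A M \<iota> q (F_op A M \<iota> q (W q)) (phi A (\<iota> q) (X q))
             - shape_op A M \<iota> q (F_op A M \<iota> q (P_op A M \<iota> q (W q))) (X q)
             = ((sin (\<theta> q))\<^sup>2 * dir_deriv M A \<iota> q (X q) \<mu>) *\<^sub>R W q)))"
    (is "?L \<longleftrightarrow> ?proper \<and> (\<forall>p \<in> points M. ?R p)")
proof -
  interpret semi_slant A M \<iota> D D\<theta> \<theta> by (rule semi_slant.intro[OF assms])
  show ?thesis
  proof (intro iffI conjI ballI)
    show "?proper" if ?L by (rule proper_slant_along_of_warped[OF that])
    show "?R p" if ?L "p \<in> points M" for p by (rule shape_of_warped_product[OF that])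
    assume R: "?proper \<and> (\<forall>p \<in> points M. ?R p)"
    show ?L unfolding locally_warped_product_def
    proof (intro ballI allI impI)
      fix p V' assume p: "p \<in> points M" and V': "openin (mtop M) V' \<and> p \<in> V'"
      obtain V \<mu> where V: "openin (mtop M) V" "p \<in> V" "smooth_fun M V \<mu>"
        and 1: "\<forall>W. openin (mtop M) W \<and> W \<subseteq> V \<and> W \<noteq> {} \<longrightarrow> \<not> \<mu> constant_on W"
        and 2: "\<forall>Z. is_section A M \<iota> V D\<theta> Z \<longrightarrow> (\<forall>q\<in>V. dir_deriv M A \<iota> q (Z q) \<mu> = 0)"
        and 3: "\<forall>X W. is_section A M \<iota> V (plus_xi A \<iota> D) X \<and> is_section A M \<iota> V D\<theta> W \<longrightarrow>
          (\<forall>q\<in>V.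
             shape_op A M \<iota> q (F_op A M \<iota> q (W q)) (phi A (\<iota> q) (X q))
             - shape_op A M \<iota> q (F_op A M \<iota> q (P_op A M \<iota> q (W q))) (X q)
             = ((sin (\<theta> q))\<^sup>2 * dir_deriv M A \<iota> q (X q) \<mu>) *\<^sub>R W q)"
        using bspec[OF conjunct2[OF R] p] by (elim exE conjE) (rule that, assumption+)
      show "\<exists>U MT M\<theta> f \<pi>1 \<pi>2. openin (mtop M) U \<and> p \<in> U \<and> U \<subseteq> V' \<and> warped_product_piece A M \<iota> U p MT M\<theta> f \<pi>1 \<pi>2"
      proof (rule warped_product_of_shape[OF conjunct1[OF R] p V])
        show "\<not> \<mu> constant_on W" if "openin (mtop M) W" "W \<subseteq> V" "W \<noteq> {}" for W
          using 1[rule_format, of W] that by simp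
        show "dir_deriv M A \<iota> q (Z q) \<mu> = 0" if "is_section A M \<iota> V D\<theta> Z" "q \<in> V" for Z q
          by (rule 2[rule_format, OF that])
        show "shape_op A M \<iota> q (F_op A M \<iota> q (Z q)) (phi A (\<iota> q) (X q))
            - shape_op A M \<iota> q (F_op A M \<iota> q (P_op A M \<iota> q (Z q))) (X q)
          = ((sin (\<theta> q))\<^sup>2 * dir_deriv M A \<iota> q (X q) \<mu>) *\<^sub>R Z q"
          if "is_section A M \<iota> V (plus_xi A \<iota> D) X" "is_section A M \<iota> V D\<theta> Z" "q \<in> V" for X Z q
          by (rule 3[rule_format, OF conjI[OF that(1,2)] that(3)])
      qed (use V' in auto)
    qed
  qed
qed

end
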